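(* Let $d\in[0,n]$, let $E\subset\mathbb{R}^n$ be a (nonempty) closed $d$-thick set, put $\theta:=n-d$, and let $\{\mathfrak{m}_k\}_{k=0}^{\infty}$ be a strongly $d$-regular sequence of measures on $E$. Assume that $p\in[1,\infty]$, $q\in(0,\infty]$, $s\in(\frac{n-d}{p},1)$, and $\sigma\in(0,\infty)$ is such that $\sigma\le p$. Given $\phi\in L_\sigma^{\mathrm{loc}}(\{\mathfrak{m}_k\})$, the following conditions are equivalent: (1) $\phi\in B^s_{p,q}(\mathbb{R}^n)|_E^{\mathfrak{m}_0}$; (2) $\|\phi\|_{\mathfrak{B}^{s-\theta/p}_{p,q,\sigma}(E)}<\infty$. Furthermore, $$\|\phi\|_{B^s_{p,q}(\mathbb{R}^n)|_E^{\mathfrak{m}_0}}\approx\|\phi\|_{\mathfrak{B}^{s-\theta/p}_{p,q,\sigma}(E)}$$ with implicit constants independent of $\phi$. Finally, there exists a bounded linear operator $\operatorname{Ext}_{\mathfrak{m}_0}:B^s_{p,q}(\mathbb{R}^n)|_E^{\mathfrak{m}_0}\to B^s_{p,q}(\mathbb{R}^n)$ which is a right inverse to the trace operator, i.e. $\operatorname{Tr}|_E^{\mathfrak{m}_0}\circ\operatorname{Ext}_{\mathfrak{m}_0}=\operatorname{Id}$ on $B^s_{p,q}(\mathbb{R}^n)|_E^{\mathfrak{m}_0}$.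
   Context: Notation: $|x|$ is the $\ell_\infty$-norm on $\mathbb{R}^n$; $Q_r(x)$ is the closed cube with center $x$ and side length $2r$. A "measure" is a locally finite Borel regular measure on $\mathbb{R}^n$. $\mathcal{L}^n$ is Lebesgue measure, and $⨍_G f\,d\mathfrak{m}:=\frac{1}{\mathfrak{m}(G)}\int_G f\,d\mathfrak{m}$ (and $0$ if $\mathfrak{m}(G)=0$). $A\approx B$ means $C^{-1}A\le B\le CA$ for a constant $C>0$. Thick sets: $\mathcal{H}^d_\infty$ is the Hausdorff content, $\mathcal{H}^d_\infty(G)=\inf\sum_i r_i^d$ over at most countable coverings of $G$ by cubes $Q_{r_i}(x_i)$. $E$ is $d$-thick if there is $C_d(E)>0$ with $\mathcal{H}^d_\infty(Q_r(x)\cap E)\ge C_d(E)r^d$ for all $(x,r)\in E\times(0,1]$. Regular sequences: a sequence of measures $\{\mathfrak{m}_k\}_{k=0}^\infty$ is $d$-regular on $E$ if $\operatorname{supp}\mathfrak{m}_k=E$ for all $k\in\mathbb{N}_0$ and there are $C_1,C_2,C_3>0$ such that for every $k\in\mathbb{N}_0$: (M1) $\mathfrak{m}_k(Q_r(x))\le C_1r^d$ for all $(x,r)\in\mathbb{R}^n\times(0,2^{-k}]$; (M2) $\mathfrak{m}_k(Q_r(x))\ge C_2r^d$ for all $(x,r)\in E\times[2^{-k},1]$; (M3) $\mathfrak{m}_k=\gamma_k\mathfrak{m}_0$ with $\gamma_k\in L_\infty(\mathfrak{m}_0)$, and for every $j\in\mathbb{N}_0$, $\frac{2^{(d-n)j}}{C_3}\gamma_{k+j}(x)\le\gamma_k(x)\le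 C_3\gamma_{k+j}(x)$ for $\mathfrak{m}_0$-a.e. $x\in E$. It is strongly $d$-regular if moreover, for each Borel set $G\subset E$, $\limsup_{k\to\infty}\frac{\mathfrak{m}_k(Q_{2^{-k}}(x)\cap G)}{\mathfrak{m}_k(Q_{2^{-k}}(x))}>0$ for $\mathfrak{m}_0$-a.e. $x\in G$. $L_\sigma^{\mathrm{loc}}(\{\mathfrak{m}_k\}):=\bigcap_{k\ge0}L_\sigma^{\mathrm{loc}}(\mathfrak{m}_k)$. Besov space: for a Borel function $f$, $\mathbb{D}^s(f)$ is the set of sequences $\vec g=\{g_k\}_{k\in\mathbb{Z}}$ of nonnegative Borel functions for which there is an $\mathcal{L}^n$-null set $N$ such that for each $k\in\mathbb{Z}$, $|f(x)-f(y)|\le|x-y|^s(g_k(x)+g_k(y))$ whenever $x,y\in\mathbb{R}^n\setminus N$, $2^{-k-1}\le|x-y|<2^{-k}$. $B^s_{p,q}(\mathbb{R}^n)$ is the set of $f\in L_p(\mathbb{R}^n)$ with $\|f\|_{B^s_{p,q}(\mathbb{R}^n)}:=\|f\|_{L_p(\mathbb{R}^n)}+\inf_{\vec g\in\mathbb{D}^s(f)}\|\{\|g_k\|_{L_p(\mathbb{R}^n)}\}_{k\in\mathbb{Z}}\|_{\ell_q}<\infty$. Traces: for $f\in B^s_{p,q}(\mathbb{R}^n)$ let $\bar f(x):=\limsup_{r\to0}⨍_{Q_r(x)}f\,d\mathcal{L}^n$; $f|_E^{\mathfrak{m}_0}=\operatorname{Tr}|_E^{\mathfrak{m}_0}f$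 is the $\mathfrak{m}_0$-equivalence class of $\bar f|_E$. Equivalently (as $s>\frac{n-d}{p}$), it is the class of the Borel function $\phi:E\to\mathbb{R}$ with $\lim_{r\to0}⨍_{Q_r(x)}|f(y)-\phi(x)|\,dy=0$ for $\mathfrak{m}_0$-a.e. $x\in E$. The trace space $B^s_{p,q}(\mathbb{R}^n)|_E^{\mathfrak{m}_0}:=\{f|_E^{\mathfrak{m}_0}:f\in B^s_{p,q}(\mathbb{R}^n)\}$ carries the quasi-norm $\|\phi\|_{B^s_{p,q}(\mathbb{R}^n)|_E^{\mathfrak{m}_0}}:=\inf\{\|f\|_{B^s_{p,q}(\mathbb{R}^n)}:\phi=f|_E^{\mathfrak{m}_0}\}$. Functionals on $E$: $\mathcal{E}_{\mathfrak{m},\sigma}(f,G):=\inf_{c\in\mathbb{R}}\big(⨍_G|f-c|^\sigma d\mathfrak{m}\big)^{1/\sigma}$; $\widetilde{\mathcal{E}}_{\mathfrak{m},\sigma}(f,Q_r(x)):=\mathcal{E}_{\mathfrak{m},\sigma}(f,Q_{2r}(x))$ if $Q_r(x)\cap\operatorname{supp}\mathfrak{m}\ne\emptyset$, and $:=0$ otherwise. Then $$\|\phi\|_{\mathfrak{B}^{s-\theta/p}_{p,q,\sigma}(E)}:=\|\phi\|_{L_p(\mathfrak{m}_0)}+\Big\|\big\{2^{ks}\|\widetilde{\mathcal{E}}_{\mathfrak{m}_k,\sigma}(\phi,Q_{2^{-k}}(\cdot))\|_{L_p(\mathbb{R}^n)}\big\}_{k=0}^\infty\Big\|_{\ell_q}.$$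 *)

theory Defs
  imports "HOL-Analysis.Analysis" "HOL-Probability.Essential_Supremum"
begin

text \<open>
  Conventions. Measures on $R^n$ live on the Borel sigma-algebra: a Borel regular outer
  measure is determined by its restriction to Borel sets. Every equivalence class of functions is
  handled through Borel representatives, and equality of classes is equality almost everywhere.
  A function on the closed set \<open>E\<close> is represented by a function on $R^n$; its values off
  \<open>E\<close> are immaterial, because all the measures involved are supported on \<open>E\<close>.
  (Quasi-)norms are \<open>ennreal\<close>-valued; exponents that may be infinite have type \<open>ennreal\<close>.
\<close>

definition cube :: "real \<Rightarrow> real^'n \<Rightarrow> (real^'n) set"
  where "cube r x = {y. infnorm (y - x) \<le> r}"


subsection \<open>Integrability and averages\<close>

text \<open>Power with an exponent \<open>a > 0\<close>.\<close>

definition enn_powr :: "ennreal \<Rightarrow> real \<Rightarrow> ennreal"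
  where "enn_powr x a = (if x = top then top else ennreal (enn2real x powr a))"

text \<open>The $L_p$ (quasi-)norm of a nonnegative function, for \<open>0 < p \<le> \<infinity>\<close>. The norm of
  $\ell_q$ is the case of a counting measure.\<close>

definition Lp_norm :: "'a measure \<Rightarrow> ennreal \<Rightarrow> ('a \<Rightarrow> ennreal) \<Rightarrow> ennreal"
  where "Lp_norm M p f =
    (if p = top then esssup M f
     else enn_powr (\<integral>\<^sup>+x. enn_powr (f x) (enn2real p) \<partial>M) (1 / enn2real p))"

abbreviation lq_norm :: "ennreal \<Rightarrow> ('i \<Rightarrow> ennreal) \<Rightarrow> ennreal"
  where "lq_norm q a \<equiv> Lp_norm (count_space UNIV) q a"

definition average :: "'a measure \<Rightarrow> 'a set \<Rightarrow> ('a \<Rightarrow> real) \<Rightarrow> real"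
  where "average M G f =
    (if measure M G = 0 then 0 else (LINT x:G|M. f x) / measure M G)"

definition nn_average :: "'a measure \<Rightarrow> 'a set \<Rightarrow> ('a \<Rightarrow> ennreal) \<Rightarrow> ennreal"
  where "nn_average M G f =
    (if emeasure M G = 0 then 0 else (\<integral>\<^sup>+x\<in>G. f x \<partial>M) / emeasure M G)"


subsection \<open>Thick sets and regular sequences of measures\<close>

text \<open>The index set \<open>I\<close> may be finite or infinite: for \<open>d = 0\<close>, finite coverings matter.\<close>

definition hausdorff_content :: "real \<Rightarrow> (real^'n) set \<Rightarrow> ennreal"
  where "hausdorff_content d G =
    Inf {(\<Sum>\<^sub>\<infinity>i\<in>I. ennreal (r i powr d)) | (I :: nat set) r x.
           (\<forall>i\<in>I. 0 < r i) \<and> G \<subseteq> (\<Union>i\<in>I. cube (r i) (x i))}"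

definition thick :: "real \<Rightarrow> (real^'n) set \<Rightarrow> bool"
  where "thick d E \<longleftrightarrow>
    (\<exists>C>0. \<forall>x\<in>E. \<forall>r\<in>{0<..1}.
       ennreal (C * r powr d) \<le> hausdorff_content d (cube r x \<inter> E))"

definition locally_finite_borel :: "(real^'n) measure \<Rightarrow> bool"
  where "locally_finite_borel M \<longleftrightarrow>
    sets M = sets borel \<and> (\<forall>K. compact K \<longrightarrow> emeasure M K < \<infinity>)"

definition msupport :: "(real^'n) measure \<Rightarrow> (real^'n) set"
  where "msupport M = {x. \<forall>r>0. 0 < emeasure M (cube r x)}"

definition regular_seq ::
  "real \<Rightarrow> (real^'n) set \<Rightarrow> (nat \<Rightarrow> (real^'n) measure) \<Rightarrow> bool"
  where "regular_seq d E m \<longleftrightarrow>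
    (\<forall>k. locally_finite_borel (m k) \<and> msupport (m k) = E) \<and>
    (\<exists>C1>0. \<exists>C2>0. \<exists>C3>0. \<exists>\<gamma> :: nat \<Rightarrow> real^'n \<Rightarrow> real. \<forall>k.
       (\<forall>x. \<forall>r\<in>{0 <.. 2 powr (- real k)}.
          emeasure (m k) (cube r x) \<le> ennreal (C1 * r powr d)) \<and>
       (\<forall>x\<in>E. \<forall>r\<in>{2 powr (- real k) .. 1}.
          ennreal (C2 * r powr d) \<le> emeasure (m k) (cube r x)) \<and>
       \<gamma> k \<in> borel_measurable borel \<and>
       (\<exists>B. AE x in m 0. 0 \<le> \<gamma> k x \<and> \<gamma> k x \<le> B) \<and>
       m k = density (m 0) (\<lambda>x. ennreal (\<gamma> k x)) \<and>
       (\<forall>j. AE x in m 0. x \<in> E \<longrightarrow>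
          2 powr ((d - real CARD('n)) * real j) / C3 * \<gamma> (k + j) x \<le> \<gamma> k x \<and>
          \<gamma> k x \<le> C3 * \<gamma> (k + j) x))"

definition strongly_regular_seq ::
  "real \<Rightarrow> (real^'n) set \<Rightarrow> (nat \<Rightarrow> (real^'n) measure) \<Rightarrow> bool"
  where "strongly_regular_seq d E m \<longleftrightarrow>
    regular_seq d E m \<and>
    (\<forall>G\<in>sets borel. G \<subseteq> E \<longrightarrow>
       (AE x in m 0. x \<in> G \<longrightarrow>
          0 < limsup (\<lambda>k. ereal (measure (m k) (cube (2 powr (- real k)) x \<inter> G) /
                                   measure (m k) (cube (2 powr (- real k)) x)))))"

definition L_loc :: "real \<Rightarrow> (nat \<Rightarrow> (real^'n) measure) \<Rightarrow> (real^'n \<Rightarrow> real) set"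
  where "L_loc \<sigma> m =
    {f \<in> borel_measurable borel.
       \<forall>k K. compact K \<longrightarrow> (\<integral>\<^sup>+x\<in>K. ennreal (\<bar>f x\<bar> powr \<sigma>) \<partial>(m k)) < \<infinity>}"


subsection \<open>Besov spaces\<close>

definition frac_gradients :: "real \<Rightarrow> (real^'n \<Rightarrow> real) \<Rightarrow> (int \<Rightarrow> real^'n \<Rightarrow> real) set"
  where "frac_gradients s f =
    {g. (\<forall>k. g k \<in> borel_measurable borel \<and> (\<forall>x. 0 \<le> g k x)) \<and>
        (\<exists>N\<in>null_sets lebesgue. \<forall>k. \<forall>x\<in>- N. \<forall>y\<in>- N.
           2 powi (- k - 1) \<le> infnorm (x - y) \<and> infnorm (x - y) < 2 powi (- k) \<longrightarrow>
           \<bar>f x - f y\<bar> \<le> infnorm (x - y) powr s * (g k x + g k y))}"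

definition besov_norm :: "real \<Rightarrow> ennreal \<Rightarrow> ennreal \<Rightarrow> (real^'n \<Rightarrow> real) \<Rightarrow> ennreal"
  where "besov_norm s p q f =
    Lp_norm lborel p (\<lambda>x. ennreal \<bar>f x\<bar>) +
    (INF g\<in>frac_gradients s f. lq_norm q (\<lambda>k. Lp_norm lborel p (\<lambda>x. ennreal (g k x))))"

definition besov :: "real \<Rightarrow> ennreal \<Rightarrow> ennreal \<Rightarrow> (real^'n \<Rightarrow> real) set"
  where "besov s p q = {f \<in> borel_measurable borel. besov_norm s p q f < \<infinity>}"


subsection \<open>Traces\<close>

definition precise_rep :: "(real^'n \<Rightarrow> real) \<Rightarrow> real^'n \<Rightarrow> ereal"
  where "precise_rep f x = Limsup (at_right 0) (\<lambda>r. ereal (average lborel (cube r x) f))"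

text \<open>\<open>has_trace \<mu> f \<phi>\<close>: the trace of \<open>f\<close> is the \<open>\<mu>\<close>-class of \<open>\<phi>\<close>. The restriction
  to \<open>E\<close> is implicit, since \<open>E\<close> is the support of \<open>\<mu>\<close>.\<close>

definition has_trace :: "(real^'n) measure \<Rightarrow> (real^'n \<Rightarrow> real) \<Rightarrow> (real^'n \<Rightarrow> real) \<Rightarrow> bool"
  where "has_trace \<mu> f \<phi> \<longleftrightarrow> (AE x in \<mu>. ereal (\<phi> x) = precise_rep f x)"

definition trace_space ::
  "real \<Rightarrow> ennreal \<Rightarrow> ennreal \<Rightarrow> (real^'n) measure \<Rightarrow> (real^'n \<Rightarrow> real) set"
  where "trace_space s p q \<mu> =
    {\<phi> \<in> borel_measurable borel. \<exists>f\<in>besov s p q. has_trace \<mu> f \<phi>}"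

definition trace_norm ::
  "real \<Rightarrow> ennreal \<Rightarrow> ennreal \<Rightarrow> (real^'n) measure \<Rightarrow> (real^'n \<Rightarrow> real) \<Rightarrow> ennreal"
  where "trace_norm s p q \<mu> \<phi> =
    (INF f\<in>{f \<in> besov s p q. has_trace \<mu> f \<phi>}. besov_norm s p q f)"


subsection \<open>Best approximations and the intrinsic Besov norm\<close>

definition best_approx ::
  "(real^'n) measure \<Rightarrow> real \<Rightarrow> (real^'n \<Rightarrow> real) \<Rightarrow> (real^'n) set \<Rightarrow> ennreal"
  where "best_approx \<mu> \<sigma> f G =
    (INF c::real. enn_powr (nn_average \<mu> G (\<lambda>y. ennreal (\<bar>f y - c\<bar> powr \<sigma>))) (1 / \<sigma>))"

definition best_approx_mod ::
  "(real^'n) measure \<Rightarrow> real \<Rightarrow> (real^'n \<Rightarrow> real) \<Rightarrow> real \<Rightarrow> real^'n \<Rightarrow> ennreal"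
  where "best_approx_mod \<mu> \<sigma> f r x =
    (if cube r x \<inter> msupport \<mu> \<noteq> {} then best_approx \<mu> \<sigma> f (cube (2 * r) x) else 0)"

text \<open>The norm of order \<open>s - \<theta>/p\<close>. As in its defining formula, only \<open>s\<close> is needed;
  \<open>\<theta>\<close> enters through \<open>m\<close>.\<close>

definition intrinsic_norm ::
  "real \<Rightarrow> ennreal \<Rightarrow> ennreal \<Rightarrow> real \<Rightarrow> (nat \<Rightarrow> (real^'n) measure) \<Rightarrow>
   (real^'n \<Rightarrow> real) \<Rightarrow> ennreal"
  where "intrinsic_norm s p q \<sigma> m \<phi> =
    Lp_norm (m 0) p (\<lambda>x. ennreal \<bar>\<phi> x\<bar>) +
    lq_norm q (\<lambda>k::nat. ennreal (2 powr (real k * s)) *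
      Lp_norm lborel p (best_approx_mod (m k) \<sigma> \<phi> (2 powr (- real k))))"


subsection \<open>Extension operators\<close>

text \<open>A bounded linear operator from the trace space to the Besov space that is a right inverse
  of the trace, as a map on Borel representatives that descends to equivalence classes.\<close>

definition bounded_linear_trace_extension ::
  "real \<Rightarrow> ennreal \<Rightarrow> ennreal \<Rightarrow> (real^'n) measure \<Rightarrow>
   ((real^'n \<Rightarrow> real) \<Rightarrow> real^'n \<Rightarrow> real) \<Rightarrow> bool"
  where "bounded_linear_trace_extension s p q \<mu> Ext \<longleftrightarrow>
    (\<forall>\<phi>\<in>trace_space s p q \<mu>. Ext \<phi> \<in> besov s p q) \<and>
    (\<forall>\<phi>\<in>trace_space s p q \<mu>. \<forall>\<psi>\<in>trace_space s p q \<mu>.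
       (AE x in \<mu>. \<phi> x = \<psi> x) \<longrightarrow> (AE x in lborel. Ext \<phi> x = Ext \<psi> x)) \<and>
    (\<forall>\<phi>\<in>trace_space s p q \<mu>. \<forall>\<psi>\<in>trace_space s p q \<mu>. \<forall>a b.
       (\<lambda>x. a * \<phi> x + b * \<psi> x) \<in> trace_space s p q \<mu> \<and>
       (AE x in lborel. Ext (\<lambda>x. a * \<phi> x + b * \<psi> x) x = a * Ext \<phi> x + b * Ext \<psi> x)) \<and>
    (\<exists>C>0. \<forall>\<phi>\<in>trace_space s p q \<mu>.
       besov_norm s p q (Ext \<phi>) \<le> ennreal C * trace_norm s p q \<mu> \<phi>) \<and>
    (\<forall>\<phi>\<in>trace_space s p q \<mu>. has_trace \<mu> (Ext \<phi>) \<phi>)"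

end

theory Submission
  imports Defs
begin

text \<open>
  Write $r_k = 2^{-k}$ and $\theta = n - d$. \<^bold>\<open>Traces.\<close> The averages of \<open>f\<close> over two cubes of size about
  $r_j$ near \<open>x\<close> differ by at most $C r_j^s$ times the mean of $g_j$ over the cube of radius $r_j$
  about \<open>x\<close>. Since $m_k(Q_r) \le C r^d$ for $r \le r_k$, averaging at a scale $r_j \le r_k$ maps $L_p(R^n)$ to
  $L_p(m_k)$ with norm at most $C r_j^{-\theta/p}$. As $s > \theta/p$, the telescoping series of the averages
  converges $m_0$-a.e., with geometrically decaying tails, and a Hardy inequality gives the
  $\ell_q$ bound.

  \<^bold>\<open>Reduction to $\sigma = 1$.\<close> In the same way, nearly optimal constants for \<open>\<phi>\<close> on cubes about a
  point \<open>x\<close> of \<open>E\<close> converge $m_0$-a.e. Strong regularity identifies the limit with \<open>\<phi> x\<close>.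

  \<^bold>\<open>Extension.\<close> Let $F_k$ be the mean of \<open>\<phi>\<close> with respect to $m_k$, weighted by a Lipschitz bump of
  size $r_k$, and let $\chi_k$ be a Lipschitz cutoff, equal to \<open>1\<close> at distance at most $r_k/16$ from
  \<open>E\<close> and to \<open>0\<close> beyond $r_k/8$. The extension is
  $\chi_0 F_0 + \sum_k \chi_{k+1} (F_{k+1} - F_k)$. The \<open>k\<close>-th term is bounded by the best approximation
  of \<open>\<phi>\<close> at scale $r_k$, and its Lipschitz constant by $2^k$ times that; as $0 < s < 1$, such a series
  can be summed in the Besov space.
\<close>


subsection \<open>Powers and \<open>L\<^sub>p\<close> quasi-norms\<close>

text \<open>Three features shape the estimates. The exponents \<open>q\<close> and \<sigma> may lie
  below 1, so sums over infinitely many scales cannot rest on Minkowski's inequality. Each such sum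
  carries a geometric weight instead: part of its decay pays for the missing triangle inequality,
  the rest is kept for the next norm. The decay comes from \<open>s - \<tau>\<close>, with
  \<open>\<tau>\<close> = \<theta>/p, whenever E is involved, and from 0 < s < 1 when a Besov
  function is put together. Next, the upper and the lower bounds on the mass of m_k hold on opposite
  sides of the radius 2^{-k}. The lower bound is therefore always taken at that radius, where the
  two meet, and a passage from one measure to the next costs a constant factor. Finally, nearly
  optimal constants are chosen point by point, neither uniquely nor linearly in \<phi>; they serve
  only as numbers through which other quantities are compared, while the operator itself is made of
  means.\<close>

lemma enn_powr_ennreal: "0 \<le> x \<Longrightarrow> enn_powr (ennreal x) a = ennreal (x powr a)"
  by (simp add: enn_powr_def)

lemma enn_powr_top [simp]: "enn_powr top a = top"
  by (simp add: enn_powr_def)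

lemma enn_powr_0 [simp]: "enn_powr 0 a = 0"
  by (simp add: enn_powr_def)

lemma enn_powr_mono: "x \<le> y \<Longrightarrow> 0 \<le> a \<Longrightarrow> enn_powr x a \<le> enn_powr y a"
  by (cases x; cases y) (auto simp: enn_powr_ennreal powr_mono2 top_unique)

lemma enn_powr_mult: "enn_powr (x * y) a = enn_powr x a * enn_powr y a"
proof (cases x; cases y)
  fix r s assume "x = ennreal r" "0 \<le> r" "y = ennreal s" "0 \<le> s"
  then show ?thesis by (simp add: enn_powr_ennreal powr_mult flip: ennreal_mult)
next
  fix r assume "x = ennreal r" "0 \<le> r" "y = top"
  then show ?thesis by (cases "r = 0") (auto simp: ennreal_mult_top enn_powr_ennreal)
next
  fix r assume "y = ennreal r" "0 \<le> r" "x = top"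
  then show ?thesis by (cases "r = 0") (auto simp: ennreal_top_mult enn_powr_ennreal)
qed auto

lemma enn_powr_powr: "enn_powr (enn_powr x a) b = enn_powr x (a * b)"
  by (cases x) (auto simp: enn_powr_ennreal powr_powr)

lemma enn_powr_one [simp]: "enn_powr x 1 = x"
  by (cases x) (auto simp: enn_powr_ennreal)

lemma enn_powr_inverse:
  "a \<noteq> 0 \<Longrightarrow> enn_powr (enn_powr x a) (1 / a) = x"
  "a \<noteq> 0 \<Longrightarrow> enn_powr (enn_powr x (1 / a)) a = x"
  by (auto simp: enn_powr_powr)

lemma enn_powr_le_iff: "0 < a \<Longrightarrow> enn_powr x a \<le> enn_powr y a \<longleftrightarrow> x \<le> y"
  by (metis enn_powr_inverse(1) enn_powr_mono less_eq_real_def order_less_irrefl zero_less_divide_1_iff)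

lemma enn_powr_le_swap: "0 < a \<Longrightarrow> enn_powr x (1 / a) \<le> y \<longleftrightarrow> x \<le> enn_powr y a"
  by (metis enn_powr_inverse(2) enn_powr_le_iff less_numeral_extra(3))

lemma le_enn_powr_swap: "0 < a \<Longrightarrow> x \<le> enn_powr y (1 / a) \<longleftrightarrow> enn_powr x a \<le> y"
  by (metis enn_powr_inverse(2) enn_powr_le_iff less_numeral_extra(3))

lemma enn_powr_lt_top: "x < top \<Longrightarrow> enn_powr x a < top"
  by (cases x) (auto simp: enn_powr_ennreal)

text \<open>The crude bound of a sum by twice the maximum works for every positive exponent, without
  distinguishing a < 1 from a \<ge> 1.\<close>

lemma enn_powr_add_le:
  assumes "0 < a"
  shows "enn_powr (x + y) a \<le> ennreal (2 powr a) * (enn_powr x a + enn_powr y a)"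
proof -
  have "x + y \<le> 2 * max x y"
    by (metis add_mono max.cobounded1 max.cobounded2 mult_2)
  then have "enn_powr (x + y) a \<le> enn_powr (ennreal 2 * max x y) a"
    using assms by (intro enn_powr_mono) auto
  also have "\<dots> = ennreal (2 powr a) * enn_powr (max x y) a"
    by (subst enn_powr_mult) (simp add: enn_powr_ennreal del: ennreal_numeral)
  also have "\<dots> \<le> ennreal (2 powr a) * (enn_powr x a + enn_powr y a)"
    by (intro mult_left_mono) (auto simp: max_def)
  finally show ?thesis .
qed

lemma measurable_enn_powr [measurable (raw)]:
  assumes [measurable]: "f \<in> borel_measurable M"
  shows "(\<lambda>x. enn_powr (f x) a) \<in> borel_measurable M"
  unfolding enn_powr_def by measurable

lemma enn2real_pos: "0 < p \<Longrightarrow> p \<noteq> top \<Longrightarrow> 0 < enn2real p"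
  by (simp add: enn2real_positive_iff less_top)

lemma Lp_norm_le_iff:
  assumes "0 < p" "p \<noteq> top"
  shows "Lp_norm M p f \<le> c \<longleftrightarrow>
    (\<integral>\<^sup>+x. enn_powr (f x) (enn2real p) \<partial>M) \<le> enn_powr c (enn2real p)"
  unfolding Lp_norm_def using enn2real_pos[OF assms] assms by (simp add: enn_powr_le_swap)

lemma Lp_norm_powr:
  assumes "0 < p" "p \<noteq> top"
  shows "enn_powr (Lp_norm M p f) (enn2real p) = (\<integral>\<^sup>+x. enn_powr (f x) (enn2real p) \<partial>M)"
  unfolding Lp_norm_def using enn2real_pos[OF assms] assms by (simp add: enn_powr_inverse)

lemma Lp_norm_top_le_iff:
  assumes "f \<in> borel_measurable M"
  shows "Lp_norm M top f \<le> c \<longleftrightarrow> (AE x in M. f x \<le> c)"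
proof
  assume "Lp_norm M top f \<le> c"
  then have "esssup M f \<le> c" by (simp add: Lp_norm_def)
  with esssup_AE[where M=M and f=f] show "AE x in M. f x \<le> c"
    by (auto elim!: eventually_mono)
qed (use assms in \<open>auto simp: Lp_norm_def\<close>)

lemma AE_le_Lp_norm_top: "AE x in M. f x \<le> Lp_norm M top f"
  using esssup_AE[where M=M and f=f] by (simp add: Lp_norm_def)

lemma Lp_norm_mono_AE:
  assumes "0 < p" "f \<in> borel_measurable M" "AE x in M. f x \<le> g x"
  shows "Lp_norm M p f \<le> Lp_norm M p g"
proof (cases "p = top")
  case True
  with assms show ?thesis by (simp add: Lp_norm_def esssup_AE_mono)
next
  case False
  have "(\<integral>\<^sup>+x. enn_powr (f x) (enn2real p) \<partial>M) \<le> (\<integral>\<^sup>+x. enn_powr (g x) (enn2real p) \<partial>M)"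
    using assms(3) by (intro nn_integral_mono_AE) (auto elim!: eventually_mono intro: enn_powr_mono)
  with False assms(1) show ?thesis by (simp add: Lp_norm_le_iff Lp_norm_powr)
qed

lemma Lp_norm_cmult_le:
  assumes "0 < p" "f \<in> borel_measurable M"
  shows "Lp_norm M p (\<lambda>x. c * f x) \<le> c * Lp_norm M p f"
proof (cases "p = top")
  case True
  have "AE x in M. c * f x \<le> c * Lp_norm M top f"
    using AE_le_Lp_norm_top[where M=M and f=f] by (auto elim!: eventually_mono intro: mult_left_mono)
  with assms True show ?thesis by (simp add: Lp_norm_top_le_iff)
next
  case False
  with assms show ?thesis
    by (simp add: Lp_norm_le_iff enn_powr_mult Lp_norm_powr nn_integral_cmult)
qed

text \<open>A quasi-triangle inequality whose constant depends on the exponent alone; it can thus be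
  fixed before the measures and functions to which it is applied.\<close>

lemma Lp_norm_add_le:
  assumes p: "0 < p"
  obtains C :: real where "0 < C"
    "\<And>M f g. f \<in> borel_measurable M \<Longrightarrow> g \<in> borel_measurable M \<Longrightarrow>
       Lp_norm M p (\<lambda>x. f x + g x) \<le> ennreal C * (Lp_norm M p f + Lp_norm M p g)"
proof (cases "p = top")
  case True
  show ?thesis
  proof (rule that[of 1])
    fix M :: "'b measure" and f g :: "'b \<Rightarrow> ennreal"
    assume [measurable]: "f \<in> borel_measurable M" "g \<in> borel_measurable M"
    have "AE x in M. f x + g x \<le> Lp_norm M top f + Lp_norm M top g"
      using AE_le_Lp_norm_top[where M=M and f=f] AE_le_Lp_norm_top[where M=M and f=g] by eventually_elim (rule add_mono)
    with True show "Lp_norm M p (\<lambda>x. f x + g x) \<le> ennreal 1 * (Lp_norm M p f + Lp_norm M p g)"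
      by (simp add: Lp_norm_top_le_iff)
  qed simp
next
  case False
  define P where "P = enn2real p"
  have P: "0 < P" using enn2real_pos[OF p False] by (simp add: P_def)
  \<comment> \<open>The factor 2 stands for the two integrals, each at most the P-th power of the
    sum of the norms; 2^P comes from the power inequality.\<close>
  define C where "C = (2 powr P * 2) powr (1 / P)"
  have C0: "0 < C" by (simp add: C_def)
  show ?thesis
  proof (rule that[OF C0])
    fix M :: "'b measure" and f g :: "'b \<Rightarrow> ennreal"
    assume [measurable]: "f \<in> borel_measurable M" "g \<in> borel_measurable M"
    let ?N = "Lp_norm M p f + Lp_norm M p g"
    have "(\<integral>\<^sup>+x. enn_powr (f x + g x) P \<partial>M) \<le> (\<integral>\<^sup>+x. ennreal (2 powr P) * (enn_powr (f x) P + enn_powr (g x) P) \<partial>M)"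
      by (intro nn_integral_mono enn_powr_add_le P)
    also have "\<dots> = ennreal (2 powr P) * (enn_powr (Lp_norm M p f) P + enn_powr (Lp_norm M p g) P)"
      by (simp add: nn_integral_cmult nn_integral_add Lp_norm_powr[OF p False] P_def)
    also have "\<dots> \<le> ennreal (2 powr P) * (enn_powr ?N P + enn_powr ?N P)"
      using P by (intro mult_left_mono add_mono enn_powr_mono) auto
    also have "\<dots> = ennreal (2 powr P * 2) * enn_powr ?N P"
      by (simp add: ennreal_mult mult_2[symmetric] mult.assoc)
    also have "\<dots> = enn_powr (ennreal C * ?N) P"
      using P by (simp add: enn_powr_mult C_def enn_powr_ennreal powr_powr)
    finally show "Lp_norm M p (\<lambda>x. f x + g x) \<le> ennreal C * ?N"
      by (simp add: Lp_norm_le_iff[OF p False] P_def)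
  qed
qed

lemma Lp_norm_finite_AE:
  assumes "0 < p" "f \<in> borel_measurable M" "Lp_norm M p f < top"
  shows "AE x in M. f x < top"
proof (cases "p = top")
  case True
  with assms AE_le_Lp_norm_top[where M=M and f=f] show ?thesis
    by (auto elim!: eventually_mono)
next
  case False
  have "(\<integral>\<^sup>+x. enn_powr (f x) (enn2real p) \<partial>M) \<noteq> \<infinity>"
    using assms(3) enn_powr_lt_top[OF assms(3)] Lp_norm_powr[OF assms(1) False, of M f]
    by (metis infinity_ennreal_def less_irrefl)
  with assms(2) have "AE x in M. enn_powr (f x) (enn2real p) \<noteq> \<infinity>"
    by (intro nn_integral_PInf_AE) auto
  then show ?thesis by eventually_elim (metis enn_powr_top infinity_ennreal_def less_top)
qed

section \<open>Geometrically weighted sums\<close>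

lemma suminf_powr_geometric:
  fixes \<delta> :: real
  assumes "0 < \<delta>"
  obtains K :: real where "0 < K" "(\<Sum>i. ennreal (2 powr (- \<delta> * real i))) = ennreal K"
proof
  let ?q = "2 powr (- \<delta>)"
  have q: "0 < ?q" "?q < 1" using assms by (auto simp: powr_less_one)
  have eq: "2 powr (- \<delta> * real i) = ?q ^ i" for i
    by (simp add: powr_powr powr_realpow[symmetric])
  have s: "(\<lambda>i. ?q ^ i) sums (1 / (1 - ?q))" using q by (intro geometric_sums) auto
  show "(\<Sum>i. ennreal (2 powr (- \<delta> * real i))) = ennreal (1 / (1 - ?q))"
    unfolding eq using q s by (intro suminf_ennreal_eq) auto
  show "0 < 1 / (1 - ?q)" using q by simp
qed

text \<open>Half of the decay is spent on a supremum: 2^(-\<delta> i / 2) b_i is at most S^(1/P),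
  where S is the sum on the right. The other half makes these bounds summable. The argument is the
  same for P below and above 1.\<close>

lemma enn_powr_geometric:
  fixes \<delta> P :: real
  assumes "0 < \<delta>" "0 < P"
  obtains C :: real where "0 < C"
    "\<And>b. enn_powr (\<Sum>i. ennreal (2 powr (- \<delta> * real i)) * b i) P
       \<le> ennreal C * (\<Sum>i. ennreal (2 powr (- (\<delta> * P / 2) * real i)) * enn_powr (b i) P)"
proof -
  obtain K where K: "0 < K" "(\<Sum>i. ennreal (2 powr (- (\<delta> / 2) * real i))) = ennreal K"
    by (rule suminf_powr_geometric[of "\<delta> / 2"]) (use assms in simp)
  show ?thesis
  proof (rule that[of "K powr P"])
    fix b :: "nat \<Rightarrow> ennreal"
    let ?t = "\<lambda>i. ennreal (2 powr (- (\<delta> * P / 2) * real i)) * enn_powr (b i) P"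
    define S where "S = (\<Sum>i. ?t i)"
    have eq: "?t i = enn_powr (ennreal (2 powr (- (\<delta> / 2) * real i)) * b i) P" for i
      by (simp add: enn_powr_mult enn_powr_ennreal powr_powr algebra_simps)
    have "?t i \<le> S" for i
      using sum_le_suminf[of ?t "{i}"] by (simp add: S_def)
    then have *: "ennreal (2 powr (- (\<delta> / 2) * real i)) * b i \<le> enn_powr S (1 / P)" for i
      unfolding le_enn_powr_swap[OF assms(2)] eq[symmetric] .
    have "(\<Sum>i. ennreal (2 powr (- \<delta> * real i)) * b i)
        = (\<Sum>i. ennreal (2 powr (- (\<delta> / 2) * real i)) * (ennreal (2 powr (- (\<delta> / 2) * real i)) * b i))"
      by (auto simp: mult.assoc[symmetric] ennreal_mult[symmetric] powr_add[symmetric] intro!: suminf_cong)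
    also have "\<dots> \<le> (\<Sum>i. ennreal (2 powr (- (\<delta> / 2) * real i)) * enn_powr S (1 / P))"
      by (intro suminf_le mult_left_mono *) auto
    also have "\<dots> = ennreal K * enn_powr S (1 / P)" by (simp only: ennreal_suminf_multc K(2))
    finally have "enn_powr (\<Sum>i. ennreal (2 powr (- \<delta> * real i)) * b i) P \<le> enn_powr (ennreal K * enn_powr S (1 / P)) P"
      using assms(2) by (rule enn_powr_mono[OF _ less_imp_le])
    also have "\<dots> = ennreal (K powr P) * S"
      using K assms by (simp add: enn_powr_mult enn_powr_ennreal enn_powr_powr)
    finally show "enn_powr (\<Sum>i. ennreal (2 powr (- \<delta> * real i)) * b i) P \<le> ennreal (K powr P) * (\<Sum>i. ?t i)"
      by (simp add: S_def)
  qed (use K in auto)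
qed

text \<open>A substitute for Minkowski's inequality, valid for every p > 0. With Lebesgue measure or
  \<open>m k\<close> it adds up functions; with a counting measure, and with the f_i shifts of one
  sequence, it is the Hardy inequality for sums over scales.\<close>

lemma Lp_norm_geometric:
  fixes \<delta> :: real and p :: ennreal
  assumes "0 < \<delta>" "0 < p"
  obtains C :: real where "0 < C"
    "\<And>M f B. (\<And>i. f i \<in> borel_measurable M) \<Longrightarrow> (\<And>i. Lp_norm M p (f i) \<le> B) \<Longrightarrow>
       Lp_norm M p (\<lambda>x. \<Sum>i. ennreal (2 powr (- \<delta> * real i)) * f i x) \<le> ennreal C * B"
proof (cases "p = top")
  case True
  obtain K where K: "0 < K" "(\<Sum>i. ennreal (2 powr (- \<delta> * real i))) = ennreal K"
    by (rule suminf_powr_geometric[OF assms(1)])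
  show ?thesis
  proof (rule that[OF K(1)])
    fix M :: "'b measure" and f :: "nat \<Rightarrow> 'b \<Rightarrow> ennreal" and B
    assume [measurable]: "\<And>i. f i \<in> borel_measurable M" and B: "\<And>i. Lp_norm M p (f i) \<le> B"
    have "AE x in M. \<forall>i. f i x \<le> B"
    proof (intro AE_all_countable[THEN iffD2] allI)
      fix i show "AE x in M. f i x \<le> B"
        using B[of i] True by (simp add: Lp_norm_top_le_iff)
    qed
    then have "AE x in M. (\<Sum>i. ennreal (2 powr (- \<delta> * real i)) * f i x) \<le> ennreal K * B"
    proof eventually_elim
      case (elim x)
      have "(\<Sum>i. ennreal (2 powr (- \<delta> * real i)) * f i x) \<le> (\<Sum>i. ennreal (2 powr (- \<delta> * real i)) * B)"
        using elim by (intro suminf_le mult_left_mono) auto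
      then show ?case using K by simp
    qed
    then show "Lp_norm M p (\<lambda>x. \<Sum>i. ennreal (2 powr (- \<delta> * real i)) * f i x) \<le> ennreal K * B"
      by (simp add: True Lp_norm_top_le_iff)
  qed
next
  case False
  define P where "P = enn2real p"
  have P: "0 < P" using enn2real_pos[OF assms(2) False] by (simp add: P_def)
  obtain C where C: "0 < C" "\<And>b. enn_powr (\<Sum>i. ennreal (2 powr (- \<delta> * real i)) * b i) P
       \<le> ennreal C * (\<Sum>i. ennreal (2 powr (- (\<delta> * P / 2) * real i)) * enn_powr (b i) P)"
    using enn_powr_geometric[OF assms(1) P] by blast
  obtain K where K: "0 < K" "(\<Sum>i. ennreal (2 powr (- (\<delta> * P / 2) * real i))) = ennreal K"
    by (rule suminf_powr_geometric[of "\<delta> * P / 2"]) (use assms P in simp)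
  show ?thesis
  proof (rule that[of "(C * K) powr (1 / P)"])
    fix M :: "'b measure" and f :: "nat \<Rightarrow> 'b \<Rightarrow> ennreal" and B
    assume [measurable]: "\<And>i. f i \<in> borel_measurable M" and B: "\<And>i. Lp_norm M p (f i) \<le> B"
    have "(\<integral>\<^sup>+x. enn_powr (\<Sum>i. ennreal (2 powr (- \<delta> * real i)) * f i x) P \<partial>M)
       \<le> (\<integral>\<^sup>+x. ennreal C * (\<Sum>i. ennreal (2 powr (- (\<delta> * P / 2) * real i)) * enn_powr (f i x) P) \<partial>M)"
      by (intro nn_integral_mono C)
    also have "\<dots> = ennreal C * (\<Sum>i. ennreal (2 powr (- (\<delta> * P / 2) * real i)) * enn_powr (Lp_norm M p (f i)) P)"
      by (simp add: nn_integral_cmult nn_integral_suminf Lp_norm_powr[OF assms(2) False] P_def)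
    also have "\<dots> \<le> ennreal C * (\<Sum>i. ennreal (2 powr (- (\<delta> * P / 2) * real i)) * enn_powr B P)"
      using P B by (intro mult_left_mono suminf_le enn_powr_mono) auto
    also have "\<dots> = ennreal C * (ennreal K * enn_powr B P)"
      by (simp only: ennreal_suminf_multc K(2))
    also have "\<dots> = enn_powr (ennreal ((C * K) powr (1 / P)) * B) P"
      using P C K(1) by (simp add: enn_powr_mult enn_powr_ennreal powr_powr ennreal_mult mult.assoc)
    finally show "Lp_norm M p (\<lambda>x. \<Sum>i. ennreal (2 powr (- \<delta> * real i)) * f i x) \<le> ennreal ((C * K) powr (1 / P)) * B"
      by (simp add: Lp_norm_le_iff[OF assms(2) False] P_def)
  qed (use C K in auto)
qed

section \<open>Sequence norms under change of index\<close>

lemma lq_norm_inj_le: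
  assumes "0 < q" "inj \<tau>"
  shows "lq_norm q (\<lambda>i. b (\<tau> i)) \<le> lq_norm q b"
proof (cases "q = top")
  case True
  have "AE i in count_space UNIV. b (\<tau> i) \<le> Lp_norm (count_space UNIV) top b"
    using AE_le_Lp_norm_top[where f=b and M="count_space UNIV"] by (simp add: AE_count_space)
  then show ?thesis unfolding True by (subst Lp_norm_top_le_iff) auto
next
  case False
  have "(\<integral>\<^sup>+i. enn_powr (b (\<tau> i)) (enn2real q) \<partial>count_space UNIV)
      = (\<integral>\<^sup>+j. enn_powr (b j) (enn2real q) \<partial>count_space (range \<tau>))"
    using assms(2) by (intro nn_integral_bij_count_space) (simp add: inj_on_imp_bij_betw)
  also have "\<dots> \<le> (\<integral>\<^sup>+j. enn_powr (b j) (enn2real q) \<partial>count_space UNIV)"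
    by (subst nn_integral_count_space_indicator) (auto intro!: nn_integral_mono simp: indicator_def)
  finally show ?thesis using assms(1) False by (simp add: Lp_norm_le_iff Lp_norm_powr)
qed

lemma lq_norm_extend_le:
  fixes a :: "nat \<Rightarrow> ennreal"
  assumes "0 < q"
  shows "lq_norm q (\<lambda>j::int. if j < 0 then 0 else a (nat j)) \<le> lq_norm q a"
proof (cases "q = top")
  case True
  have "\<forall>j. a j \<le> Lp_norm (count_space UNIV) top a"
    using AE_le_Lp_norm_top[where f=a and M="count_space UNIV"] by (simp add: AE_count_space)
  then show ?thesis unfolding True by (subst Lp_norm_top_le_iff) (auto simp: AE_count_space)
next
  case False
  have "(\<integral>\<^sup>+(j::int). enn_powr (if j < 0 then 0 else a (nat j)) (enn2real q) \<partial>count_space UNIV)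
      = (\<integral>\<^sup>+(j::int). enn_powr (a (nat j)) (enn2real q) \<partial>count_space {0..})"
    by (subst nn_integral_count_space_indicator[of "{0..}"]) (auto intro!: nn_integral_cong simp: indicator_def)
  also have "\<dots> = (\<integral>\<^sup>+i. enn_powr (a (nat (int i))) (enn2real q) \<partial>count_space UNIV)"
    by (intro nn_integral_bij_count_space[symmetric] bij_betwI[where g=nat]) auto
  finally show ?thesis using assms(1) False by (simp add: Lp_norm_le_iff Lp_norm_powr)
qed

lemma le_lq_norm:
  assumes "0 < q"
  shows "a i \<le> lq_norm q a"
proof (cases "q = top")
  case True
  then show ?thesis
    using AE_le_Lp_norm_top[where f=a and M="count_space UNIV"] by (simp add: AE_count_space)
next
  case False
  have "enn_powr (a i) (enn2real q) = (\<integral>\<^sup>+j. enn_powr (a j) (enn2real q) * indicator {i} j \<partial>count_space UNIV)"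
    by (subst nn_integral_indicator_singleton) auto
  also have "\<dots> \<le> (\<integral>\<^sup>+j. enn_powr (a j) (enn2real q) \<partial>count_space UNIV)"
    by (intro nn_integral_mono) (auto simp: indicator_def)
  finally show ?thesis using enn2real_pos[OF assms False]
    by (simp add: Lp_norm_powr[OF assms False, symmetric] enn_powr_le_iff)
qed

text \<open>Jensen's inequality for total mass at most A. The function x^P lies above its tangent at
  t; this is integrated, and then t is taken to be the integral of g divided by A.\<close>

lemma nn_integral_powr_le:
  fixes A P :: real
  assumes [measurable]: "g \<in> borel_measurable M" and A: "emeasure M (space M) \<le> ennreal A" "0 < A" and P: "1 \<le> P"
  shows "enn_powr (\<integral>\<^sup>+x. g x \<partial>M) P \<le> ennreal (A powr (P - 1)) * (\<integral>\<^sup>+x. enn_powr (g x) P \<partial>M)"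
proof (cases "(\<integral>\<^sup>+x. enn_powr (g x) P \<partial>M) = top")
  case True
  then show ?thesis using A by (simp add: ennreal_mult_top)
next
  case False
  define J where "J = enn2real (\<integral>\<^sup>+x. enn_powr (g x) P \<partial>M)"
  have J: "(\<integral>\<^sup>+x. enn_powr (g x) P \<partial>M) = ennreal J" "0 \<le> J" using False by (auto simp: J_def less_top)
  \<comment> \<open>The tangent inequality at t. The case P = 1 is apart because Young's inequality
    needs the conjugate exponent to be finite.\<close>
  have young: "ennreal (P * t powr (P - 1)) * x \<le> enn_powr x P + ennreal ((P - 1) * t powr P)" if "0 < t" for t :: real and x
  proof (cases x)
    case (real a)
    have "P * t powr (P - 1) * a \<le> a powr P + (P - 1) * t powr P"
    proof (cases "P = 1")
      case True then show ?thesis using that real by simp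
    next
      case False
      then have P1: "1 < P" using P by simp
      have "a * t powr (P - 1) \<le> a powr P / P + (t powr (P - 1)) powr (P / (P - 1)) / (P / (P - 1))"
        using P1 real by (intro Youngs_inequality) (auto simp: field_simps)
      also have "(t powr (P - 1)) powr (P / (P - 1)) = t powr P" using P1 by (simp add: powr_powr)
      finally have "P * (a * t powr (P - 1)) \<le> P * (a powr P / P + t powr P / (P / (P - 1)))"
        using P1 by (intro mult_left_mono) auto
      also have "P * (a powr P / P + t powr P / (P / (P - 1))) = a powr P + (P - 1) * t powr P"
        using P1 by (simp add: field_simps)
      finally show ?thesis by (simp add: mult_ac)
    qed
    then show ?thesis using real P that
      by (auto simp: enn_powr_ennreal ennreal_mult[symmetric] ennreal_plus[symmetric] simp del: ennreal_plus intro!: ennreal_leI)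
  qed auto
  have int: "ennreal (P * t powr (P - 1)) * (\<integral>\<^sup>+x. g x \<partial>M) \<le> ennreal (J + (P - 1) * t powr P * A)" if "0 < t" for t
  proof -
    have "ennreal (P * t powr (P - 1)) * (\<integral>\<^sup>+x. g x \<partial>M) = (\<integral>\<^sup>+x. ennreal (P * t powr (P - 1)) * g x \<partial>M)"
      by (simp add: nn_integral_cmult)
    also have "\<dots> \<le> (\<integral>\<^sup>+x. enn_powr (g x) P + ennreal ((P - 1) * t powr P) \<partial>M)"
      by (intro nn_integral_mono young that)
    also have "\<dots> = ennreal J + ennreal ((P - 1) * t powr P) * emeasure M (space M)"
      by (simp add: nn_integral_add J)
    also have "\<dots> \<le> ennreal J + ennreal ((P - 1) * t powr P) * ennreal A"
      using A by (intro add_left_mono mult_left_mono) auto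
    also have "\<dots> = ennreal (J + (P - 1) * t powr P * A)"
      using J P A by (simp add: ennreal_mult)
    finally show ?thesis .
  qed
  have "(\<integral>\<^sup>+x. g x \<partial>M) \<noteq> top"
    using int[of 1] P by (auto simp: ennreal_mult_top top_unique)
  then obtain I where I: "(\<integral>\<^sup>+x. g x \<partial>M) = ennreal I" "0 \<le> I" by (cases "\<integral>\<^sup>+x. g x \<partial>M") auto
  have "I powr P \<le> A powr (P - 1) * J"
  proof (cases "I = 0")
    case True then show ?thesis using P J by simp
  next
    case False
    define t where "t = I / A"
    have t: "0 < t" "I = t * A" using I False A by (auto simp: t_def)
    have "P * t powr (P - 1) * I \<le> J + (P - 1) * t powr P * A"
      using int[OF t(1)] J P A unfolding I(1)
      by (subst (asm) ennreal_mult[symmetric]) (auto simp: I ennreal_le_iff simp del: ennreal_plus)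
    moreover have "P * t powr (P - 1) * I = P * t powr P * A"
      using t by (simp add: powr_diff)
    ultimately have "P * t powr P * A \<le> J + (P - 1) * t powr P * A" by simp
    then have "t powr P * A \<le> J" by (simp add: algebra_simps)
    then have "A powr (P - 1) * (t powr P * A) \<le> A powr (P - 1) * J" by (intro mult_left_mono) auto
    then show ?thesis using t A by (simp add: powr_diff powr_mult mult_ac)
  qed
  then show ?thesis using I J by (simp add: enn_powr_ennreal ennreal_mult[symmetric] ennreal_leI)
qed


subsection \<open>Cubes\<close>

lemma infnorm_le_iff: "infnorm (x::real^'n) \<le> r \<longleftrightarrow> (\<forall>i. \<bar>x $ i\<bar> \<le> r)"
proof
  assume "infnorm x \<le> r"
  then show "\<forall>i. \<bar>x $ i\<bar> \<le> r" using component_le_infnorm_cart order_trans by blast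
next
  assume "\<forall>i. \<bar>x $ i\<bar> \<le> r"
  then show "infnorm x \<le> r" unfolding infnorm_cart by (intro cSup_least) auto
qed

lemma mem_cube: "y \<in> cube r x \<longleftrightarrow> infnorm (y - x) \<le> r"
  by (simp add: cube_def)

lemma mem_cube_sym: "y \<in> cube r x \<longleftrightarrow> x \<in> cube r y"
  by (simp add: mem_cube infnorm_sub)

lemma mem_cube_self [simp]: "0 \<le> r \<Longrightarrow> x \<in> cube r x"
  by (simp add: mem_cube infnorm_0)

lemma cube_eq_cbox: "cube r x = cbox (x - vec r) (x + vec r)"
  by (auto simp: mem_cube infnorm_le_iff mem_box_cart abs_le_iff algebra_simps)

lemma cube_mono: "infnorm (x - y) + r \<le> s \<Longrightarrow> cube r x \<subseteq> cube s y"
proof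
  fix z assume "infnorm (x - y) + r \<le> s" "z \<in> cube r x"
  then show "z \<in> cube s y" using infnorm_triangle[of "z - x" "x - y"] by (simp add: mem_cube)
qed

lemma cube_mono_radius: "r \<le> s \<Longrightarrow> cube r x \<subseteq> cube s x"
  by (auto simp: mem_cube)

lemma compact_cube: "compact (cube r x)"
  unfolding cube_eq_cbox by (rule compact_cbox)

lemma sets_cube [measurable]: "cube r x \<in> sets borel"
  unfolding cube_eq_cbox by simp

lemma emeasure_lborel_cube:
  assumes "0 \<le> r"
  shows "emeasure lborel (cube r (x::real^'n)) = ennreal ((2 * r) ^ CARD('n))"
proof -
  have b: "vec r \<bullet> b = r" if "b \<in> Basis" for b :: "real^'n"
    using that by (auto simp: Basis_vec_def inner_axis)
  have "((x + vec r) - (x - vec r)) \<bullet> b = 2 * r" if "b \<in> Basis" for b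
    unfolding inner_diff_left inner_add_left b[OF that] by simp
  then have "(\<Prod>b\<in>Basis. ((x + vec r) - (x - vec r)) \<bullet> b) = (\<Prod>b\<in>(Basis :: (real^'n) set). 2 * r)"
    by (intro prod.cong refl) blast
  also have "\<dots> = (2 * r) ^ CARD('n)" by (simp add: prod_constant)
  finally show ?thesis
    using assms unfolding cube_eq_cbox
    by (subst emeasure_lborel_cbox) (auto simp: inner_add_left inner_diff_left b)
qed

lemma measure_lborel_cube: "0 \<le> r \<Longrightarrow> measure lborel (cube r (x::real^'n)) = (2 * r) ^ CARD('n)"
  by (simp add: measure_def emeasure_lborel_cube)

lemma borel_measurable_infnorm [measurable]: "infnorm \<in> borel_measurable (borel :: (real^'n) measure)"
  by (intro borel_measurable_continuous_onI continuous_on_infnorm continuous_on_id)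

lemma measurable_cube [measurable]:
  assumes [measurable]: "f \<in> borel_measurable M" "g \<in> borel_measurable M"
  shows "Measurable.pred M (\<lambda>z. (g z :: real^'n) \<in> cube r (f z))"
  unfolding mem_cube by measurable

lemma measurable_indicator_cube [measurable]:
  assumes [measurable]: "f \<in> borel_measurable M" "g \<in> borel_measurable M"
  shows "(\<lambda>z. indicator (cube r (f z)) (g z :: real^'n) :: ennreal) \<in> borel_measurable M"
  unfolding indicator_def by measurable

lemma emeasure_cube_finite: "locally_finite_borel M \<Longrightarrow> emeasure M (cube r x) < top"
  using compact_cube[of r x] by (auto simp: locally_finite_borel_def)

lemma locally_finite_borel_sets: "locally_finite_borel M \<Longrightarrow> sets M = sets borel"
  by (simp add: locally_finite_borel_def)

lemma locally_finite_borel_space: "locally_finite_borel M \<Longrightarrow> space M = UNIV"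
  using sets_eq_imp_space_eq[of M borel] by (simp add: locally_finite_borel_def)

lemma locally_finite_borel_sigma_finite:
  assumes "locally_finite_borel (M :: (real^'n) measure)"
  shows "sigma_finite_measure M"
proof
  have "\<exists>n. x \<in> cube (real n) 0" for x :: "real^'n"
    using real_arch_simple[of "infnorm x"] by (auto simp: mem_cube)
  then have "\<Union> (range (\<lambda>n. cube (real n) (0 :: real^'n))) = space M"
    using locally_finite_borel_space[OF assms] by auto
  then show "\<exists>A::(real^'n) set set. countable A \<and> A \<subseteq> sets M \<and> \<Union> A = space M \<and> (\<forall>a\<in>A. emeasure M a \<noteq> \<infinity>)"
    using emeasure_cube_finite[OF assms]
    by (intro exI[of _ "range (\<lambda>n. cube (real n) 0)"])
       (auto simp: locally_finite_borel_sets[OF assms] less_top)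
qed

lemma locally_finite_borel_lborel: "locally_finite_borel lborel"
  using emeasure_bounded_finite compact_imp_bounded by (auto simp: locally_finite_borel_def)

text \<open>A cube of radius 2r is covered by 2^n cubes of radius r, one for each vector of signs.
  The bound \<open>c\<close> has to hold for all centres, since those of the small cubes differ from
  x.\<close>

lemma emeasure_cube_double:
  obtains N :: real where "1 \<le> N"
    "\<And>(\<mu> :: (real^'n) measure) r c x. sets \<mu> = sets borel \<Longrightarrow> 0 \<le> r \<Longrightarrow> (\<And>x. emeasure \<mu> (cube r x) \<le> c)
       \<Longrightarrow> emeasure \<mu> (cube (2 * r) x) \<le> ennreal N * c"
proof -
  define S where "S = {e :: real^'n. \<forall>i. e $ i \<in> {-1, 1}}"
  have "S \<subseteq> (\<lambda>f. \<chi> i. f i) ` (UNIV \<rightarrow>\<^sub>E {-1, 1})"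
  proof
    fix e assume "e \<in> S"
    then show "e \<in> (\<lambda>f. \<chi> i. f i) ` (UNIV \<rightarrow>\<^sub>E {-1, 1})"
      by (intro image_eqI[of _ _ "\<lambda>i. e $ i"]) (auto simp: S_def)
  qed
  then have fin: "finite S"
    by (rule finite_subset) (intro finite_imageI finite_PiE, auto)
  have "(\<chi> i. 1) \<in> S" by (auto simp: S_def)
  with fin have "1 \<le> card S" by (metis One_nat_def Suc_leI card_gt_0_iff empty_iff)
  then show ?thesis
  proof (intro that[of "real (card S)"])
    fix \<mu> :: "(real^'n) measure" and r :: real and c x
    assume s: "sets \<mu> = sets borel" and r: "0 \<le> r" and c: "\<And>x. emeasure \<mu> (cube r x) \<le> c"
    have "cube (2 * r) x \<subseteq> (\<Union>e\<in>S. cube r (x + r *\<^sub>R e))"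
    proof
      fix y assume y: "y \<in> cube (2 * r) x"
      \<comment> \<open>The signs of the coordinates of y - x select the small cube that contains
        y.\<close>
      define e :: "real^'n" where "e = (\<chi> i. if (y - x) $ i \<ge> 0 then 1 else -1)"
      have "\<bar>(y - (x + r *\<^sub>R e)) $ i\<bar> \<le> r" for i
        using y[unfolded mem_cube infnorm_le_iff, rule_format, of i] r by (auto simp: e_def)
      then have "y \<in> cube r (x + r *\<^sub>R e)" by (simp add: mem_cube infnorm_le_iff)
      moreover have "e \<in> S" by (auto simp: S_def e_def)
      ultimately show "y \<in> (\<Union>e\<in>S. cube r (x + r *\<^sub>R e))" by blast
    qed
    then have "emeasure \<mu> (cube (2 * r) x) \<le> emeasure \<mu> (\<Union>e\<in>S. cube r (x + r *\<^sub>R e))"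
      by (intro emeasure_mono) (auto simp: s fin intro!: sets.finite_UN)
    also have "\<dots> \<le> (\<Sum>e\<in>S. emeasure \<mu> (cube r (x + r *\<^sub>R e)))"
      using fin by (intro emeasure_subadditive_finite) (auto simp: s)
    also have "\<dots> \<le> (\<Sum>e\<in>S. c)" by (intro sum_mono c)
    finally show "emeasure \<mu> (cube (2 * r) x) \<le> ennreal (real (card S)) * c"
      by (simp add: ennreal_of_nat_eq_real_of_nat)
  qed simp
qed

text \<open>A Schur test. With \<open>\<mu>\<close> and \<open>\<nu>\<close> equal to Lebesgue measure or to one of the measures
  \<open>m k\<close>, it carries all the passages between $R^n$ and \<open>E\<close>.\<close>

lemma Lp_norm_averaging:
  fixes \<mu> \<nu> :: "(real^'n) measure" and A B \<sigma> :: real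
  assumes lf: "locally_finite_borel \<mu>" "locally_finite_borel \<nu>"
    and \<sigma>: "0 < \<sigma>" "ennreal \<sigma> \<le> p"
    and h[measurable]: "h \<in> borel_measurable borel" and F[measurable]: "F \<in> borel_measurable borel"
    and w: "w < top"
    and le: "AE y in \<nu>. enn_powr (F y) \<sigma> \<le> w * (\<integral>\<^sup>+x\<in>cube r y. enn_powr (h x) \<sigma> \<partial>\<mu>)"
    and A: "0 < A" "\<And>y. F y \<noteq> 0 \<Longrightarrow> w * emeasure \<mu> (cube r y) \<le> ennreal A"
    and B: "0 < B" "AE x in \<mu>. w * emeasure \<nu> (cube r x) \<le> ennreal B"
  shows "Lp_norm \<nu> p F \<le> ennreal (A powr (1 / \<sigma> - 1 / enn2real p) * B powr (1 / enn2real p)) * Lp_norm \<mu> p h"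
proof -
  note [measurable_cong] = locally_finite_borel_sets[OF lf(1)] locally_finite_borel_sets[OF lf(2)]
  interpret M: sigma_finite_measure \<mu> by (rule locally_finite_borel_sigma_finite[OF lf(1)])
  interpret N: sigma_finite_measure \<nu> by (rule locally_finite_borel_sigma_finite[OF lf(2)])
  interpret P: pair_sigma_finite \<mu> \<nu> ..
  have p: "0 < p" using \<sigma> by (metis ennreal_eq_0_iff linorder_not_le not_gr_zero order_less_le_trans)
  show ?thesis
  proof (cases "p = top")
    case True
    \<comment> \<open>For infinite p, \<open>enn2real p\<close> is 0 and so is 1 divided by it; the
      constant claimed is then A^(1/\<sigma>).\<close>
    let ?H = "Lp_norm \<mu> top h"
    have "AE y in \<nu>. F y \<le> ennreal (A powr (1 / \<sigma>)) * ?H"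
      using le
    proof eventually_elim
      case (elim y)
      show ?case
      proof (cases "F y = 0")
        case False
        have "(\<integral>\<^sup>+x\<in>cube r y. enn_powr (h x) \<sigma> \<partial>\<mu>) \<le> (\<integral>\<^sup>+x\<in>cube r y. enn_powr ?H \<sigma> \<partial>\<mu>)"
          using AE_le_Lp_norm_top[where M=\<mu> and f=h] \<sigma>
          by (intro nn_integral_mono_AE) (auto elim!: eventually_mono intro!: mult_right_mono enn_powr_mono)
        also have "\<dots> = enn_powr ?H \<sigma> * emeasure \<mu> (cube r y)"
          by (subst nn_integral_cmult_indicator) auto
        finally have "enn_powr (F y) \<sigma> \<le> w * (enn_powr ?H \<sigma> * emeasure \<mu> (cube r y))"
          using order_trans[OF elim mult_left_mono] by simp
        also have "\<dots> = enn_powr ?H \<sigma> * (w * emeasure \<mu> (cube r y))" by (simp add: mult_ac)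
        also have "\<dots> \<le> enn_powr ?H \<sigma> * ennreal A" by (intro mult_left_mono A(2) False) auto
        also have "\<dots> = enn_powr (ennreal (A powr (1 / \<sigma>)) * ?H) \<sigma>"
          using A \<sigma> by (simp add: enn_powr_mult enn_powr_ennreal powr_powr mult_ac)
        finally show ?thesis using \<sigma> by (simp add: enn_powr_le_iff)
      qed auto
    qed
    then show ?thesis using True B by (simp add: Lp_norm_top_le_iff)
  next
    case False
    define Q where "Q = enn2real p"
    have Q: "0 < Q" "\<sigma> \<le> Q" "ennreal Q = p"
      using enn2real_pos[OF p False] False \<sigma> unfolding Q_def
      by (auto simp: enn2real_leI ennreal_le_iff2 dest: enn2real_mono simp flip: less_top)
    have "(\<integral>\<^sup>+y. enn_powr (F y) Q \<partial>\<nu>)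
        \<le> (\<integral>\<^sup>+y. ennreal (A powr (Q / \<sigma> - 1)) * (w * (\<integral>\<^sup>+x\<in>cube r y. enn_powr (h x) Q \<partial>\<mu>)) \<partial>\<nu>)"
      using le
    proof (intro nn_integral_mono_AE, eventually_elim)
      case (elim y)
      show ?case
      proof (cases "F y = 0")
        case nz: False
        \<comment> \<open>The kernel as a measure of mass at most A. Jensen's inequality with
          exponent Q / \<sigma> turns the mean of order \<sigma> into one of order Q; that this
          exponent is at least 1 is the condition \<sigma> \<le> p.\<close>
        define K where "K = density \<mu> (\<lambda>x. w * indicator (cube r y) x)"
        have I: "(\<integral>\<^sup>+x. g x \<partial>K) = w * (\<integral>\<^sup>+x\<in>cube r y. g x \<partial>\<mu>)" if [measurable]: "g \<in> borel_measurable borel" for g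
          unfolding K_def by (subst nn_integral_density) (auto simp: nn_integral_cmult[symmetric] mult_ac)
        have m: "emeasure K (space K) \<le> ennreal A"
          using I[of "\<lambda>x. 1"] A(2)[OF nz] by (simp add: nn_integral_indicator)
        have [measurable_cong]: "sets K = sets borel" by (simp add: K_def locally_finite_borel_sets[OF lf(1)])
        have "enn_powr (F y) Q = enn_powr (enn_powr (F y) \<sigma>) (Q / \<sigma>)" using \<sigma> by (simp add: enn_powr_powr)
        also have "\<dots> \<le> enn_powr (\<integral>\<^sup>+x. enn_powr (h x) \<sigma> \<partial>K) (Q / \<sigma>)"
          using elim Q \<sigma> by (intro enn_powr_mono) (auto simp: I)
        also have "\<dots> \<le> ennreal (A powr (Q / \<sigma> - 1)) * (\<integral>\<^sup>+x. enn_powr (enn_powr (h x) \<sigma>) (Q / \<sigma>) \<partial>K)"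
          using m A Q \<sigma> by (intro nn_integral_powr_le) auto
        also have "(\<integral>\<^sup>+x. enn_powr (enn_powr (h x) \<sigma>) (Q / \<sigma>) \<partial>K) = w * (\<integral>\<^sup>+x\<in>cube r y. enn_powr (h x) Q \<partial>\<mu>)"
          using \<sigma> by (simp add: enn_powr_powr I)
        finally show ?thesis .
      qed auto
    qed
    also have "\<dots> = ennreal (A powr (Q / \<sigma> - 1)) * (\<integral>\<^sup>+y. (\<integral>\<^sup>+x. w * (enn_powr (h x) Q * indicator (cube r y) x) \<partial>\<mu>) \<partial>\<nu>)"
      by (simp add: nn_integral_cmult)
    also have "(\<integral>\<^sup>+y. (\<integral>\<^sup>+x. w * (enn_powr (h x) Q * indicator (cube r y) x) \<partial>\<mu>) \<partial>\<nu>)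
        = (\<integral>\<^sup>+x. (\<integral>\<^sup>+y. w * (enn_powr (h x) Q * indicator (cube r y) x) \<partial>\<nu>) \<partial>\<mu>)"
      by (rule P.Fubini') measurable
    also have "\<dots> = (\<integral>\<^sup>+x. enn_powr (h x) Q * (w * emeasure \<nu> (cube r x)) \<partial>\<mu>)"
    proof (intro nn_integral_cong)
      fix x
      have "(\<integral>\<^sup>+y. w * (enn_powr (h x) Q * indicator (cube r y) x) \<partial>\<nu>)
          = (\<integral>\<^sup>+y. w * enn_powr (h x) Q * indicator (cube r x) y \<partial>\<nu>)"
        by (intro nn_integral_cong) (auto simp: indicator_def mem_cube_sym[of x] mult_ac)
      also have "\<dots> = enn_powr (h x) Q * (w * emeasure \<nu> (cube r x))"
        by (subst nn_integral_cmult_indicator) (auto simp: mult_ac)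
      finally show "(\<integral>\<^sup>+y. w * (enn_powr (h x) Q * indicator (cube r y) x) \<partial>\<nu>)
        = enn_powr (h x) Q * (w * emeasure \<nu> (cube r x))" .
    qed
    also have "\<dots> \<le> (\<integral>\<^sup>+x. enn_powr (h x) Q * ennreal B \<partial>\<mu>)"
      using B(2) by (intro nn_integral_mono_AE) (auto elim!: eventually_mono intro!: mult_left_mono)
    also have "\<dots> = enn_powr (Lp_norm \<mu> p h) Q * ennreal B"
      by (simp add: nn_integral_multc Lp_norm_powr[OF p False] Q_def)
    finally have "(\<integral>\<^sup>+y. enn_powr (F y) Q \<partial>\<nu>)
      \<le> ennreal (A powr (Q / \<sigma> - 1)) * (enn_powr (Lp_norm \<mu> p h) Q * ennreal B)"
      by (simp add: mult_left_mono)
    also have "\<dots> = enn_powr (ennreal (A powr (1 / \<sigma> - 1 / Q) * B powr (1 / Q)) * Lp_norm \<mu> p h) Q"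
      using A B Q by (simp add: enn_powr_mult enn_powr_ennreal powr_mult powr_powr ennreal_mult algebra_simps)
    finally show ?thesis by (simp add: Lp_norm_le_iff[OF p False] Q_def)
  qed
qed


subsection \<open>Best approximations\<close>

lemma le_divide_ennreal_iff:
  fixes x a m :: ennreal
  assumes "0 < m" "m < top"
  shows "x \<le> a / m \<longleftrightarrow> x * m \<le> a"
  using divide_less_ennreal[of m a x] assms by (metis leD leI less_irrefl)

lemma best_approx_le:
  assumes "0 < \<sigma>" "0 < emeasure \<mu> G" "emeasure \<mu> G < top"
  shows "enn_powr (best_approx \<mu> \<sigma> f G) \<sigma> * emeasure \<mu> G \<le> (\<integral>\<^sup>+y\<in>G. ennreal (\<bar>f y - c\<bar> powr \<sigma>) \<partial>\<mu>)"
proof -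
  have "best_approx \<mu> \<sigma> f G \<le> enn_powr (nn_average \<mu> G (\<lambda>y. ennreal (\<bar>f y - c\<bar> powr \<sigma>))) (1 / \<sigma>)"
    unfolding best_approx_def by (rule INF_lower) simp
  then show ?thesis
    using assms by (auto simp: le_enn_powr_swap nn_average_def le_divide_ennreal_iff split: if_splits)
qed

lemma best_approx_greatest:
  assumes "0 < \<sigma>" "0 < emeasure \<mu> G" "emeasure \<mu> G < top"
    and "\<And>c. enn_powr X \<sigma> * emeasure \<mu> G \<le> (\<integral>\<^sup>+y\<in>G. ennreal (\<bar>f y - c\<bar> powr \<sigma>) \<partial>\<mu>)"
  shows "X \<le> best_approx \<mu> \<sigma> f G"
  unfolding best_approx_def
  using assms by (intro INF_greatest) (auto simp: le_enn_powr_swap nn_average_def le_divide_ennreal_iff)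

lemma powr_add_le:
  fixes a b \<sigma> :: real
  assumes "0 \<le> a" "0 \<le> b" "0 < \<sigma>"
  shows "(a + b) powr \<sigma> \<le> 2 powr \<sigma> * (a powr \<sigma> + b powr \<sigma>)"
proof -
  have "(a + b) powr \<sigma> \<le> (2 * max a b) powr \<sigma>" using assms by (intro powr_mono2) auto
  also have "\<dots> = 2 powr \<sigma> * max a b powr \<sigma>" using assms by (simp add: powr_mult)
  also have "\<dots> \<le> 2 powr \<sigma> * (a powr \<sigma> + b powr \<sigma>)" by (intro mult_left_mono) (auto simp: max_def)
  finally show ?thesis .
qed

lemma dist_powr_le:
  fixes a b c \<sigma> :: real
  assumes "0 < \<sigma>"
  shows "\<bar>a - b\<bar> powr \<sigma> \<le> 2 powr \<sigma> * (\<bar>c - a\<bar> powr \<sigma> + \<bar>c - b\<bar> powr \<sigma>)"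
proof -
  have "\<bar>a - b\<bar> powr \<sigma> \<le> (\<bar>c - a\<bar> + \<bar>c - b\<bar>) powr \<sigma>" using assms by (intro powr_mono2) auto
  also have "\<dots> \<le> 2 powr \<sigma> * (\<bar>c - a\<bar> powr \<sigma> + \<bar>c - b\<bar> powr \<sigma>)" by (rule powr_add_le) (use assms in auto)
  finally show ?thesis .
qed

lemma nn_integral_dist_powr_le:
  fixes f :: "'a \<Rightarrow> real"
  assumes [measurable]: "f \<in> borel_measurable M" "G \<in> sets M" and \<sigma>: "0 < \<sigma>"
  shows "ennreal (\<bar>a - b\<bar> powr \<sigma>) * emeasure M G \<le> ennreal (2 powr \<sigma>) *
    ((\<integral>\<^sup>+y\<in>G. ennreal (\<bar>f y - a\<bar> powr \<sigma>) \<partial>M) + (\<integral>\<^sup>+y\<in>G. ennreal (\<bar>f y - b\<bar> powr \<sigma>) \<partial>M))"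
proof -
  have "ennreal (\<bar>a - b\<bar> powr \<sigma>) * emeasure M G = (\<integral>\<^sup>+y. ennreal (\<bar>a - b\<bar> powr \<sigma>) * indicator G y \<partial>M)"
    by (simp add: nn_integral_cmult_indicator)
  also have "\<dots> \<le> (\<integral>\<^sup>+y. ennreal (2 powr \<sigma>) * (ennreal (\<bar>f y - a\<bar> powr \<sigma>) * indicator G y
      + ennreal (\<bar>f y - b\<bar> powr \<sigma>) * indicator G y) \<partial>M)"
    using dist_powr_le[OF \<sigma>, of a b "f y" for y]
    by (intro nn_integral_mono)
       (auto simp: indicator_def ennreal_mult[symmetric] ennreal_plus[symmetric] simp del: ennreal_plus intro!: ennreal_leI)
  finally show ?thesis by (simp add: nn_integral_cmult nn_integral_add)
qed

lemma nn_integral_shift_powr_le: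
  fixes f :: "'a \<Rightarrow> real"
  assumes [measurable]: "f \<in> borel_measurable M" "G \<in> sets M" and \<sigma>: "0 < \<sigma>"
  shows "(\<integral>\<^sup>+y\<in>G. ennreal (\<bar>f y - a\<bar> powr \<sigma>) \<partial>M) \<le> ennreal (2 powr \<sigma>) *
    ((\<integral>\<^sup>+y\<in>G. ennreal (\<bar>f y - b\<bar> powr \<sigma>) \<partial>M) + ennreal (\<bar>b - a\<bar> powr \<sigma>) * emeasure M G)"
proof -
  have "(\<integral>\<^sup>+y\<in>G. ennreal (\<bar>f y - a\<bar> powr \<sigma>) \<partial>M)
    \<le> (\<integral>\<^sup>+y. ennreal (2 powr \<sigma>) * (ennreal (\<bar>f y - b\<bar> powr \<sigma>) * indicator G y
      + ennreal (\<bar>b - a\<bar> powr \<sigma>) * indicator G y) \<partial>M)"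
    using dist_powr_le[OF \<sigma>, of "f y" a b for y]
    by (intro nn_integral_mono)
       (auto simp: indicator_def ennreal_mult[symmetric] ennreal_plus[symmetric] abs_minus_commute
         simp del: ennreal_plus intro!: ennreal_leI)
  also have "\<dots> = ennreal (2 powr \<sigma>) *
    ((\<integral>\<^sup>+y\<in>G. ennreal (\<bar>f y - b\<bar> powr \<sigma>) \<partial>M) + ennreal (\<bar>b - a\<bar> powr \<sigma>) * emeasure M G)"
    by (simp add: nn_integral_cmult nn_integral_add nn_integral_cmult_indicator)
  finally show ?thesis .
qed

lemma best_approx_near:
  fixes f :: "real^'n \<Rightarrow> real"
  assumes "0 < \<sigma>" "0 < emeasure \<mu> G" "emeasure \<mu> G < top" "best_approx \<mu> \<sigma> f G < X"
  shows "\<exists>c. (\<integral>\<^sup>+y\<in>G. ennreal (\<bar>f y - c\<bar> powr \<sigma>) \<partial>\<mu>) \<le> enn_powr X \<sigma> * emeasure \<mu> G"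
proof (rule ccontr)
  assume "\<nexists>c. (\<integral>\<^sup>+y\<in>G. ennreal (\<bar>f y - c\<bar> powr \<sigma>) \<partial>\<mu>) \<le> enn_powr X \<sigma> * emeasure \<mu> G"
  then have "enn_powr X \<sigma> * emeasure \<mu> G \<le> (\<integral>\<^sup>+y\<in>G. ennreal (\<bar>f y - c\<bar> powr \<sigma>) \<partial>\<mu>)" for c
    by (meson linorder_le_cases)
  from best_approx_greatest[OF assms(1-3) this] assms(4) show False by simp
qed

text \<open>The factor 2 leaves room whenever the infimum is positive and finite. If it is 0 there
  is no room, and a true minimizer must be found: constants of smaller and smaller error form a
  Cauchy sequence, because two constants close to the same function on a set of positive finite mass
  are close to each other.\<close>

lemma best_approx_attained:
  fixes f :: "real^'n \<Rightarrow> real"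
  assumes [measurable]: "f \<in> borel_measurable \<mu>" "G \<in> sets \<mu>"
    and \<sigma>: "0 < \<sigma>" and pos: "0 < emeasure \<mu> G" and fin: "emeasure \<mu> G < top"
  shows "\<exists>c. (\<integral>\<^sup>+y\<in>G. ennreal (\<bar>f y - c\<bar> powr \<sigma>) \<partial>\<mu>) \<le> enn_powr (2 * best_approx \<mu> \<sigma> f G) \<sigma> * emeasure \<mu> G"
proof (cases "best_approx \<mu> \<sigma> f G = 0 \<or> best_approx \<mu> \<sigma> f G = top")
  case False
  then obtain r where r: "best_approx \<mu> \<sigma> f G = ennreal r" "0 < r"
    by (cases "best_approx \<mu> \<sigma> f G") auto
  have "ennreal r < ennreal (2 * r)" using r by (simp add: ennreal_less_iff)
  then have "best_approx \<mu> \<sigma> f G < 2 * best_approx \<mu> \<sigma> f G"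
    using r by (simp add: ennreal_mult)
  from best_approx_near[OF \<sigma> pos fin this] show ?thesis .
next
  case True
  then show ?thesis
  proof
    assume "best_approx \<mu> \<sigma> f G = top"
    then show ?thesis using pos by (auto simp: ennreal_mult_top ennreal_top_mult)
  next
    assume b0: "best_approx \<mu> \<sigma> f G = 0"
    let ?I = "\<lambda>c. \<integral>\<^sup>+y\<in>G. ennreal (\<bar>f y - c\<bar> powr \<sigma>) \<partial>\<mu>"
    obtain m where m: "emeasure \<mu> G = ennreal m" "0 < m"
      using pos fin by (cases "emeasure \<mu> G") auto
    have "\<exists>c. ?I c \<le> ennreal (\<epsilon> * m)" if "0 < \<epsilon>" for \<epsilon> :: real
      using best_approx_near[OF \<sigma> pos fin, of f "ennreal (\<epsilon> powr (1 / \<sigma>))"] that \<sigma> m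
      by (simp add: b0 enn_powr_ennreal powr_powr ennreal_mult)
    then obtain c where c: "\<And>\<epsilon>::real. 0 < \<epsilon> \<Longrightarrow> ?I (c \<epsilon>) \<le> ennreal (\<epsilon> * m)" by metis
    have dist: "\<bar>c \<epsilon> - c \<delta>\<bar> powr \<sigma> \<le> 2 powr \<sigma> * (\<epsilon> + \<delta>)" if "0 < \<epsilon>" "0 < \<delta>" for \<epsilon> \<delta>
    proof -
      have "ennreal (\<bar>c \<epsilon> - c \<delta>\<bar> powr \<sigma>) * ennreal m \<le> ennreal (2 powr \<sigma>) * (?I (c \<epsilon>) + ?I (c \<delta>))"
        using nn_integral_dist_powr_le[of f \<mu> G \<sigma> "c \<epsilon>" "c \<delta>"] \<sigma> m by simp
      also have "\<dots> \<le> ennreal (2 powr \<sigma>) * (ennreal (\<epsilon> * m) + ennreal (\<delta> * m))"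
        using c that by (intro mult_left_mono add_mono) auto
      finally have "\<bar>c \<epsilon> - c \<delta>\<bar> powr \<sigma> * m \<le> 2 powr \<sigma> * (\<epsilon> * m + \<delta> * m)"
        using that m by (simp add: ennreal_mult[symmetric] ennreal_plus[symmetric] ennreal_le_iff del: ennreal_plus)
      then have "\<bar>c \<epsilon> - c \<delta>\<bar> powr \<sigma> * m \<le> (2 powr \<sigma> * (\<epsilon> + \<delta>)) * m" by (simp add: algebra_simps)
      then show ?thesis using m by (simp add: mult_le_cancel_right)
    qed
    define e where "e j = inverse (real (Suc j))" for j
    have e: "0 < e j" for j by (simp add: e_def)
    have e0: "e \<longlonglongrightarrow> 0" unfolding e_def by (rule LIMSEQ_inverse_real_of_nat)
    have small: "\<exists>\<epsilon>>0. \<forall>x. \<bar>x\<bar> powr \<sigma> \<le> \<epsilon> \<longrightarrow> \<bar>x\<bar> < \<eta>" if "0 < \<eta>" for \<eta> :: real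
    proof (intro exI[of _ "(\<eta> / 2) powr \<sigma>"] conjI allI impI)
      fix x assume *: "\<bar>x\<bar> powr \<sigma> \<le> (\<eta> / 2) powr \<sigma>"
      then have "\<bar>x\<bar> \<le> \<eta> / 2"
        using that \<sigma> by (metis abs_ge_zero half_gt_zero less_eq_real_def linorder_not_le powr_less_mono2)
      then show "\<bar>x\<bar> < \<eta>" using that by simp
    qed (use that in auto)
    have "Cauchy (\<lambda>j. c (e j))"
    proof (rule metric_CauchyI)
      fix \<eta> :: real assume "0 < \<eta>"
      then obtain \<epsilon> where \<epsilon>: "0 < \<epsilon>" "\<And>x. \<bar>x\<bar> powr \<sigma> \<le> \<epsilon> \<Longrightarrow> \<bar>x\<bar> < \<eta>" using small by blast
      have "\<forall>\<^sub>F j in sequentially. e j < \<epsilon> / (2 powr \<sigma> * 2)"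
        using e0 \<epsilon>(1) by (intro order_tendstoD) auto
      then obtain M where M: "\<And>j. j \<ge> M \<Longrightarrow> e j < \<epsilon> / (2 powr \<sigma> * 2)" by (auto simp: eventually_sequentially)
      show "\<exists>M. \<forall>i\<ge>M. \<forall>j\<ge>M. dist (c (e i)) (c (e j)) < \<eta>"
      proof (intro exI[of _ M] allI impI)
        fix i j assume ij: "i \<ge> M" "j \<ge> M"
        have "\<bar>c (e i) - c (e j)\<bar> powr \<sigma> \<le> 2 powr \<sigma> * (e i + e j)" by (intro dist e)
        also have "\<dots> \<le> 2 powr \<sigma> * (\<epsilon> / (2 powr \<sigma> * 2) + \<epsilon> / (2 powr \<sigma> * 2))"
          using M[OF ij(1)] M[OF ij(2)] by (intro mult_left_mono) auto
        also have "\<dots> = \<epsilon>" by (simp add: field_simps)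
        finally show "dist (c (e i)) (c (e j)) < \<eta>" using \<epsilon>(2) by (simp add: dist_real_def)
      qed
    qed
    then obtain l where l: "(\<lambda>j. c (e j)) \<longlonglongrightarrow> l" using Cauchy_convergent convergent_def by blast
    have "?I l \<le> ennreal (2 powr \<sigma> * (e j * m + \<bar>c (e j) - l\<bar> powr \<sigma> * m))" for j
    proof -
      have "?I l \<le> ennreal (2 powr \<sigma>) * (?I (c (e j)) + ennreal (\<bar>c (e j) - l\<bar> powr \<sigma>) * ennreal m)"
        using nn_integral_shift_powr_le[of f \<mu> G \<sigma> l "c (e j)"] \<sigma> m by simp
      also have "\<dots> \<le> ennreal (2 powr \<sigma>) * (ennreal (e j * m) + ennreal (\<bar>c (e j) - l\<bar> powr \<sigma>) * ennreal m)"
        using c[OF e[of j]] by (intro mult_left_mono add_right_mono) auto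
      finally show ?thesis using m e[of j]
        by (simp add: ennreal_mult[symmetric] ennreal_plus[symmetric] del: ennreal_plus)
    qed
    moreover have "(\<lambda>j. ennreal (2 powr \<sigma> * (e j * m + \<bar>c (e j) - l\<bar> powr \<sigma> * m))) \<longlonglongrightarrow> ennreal (2 powr \<sigma> * (0 * m + \<bar>l - l\<bar> powr \<sigma> * m))"
      using \<sigma> by (intro tendsto_ennrealI tendsto_intros e0 l tendsto_powr') auto
    ultimately have "?I l \<le> 0"
      using LIMSEQ_le_const by fastforce
    then show ?thesis by (intro exI[of _ l]) simp
  qed
qed

section \<open>Measurability of best approximations\<close>

lemma measurable_nn_integral_cube:
  fixes \<mu> :: "(real^'n) measure"
  assumes lf: "locally_finite_borel \<mu>" and [measurable]: "g \<in> borel_measurable borel"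
  shows "(\<lambda>x. \<integral>\<^sup>+y\<in>cube r x. g y \<partial>\<mu>) \<in> borel_measurable borel"
proof -
  note [measurable_cong] = locally_finite_borel_sets[OF lf]
  interpret sigma_finite_measure \<mu> by (rule locally_finite_borel_sigma_finite[OF lf])
  show ?thesis by (rule borel_measurable_nn_integral) measurable
qed

lemma measurable_emeasure_cube:
  fixes \<mu> :: "(real^'n) measure"
  assumes lf: "locally_finite_borel \<mu>"
  shows "(\<lambda>x. emeasure \<mu> (cube r x)) \<in> borel_measurable borel"
proof -
  have "emeasure \<mu> (cube r x) = (\<integral>\<^sup>+y\<in>cube r x. 1 \<partial>\<mu>)" for x
    using locally_finite_borel_sets[OF lf] by (simp add: nn_integral_indicator)
  then show ?thesis using measurable_nn_integral_cube[OF lf, of "\<lambda>x. 1" r] by simp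
qed

text \<open>The set is the Minkowski sum of the closed set E and a compact cube, hence
  closed.\<close>

lemma sets_cube_hits:
  fixes E :: "(real^'n) set"
  assumes "closed E"
  shows "{x. cube r x \<inter> E \<noteq> {}} \<in> sets borel"
proof -
  have "{x. cube r x \<inter> E \<noteq> {}} = (\<Union>y\<in>E. \<Union>z\<in>cube r (0::real^'n). {y + z})"
  proof (auto simp: set_eq_iff)
    fix x y assume "y \<in> cube r x" "y \<in> E"
    then show "\<exists>y\<in>E. \<exists>z\<in>cube r (0::real^'n). x = y + z"
      by (intro bexI[of _ y] bexI[of _ "x - y"]) (auto simp: mem_cube infnorm_sub)
  next
    fix y z :: "real^'n" assume "y \<in> E" "z \<in> cube r 0"
    then show "\<exists>w. w \<in> cube r (y + z) \<and> w \<in> E" by (intro exI[of _ y]) (auto simp: mem_cube infnorm_neg)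
  qed
  moreover have "closed \<dots>" by (intro closed_compact_sums assms compact_cube)
  ultimately show ?thesis by simp
qed

text \<open>Makes the infimum countable, for the sake of measurability. The error integral is
  continuous in c by dominated convergence, which is where the local \<sigma>-integrability of f
  enters.\<close>

lemma best_approx_rational:
  fixes f :: "real^'n \<Rightarrow> real"
  assumes [measurable]: "f \<in> borel_measurable \<mu>" "G \<in> sets \<mu>"
    and \<sigma>: "0 < \<sigma>" and fin: "emeasure \<mu> G < top" "(\<integral>\<^sup>+y\<in>G. ennreal (\<bar>f y\<bar> powr \<sigma>) \<partial>\<mu>) < top"
  shows "best_approx \<mu> \<sigma> f G = (INF c\<in>\<rat>. enn_powr (nn_average \<mu> G (\<lambda>y. ennreal (\<bar>f y - c\<bar> powr \<sigma>))) (1 / \<sigma>))"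
proof (cases "emeasure \<mu> G = 0")
  case True
  moreover have "(\<rat> :: real set) \<noteq> {}" using Rats_0 by blast
  ultimately show ?thesis by (simp add: best_approx_def nn_average_def)
next
  case False
  then have pos: "0 < emeasure \<mu> G" by (simp add: zero_less_iff_neq_zero)
  let ?I = "\<lambda>c. \<integral>\<^sup>+y\<in>G. ennreal (\<bar>f y - c\<bar> powr \<sigma>) \<partial>\<mu>"
  let ?R = "INF c\<in>\<rat>. enn_powr (nn_average \<mu> G (\<lambda>y. ennreal (\<bar>f y - c\<bar> powr \<sigma>))) (1 / \<sigma>)"
  show ?thesis
  proof (rule antisym)
    show "best_approx \<mu> \<sigma> f G \<le> ?R" unfolding best_approx_def by (intro INF_superset_mono) auto
    have Q: "enn_powr ?R \<sigma> * emeasure \<mu> G \<le> ?I c" if "c \<in> \<rat>" for c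
    proof -
      have "?R \<le> enn_powr (nn_average \<mu> G (\<lambda>y. ennreal (\<bar>f y - c\<bar> powr \<sigma>))) (1 / \<sigma>)"
        using that by (rule INF_lower)
      then show ?thesis using \<sigma> pos fin by (auto simp: le_enn_powr_swap nn_average_def le_divide_ennreal_iff split: if_splits)
    qed
    show "?R \<le> best_approx \<mu> \<sigma> f G"
    proof (rule best_approx_greatest[OF \<sigma> pos fin(1)])
      fix c :: real
      have "\<exists>q\<in>\<rat>. c < q \<and> q < c + inverse (real (Suc n))" for n
        by (intro Rats_dense_in_real) auto
      then obtain q where q: "\<And>n. q n \<in> \<rat>" "\<And>n. c < q n" "\<And>n. q n < c + inverse (real (Suc n))" by metis
      have "q \<longlonglongrightarrow> c"
      proof (rule real_tendsto_sandwich[of "\<lambda>_. c" q _ "\<lambda>n. c + inverse (real (Suc n))"])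
        show "(\<lambda>n. c + inverse (real (Suc n))) \<longlonglongrightarrow> c"
          using tendsto_add[OF tendsto_const LIMSEQ_inverse_real_of_nat, of c] by simp
      qed (use q(2,3) in \<open>auto intro!: always_eventually less_imp_le\<close>)
      have bnd: "\<bar>f y - q n\<bar> powr \<sigma> \<le> 2 powr \<sigma> * (\<bar>f y\<bar> powr \<sigma> + (\<bar>c\<bar> + 1) powr \<sigma>)" for n y
      proof -
        have "inverse (real (Suc n)) \<le> 1" by (simp add: inverse_le_1_iff)
        then have "\<bar>q n\<bar> \<le> \<bar>c\<bar> + 1" using q(2)[of n] q(3)[of n] by (simp only: abs_le_iff) linarith
        then have "\<bar>f y - q n\<bar> powr \<sigma> \<le> (\<bar>f y\<bar> + (\<bar>c\<bar> + 1)) powr \<sigma>" using \<sigma> by (intro powr_mono2) auto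
        also have "\<dots> \<le> 2 powr \<sigma> * (\<bar>f y\<bar> powr \<sigma> + (\<bar>c\<bar> + 1) powr \<sigma>)" by (rule powr_add_le) (use \<sigma> in auto)
        finally show ?thesis .
      qed
      have "(\<lambda>n. ?I (q n)) \<longlonglongrightarrow> ?I c"
      proof (rule nn_integral_dominated_convergence)
        let ?w = "\<lambda>y. ennreal (2 powr \<sigma>) * (ennreal (\<bar>f y\<bar> powr \<sigma>) * indicator G y + ennreal ((\<bar>c\<bar> + 1) powr \<sigma>) * indicator G y)"
        show "AE y in \<mu>. ennreal (\<bar>f y - q n\<bar> powr \<sigma>) * indicator G y \<le> ?w y" for n
          using bnd[of _ n]
          by (auto simp: indicator_def ennreal_mult[symmetric] ennreal_plus[symmetric] simp del: ennreal_plus intro!: ennreal_leI)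
        show "(\<integral>\<^sup>+y. ?w y \<partial>\<mu>) < \<infinity>"
          using fin by (simp add: nn_integral_cmult nn_integral_add nn_integral_cmult_indicator ennreal_mult_less_top)
        show "AE y in \<mu>. (\<lambda>n. ennreal (\<bar>f y - q n\<bar> powr \<sigma>) * indicator G y) \<longlonglongrightarrow> ennreal (\<bar>f y - c\<bar> powr \<sigma>) * indicator G y"
        proof (intro AE_I2)
          fix y
          have "(\<lambda>n. ennreal (\<bar>f y - q n\<bar> powr \<sigma>)) \<longlonglongrightarrow> ennreal (\<bar>f y - c\<bar> powr \<sigma>)"
            using \<sigma> \<open>q \<longlonglongrightarrow> c\<close> by (intro tendsto_ennrealI tendsto_powr' tendsto_intros) auto
          then show "(\<lambda>n. ennreal (\<bar>f y - q n\<bar> powr \<sigma>) * indicator G y) \<longlonglongrightarrow> ennreal (\<bar>f y - c\<bar> powr \<sigma>) * indicator G y"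
            by (cases "y \<in> G") auto
        qed
      qed measurable
      then show "enn_powr ?R \<sigma> * emeasure \<mu> G \<le> ?I c"
        by (rule LIMSEQ_le_const) (use Q[OF q(1)] in auto)
    qed
  qed
qed

lemma measurable_best_approx_mod:
  fixes f :: "real^'n \<Rightarrow> real"
  assumes lf: "locally_finite_borel \<mu>" and cl: "closed (msupport \<mu>)" and \<sigma>: "0 < \<sigma>"
    and f: "f \<in> borel_measurable borel" "\<And>K. compact K \<Longrightarrow> (\<integral>\<^sup>+x\<in>K. ennreal (\<bar>f x\<bar> powr \<sigma>) \<partial>\<mu>) < top"
  shows "best_approx_mod \<mu> \<sigma> f r \<in> borel_measurable borel"
proof -
  note [measurable] = f(1)
  note s = locally_finite_borel_sets[OF lf]
  have "best_approx_mod \<mu> \<sigma> f r = (\<lambda>x. if x \<in> {x. cube r x \<inter> msupport \<mu> \<noteq> {}} then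
      (INF c\<in>\<rat>. enn_powr (nn_average \<mu> (cube (2 * r) x) (\<lambda>y. ennreal (\<bar>f y - c\<bar> powr \<sigma>))) (1 / \<sigma>)) else 0)"
  proof
    fix x
    have "f \<in> borel_measurable \<mu>" using f(1) s by (simp cong: measurable_cong_sets)
    then have "best_approx \<mu> \<sigma> f (cube (2 * r) x) = (INF c\<in>\<rat>. enn_powr (nn_average \<mu> (cube (2 * r) x) (\<lambda>y. ennreal (\<bar>f y - c\<bar> powr \<sigma>))) (1 / \<sigma>))"
      using f(2)[OF compact_cube] emeasure_cube_finite[OF lf] \<sigma> s by (intro best_approx_rational) auto
    then show "best_approx_mod \<mu> \<sigma> f r x = (if x \<in> {x. cube r x \<inter> msupport \<mu> \<noteq> {}} then
      (INF c\<in>\<rat>. enn_powr (nn_average \<mu> (cube (2 * r) x) (\<lambda>y. ennreal (\<bar>f y - c\<bar> powr \<sigma>))) (1 / \<sigma>)) else 0)"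
      by (simp add: best_approx_mod_def)
  qed
  also have "\<dots> \<in> borel_measurable borel"
  proof (intro measurable_If_set borel_measurable_INF measurable_enn_powr)
    fix c :: real
    show "(\<lambda>x. nn_average \<mu> (cube (2 * r) x) (\<lambda>y. ennreal (\<bar>f y - c\<bar> powr \<sigma>))) \<in> borel_measurable borel"
      unfolding nn_average_def
      using measurable_emeasure_cube[OF lf] measurable_nn_integral_cube[OF lf] by measurable
  qed (use sets_cube_hits[OF cl] countable_rat in auto)
  finally show ?thesis .
qed

text \<open>The bounds are \<open>ennreal\<close>-valued so that, at a given point, finiteness of
  one series is all that has to be known; that finiteness is available almost everywhere from a norm
  estimate.\<close>

lemma telescoping_limit:
  fixes a :: "nat \<Rightarrow> real" and b :: "nat \<Rightarrow> ennreal"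
  assumes ab: "\<And>i. ennreal \<bar>a (Suc i) - a i\<bar> \<le> b i" and fin: "(\<Sum>i. b i) < top"
  obtains l where "a \<longlonglongrightarrow> l" "\<And>k. ennreal \<bar>l - a k\<bar> \<le> (\<Sum>i. b (i + k))"
proof -
  have bt: "b i < top" for i
    using sum_le_suminf[of b "{i}"] fin by (simp add: le_less_trans)
  define \<beta> where "\<beta> i = enn2real (b i)" for i
  have \<beta>: "0 \<le> \<beta> i" "ennreal (\<beta> i) = b i" for i using bt[of i] by (auto simp: \<beta>_def less_top)
  have s\<beta>: "summable \<beta>"
    using fin \<beta> by (intro summable_suminf_not_top) auto
  have ab': "\<bar>a (Suc i) - a i\<bar> \<le> \<beta> i" for i
    using ab[of i] \<beta>[of i] by (metis ennreal_le_iff)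
  have sa: "summable (\<lambda>i. \<bar>a (Suc i) - a i\<bar>)"
    by (rule summable_comparison_test'[OF s\<beta>, of 0]) (use ab' in auto)
  then have "summable (\<lambda>i. a (Suc i) - a i)" by (rule summable_rabs_cancel)
  then obtain S where "(\<lambda>i. a (Suc i) - a i) sums S" by (auto simp: summable_def)
  then have "(\<lambda>n. \<Sum>i<n. a (Suc i) - a i) \<longlonglongrightarrow> S" by (simp add: sums_def)
  then have "(\<lambda>n. a n - a 0) \<longlonglongrightarrow> S" by (simp add: sum_lessThan_telescope)
  then have "(\<lambda>n. (a n - a 0) + a 0) \<longlonglongrightarrow> S + a 0" by (intro tendsto_intros)
  then have l: "a \<longlonglongrightarrow> S + a 0" by simp
  show ?thesis
  proof (rule that[OF l])
    fix k
    have "(\<lambda>i. a (i + k)) \<longlonglongrightarrow> S + a 0" using l by (rule LIMSEQ_ignore_initial_segment)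
    then have "(\<lambda>i. a (Suc i + k) - a (i + k)) sums (S + a 0 - a (0 + k))"
      by (rule telescope_sums)
    then have eq: "S + a 0 - a k = (\<Sum>i. a (Suc (i + k)) - a (i + k))" by (simp add: sums_iff)
    have sk: "summable (\<lambda>i. \<bar>a (Suc (i + k)) - a (i + k)\<bar>)"
      using sa summable_iff_shift[of "\<lambda>i. \<bar>a (Suc i) - a i\<bar>" k] by simp
    have "\<bar>S + a 0 - a k\<bar> \<le> (\<Sum>i. \<bar>a (Suc (i + k)) - a (i + k)\<bar>)" unfolding eq by (rule summable_rabs[OF sk])
    also have "\<dots> \<le> (\<Sum>i. \<beta> (i + k))"
      using ab' sk s\<beta> by (intro suminf_le) (auto simp: summable_iff_shift)
    finally have "ennreal \<bar>S + a 0 - a k\<bar> \<le> ennreal (\<Sum>i. \<beta> (i + k))" by (rule ennreal_leI)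
    also have "\<dots> = (\<Sum>i. b (i + k))"
      using \<beta> s\<beta> by (subst suminf_ennreal2[symmetric]) (auto simp: summable_iff_shift)
    finally show "ennreal \<bar>S + a 0 - a k\<bar> \<le> (\<Sum>i. b (i + k))" .
  qed
qed


subsection \<open>The setting\<close>

text \<open>The index is an integer because Besov gradients run over all integers and estimates at
  scale k reach up to scale k - 6.\<close>

definition dy :: "int \<Rightarrow> real" where "dy j = 2 powr (- real_of_int j)"

lemma dy_pos [simp]: "0 < dy j" "0 \<le> dy j" "dy j \<noteq> 0"
  by (auto simp: dy_def)

lemma dy_nat: "dy (int k) = 2 powr (- real k)"
  by (simp add: dy_def)

lemma dy_add: "dy (i + j) = dy i * dy j"
  by (simp add: dy_def powr_add[symmetric])

lemma dy_0 [simp]: "dy 0 = 1" by (simp add: dy_def)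

lemma dy_numeral: "dy (numeral a) = 1 / 2 ^ numeral a" "dy (- numeral a) = 2 ^ numeral a"
  by (simp_all add: dy_def powr_minus_divide)

lemma dy_1 [simp]: "dy 1 = 1 / 2" "dy (-1) = 2"
  by (simp_all add: dy_def powr_minus_divide)

lemma dy_diff: "dy (i - j) = dy i * dy (- j)"
  using dy_add[of i "-j"] by simp

lemma dy_mono: "i \<le> j \<Longrightarrow> dy j \<le> dy i"
  by (simp add: dy_def)

lemma dy_powi: "2 powi (- j) = dy j"
  unfolding dy_def by (simp add: powr_real_of_int' flip: of_int_minus)

lemma dy_tendsto_0: "(\<lambda>i. dy (int i + j)) \<longlonglongrightarrow> 0"
proof -
  have "(\<lambda>i. (1 / 2) ^ i * dy j) \<longlonglongrightarrow> 0 * dy j"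
    by (intro tendsto_intros LIMSEQ_power_zero) auto
  moreover have "(1 / 2) ^ i = dy (int i)" for i
    by (simp add: dy_nat powr_minus powr_realpow power_one_over inverse_eq_divide)
  ultimately show ?thesis by (simp add: dy_add)
qed

text \<open>Mean value over the cube of radius \<open>dy j\<close>, up to the factor \<open>2 ^ n\<close>.\<close>

definition avg :: "int \<Rightarrow> (real^'n \<Rightarrow> ennreal) \<Rightarrow> real^'n \<Rightarrow> ennreal"
  where "avg j h x = ennreal (dy j powr (- real CARD('n))) * (\<integral>\<^sup>+y\<in>cube (dy j) x. h y \<partial>lborel)"

lemma measurable_avg [measurable (raw)]:
  assumes "h \<in> borel_measurable borel"
  shows "avg j h \<in> borel_measurable borel"
proof -
  have [measurable]: "(\<lambda>x. \<integral>\<^sup>+y\<in>cube (dy j) x. h y \<partial>lborel) \<in> borel_measurable borel"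
    by (rule measurable_nn_integral_cube[OF locally_finite_borel_lborel assms])
  show ?thesis unfolding avg_def by measurable
qed

text \<open>Since p \<ge> 1, a nonnegative number is at most 1 plus its p-th power, and compact sets
  have finite mass.\<close>

lemma Lp_locally_integrable:
  fixes \<mu> :: "(real^'n) measure"
  assumes lf: "locally_finite_borel \<mu>" and p: "1 \<le> p" and [measurable]: "h \<in> borel_measurable borel"
    and fin: "Lp_norm \<mu> p h < top" and K: "compact K"
  shows "(\<integral>\<^sup>+x\<in>K. h x \<partial>\<mu>) < top"
proof -
  note [measurable_cong] = locally_finite_borel_sets[OF lf]
  have p0: "0 < p" using p by (metis less_le_trans zero_less_one)
  have [measurable]: "K \<in> sets borel" using K by (simp add: borel_closed compact_imp_closed)
  have mK: "emeasure \<mu> K < top" using lf K by (auto simp: locally_finite_borel_def)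
  show ?thesis
  proof (cases "p = top")
    case True
    have "(\<integral>\<^sup>+x\<in>K. h x \<partial>\<mu>) \<le> (\<integral>\<^sup>+x\<in>K. Lp_norm \<mu> top h \<partial>\<mu>)"
      using AE_le_Lp_norm_top[where M=\<mu> and f=h]
      by (intro nn_integral_mono_AE) (auto elim!: eventually_mono intro: mult_right_mono)
    also have "\<dots> = Lp_norm \<mu> top h * emeasure \<mu> K" by (subst nn_integral_cmult_indicator) auto
    also have "\<dots> < top" using fin True mK by (simp add: ennreal_mult_less_top)
    finally show ?thesis .
  next
    case False
    define P where "P = enn2real p"
    have "enn2real 1 \<le> P" unfolding P_def using p False by (intro enn2real_mono) (auto simp: less_top)
    then have P: "1 \<le> P" by simp
    have "h x \<le> 1 + enn_powr (h x) P" for x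
    proof (cases "h x \<le> 1")
      case True
      then show ?thesis by (metis add_increasing2 zero_le)
    next
      case False
      then have "h x \<le> enn_powr (h x) P"
      proof (cases "h x")
        case (real r)
        then have "1 \<le> r" using False by (metis ennreal_leI ennreal_1 linorder_le_cases)
        then show ?thesis using real powr_mono[OF P, of r] by (simp add: enn_powr_ennreal ennreal_leI)
      qed simp
      then show ?thesis by (metis add_increasing zero_le)
    qed
    then have "(\<integral>\<^sup>+x\<in>K. h x \<partial>\<mu>) \<le> (\<integral>\<^sup>+x. indicator K x + enn_powr (h x) P \<partial>\<mu>)"
      by (intro nn_integral_mono) (auto simp: indicator_def)
    also have "\<dots> = emeasure \<mu> K + enn_powr (Lp_norm \<mu> p h) P"
      by (subst nn_integral_add) (auto simp: Lp_norm_powr[OF p0 False] P_def)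
    also have "\<dots> < top" using mK enn_powr_lt_top[OF fin] by simp
    finally show ?thesis .
  qed
qed

text \<open>The complement of the support is a union of open null balls, and by Lindelof countably
  many of them suffice.\<close>

lemma AE_msupport:
  fixes \<mu> :: "(real^'n) measure"
  assumes lf: "locally_finite_borel \<mu>"
  shows "AE x in \<mu>. x \<in> msupport \<mu>"
proof -
  note [simp] = locally_finite_borel_sets[OF lf]
  let ?E = "msupport \<mu>"
  have "\<exists>U. open U \<and> x \<in> U \<and> emeasure \<mu> U = 0" if x: "x \<notin> ?E" for x
  proof -
    obtain r where r: "0 < r" "emeasure \<mu> (cube r x) = 0"
      using x unfolding msupport_def by (auto simp: zero_less_iff_neq_zero)
    have "ball x r \<subseteq> cube r x"
    proof
      fix y assume "y \<in> ball x r"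
      then show "y \<in> cube r x"
        using infnorm_le_norm[of "y - x"] by (simp add: mem_cube dist_norm norm_minus_commute)
    qed
    then have "emeasure \<mu> (ball x r) = 0"
      using r emeasure_mono[of "ball x r" "cube r x" \<mu>] by simp
    with r show ?thesis by (intro exI[of _ "ball x r"]) auto
  qed
  then obtain U where U: "\<And>x. x \<notin> ?E \<Longrightarrow> open (U x) \<and> x \<in> U x \<and> emeasure \<mu> (U x) = 0" by metis
  have "\<And>S. S \<in> U ` (- ?E) \<Longrightarrow> open S" using U by blast
  then obtain F' where F': "F' \<subseteq> U ` (- ?E)" "countable F'" "\<Union> F' = \<Union> (U ` (- ?E))"
    by (rule Lindelof)
  have "(\<Union>G\<in>F'. G) \<in> null_sets \<mu>"
    using F' U by (intro null_sets_UN') (auto simp: null_sets_def)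
  moreover have "- ?E \<subseteq> (\<Union>G\<in>F'. G)" using F'(3) U by auto
  ultimately show ?thesis by (intro AE_I'[of "\<Union>G\<in>F'. G"]) auto
qed

text \<open>The data with all constants fixed. For infinite p, \<open>enn2real p\<close> is 0 and
  hence \<open>\<tau>\<close> is 0, the right value. \<open>M3\<close> turns the comparison of
  densities into one of integrals for two consecutive measures; when the locale is entered, its
  constant is that of the densities times 2^(n-d).\<close>

locale trace_setting =
  fixes d s :: real and p :: ennreal and E :: "(real^'n) set" and m :: "nat \<Rightarrow> (real^'n) measure"
    and C1 C2 C3 \<tau> :: real
  assumes d: "0 \<le> d" "d \<le> real CARD('n)"
    and closed_E: "closed E" and E_ne: "E \<noteq> {}"
    and p: "1 \<le> p"
    and \<tau>: "\<tau> = (real CARD('n) - d) / enn2real p" and s: "\<tau> < s" "s < 1"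
    and lf: "locally_finite_borel (m k)"
    and supp: "msupport (m k) = E"
    and C: "0 < C1" "0 < C2" "0 < C3"
    and M1: "0 < r \<Longrightarrow> r \<le> 2 powr (- real k) \<Longrightarrow> emeasure (m k) (cube r x) \<le> ennreal (C1 * r powr d)"
    and M2: "x \<in> E \<Longrightarrow> 2 powr (- real k) \<le> r \<Longrightarrow> r \<le> 1 \<Longrightarrow> ennreal (C2 * r powr d) \<le> emeasure (m k) (cube r x)"
    and M3: "h \<in> borel_measurable borel \<Longrightarrow> (\<integral>\<^sup>+x. h x \<partial>m (Suc k)) \<le> ennreal C3 * (\<integral>\<^sup>+x. h x \<partial>m k)"
    and strong: "G \<in> sets borel \<Longrightarrow> G \<subseteq> E \<Longrightarrow> AE x in m 0. x \<in> G \<longrightarrow>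
          0 < limsup (\<lambda>k. ereal (measure (m k) (cube (2 powr (- real k)) x \<inter> G) /
                                   measure (m k) (cube (2 powr (- real k)) x)))"
begin

lemma p_pos: "0 < p"
  using p by (metis less_le_trans zero_less_one)

lemma \<tau>_nonneg: "0 \<le> \<tau>"
  using d by (simp add: \<tau>)

lemma s_pos: "0 < s"
  using s \<tau>_nonneg by linarith

lemma sets_m [simp, measurable_cong]: "sets (m k) = sets borel"
  by (rule locally_finite_borel_sets[OF lf])

lemma space_m [simp]: "space (m k) = UNIV"
  by (rule locally_finite_borel_space[OF lf])

lemma M3_shift:
  assumes [measurable]: "h \<in> borel_measurable borel"
  shows "(\<integral>\<^sup>+x. h x \<partial>m (k + i)) \<le> ennreal (C3 ^ i) * (\<integral>\<^sup>+x. h x \<partial>m k)"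
proof (induction i)
  case (Suc i)
  have "(\<integral>\<^sup>+x. h x \<partial>m (k + Suc i)) \<le> ennreal C3 * (\<integral>\<^sup>+x. h x \<partial>m (k + i))"
    using M3[of h "k + i"] by simp
  also have "\<dots> \<le> ennreal C3 * (ennreal (C3 ^ i) * (\<integral>\<^sup>+x. h x \<partial>m k))"
    by (intro mult_left_mono Suc) auto
  also have "\<dots> = ennreal (C3 ^ Suc i) * (\<integral>\<^sup>+x. h x \<partial>m k)"
    using C by (simp add: ennreal_mult mult.assoc)
  finally show ?case .
qed simp

text \<open>Applied to indicators, the integral bound is absolute continuity with respect to m_0; so
  a statement is proved m_0-almost everywhere once and used for every m_k.\<close>

lemma AE_m:
  assumes "AE x in m 0. P x"
  shows "AE x in m k. P x"
proof -
  obtain N where N: "{x. \<not> P x} \<subseteq> N" "N \<in> sets borel" "emeasure (m 0) N = 0"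
    using assms by (auto elim!: AE_E)
  have "emeasure (m k) N \<le> ennreal (C3 ^ k) * emeasure (m 0) N"
    using M3_shift[of "indicator N" 0 k] N by simp
  then have "emeasure (m k) N = 0" using N by simp
  then show ?thesis using N by (intro AE_I[of _ _ N]) auto
qed

lemma AE_in_E: "AE x in m k. x \<in> E"
  using AE_msupport[OF lf, of k] by (simp add: supp)

section \<open>Passage between Lebesgue measure and the measures on E\<close>

lemma mass_le:
  obtains C4 :: real where "0 < C4"
    "\<And>k j x. int k - 6 \<le> j \<Longrightarrow> emeasure (m k) (cube (dy j) x) \<le> ennreal (C4 * dy j powr d)"
proof -
  obtain N :: real where N: "1 \<le> N"
    "\<And>(\<mu> :: (real^'n) measure) r c x. sets \<mu> = sets borel \<Longrightarrow> 0 \<le> r \<Longrightarrow> (\<And>x. emeasure \<mu> (cube r x) \<le> c)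
       \<Longrightarrow> emeasure \<mu> (cube (2 * r) x) \<le> ennreal N * c"
    using emeasure_cube_double by metis
  \<comment> \<open>\<open>M1\<close> ends at the radius 2^{-k}; beyond it, cubes are covered by
    smaller ones, doubling after doubling.\<close>
  have it: "emeasure (m k) (cube (2 ^ a * r) x) \<le> ennreal (N ^ a * (C1 * r powr d))"
    if r: "0 < r" "r \<le> 2 powr (- real k)" for a k r x
  proof (induction a arbitrary: x)
    case (Suc a)
    have "emeasure (m k) (cube (2 * (2 ^ a * r)) x) \<le> ennreal N * ennreal (N ^ a * (C1 * r powr d))"
      using r by (intro N(2) Suc) auto
    then show ?case using N C by (simp add: mult.assoc ennreal_mult[symmetric])
  qed (use M1[OF r] in simp)
  \<comment> \<open>Six doublings correspond to the six extra scales at which the oscillation series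
    \<open>osc_tail\<close> starts.\<close>
  show ?thesis
  proof (rule that[of "N ^ 6 * C1"])
    fix k j x assume j: "int k - 6 \<le> j"
    have "dy (j + 6) \<le> dy (int k)" using j by (intro dy_mono) auto
    moreover have eq: "2 ^ 6 * dy (j + 6) = dy j" by (simp add: dy_add dy_numeral)
    ultimately have "emeasure (m k) (cube (dy j) x) \<le> ennreal (N ^ 6 * (C1 * dy (j + 6) powr d))"
      using it[of "dy (j + 6)" k 6 x] by (simp add: dy_nat)
    also have "\<dots> \<le> ennreal (N ^ 6 * (C1 * dy j powr d))"
      using N C d by (intro ennreal_leI mult_left_mono powr_mono2 dy_mono) auto
    finally show "emeasure (m k) (cube (dy j) x) \<le> ennreal (N ^ 6 * C1 * dy j powr d)"
      by (simp add: mult.assoc)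
  qed (use N C in auto)
qed

text \<open>The kernel r^(-n) on cubes of radius r = \<open>dy j\<close> has mass 2^n for Lebesgue
  measure and at most a multiple of r^(d-n) for m_k. The Schur test raises the second bound to the
  power 1/p, which gives r^(-\<tau>).\<close>

lemma avg_norm_le:
  obtains C :: real where "0 < C"
    "\<And>k j h. int k - 6 \<le> j \<Longrightarrow> h \<in> borel_measurable borel \<Longrightarrow>
       Lp_norm (m k) p (avg j h) \<le> ennreal (C * dy j powr (- \<tau>)) * Lp_norm lborel p h"
proof -
  let ?n = "real CARD('n)" and ?P = "enn2real p"
  obtain C4 where C4: "0 < C4"
    "\<And>k j x. int k - 6 \<le> j \<Longrightarrow> emeasure (m k) (cube (dy j) x) \<le> ennreal (C4 * dy j powr d)"
    using mass_le by blast
  show ?thesis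
  proof (rule that[of "(2 ^ CARD('n)) powr (1 - 1 / ?P) * C4 powr (1 / ?P)"])
    fix k j and h :: "real^'n \<Rightarrow> ennreal"
    assume kj: "int k - 6 \<le> j" and [measurable]: "h \<in> borel_measurable borel"
    let ?B = "C4 * dy j powr (d - ?n)"
    have "Lp_norm (m k) p (avg j h)
      \<le> ennreal ((2 ^ CARD('n)) powr (1 / 1 - 1 / ?P) * ?B powr (1 / ?P)) * Lp_norm lborel p h"
    proof (rule Lp_norm_averaging[OF locally_finite_borel_lborel lf])
      show "ennreal (dy j powr (- ?n)) < top" by simp
      show "AE y in m k. enn_powr (avg j h y) 1 \<le> ennreal (dy j powr (- ?n)) * (\<integral>\<^sup>+x\<in>cube (dy j) y. enn_powr (h x) 1 \<partial>lborel)"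
        by (simp add: avg_def)
      show "ennreal (dy j powr (- ?n)) * emeasure lborel (cube (dy j) y) \<le> ennreal (2 ^ CARD('n))" for y :: "real^'n"
        by (simp add: emeasure_lborel_cube ennreal_mult[symmetric] power_mult_distrib powr_minus powr_realpow)
      show "AE x in lborel. ennreal (dy j powr (- ?n)) * emeasure (m k) (cube (dy j) x) \<le> ennreal ?B"
      proof (intro AE_I2)
        fix x
        have "ennreal (dy j powr (- ?n)) * emeasure (m k) (cube (dy j) x)
          \<le> ennreal (dy j powr (- ?n)) * ennreal (C4 * dy j powr d)"
          by (intro mult_left_mono C4 kj) auto
        also have "\<dots> = ennreal ?B" using C4
          by (simp add: ennreal_mult[symmetric] powr_diff powr_minus field_simps)
        finally show "ennreal (dy j powr (- ?n)) * emeasure (m k) (cube (dy j) x) \<le> ennreal ?B" .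
      qed
    qed (use C4 p in \<open>auto simp: ennreal_1\<close>)
    also have "?B powr (1 / ?P) = C4 powr (1 / ?P) * dy j powr (- \<tau>)"
      using C4 by (simp add: powr_mult powr_powr \<tau> minus_divide_left)
    finally show "Lp_norm (m k) p (avg j h)
      \<le> ennreal ((2 ^ CARD('n)) powr (1 - 1 / ?P) * C4 powr (1 / ?P) * dy j powr (- \<tau>)) * Lp_norm lborel p h"
      by (simp add: mult.assoc)
  qed (use C4 in auto)
qed

text \<open>The reason for the doubled cube in \<open>best_approx_mod\<close>: a cube that meets E
  may barely touch it, but its double contains a full cube centred on E.\<close>

lemma cube_mass_pos:
  assumes "cube (dy (int k)) y \<inter> E \<noteq> {}"
  shows "ennreal (C2 * dy (int k) powr d) \<le> emeasure (m k) (cube (2 * dy (int k)) y)"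
proof -
  obtain y0 where y0: "y0 \<in> E" "y0 \<in> cube (dy (int k)) y" using assms by blast
  have "ennreal (C2 * dy (int k) powr d) \<le> emeasure (m k) (cube (dy (int k)) y0)"
    using y0 dy_mono[of 0 "int k"] by (intro M2) (auto simp: dy_nat)
  also have "\<dots> \<le> emeasure (m k) (cube (2 * dy (int k)) y)"
    using y0(2) by (intro emeasure_mono cube_mono) (auto simp: mem_cube)
  finally show ?thesis .
qed

text \<open>The passage back, from E to R^n. The kernel 1 / (C2 r^d) has bounded mass for m_k and
  mass of order r^(n-d) for Lebesgue measure; hence the gain r^\<tau>. The comparison constant
  \<open>c y\<close> may depend on y in any way, measurable or not, so that it can be an average or
  the result of a choice.\<close>

lemma best_approx_norm_le:
  assumes \<sigma>: "0 < \<sigma>" "ennreal \<sigma> \<le> p"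
  obtains C :: real where "0 < C"
    "\<And>k \<phi> c h. \<phi> \<in> L_loc \<sigma> m \<Longrightarrow> h \<in> borel_measurable borel \<Longrightarrow>
      (AE x in m k. \<forall>y. infnorm (x - y) \<le> 2 * dy (int k) \<longrightarrow> cube (dy (int k)) y \<inter> E \<noteq> {} \<longrightarrow>
         ennreal \<bar>\<phi> x - c y\<bar> \<le> h x) \<Longrightarrow>
      Lp_norm lborel p (best_approx_mod (m k) \<sigma> \<phi> (dy (int k)))
        \<le> ennreal (C * dy (int k) powr \<tau>) * Lp_norm (m k) p h"
proof -
  let ?n = "real CARD('n)" and ?P = "enn2real p"
  obtain C4 where C4: "0 < C4"
    "\<And>k j x. int k - 6 \<le> j \<Longrightarrow> emeasure (m k) (cube (dy j) x) \<le> ennreal (C4 * dy j powr d)"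
    using mass_le by blast
  define A where "A = C4 * 2 powr d / C2"
  define D where "D = 4 ^ CARD('n) / C2"
  have A: "0 < A" and D: "0 < D" using C4 C by (auto simp: A_def D_def)
  show ?thesis
  proof (rule that[of "A powr (1 / \<sigma> - 1 / ?P) * D powr (1 / ?P)"])
    fix k \<phi> and c :: "real^'n \<Rightarrow> real" and h :: "real^'n \<Rightarrow> ennreal"
    assume \<phi>: "\<phi> \<in> L_loc \<sigma> m" and h[measurable]: "h \<in> borel_measurable borel"
      and le: "AE x in m k. \<forall>y. infnorm (x - y) \<le> 2 * dy (int k) \<longrightarrow> cube (dy (int k)) y \<inter> E \<noteq> {} \<longrightarrow>
         ennreal \<bar>\<phi> x - c y\<bar> \<le> h x"
    let ?r = "dy (int k)"
    let ?F = "best_approx_mod (m k) \<sigma> \<phi> ?r"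
    have [measurable]: "\<phi> \<in> borel_measurable borel" using \<phi> by (simp add: L_loc_def)
    define w where "w = 1 / (C2 * ?r powr d)"
    have w: "0 < w" using C by (simp add: w_def)
    have F[measurable]: "?F \<in> borel_measurable borel"
      using \<phi> closed_E by (intro measurable_best_approx_mod lf \<sigma>) (auto simp: supp L_loc_def)
    have "Lp_norm lborel p ?F \<le> ennreal (A powr (1 / \<sigma> - 1 / ?P) * (D * ?r powr (?n - d)) powr (1 / ?P)) * Lp_norm (m k) p h"
    proof (rule Lp_norm_averaging[OF lf locally_finite_borel_lborel \<sigma> h F])
      show "ennreal w < top" by simp
      have "enn_powr (?F y) \<sigma> \<le> ennreal w * (\<integral>\<^sup>+x\<in>cube (2 * ?r) y. enn_powr (h x) \<sigma> \<partial>m k)" for y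
      proof (cases "cube ?r y \<inter> E = {}")
        case True
        then show ?thesis by (simp add: best_approx_mod_def supp)
      next
        case False
        let ?G = "cube (2 * ?r) y"
        have m1: "ennreal (C2 * ?r powr d) \<le> emeasure (m k) ?G" by (rule cube_mass_pos[OF False])
        then have pos: "0 < emeasure (m k) ?G"
          using C by (metis dy_pos(1) ennreal_less_zero_iff less_le_trans mult_pos_pos powr_gt_zero order_less_irrefl)
        have "1 = ennreal w * ennreal (C2 * ?r powr d)"
          using C by (simp add: w_def ennreal_mult[symmetric])
        also have "\<dots> \<le> ennreal w * emeasure (m k) ?G" by (intro mult_left_mono m1) auto
        finally have "enn_powr (?F y) \<sigma> * 1 \<le> enn_powr (?F y) \<sigma> * (ennreal w * emeasure (m k) ?G)"
          by (intro mult_left_mono) auto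
        also have "\<dots> = ennreal w * (enn_powr (best_approx (m k) \<sigma> \<phi> ?G) \<sigma> * emeasure (m k) ?G)"
          using False by (simp add: best_approx_mod_def supp mult_ac)
        also have "\<dots> \<le> ennreal w * (\<integral>\<^sup>+x\<in>?G. ennreal (\<bar>\<phi> x - c y\<bar> powr \<sigma>) \<partial>m k)"
          by (intro mult_left_mono best_approx_le \<sigma> pos emeasure_cube_finite lf) auto
        also have "\<dots> \<le> ennreal w * (\<integral>\<^sup>+x\<in>?G. enn_powr (h x) \<sigma> \<partial>m k)"
        proof (intro mult_left_mono nn_integral_mono_AE)
          show "AE x in m k. ennreal (\<bar>\<phi> x - c y\<bar> powr \<sigma>) * indicator ?G x \<le> enn_powr (h x) \<sigma> * indicator ?G x"
            using le
          proof eventually_elim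
            case (elim x)
            have "ennreal (\<bar>\<phi> x - c y\<bar> powr \<sigma>) \<le> enn_powr (h x) \<sigma>" if "x \<in> ?G"
              using elim[rule_format, of y] that False enn_powr_mono[of "ennreal \<bar>\<phi> x - c y\<bar>" "h x" \<sigma>] \<sigma>
              by (simp add: mem_cube enn_powr_ennreal)
            then show ?case by (simp add: indicator_def)
          qed
        qed auto
        finally show ?thesis by simp
      qed
      then show "AE y in lborel. enn_powr (?F y) \<sigma> \<le> ennreal w * (\<integral>\<^sup>+x\<in>cube (2 * ?r) y. enn_powr (h x) \<sigma> \<partial>m k)"
        by simp
      show "ennreal w * emeasure (m k) (cube (2 * ?r) y) \<le> ennreal A" for y
      proof -
        have eq: "2 * ?r = dy (int k - 1)" by (simp add: dy_diff)
        have "ennreal w * emeasure (m k) (cube (2 * ?r) y) \<le> ennreal w * ennreal (C4 * dy (int k - 1) powr d)"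
          unfolding eq by (intro mult_left_mono C4) auto
        also have "\<dots> = ennreal A"
          using w C4 C by (simp add: ennreal_mult[symmetric] eq[symmetric] powr_mult A_def w_def)
        finally show ?thesis .
      qed
      have "ennreal w * emeasure lborel (cube (2 * ?r) x) = ennreal (D * ?r powr (?n - d))" for x :: "real^'n"
        using w C by (simp add: emeasure_lborel_cube ennreal_mult[symmetric] D_def w_def powr_diff power_mult_distrib powr_realpow)
      then show "AE x in m k. ennreal w * emeasure lborel (cube (2 * ?r) x) \<le> ennreal (D * ?r powr (?n - d))"
        by simp
    qed (use A D in auto)
    also have "(D * ?r powr (?n - d)) powr (1 / ?P) = D powr (1 / ?P) * ?r powr \<tau>"
      using D by (simp add: powr_mult powr_powr \<tau>)
    finally show "Lp_norm lborel p ?F \<le> ennreal (A powr (1 / \<sigma> - 1 / ?P) * D powr (1 / ?P) * ?r powr \<tau>) * Lp_norm (m k) p h"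
      by (simp add: mult.assoc)
  qed (use A D in auto)
qed

end


subsection \<open>Traces of Besov functions\<close>

lemma ennreal_dist_triangle: "ennreal \<bar>a - c\<bar> \<le> ennreal \<bar>a - b\<bar> + ennreal \<bar>b - c\<bar>"
proof -
  have "ennreal \<bar>a - c\<bar> \<le> ennreal (\<bar>a - b\<bar> + \<bar>b - c\<bar>)" by (intro ennreal_leI) linarith
  then show ?thesis by simp
qed

lemma average_dist_le:
  fixes f :: "real^'n \<Rightarrow> real"
  assumes [measurable]: "f \<in> borel_measurable M" "G \<in> sets M"
    and fin: "(\<integral>\<^sup>+x\<in>G. ennreal \<bar>f x\<bar> \<partial>M) < top" and G: "0 < emeasure M G" "emeasure M G < top"
  shows "ennreal \<bar>average M G f - c\<bar> * emeasure M G \<le> (\<integral>\<^sup>+x\<in>G. ennreal \<bar>f x - c\<bar> \<partial>M)"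
proof -
  have mG: "emeasure M G = ennreal (measure M G)" using G by (simp add: emeasure_eq_ennreal_measure less_top)
  have pos: "0 < measure M G" using G mG by (metis ennreal_0 less_irrefl zero_less_measure_iff)
  have i: "integrable M (\<lambda>x. indicator G x * f x)"
  proof (rule integrableI_bounded)
    have "(\<integral>\<^sup>+x. ennreal (norm (indicator G x * f x)) \<partial>M) = (\<integral>\<^sup>+x\<in>G. ennreal \<bar>f x\<bar> \<partial>M)"
      by (intro nn_integral_cong) (auto simp: indicator_def)
    with fin show "(\<integral>\<^sup>+x. ennreal (norm (indicator G x * f x)) \<partial>M) < \<infinity>" by simp
  qed measurable
  have ic: "integrable M (\<lambda>x. indicator G x * c)"
    using G by (intro integrable_mult_left) (auto simp: integrable_indicator_iff)
  have "(average M G f - c) * measure M G = (\<integral>x. indicator G x * f x \<partial>M) - (\<integral>x. indicator G x * c \<partial>M)"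
    using pos by (simp add: average_def set_lebesgue_integral_def left_diff_distrib)
  also have "\<dots> = (\<integral>x. indicator G x * f x - indicator G x * c \<partial>M)"
    by (rule Bochner_Integration.integral_diff[OF i ic, symmetric])
  finally have eq: "(average M G f - c) * measure M G = (\<integral>x. indicator G x * f x - indicator G x * c \<partial>M)" .
  have "ennreal \<bar>average M G f - c\<bar> * emeasure M G = ennreal (norm ((average M G f - c) * measure M G))"
    by (simp add: mG ennreal_mult[symmetric] abs_mult)
  also have "\<dots> \<le> (\<integral>\<^sup>+x. ennreal (norm (indicator G x * f x - indicator G x * c)) \<partial>M)"
    unfolding eq by (rule integral_norm_bound_ennreal) (intro Bochner_Integration.integrable_diff i ic)
  also have "\<dots> = (\<integral>\<^sup>+x\<in>G. ennreal \<bar>f x - c\<bar> \<partial>M)"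
    by (intro nn_integral_cong) (auto simp: indicator_def)
  finally show ?thesis .
qed

text \<open>The point must not only stay below the mean but also avoid the exceptional set of a
  fractional gradient; hence the set \<open>N\<close>.\<close>

lemma exists_le_mean:
  assumes [measurable]: "h \<in> borel_measurable M" "Z \<in> sets M"
    and Z: "0 < emeasure M Z" "emeasure M Z < top" and N: "AE x in M. x \<notin> N"
  shows "\<exists>z\<in>Z. z \<notin> N \<and> h z * emeasure M Z \<le> (\<integral>\<^sup>+x\<in>Z. h x \<partial>M)"
proof (rule ccontr)
  let ?I = "\<integral>\<^sup>+x\<in>Z. h x \<partial>M"
  assume "\<not> ?thesis"
  then have gt: "?I < h z * emeasure M Z" if "z \<in> Z" "z \<notin> N" for z using that by (meson linorder_not_le)
  have nz: "\<not> (AE x in M. x \<notin> Z)"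
    using Z by (simp add: AE_iff_measurable[OF _ refl] Int_absorb1 sets.sets_into_space flip: Int_def)
  have "\<exists>z\<in>Z. z \<notin> N"
  proof (rule ccontr)
    assume "\<not> (\<exists>z\<in>Z. z \<notin> N)"
    with N have "AE x in M. x \<notin> Z" by (auto elim!: eventually_mono)
    with nz show False ..
  qed
  then have fin: "?I < top" using gt by (metis less_top not_less_iff_gr_or_eq order_less_trans)
  define c where "c = ?I / emeasure M Z"
  have c: "c < h z" if "z \<in> Z" "z \<notin> N" for z
    unfolding c_def using gt[OF that] Z by (subst divide_less_ennreal) auto
  have Ic: "(\<integral>\<^sup>+x. c * indicator Z x \<partial>M) = ?I"
    using Z by (subst nn_integral_cmult_indicator) (auto simp: c_def ennreal_divide_times)
  have "(\<integral>\<^sup>+x. c * indicator Z x \<partial>M) < (\<integral>\<^sup>+x. h x * indicator Z x \<partial>M)"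
  proof (rule nn_integral_less)
    show "(\<integral>\<^sup>+x. c * indicator Z x \<partial>M) \<noteq> \<infinity>" using Ic fin by simp
    show "AE x in M. c * indicator Z x \<le> h x * indicator Z x"
      using N by eventually_elim (auto simp: indicator_def intro: less_imp_le[OF c])
    show "\<not> (AE x in M. h x * indicator Z x \<le> c * indicator Z x)"
    proof
      assume "AE x in M. h x * indicator Z x \<le> c * indicator Z x"
      with N have "AE x in M. x \<notin> Z" 
      proof eventually_elim
        case (elim x)
        show ?case
        proof
          assume "x \<in> Z"
          then show False using c[of x] elim by auto
        qed
      qed
      with nz show False ..
    qed
  qed measurable
  then show False using Ic by simp
qed

lemma frac_gradients_AE:
  fixes f :: "real^'n \<Rightarrow> real"
  assumes "g \<in> frac_gradients s f"
  obtains N where "AE x in lborel. x \<notin> N"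
    "\<And>k x y. x \<notin> N \<Longrightarrow> y \<notin> N \<Longrightarrow> dy k / 2 \<le> infnorm (x - y) \<Longrightarrow> infnorm (x - y) < dy k \<Longrightarrow>
       \<bar>f x - f y\<bar> \<le> infnorm (x - y) powr s * (g k x + g k y)"
proof -
  obtain N where N: "N \<in> null_sets lebesgue" "\<forall>k. \<forall>x\<in>- N. \<forall>y\<in>- N.
           2 powi (- k - 1) \<le> infnorm (x - y) \<and> infnorm (x - y) < 2 powi (- k) \<longrightarrow>
           \<bar>f x - f y\<bar> \<le> infnorm (x - y) powr s * (g k x + g k y)"
    using assms by (auto simp: frac_gradients_def)
  have eq: "(2::real) powi (- k - 1) = dy k / 2" for k
    using dy_powi[of "k + 1"] by (simp add: dy_add)
  have "AE x in lebesgue. x \<notin> N" by (rule AE_not_in[OF N(1)])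
  then have "AE x in lborel. x \<notin> N" by (simp add: AE_completion_iff)
  then show ?thesis using N(2) by (intro that[of N]) (auto simp: eq dy_powi)
qed

text \<open>The point \<open>z\<close> found below lies at distance between \<open>dy j / 2\<close> and \<open>dy j\<close> from every point of
  \<open>G\<close>, the range governed by \<open>g j\<close>; so averages over nearby sets are compared through \<open>b = f z\<close>.\<close>

lemma oscillation_le:
  fixes f :: "real^'n \<Rightarrow> real" and g :: "int \<Rightarrow> real^'n \<Rightarrow> real"
  assumes f[measurable]: "f \<in> borel_measurable borel"
    and loc: "\<And>K. compact K \<Longrightarrow> (\<integral>\<^sup>+x\<in>K. ennreal \<bar>f x\<bar> \<partial>lborel) < top"
    and g: "g \<in> frac_gradients s f" and s: "0 < s"
  shows "\<exists>b. \<forall>G. G \<in> sets borel \<and> G \<subseteq> cube (dy j / 16) x \<and> ennreal ((dy j / 32) ^ CARD('n)) \<le> emeasure lborel G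
    \<longrightarrow> ennreal \<bar>average lborel G f - b\<bar> \<le> ennreal (2 * 32 ^ CARD('n) * dy j powr s) * avg j (\<lambda>y. ennreal (g j y)) x"
proof -
  let ?n = "CARD('n)"
  have [measurable]: "g j \<in> borel_measurable borel" and g0: "\<And>y. 0 \<le> g j y" using g by (auto simp: frac_gradients_def)
  obtain N where N: "AE x in lborel. x \<notin> N"
    "\<And>k x y. x \<notin> N \<Longrightarrow> y \<notin> N \<Longrightarrow> dy k / 2 \<le> infnorm (x - y) \<Longrightarrow> infnorm (x - y) < dy k \<Longrightarrow>
       \<bar>f x - f y\<bar> \<le> infnorm (x - y) powr s * (g k x + g k y)"
    using frac_gradients_AE[OF g] by blast
  let ?h = "\<lambda>y. ennreal (g j y)"
  let ?I = "\<integral>\<^sup>+y\<in>cube (dy j) x. ?h y \<partial>lborel"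
  have A: "?I = ennreal (dy j ^ ?n) * avg j ?h x"
    by (simp add: avg_def mult.assoc[symmetric] ennreal_mult[symmetric] powr_minus powr_realpow)
  \<comment> \<open>A shift by 3/4 in every coordinate, with 1/16 of freedom at both ends, puts the
    distance between 5/8 and 7/8 of \<open>dy j\<close>.\<close>
  define v :: "real^'n" where "v = vec (3 / 4 * dy j)"
  define Z where "Z = cube (dy j / 16) (x + v)"
  have eZ: "emeasure lborel Z = ennreal ((dy j / 8) ^ ?n)"
    unfolding Z_def by (subst emeasure_lborel_cube) auto
  have Zs: "Z \<in> sets borel" by (simp add: Z_def)
  \<comment> \<open>The choice depends only on \<open>Z\<close> and g_j, so one z serves all sets
    G.\<close>
  obtain z where z: "z \<in> Z" "z \<notin> N" "?h z * emeasure lborel Z \<le> (\<integral>\<^sup>+y\<in>Z. ?h y \<partial>lborel)"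
    using exists_le_mean[of ?h lborel Z N] Zs N(1) by (auto simp: eZ zero_less_power)
  have v: "v $ i = 3 / 4 * dy j" for i by (simp add: v_def)
  have vi: "infnorm v \<le> 3 / 4 * dy j" unfolding infnorm_le_iff v by simp
  have "Z \<subseteq> cube (dy j) x" unfolding Z_def using vi dy_pos(1)[of j] by (intro cube_mono) (simp del: dy_pos)
  then have "(\<integral>\<^sup>+y\<in>Z. ?h y \<partial>lborel) \<le> ?I"
    by (intro nn_integral_mono) (auto simp: indicator_def)
  with z(3) have "?h z * ennreal ((dy j / 8) ^ ?n) \<le> ennreal (dy j ^ ?n) * avg j ?h x" by (simp add: eZ A)
  then have "?h z \<le> ennreal (dy j ^ ?n) * avg j ?h x / ennreal ((dy j / 8) ^ ?n)"
    by (subst le_divide_ennreal_iff) auto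
  also have "\<dots> = ennreal (8 ^ ?n) * avg j ?h x"
    by (simp add: divide_ennreal_def inverse_ennreal mult.assoc mult.commute[of "avg j ?h x"] ennreal_mult[symmetric]
         power_divide) (simp add: mult.assoc[symmetric] ennreal_mult[symmetric])
  also have "\<dots> \<le> ennreal (32 ^ ?n) * avg j ?h x"
    by (intro mult_right_mono ennreal_leI power_mono) auto
  finally have hz: "?h z \<le> ennreal (32 ^ ?n) * avg j ?h x" .
  show ?thesis
  proof (intro exI[of _ "f z"] allI impI, elim conjE)
    fix G assume G[measurable]: "G \<in> sets borel" and sub: "G \<subseteq> cube (dy j / 16) x"
      and big: "ennreal ((dy j / 32) ^ ?n) \<le> emeasure lborel G"
    have pos: "0 < emeasure lborel G"
      using big by (metis dy_pos(1) ennreal_less_zero_iff less_le_trans zero_less_divide_iff zero_less_numeral zero_less_power)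
    have fin: "emeasure lborel G < top"
      using emeasure_mono[OF sub, of lborel] by (auto simp: emeasure_lborel_cube intro: le_less_trans)
    have "ennreal \<bar>average lborel G f - f z\<bar> * emeasure lborel G \<le> (\<integral>\<^sup>+u\<in>G. ennreal \<bar>f u - f z\<bar> \<partial>lborel)"
    proof (rule average_dist_le)
      have "(\<integral>\<^sup>+u\<in>G. ennreal \<bar>f u\<bar> \<partial>lborel) \<le> (\<integral>\<^sup>+u\<in>cube (dy j / 16) x. ennreal \<bar>f u\<bar> \<partial>lborel)"
        using sub by (intro nn_integral_mono) (auto simp: indicator_def)
      then show "(\<integral>\<^sup>+u\<in>G. ennreal \<bar>f u\<bar> \<partial>lborel) < top" using loc[OF compact_cube] by (rule le_less_trans)
    qed (use pos fin in auto)
    also have "\<dots> \<le> (\<integral>\<^sup>+u. ennreal (dy j powr s) * (?h u * indicator (cube (dy j) x) u + ?h z * indicator G u) \<partial>lborel)"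
      using N(1)
    proof (intro nn_integral_mono_AE, eventually_elim)
      case (elim u)
      show ?case
      proof (cases "u \<in> G")
        case True
        then have u: "u \<in> cube (dy j / 16) x" using sub by blast
        then have u': "u \<in> cube (dy j) x" using cube_mono_radius[of "dy j / 16" "dy j" x] by auto
        have "infnorm (u - x) \<le> dy j / 16" "infnorm (z - (x + v)) \<le> dy j / 16"
          using u z(1) by (simp_all only: Z_def mem_cube)
        then have ui: "\<bar>(u - x) $ i\<bar> \<le> dy j / 16" "\<bar>(z - (x + v)) $ i\<bar> \<le> dy j / 16" for i
          unfolding infnorm_le_iff by blast+
        have comp: "5 / 8 * dy j \<le> \<bar>(u - z) $ i\<bar>" "\<bar>(u - z) $ i\<bar> \<le> 7 / 8 * dy j" for i
          using ui[of i] dy_pos(1)[of j] v[of i] unfolding vector_minus_component vector_add_component by linarith+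
        have "infnorm (u - z) \<le> 7 / 8 * dy j" using comp(2) unfolding infnorm_le_iff by blast
        moreover have "7 / 8 * dy j < dy j" by simp
        moreover have "dy j / 2 \<le> infnorm (u - z)"
          using comp(1)[of undefined] component_le_infnorm_cart[of "u - z" undefined] dy_pos(1)[of j] by linarith
        ultimately have r: "dy j / 2 \<le> infnorm (u - z)" "infnorm (u - z) < dy j" by linarith+
        have "\<bar>f u - f z\<bar> \<le> infnorm (u - z) powr s * (g j u + g j z)"
          by (rule N(2)[OF elim(2) z(2) r])
        also have "\<dots> \<le> dy j powr s * (g j u + g j z)"
          using r s g0 by (intro mult_right_mono powr_mono2) (auto intro: add_nonneg_nonneg infnorm_pos_le)
        finally show ?thesis using True u' g0
          by (simp add: ennreal_mult[symmetric] ennreal_plus[symmetric] ennreal_leI del: ennreal_plus)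
      qed simp
    qed
    also have "\<dots> = ennreal (dy j powr s) * (?I + ?h z * emeasure lborel G)"
      by (simp add: nn_integral_cmult nn_integral_add nn_integral_cmult_indicator)
    also have "?I \<le> ennreal (32 ^ ?n) * avg j ?h x * emeasure lborel G"
    proof -
      have "?I = ennreal (32 ^ ?n) * avg j ?h x * ennreal ((dy j / 32) ^ ?n)"
        unfolding A by (simp add: mult_ac ennreal_mult[symmetric] power_divide)
      also have "\<dots> \<le> ennreal (32 ^ ?n) * avg j ?h x * emeasure lborel G"
        by (intro mult_left_mono big) auto
      finally show ?thesis .
    qed
    also have "?h z * emeasure lborel G \<le> ennreal (32 ^ ?n) * avg j ?h x * emeasure lborel G"
      by (intro mult_right_mono hz) auto
    also have "ennreal (dy j powr s) * (ennreal (32 ^ ?n) * avg j ?h x * emeasure lborel G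
        + ennreal (32 ^ ?n) * avg j ?h x * emeasure lborel G)
      = (ennreal (2 * 32 ^ ?n * dy j powr s) * avg j ?h x) * emeasure lborel G"
      by (simp add: ennreal_mult mult_2[symmetric] mult_ac)
    finally have "ennreal \<bar>average lborel G f - f z\<bar> * emeasure lborel G
       \<le> (ennreal (2 * 32 ^ ?n * dy j powr s) * avg j ?h x) * emeasure lborel G"
      by (simp add: add_mono mult_left_mono)
    then show "ennreal \<bar>average lborel G f - f z\<bar> \<le> ennreal (2 * 32 ^ ?n * dy j powr s) * avg j ?h x"
      using pos fin by (metis ennreal_mult_divide_eq divide_right_mono_ennreal less_irrefl less_top)
  qed
qed

text \<open>Both averages are compared with the same constant b. The range of radii, from 1/64 to
  1/16 of \<open>dy j\<close>, has room for two consecutive dyadic radii about x as well as for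
  smaller cubes with displaced centres.\<close>

lemma oscillation_two_le:
  fixes f :: "real^'n \<Rightarrow> real" and g :: "int \<Rightarrow> real^'n \<Rightarrow> real"
  assumes f[measurable]: "f \<in> borel_measurable borel"
    and loc: "\<And>K. compact K \<Longrightarrow> (\<integral>\<^sup>+x\<in>K. ennreal \<bar>f x\<bar> \<partial>lborel) < top"
    and g: "g \<in> frac_gradients s f" and s: "0 < s"
    and r: "dy j / 64 \<le> r" "infnorm (y - x) + r \<le> dy j / 16"
    and r': "dy j / 64 \<le> r'" "infnorm (y' - x) + r' \<le> dy j / 16"
  shows "ennreal \<bar>average lborel (cube r y) f - average lborel (cube r' y') f\<bar>
    \<le> ennreal (4 * 32 ^ CARD('n) * dy j powr s) * avg j (\<lambda>y. ennreal (g j y)) x"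
proof -
  let ?B = "ennreal (2 * 32 ^ CARD('n) * dy j powr s) * avg j (\<lambda>y. ennreal (g j y)) x"
  obtain b where b: "\<And>G. G \<in> sets borel \<Longrightarrow> G \<subseteq> cube (dy j / 16) x \<Longrightarrow> ennreal ((dy j / 32) ^ CARD('n)) \<le> emeasure lborel G
    \<Longrightarrow> ennreal \<bar>average lborel G f - b\<bar> \<le> ?B"
    using oscillation_le[OF f loc g s, of j x] by blast
  have vol: "ennreal ((dy j / 32) ^ CARD('n)) \<le> emeasure lborel (cube r (y :: real^'n))" if "dy j / 64 \<le> r" for r y
  proof -
    have "0 \<le> r" using that dy_pos(1)[of j] by linarith
    moreover have "(dy j / 32) ^ CARD('n) \<le> (2 * r) ^ CARD('n)" using that by (intro power_mono) auto
    ultimately show ?thesis by (subst emeasure_lborel_cube) (auto intro!: ennreal_leI simp del: power_mult_distrib)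
  qed
  have 1: "ennreal \<bar>average lborel (cube r y) f - b\<bar> \<le> ?B" by (rule b[OF sets_cube cube_mono[OF r(2)] vol[OF r(1)]])
  have 2: "ennreal \<bar>average lborel (cube r' y') f - b\<bar> \<le> ?B" by (rule b[OF sets_cube cube_mono[OF r'(2)] vol[OF r'(1)]])
  have "ennreal \<bar>average lborel (cube r y) f - average lborel (cube r' y') f\<bar>
    \<le> ennreal \<bar>average lborel (cube r y) f - b\<bar> + ennreal \<bar>average lborel (cube r' y') f - b\<bar>"
    using ennreal_dist_triangle[of "average lborel (cube r y) f" "average lborel (cube r' y') f" b] by (simp add: abs_minus_commute)
  also have "\<dots> \<le> ?B + ?B" by (intro add_mono 1 2)
  also have "\<dots> = ennreal (2 * 32 ^ CARD('n) * dy j powr s + 2 * 32 ^ CARD('n) * dy j powr s) * avg j (\<lambda>y. ennreal (g j y)) x"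
    by (subst ennreal_plus) (auto simp: distrib_right)
  finally show ?thesis by (simp add: mult_ac)
qed


section \<open>Sums of oscillations over scales\<close>

definition osc_bound :: "real \<Rightarrow> (int \<Rightarrow> real^'n \<Rightarrow> ennreal) \<Rightarrow> int \<Rightarrow> real^'n \<Rightarrow> ennreal"
  where "osc_bound s g j x = ennreal (4 * 32 ^ CARD('n) * dy j powr s) * avg j (g j) x"

text \<open>The start at k - 6 is set by displaced cubes: a cube of radius \<open>dy k\<close> with
  centre within \<open>2 * dy k\<close> of x lies in the cube of radius \<open>4 * dy k\<close>,
  that is \<open>dy (k - 6) / 16\<close>, about x.\<close>

definition osc_tail :: "real \<Rightarrow> (int \<Rightarrow> real^'n \<Rightarrow> ennreal) \<Rightarrow> nat \<Rightarrow> real^'n \<Rightarrow> ennreal"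
  where "osc_tail s g k x = (\<Sum>i. osc_bound s g (int k - 6 + int i) x)"

lemma osc_tail_antimono:
  assumes "k \<le> l"
  shows "osc_tail s g l x \<le> osc_tail s g k x"
proof -
  have "osc_tail s g l x = (\<Sum>i. osc_bound s g (int k - 6 + int (i + (l - k))) x)"
    using assms by (simp add: osc_tail_def algebra_simps of_nat_diff)
  also have "\<dots> \<le> (\<Sum>i. osc_bound s g (int k - 6 + int (i + (l - k))) x) + (\<Sum>i<l - k. osc_bound s g (int k - 6 + int i) x)"
    by simp
  also have "\<dots> = osc_tail s g k x"
    unfolding osc_tail_def
    using suminf_offset[of "\<lambda>i. osc_bound s g (int k - 6 + int i) x" "l - k"] by (simp add: add.commute)
  finally show ?thesis .
qed

lemma ennreal_suminf_tendsto_0: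
  fixes b :: "nat \<Rightarrow> ennreal"
  assumes fin: "(\<Sum>i. b i) < top"
  shows "b \<longlonglongrightarrow> 0"
proof -
  have bt: "b i < top" for i
    using sum_le_suminf[of b "{i}"] fin by (simp add: le_less_trans)
  then have "summable (\<lambda>i. enn2real (b i))"
    using fin by (intro summable_suminf_not_top) (auto simp: less_top)
  then have "(\<lambda>i. ennreal (enn2real (b i))) \<longlonglongrightarrow> ennreal 0"
    by (intro tendsto_ennrealI summable_LIMSEQ_zero)
  then show ?thesis using bt by (simp add: less_top)
qed

lemma trace_limit:
  fixes f :: "real^'n \<Rightarrow> real" and g :: "int \<Rightarrow> real^'n \<Rightarrow> real"
  assumes f: "f \<in> borel_measurable borel"
    and loc: "\<And>K. compact K \<Longrightarrow> (\<integral>\<^sup>+x\<in>K. ennreal \<bar>f x\<bar> \<partial>lborel) < top"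
    and g: "g \<in> frac_gradients s f" and s: "0 < s"
    and fin: "osc_tail s (\<lambda>j y. ennreal (g j y)) 0 x < top"
  obtains l where "((\<lambda>r. average lborel (cube r x) f) \<longlongrightarrow> l) (at_right 0)"
    "\<And>k y. infnorm (x - y) \<le> 2 * dy (int k) \<Longrightarrow>
       ennreal \<bar>l - average lborel (cube (dy (int k)) y) f\<bar> \<le> 2 * osc_tail s (\<lambda>j y. ennreal (g j y)) k x"
proof -
  note two = oscillation_two_le[OF f loc g s]
  define a where "a i = average lborel (cube (dy (int i - 6) / 16) x) f" for i
  define b where "b i = osc_bound s (\<lambda>j y. ennreal (g j y)) (int i - 6) x" for i
  have step: "ennreal \<bar>a (Suc i) - a i\<bar> \<le> b i" for i
  proof -
    have e: "dy (int (Suc i) - 6) = dy (int i - 6) / 2"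
      using dy_add[of "int i - 6" 1] by (simp add: algebra_simps)
    show ?thesis unfolding a_def b_def osc_bound_def e
      by (intro two; insert dy_pos(1)[of "int i - 6"]; (simp only: diff_self infnorm_0)?; linarith)
  qed
  have "(\<Sum>i. b i) < top" using fin by (simp add: osc_tail_def b_def)
  then obtain l where l: "a \<longlonglongrightarrow> l" "\<And>k. ennreal \<bar>l - a k\<bar> \<le> (\<Sum>i. b (i + k))"
    using telescoping_limit[of a b, OF step] by blast
  have tail: "(\<Sum>i. b (i + k)) = osc_tail s (\<lambda>j y. ennreal (g j y)) k x" for k
    by (simp add: osc_tail_def b_def algebra_simps)
  have bk: "b k \<le> osc_tail s (\<lambda>j y. ennreal (g j y)) k x" for k
    using sum_le_suminf[of "\<lambda>i. b (i + k)" "{0}"] by (simp add: tail)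
  have "ennreal \<bar>l - average lborel (cube (dy (int k)) y) f\<bar> \<le> 2 * osc_tail s (\<lambda>j y. ennreal (g j y)) k x"
    if y: "infnorm (x - y) \<le> 2 * dy (int k)" for k y
  proof -
    have e: "dy (int k - 6) = 64 * dy (int k)" by (simp add: dy_diff dy_numeral)
    have "ennreal \<bar>a k - average lborel (cube (dy (int k)) y) f\<bar> \<le> b k"
      unfolding a_def b_def osc_bound_def e[symmetric]
      by (intro two; insert y dy_pos(1)[of "int k"]; (simp only: diff_self infnorm_0 infnorm_sub[of y x])?; simp only: e; linarith)
    with bk have 1: "ennreal \<bar>a k - average lborel (cube (dy (int k)) y) f\<bar> \<le> osc_tail s (\<lambda>j y. ennreal (g j y)) k x"
      by (rule order_trans[rotated])
    have "ennreal \<bar>l - average lborel (cube (dy (int k)) y) f\<bar> \<le> ennreal \<bar>l - a k\<bar> + ennreal \<bar>a k - average lborel (cube (dy (int k)) y) f\<bar>"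
      by (rule ennreal_dist_triangle)
    also have "\<dots> \<le> osc_tail s (\<lambda>j y. ennreal (g j y)) k x + osc_tail s (\<lambda>j y. ennreal (g j y)) k x"
      using l(2)[of k] 1 by (intro add_mono) (auto simp: tail)
    finally show ?thesis by (simp add: mult_2)
  qed
  moreover have "((\<lambda>r. average lborel (cube r x) f) \<longlongrightarrow> l) (at_right 0)"
  proof (rule tendstoI)
    fix e :: real assume e: "0 < e"
    have "b \<longlonglongrightarrow> 0" by (rule ennreal_suminf_tendsto_0) fact
    then have "\<forall>\<^sub>F i in sequentially. b i < ennreal (e / 2)"
      using e by (intro order_tendstoD) auto
    moreover have "\<forall>\<^sub>F i in sequentially. dist (a i) l < e / 2"
      using l(1) e by (intro tendstoD) auto
    ultimately have "\<forall>\<^sub>F i in sequentially. b i < ennreal (e / 2) \<and> dist (a i) l < e / 2" by eventually_elim auto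
    then obtain I where I: "\<And>i. i \<ge> I \<Longrightarrow> b i < ennreal (e / 2) \<and> dist (a i) l < e / 2"
      by (auto simp: eventually_sequentially)
    have "dist (average lborel (cube r x) f) l < e" if r: "0 < r" "r < dy (int I - 6) / 16" for r
    proof -
      have "\<exists>i. i \<ge> I \<and> dy (int i - 6) / 32 \<le> r"
      proof -
        have "\<forall>\<^sub>F i in sequentially. dy (int i + (- 6)) < r * 32"
          using r by (intro order_tendstoD(2)[OF dy_tendsto_0]) auto
        then obtain i0 where "\<And>i. i \<ge> i0 \<Longrightarrow> dy (int i + (- 6)) < r * 32" by (auto simp: eventually_sequentially)
        from this[of "max I i0"] show ?thesis by (intro exI[of _ "max I i0"]) auto
      qed
      \<comment> \<open>By minimality r lies between the two consecutive radii
        \<open>dy (i - 6) / 32\<close> and \<open>dy (i - 6) / 16\<close>, so the average over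
        radius r is comparable with \<open>a i\<close> at the cost of one term.\<close>
      then obtain i where i: "i \<ge> I \<and> dy (int i - 6) / 32 \<le> r"
        "\<And>i'. i' < i \<Longrightarrow> \<not> (i' \<ge> I \<and> dy (int i' - 6) / 32 \<le> r)"
        using exists_least_iff[of "\<lambda>i. i \<ge> I \<and> dy (int i - 6) / 32 \<le> r"] by blast
      have up: "r \<le> dy (int i - 6) / 16"
      proof (cases "i = I")
        case False
        then have "\<not> dy (int (i - 1) - 6) / 32 \<le> r" using i(2)[of "i - 1"] i(1) by auto
        moreover have "dy (int (i - 1) - 6) = 2 * dy (int i - 6)"
          using False i(1) dy_add[of "int i - 6" "-1"] by (simp add: algebra_simps of_nat_diff)
        ultimately show ?thesis by simp
      qed (use r in simp)
      have "ennreal \<bar>average lborel (cube r x) f - a i\<bar> \<le> b i"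
        unfolding a_def b_def osc_bound_def using i(1) up r by (intro two) (auto simp: infnorm_0)
      also have "\<dots> < ennreal (e / 2)" using I i by blast
      finally have "\<bar>average lborel (cube r x) f - a i\<bar> < e / 2" using e by (simp add: ennreal_less_iff)
      moreover have "dist (a i) l < e / 2" using I i by blast
      ultimately show ?thesis unfolding dist_real_def by linarith
    qed
    then show "\<forall>\<^sub>F r in at_right 0. dist (average lborel (cube r x) f) l < e"
      unfolding eventually_at_right_field by (intro exI[of _ "dy (int I - 6) / 16"]) auto
  qed
  ultimately show ?thesis by (rule that[rotated])
qed

lemma precise_rep_eq:
  assumes "((\<lambda>r. average lborel (cube r x) f) \<longlongrightarrow> l) (at_right 0)"
  shows "precise_rep f x = ereal l"
  unfolding precise_rep_def using assms by (intro lim_imp_Limsup) auto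

lemma measurable_osc_tail [measurable (raw)]:
  assumes [measurable]: "\<And>j. g j \<in> borel_measurable borel"
  shows "osc_tail s g k \<in> borel_measurable borel"
  unfolding osc_tail_def osc_bound_def by measurable

text \<open>Takes the infimum over gradients beside the fixed term \<open>a\<close>. It is done by
  subtracting \<open>a\<close>, hence the separate case of infinite \<open>a\<close>.\<close>

lemma ennreal_le_INF_affine:
  fixes X a :: ennreal and c :: real
  assumes "0 < c" and le: "\<And>g. g \<in> G \<Longrightarrow> X \<le> ennreal c * (a + N g)"
  shows "X \<le> ennreal c * (a + (INF g\<in>G. N g))"
proof (cases "a = top")
  case True
  then show ?thesis using assms by (simp add: ennreal_mult_top)
next
  case False
  have "X / ennreal c \<le> a + N g" if "g \<in> G" for g
    using le[OF that] \<open>0 < c\<close> by (intro divide_le_posI_ennreal) auto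
  then have "X / ennreal c - a \<le> (INF g\<in>G. N g)"
    using False by (intro INF_greatest) (simp add: ennreal_minus_le_iff)
  then have "X / ennreal c \<le> a + (INF g\<in>G. N g)" using False by (simp add: ennreal_minus_le_iff)
  then have "ennreal c * (X / ennreal c) \<le> ennreal c * (a + (INF g\<in>G. N g))" by (rule mult_left_mono) simp
  moreover have "ennreal c * (X / ennreal c) = X"
    using \<open>0 < c\<close> by (simp add: ennreal_times_divide ennreal_mult_divide_eq mult.commute[of _ X])
  ultimately show ?thesis by simp
qed

context trace_setting
begin

text \<open>An oscillation at scale j gains r_j^s and its transfer to E costs r_j^(-\<tau>), which
  leaves r_j^(s-\<tau>). Half of the decay relative to scale k sums the functions in L_p; the other
  half stays in the bound as a weight for the later sum in l_q.\<close>

lemma osc_tail_norm_le: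
  obtains C :: real where "0 < C"
    "\<And>g k. (\<And>j. g j \<in> borel_measurable borel) \<Longrightarrow>
      Lp_norm (m k) p (osc_tail s g k) \<le> ennreal (C * dy (int k) powr (s - \<tau>)) *
        (\<Sum>i. ennreal (2 powr (- ((s - \<tau>) / 2) * real i)) * Lp_norm lborel p (g (int k - 6 + int i)))"
proof -
  define \<delta> where "\<delta> = (s - \<tau>) / 2"
  have \<delta>: "0 < \<delta>" "s - \<tau> = 2 * \<delta>" using s by (auto simp: \<delta>_def)
  obtain CA where CA: "0 < CA"
    "\<And>k j h. int k - 6 \<le> j \<Longrightarrow> h \<in> borel_measurable borel \<Longrightarrow>
       Lp_norm (m k) p (avg j h) \<le> ennreal (CA * dy j powr (- \<tau>)) * Lp_norm lborel p h"
    using avg_norm_le by blast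
  obtain CG where CG: "0 < CG"
    "\<And>(M :: (real^'n) measure) f B. (\<And>i. f i \<in> borel_measurable M) \<Longrightarrow> (\<And>i. Lp_norm M p (f i) \<le> B) \<Longrightarrow>
       Lp_norm M p (\<lambda>x. \<Sum>i. ennreal (2 powr (- \<delta> * real i)) * f i x) \<le> ennreal CG * B"
    using Lp_norm_geometric[OF \<delta>(1) p_pos] by blast
  define D where "D = 4 * 32 ^ CARD('n) * CA * dy (- 6) powr (s - \<tau>)"
  have D: "0 < D" using CA by (simp add: D_def)
  show ?thesis
  proof (rule that[of "CG * D"])
    fix g :: "int \<Rightarrow> real^'n \<Rightarrow> ennreal" and k
    assume [measurable]: "\<And>j. g j \<in> borel_measurable borel"
    let ?N = "\<lambda>i. Lp_norm lborel p (g (int k - 6 + int i))"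
    define S where "S = (\<Sum>i. ennreal (2 powr (- \<delta> * real i)) * ?N i)"
    \<comment> \<open>The weight 2^(\<delta> i) borrowed here is given back when
      \<open>osc_tail\<close> is written as the sum of 2^(-\<delta> i) \<open>F i\<close>.\<close>
    define F where "F i x = ennreal (2 powr (\<delta> * real i)) * osc_bound s g (int k - 6 + int i) x" for i x
    have [measurable]: "F i \<in> borel_measurable borel" for i
      unfolding F_def osc_bound_def by measurable
    have N: "Lp_norm (m k) p (F i) \<le> ennreal (D * dy (int k) powr (s - \<tau>)) * S" for i
    proof -
      let ?j = "int k - 6 + int i"
      let ?c = "2 powr (\<delta> * real i) * (4 * 32 ^ CARD('n) * dy ?j powr s)"
      have "F i = (\<lambda>x. ennreal ?c * avg ?j (g ?j) x)"
        by (simp add: F_def osc_bound_def fun_eq_iff ennreal_mult mult.assoc)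
      then have "Lp_norm (m k) p (F i) \<le> ennreal ?c * Lp_norm (m k) p (avg ?j (g ?j))"
        using p_pos by (simp only:) (intro Lp_norm_cmult_le, auto)
      also have "\<dots> \<le> ennreal ?c * (ennreal (CA * dy ?j powr (- \<tau>)) * ?N i)"
        by (intro mult_left_mono CA) auto
      also have "\<dots> = ennreal (?c * (CA * dy ?j powr (- \<tau>))) * ?N i"
        using CA by (simp add: ennreal_mult mult.assoc)
      also have "?c * (CA * dy ?j powr (- \<tau>)) = D * dy (int k) powr (s - \<tau>) * 2 powr (- \<delta> * real i)"
      proof -
        have "dy ?j powr s * dy ?j powr (- \<tau>) = dy ?j powr (s - \<tau>)" by (simp flip: powr_add)
        also have "\<dots> = dy (- 6) powr (s - \<tau>) * dy (int k) powr (s - \<tau>) * dy (int i) powr (s - \<tau>)"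
          using dy_add[of "int k - 6" "int i"] dy_add[of "int k" "-6"] by (simp add: powr_mult mult_ac)
        also have "dy (int i) powr (s - \<tau>) = 2 powr (- \<delta> * real i) * 2 powr (- \<delta> * real i)"
          by (simp add: dy_nat powr_powr \<delta>(2) algebra_simps flip: powr_add)
        finally have e: "dy ?j powr s * dy ?j powr (- \<tau>) = dy (- 6) powr (s - \<tau>) * dy (int k) powr (s - \<tau>)
          * (2 powr (- \<delta> * real i) * 2 powr (- \<delta> * real i))" .
        have "?c * (CA * dy ?j powr (- \<tau>)) = 4 * 32 ^ CARD('n) * CA * 2 powr (\<delta> * real i) * (dy ?j powr s * dy ?j powr (- \<tau>))"
          by (simp add: mult_ac)
        also have "\<dots> = D * dy (int k) powr (s - \<tau>) * 2 powr (- \<delta> * real i) * (2 powr (\<delta> * real i) * 2 powr (- \<delta> * real i))"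
          unfolding e D_def by (simp add: mult_ac)
        also have "2 powr (\<delta> * real i) * 2 powr (- \<delta> * real i) = 1" by (simp flip: powr_add)
        finally show ?thesis by simp
      qed
      also have "ennreal (D * dy (int k) powr (s - \<tau>) * 2 powr (- \<delta> * real i)) * ?N i
         = ennreal (D * dy (int k) powr (s - \<tau>)) * (ennreal (2 powr (- \<delta> * real i)) * ?N i)"
        using D by (simp add: ennreal_mult mult.assoc)
      also have "\<dots> \<le> ennreal (D * dy (int k) powr (s - \<tau>)) * S"
        using sum_le_suminf[of "\<lambda>i. ennreal (2 powr (- \<delta> * real i)) * ?N i" "{i}"]
        by (intro mult_left_mono) (auto simp: S_def)
      finally show ?thesis .
    qed
    have "osc_tail s g k = (\<lambda>x. \<Sum>i. ennreal (2 powr (- \<delta> * real i)) * F i x)"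
      by (simp add: osc_tail_def F_def fun_eq_iff mult.assoc[symmetric] ennreal_mult[symmetric] powr_add[symmetric])
    then have "Lp_norm (m k) p (osc_tail s g k) \<le> ennreal CG * (ennreal (D * dy (int k) powr (s - \<tau>)) * S)"
      by (simp only:) (intro CG N, auto)
    also have "\<dots> = ennreal (CG * D * dy (int k) powr (s - \<tau>)) * S"
      using CG D by (simp add: ennreal_mult mult.assoc)
    finally show "Lp_norm (m k) p (osc_tail s g k) \<le> ennreal (CG * D * dy (int k) powr (s - \<tau>)) *
        (\<Sum>i. ennreal (2 powr (- ((s - \<tau>) / 2) * real i)) * ?N i)"
      by (simp only: S_def \<delta>_def)
  qed (use CG D in auto)
qed

lemma besov_locally_integrable:
  assumes "f \<in> besov s p q" "compact K"
  shows "(\<integral>\<^sup>+x\<in>K. ennreal \<bar>f x\<bar> \<partial>lborel) < top"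
proof (rule Lp_locally_integrable[OF locally_finite_borel_lborel p _ _ assms(2)])
  show "Lp_norm lborel p (\<lambda>x. ennreal \<bar>f x\<bar>) < top"
    using assms by (auto simp: besov_def besov_norm_def)
  have "f \<in> borel_measurable borel" using assms by (simp add: besov_def)
  then show "(\<lambda>x. ennreal \<bar>f x\<bar>) \<in> borel_measurable borel" by measurable
qed

text \<open>Each single norm is at most the l_q norm of the sequence, and the geometric weights sum;
  finiteness of the L_p(m_0) norm then gives finiteness almost everywhere.\<close>

lemma osc_tail_finite_AE:
  assumes q: "0 < q" and g: "\<And>j. g j \<in> borel_measurable borel"
    and fin: "lq_norm q (\<lambda>k. Lp_norm lborel p (g k)) < top"
  shows "AE x in m 0. osc_tail s g 0 x < top"
proof (rule Lp_norm_finite_AE[OF p_pos])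
  let ?Q = "lq_norm q (\<lambda>k. Lp_norm lborel p (g k))"
  obtain C where C: "0 < C"
    "\<And>g k. (\<And>j. g j \<in> borel_measurable borel) \<Longrightarrow>
      Lp_norm (m k) p (osc_tail s g k) \<le> ennreal (C * dy (int k) powr (s - \<tau>)) *
        (\<Sum>i. ennreal (2 powr (- ((s - \<tau>) / 2) * real i)) * Lp_norm lborel p (g (int k - 6 + int i)))"
    using osc_tail_norm_le by blast
  obtain K where K: "0 < K" "(\<Sum>i. ennreal (2 powr (- ((s - \<tau>) / 2) * real i))) = ennreal K"
    by (rule suminf_powr_geometric[of "(s - \<tau>) / 2"]) (use s in auto)
  have "Lp_norm (m 0) p (osc_tail s g 0) \<le> ennreal (C * dy (int 0) powr (s - \<tau>)) *
     (\<Sum>i. ennreal (2 powr (- ((s - \<tau>) / 2) * real i)) * Lp_norm lborel p (g (int 0 - 6 + int i)))"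
    by (rule C(2)[OF g])
  also have "\<dots> \<le> ennreal (C * dy (int 0) powr (s - \<tau>)) * (\<Sum>i. ennreal (2 powr (- ((s - \<tau>) / 2) * real i)) * ?Q)"
    by (intro mult_left_mono suminf_le le_lq_norm[OF q, of "\<lambda>k. Lp_norm lborel p (g k)"]) auto
  also have "\<dots> = ennreal (C * dy (int 0) powr (s - \<tau>)) * (ennreal K * ?Q)"
    by (simp only: ennreal_suminf_multc K(2))
  also have "\<dots> < top" using fin by (simp add: ennreal_mult_less_top)
  finally show "Lp_norm (m 0) p (osc_tail s g 0) < top" .
  show "osc_tail s g 0 \<in> borel_measurable (m 0)" using g by measurable
qed

lemma besov_gradient:
  assumes "f \<in> besov s p q"
  obtains g where "g \<in> frac_gradients s f" "lq_norm q (\<lambda>k. Lp_norm lborel p (\<lambda>x. ennreal (g k x))) < top"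
proof -
  have "(INF g\<in>frac_gradients s f. lq_norm q (\<lambda>k. Lp_norm lborel p (\<lambda>x. ennreal (g k x)))) < top"
    using assms by (auto simp: besov_def besov_norm_def)
  then show ?thesis using that by (auto simp: INF_less_iff)
qed

lemma trace_limit_AE:
  assumes q: "0 < q" and f: "f \<in> besov s p q"
  shows "AE x in m 0. \<exists>l. ((\<lambda>r. average lborel (cube r x) f) \<longlongrightarrow> l) (at_right 0)"
proof -
  obtain g where g: "g \<in> frac_gradients s f" "lq_norm q (\<lambda>k. Lp_norm lborel p (\<lambda>x. ennreal (g k x))) < top"
    using besov_gradient[OF f] by blast
  have gm[measurable]: "\<And>j. g j \<in> borel_measurable borel" using g(1) by (auto simp: frac_gradients_def)
  have "AE x in m 0. osc_tail s (\<lambda>j y. ennreal (g j y)) 0 x < top"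
    by (rule osc_tail_finite_AE[OF q _ g(2)]) measurable
  then show ?thesis
  proof eventually_elim
    case (elim x)
    have fm: "f \<in> borel_measurable borel" using f by (simp add: besov_def)
    obtain l where "((\<lambda>r. average lborel (cube r x) f) \<longlongrightarrow> l) (at_right 0)"
      by (rule trace_limit[OF fm besov_locally_integrable[OF f] g(1) s_pos elim])
    then show ?case by blast
  qed
qed

text \<open>Averages of f over cubes about y are the approximating constants, and their distance to
  \<phi> is bounded by \<open>osc_tail\<close>. Its factor r_k^(s-\<tau>), times the r_k^\<tau> of
  the passage to R^n, cancels the weight 2^(ks). The L_p bound stands apart and asks only for a
  Borel \<phi>, because it is what later shows that a trace is locally integrable at all.\<close>

lemma intrinsic_norm_le_besov_norm:
  assumes q: "0 < q" and \<sigma>: "0 < \<sigma>" "ennreal \<sigma> \<le> p"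
  obtains C :: real where "0 < C"
    "\<And>f \<phi>. f \<in> besov s p q \<Longrightarrow> \<phi> \<in> borel_measurable borel \<Longrightarrow> has_trace (m 0) f \<phi> \<Longrightarrow>
       Lp_norm (m 0) p (\<lambda>x. ennreal \<bar>\<phi> x\<bar>) \<le> ennreal C * besov_norm s p q f"
    "\<And>f \<phi>. f \<in> besov s p q \<Longrightarrow> \<phi> \<in> L_loc \<sigma> m \<Longrightarrow> has_trace (m 0) f \<phi> \<Longrightarrow>
       intrinsic_norm s p q \<sigma> m \<phi> \<le> ennreal C * besov_norm s p q f"
proof -
  define \<delta> where "\<delta> = (s - \<tau>) / 2"
  have \<delta>: "0 < \<delta>" using s by (auto simp: \<delta>_def)
  obtain CT where CT: "0 < CT"
    "\<And>g k. (\<And>j. g j \<in> borel_measurable borel) \<Longrightarrow>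
      Lp_norm (m k) p (osc_tail s g k) \<le> ennreal (CT * dy (int k) powr (s - \<tau>)) *
        (\<Sum>i. ennreal (2 powr (- \<delta> * real i)) * Lp_norm lborel p (g (int k - 6 + int i)))"
    using osc_tail_norm_le unfolding \<delta>_def by blast
  obtain CA where CA: "0 < CA"
    "\<And>k j h. int k - 6 \<le> j \<Longrightarrow> h \<in> borel_measurable borel \<Longrightarrow>
       Lp_norm (m k) p (avg j h) \<le> ennreal (CA * dy j powr (- \<tau>)) * Lp_norm lborel p h"
    using avg_norm_le by blast
  obtain CP where CP: "0 < CP"
    "\<And>(M :: (real^'n) measure) f g. f \<in> borel_measurable M \<Longrightarrow> g \<in> borel_measurable M \<Longrightarrow>
       Lp_norm M p (\<lambda>x. f x + g x) \<le> ennreal CP * (Lp_norm M p f + Lp_norm M p g)"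
    using Lp_norm_add_le[OF p_pos] by blast
  obtain CB where CB: "0 < CB"
    "\<And>k \<phi> c h. \<phi> \<in> L_loc \<sigma> m \<Longrightarrow> h \<in> borel_measurable borel \<Longrightarrow>
      (AE x in m k. \<forall>y. infnorm (x - y) \<le> 2 * dy (int k) \<longrightarrow> cube (dy (int k)) y \<inter> E \<noteq> {} \<longrightarrow>
         ennreal \<bar>\<phi> x - c y\<bar> \<le> h x) \<Longrightarrow>
      Lp_norm lborel p (best_approx_mod (m k) \<sigma> \<phi> (dy (int k)))
        \<le> ennreal (CB * dy (int k) powr \<tau>) * Lp_norm (m k) p h"
    using best_approx_norm_le[OF \<sigma>] by blast
  obtain CQ where CQ: "0 < CQ"
    "\<And>(M :: nat measure) f B. (\<And>i. f i \<in> borel_measurable M) \<Longrightarrow> (\<And>i. Lp_norm M q (f i) \<le> B) \<Longrightarrow>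
       Lp_norm M q (\<lambda>x. \<Sum>i. ennreal (2 powr (- \<delta> * real i)) * f i x) \<le> ennreal CQ * B"
    using Lp_norm_geometric[OF \<delta>(1) q] by blast
  obtain K where K: "0 < K" "(\<Sum>i. ennreal (2 powr (- \<delta> * real i))) = ennreal K"
    by (rule suminf_powr_geometric[OF \<delta>])
  define D1 where "D1 = CP * (CA + 2 * CT * K)"
  define D2 where "D2 = 2 * CB * CT * CQ"
  have D: "0 < D1" "0 < D2" using CP CA CT K CB CQ by (auto simp: D1_def D2_def intro!: mult_pos_pos add_pos_pos)
  have main: "Lp_norm (m 0) p (\<lambda>x. ennreal \<bar>\<phi> x\<bar>) \<le> ennreal (D1 + D2) * besov_norm s p q f"
    "\<phi> \<in> L_loc \<sigma> m \<Longrightarrow> intrinsic_norm s p q \<sigma> m \<phi> \<le> ennreal (D1 + D2) * besov_norm s p q f"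
    if f: "f \<in> besov s p q" and \<phi>[measurable]: "\<phi> \<in> borel_measurable borel" and tr: "has_trace (m 0) f \<phi>" for f \<phi>
  proof -
    have fm[measurable]: "f \<in> borel_measurable borel" using f by (simp add: besov_def)
    let ?P = "Lp_norm lborel p (\<lambda>x. ennreal \<bar>f x\<bar>)"
    \<comment> \<open>The gradient is fixed here and the infimum taken at the end; a gradient of
      infinite norm satisfies both bounds trivially.\<close>
    have *: "Lp_norm (m 0) p (\<lambda>x. ennreal \<bar>\<phi> x\<bar>) \<le> ennreal D1 * (?P + lq_norm q (\<lambda>k. Lp_norm lborel p (\<lambda>x. ennreal (g k x))))"
      "\<phi> \<in> L_loc \<sigma> m \<Longrightarrow> intrinsic_norm s p q \<sigma> m \<phi> \<le> ennreal (D1 + D2) * (?P + lq_norm q (\<lambda>k. Lp_norm lborel p (\<lambda>x. ennreal (g k x))))"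
      if g: "g \<in> frac_gradients s f" for g
    proof -
      let ?N = "\<lambda>j. Lp_norm lborel p (\<lambda>x. ennreal (g j x))"
      let ?Q = "lq_norm q ?N"
      have gm[measurable]: "\<And>j. g j \<in> borel_measurable borel" using g by (auto simp: frac_gradients_def)
      show "Lp_norm (m 0) p (\<lambda>x. ennreal \<bar>\<phi> x\<bar>) \<le> ennreal D1 * (?P + ?Q)"
        "\<phi> \<in> L_loc \<sigma> m \<Longrightarrow> intrinsic_norm s p q \<sigma> m \<phi> \<le> ennreal (D1 + D2) * (?P + ?Q)"
      proof -
        define c where "c k y = average lborel (cube (dy (int k)) y) f" for k y
        define S where "S k = (\<Sum>i. ennreal (2 powr (- \<delta> * real i)) * ?N (int k - 6 + int i))" for k :: nat
        \<comment> \<open>One null set serves all k and y; this is what allows the estimate to be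
          read m_k-almost everywhere for each k.\<close>
        have AE0: "AE x in m 0. \<forall>k y. infnorm (x - y) \<le> 2 * dy (int k) \<longrightarrow> ennreal \<bar>\<phi> x - c k y\<bar> \<le> 2 * osc_tail s (\<lambda>j y. ennreal (g j y)) k x"
          if "?Q < top"
        proof -
          have "AE x in m 0. osc_tail s (\<lambda>j y. ennreal (g j y)) 0 x < top"
            by (rule osc_tail_finite_AE[OF q _ that]) measurable
          then show ?thesis using tr[unfolded has_trace_def]
          proof eventually_elim
            case (elim x)
            show ?case
            proof (rule trace_limit[OF fm besov_locally_integrable[OF f] g s_pos elim(1)])
              fix l assume l: "((\<lambda>r. average lborel (cube r x) f) \<longlongrightarrow> l) (at_right 0)"
                "\<And>k y. infnorm (x - y) \<le> 2 * dy (int k) \<Longrightarrow>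
                  ennreal \<bar>l - average lborel (cube (dy (int k)) y) f\<bar> \<le> 2 * osc_tail s (\<lambda>j y. ennreal (g j y)) k x"
              have "\<phi> x = l" using elim(2) precise_rep_eq[OF l(1)] by simp
              with l(2) show ?case by (simp add: c_def)
            qed
          qed
        qed
        have S0: "S 0 \<le> ennreal K * ?Q"
        proof -
          have "S 0 \<le> (\<Sum>i. ennreal (2 powr (- \<delta> * real i)) * ?Q)"
            unfolding S_def by (intro suminf_le mult_left_mono le_lq_norm[OF q, of ?N]) auto
          then show ?thesis by (simp only: ennreal_suminf_multc K(2))
        qed
        have Lp: "Lp_norm (m 0) p (\<lambda>x. ennreal \<bar>\<phi> x\<bar>) \<le> ennreal D1 * (?P + ?Q)" if fin: "?Q < top"
        proof -
          have "AE x in m 0. ennreal \<bar>\<phi> x\<bar> \<le> avg 0 (\<lambda>x. ennreal \<bar>f x\<bar>) x + 2 * osc_tail s (\<lambda>j y. ennreal (g j y)) 0 x"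
            using AE0[OF fin]
          proof eventually_elim
            case (elim x)
            have 1: "ennreal \<bar>\<phi> x - c 0 x\<bar> \<le> 2 * osc_tail s (\<lambda>j y. ennreal (g j y)) 0 x"
              using elim[rule_format, of x 0] by (simp add: infnorm_0)
            have "emeasure lborel (cube 1 x) = ennreal (2 ^ CARD('n))" by (simp add: emeasure_lborel_cube)
            then have "ennreal \<bar>c 0 x\<bar> * ennreal (2 ^ CARD('n)) \<le> avg 0 (\<lambda>x. ennreal \<bar>f x\<bar>) x"
              using average_dist_le[of f lborel "cube 1 x" 0] besov_locally_integrable[OF f compact_cube, of 1 x]
              by (simp add: c_def avg_def)
            moreover have "ennreal \<bar>c 0 x\<bar> * ennreal 1 \<le> ennreal \<bar>c 0 x\<bar> * ennreal (2 ^ CARD('n))"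
              by (intro mult_left_mono ennreal_leI) auto
            ultimately have 2: "ennreal \<bar>c 0 x\<bar> \<le> avg 0 (\<lambda>x. ennreal \<bar>f x\<bar>) x" by simp
            have "ennreal \<bar>\<phi> x\<bar> \<le> ennreal \<bar>c 0 x\<bar> + ennreal \<bar>\<phi> x - c 0 x\<bar>"
              using ennreal_dist_triangle[of "\<phi> x" 0 "c 0 x"] by (simp add: add.commute)
            then show ?case using 1 2 by (meson add_mono order_trans)
          qed
          then have "Lp_norm (m 0) p (\<lambda>x. ennreal \<bar>\<phi> x\<bar>) \<le> Lp_norm (m 0) p (\<lambda>x. avg 0 (\<lambda>x. ennreal \<bar>f x\<bar>) x + 2 * osc_tail s (\<lambda>j y. ennreal (g j y)) 0 x)"
            by (intro Lp_norm_mono_AE p_pos) auto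
          also have "\<dots> \<le> ennreal CP * (Lp_norm (m 0) p (avg 0 (\<lambda>x. ennreal \<bar>f x\<bar>)) + Lp_norm (m 0) p (\<lambda>x. 2 * osc_tail s (\<lambda>j y. ennreal (g j y)) 0 x))"
            by (intro CP) auto
          also have "\<dots> \<le> ennreal CP * (ennreal CA * ?P + 2 * (ennreal CT * (ennreal K * ?Q)))"
          proof (intro mult_left_mono add_mono)
            show "Lp_norm (m 0) p (avg 0 (\<lambda>x. ennreal \<bar>f x\<bar>)) \<le> ennreal CA * ?P"
              using CA(2)[of 0 0 "\<lambda>x. ennreal \<bar>f x\<bar>"] by simp
            have "Lp_norm (m 0) p (\<lambda>x. 2 * osc_tail s (\<lambda>j y. ennreal (g j y)) 0 x) \<le> 2 * Lp_norm (m 0) p (osc_tail s (\<lambda>j y. ennreal (g j y)) 0)"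
              by (intro Lp_norm_cmult_le p_pos) auto
            also have "\<dots> \<le> 2 * (ennreal CT * S 0)"
              using CT(2)[of "\<lambda>j y. ennreal (g j y)" 0] by (intro mult_left_mono) (auto simp: S_def)
            also have "\<dots> \<le> 2 * (ennreal CT * (ennreal K * ?Q))"
              by (intro mult_left_mono S0) auto
            finally show "Lp_norm (m 0) p (\<lambda>x. 2 * osc_tail s (\<lambda>j y. ennreal (g j y)) 0 x) \<le> 2 * (ennreal CT * (ennreal K * ?Q))" .
          qed auto
          also have "\<dots> \<le> ennreal D1 * (?P + ?Q)"
          proof -
            have "ennreal CA * ?P + 2 * (ennreal CT * (ennreal K * ?Q)) = ennreal CA * ?P + ennreal (2 * CT * K) * ?Q"
              using CT K by (simp add: ennreal_mult mult.assoc)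
            also have "\<dots> \<le> ennreal (CA + 2 * CT * K) * ?P + ennreal (CA + 2 * CT * K) * ?Q"
              using CA CT K by (intro add_mono mult_right_mono ennreal_leI) auto
            also have "\<dots> = ennreal (CA + 2 * CT * K) * (?P + ?Q)" by (simp only: distrib_left)
            finally have "ennreal CP * (ennreal CA * ?P + 2 * (ennreal CT * (ennreal K * ?Q)))
              \<le> ennreal CP * (ennreal (CA + 2 * CT * K) * (?P + ?Q))" by (rule mult_left_mono) simp
            also have "\<dots> = ennreal D1 * (?P + ?Q)"
              unfolding D1_def mult.assoc[symmetric] using CP CA CT K by (subst ennreal_mult) auto
            finally show ?thesis .
          qed
          finally show ?thesis .
        qed
        then show "Lp_norm (m 0) p (\<lambda>x. ennreal \<bar>\<phi> x\<bar>) \<le> ennreal D1 * (?P + ?Q)"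
          using D by (cases "?Q < top") (auto simp: ennreal_mult_top less_top[symmetric])
        show "intrinsic_norm s p q \<sigma> m \<phi> \<le> ennreal (D1 + D2) * (?P + ?Q)" if \<phi>L: "\<phi> \<in> L_loc \<sigma> m"
        proof (cases "?Q < top")
          case False
          then show ?thesis using D by (auto simp: ennreal_mult_top less_top[symmetric])
        next
          case True
          have tm: "ennreal (2 powr (real k * s)) * Lp_norm lborel p (best_approx_mod (m k) \<sigma> \<phi> (2 powr (- real k)))
            \<le> ennreal (2 * CB * CT) * S k" for k
          proof -
            have "Lp_norm lborel p (best_approx_mod (m k) \<sigma> \<phi> (dy (int k)))
              \<le> ennreal (CB * dy (int k) powr \<tau>) * Lp_norm (m k) p (\<lambda>x. 2 * osc_tail s (\<lambda>j y. ennreal (g j y)) k x)"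
            proof (rule CB(2)[OF \<phi>L])
              show "AE x in m k. \<forall>y. infnorm (x - y) \<le> 2 * dy (int k) \<longrightarrow> cube (dy (int k)) y \<inter> E \<noteq> {} \<longrightarrow>
                 ennreal \<bar>\<phi> x - c k y\<bar> \<le> 2 * osc_tail s (\<lambda>j y. ennreal (g j y)) k x"
                using AE_m[OF AE0[OF True], of k] by eventually_elim blast
            qed measurable
            also have "\<dots> \<le> ennreal (CB * dy (int k) powr \<tau>) * (2 * (ennreal (CT * dy (int k) powr (s - \<tau>)) * S k))"
            proof (intro mult_left_mono)
              have "Lp_norm (m k) p (\<lambda>x. 2 * osc_tail s (\<lambda>j y. ennreal (g j y)) k x) \<le> 2 * Lp_norm (m k) p (osc_tail s (\<lambda>j y. ennreal (g j y)) k)"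
                by (intro Lp_norm_cmult_le p_pos) auto
              also have "\<dots> \<le> 2 * (ennreal (CT * dy (int k) powr (s - \<tau>)) * S k)"
                using CT(2)[of "\<lambda>j y. ennreal (g j y)" k] by (intro mult_left_mono) (auto simp: S_def)
              finally show "Lp_norm (m k) p (\<lambda>x. 2 * osc_tail s (\<lambda>j y. ennreal (g j y)) k x) \<le> 2 * (ennreal (CT * dy (int k) powr (s - \<tau>)) * S k)" .
            qed auto
            also have "\<dots> = ennreal (2 * CB * CT * dy (int k) powr s) * S k"
            proof -
              have "ennreal (CB * dy (int k) powr \<tau>) * (2 * (ennreal (CT * dy (int k) powr (s - \<tau>)) * S k))
                = ennreal ((CB * dy (int k) powr \<tau>) * 2 * (CT * dy (int k) powr (s - \<tau>))) * S k"
                using CB CT by (simp add: ennreal_mult mult.assoc)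
              also have "(CB * dy (int k) powr \<tau>) * 2 * (CT * dy (int k) powr (s - \<tau>))
                = 2 * CB * CT * (dy (int k) powr \<tau> * dy (int k) powr (s - \<tau>))" by (simp add: mult_ac)
              also have "dy (int k) powr \<tau> * dy (int k) powr (s - \<tau>) = dy (int k) powr s" by (simp flip: powr_add)
              finally show ?thesis .
            qed
            finally have "ennreal (2 powr (real k * s)) * Lp_norm lborel p (best_approx_mod (m k) \<sigma> \<phi> (dy (int k)))
              \<le> ennreal (2 powr (real k * s)) * (ennreal (2 * CB * CT * dy (int k) powr s) * S k)" by (rule mult_left_mono) simp
            also have "\<dots> = ennreal (2 powr (real k * s) * (2 * CB * CT * dy (int k) powr s)) * S k"
              using CB CT by (simp add: ennreal_mult mult.assoc)
            also have "2 powr (real k * s) * (2 * CB * CT * dy (int k) powr s) = 2 * CB * CT * (2 powr (real k * s) * dy (int k) powr s)"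
              by (simp add: mult_ac)
            also have "2 powr (real k * s) * dy (int k) powr s = 1"
              unfolding dy_nat powr_powr by (simp flip: powr_add)
            finally have "ennreal (2 powr (real k * s)) * Lp_norm lborel p (best_approx_mod (m k) \<sigma> \<phi> (dy (int k)))
              \<le> ennreal (2 * CB * CT) * S k" by simp
            then show ?thesis by (simp add: dy_nat)
          qed
          have "lq_norm q (\<lambda>k::nat. ennreal (2 powr (real k * s)) * Lp_norm lborel p (best_approx_mod (m k) \<sigma> \<phi> (2 powr (- real k))))
            \<le> lq_norm q (\<lambda>k. ennreal (2 * CB * CT) * S k)"
            using tm by (intro Lp_norm_mono_AE[OF q]) (auto simp: AE_count_space)
          also have "\<dots> \<le> ennreal (2 * CB * CT) * lq_norm q S"
            by (intro Lp_norm_cmult_le[OF q]) auto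
          also have "\<dots> \<le> ennreal (2 * CB * CT) * (ennreal CQ * ?Q)"
          proof (intro mult_left_mono)
            \<comment> \<open>Hardy's inequality: for each i the sequence of the N(k - 6 + i) is a
              shifted restriction of N, so its norm is at most that of N.\<close>
            show "lq_norm q S \<le> ennreal CQ * ?Q"
              unfolding S_def by (intro CQ(2) lq_norm_inj_le[OF q]) (auto intro!: injI)
          qed auto
          also have "\<dots> = ennreal D2 * ?Q" using CB CT CQ by (simp add: D2_def ennreal_mult mult.assoc)
          finally have "intrinsic_norm s p q \<sigma> m \<phi> \<le> ennreal D1 * (?P + ?Q) + ennreal D2 * ?Q"
            unfolding intrinsic_norm_def by (intro add_mono Lp True)
          also have "\<dots> \<le> ennreal D1 * (?P + ?Q) + ennreal D2 * (?P + ?Q)"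
            by (intro add_left_mono mult_left_mono) auto
          also have "\<dots> = ennreal (D1 + D2) * (?P + ?Q)" using D by (simp add: distrib_right)
          finally show ?thesis .
        qed
      qed
    qed
    have "Lp_norm (m 0) p (\<lambda>x. ennreal \<bar>\<phi> x\<bar>) \<le> ennreal D1 * besov_norm s p q f"
      unfolding besov_norm_def using D(1) *(1) by (rule ennreal_le_INF_affine)
    also have "\<dots> \<le> ennreal (D1 + D2) * besov_norm s p q f"
      using D by (intro mult_right_mono ennreal_leI) auto
    finally show "Lp_norm (m 0) p (\<lambda>x. ennreal \<bar>\<phi> x\<bar>) \<le> ennreal (D1 + D2) * besov_norm s p q f" .
    show "intrinsic_norm s p q \<sigma> m \<phi> \<le> ennreal (D1 + D2) * besov_norm s p q f" if \<phi>L: "\<phi> \<in> L_loc \<sigma> m"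
      unfolding besov_norm_def using D *(2)[OF _ \<phi>L] by (intro ennreal_le_INF_affine) auto
  qed
  show ?thesis
    by (rule that[of "D1 + D2"]) (use D main in \<open>auto simp: L_loc_def\<close>)
qed

end


subsection \<open>Best approximations along the measures\<close>

lemma ennreal_mult_le_cancel:
  fixes a b c :: ennreal
  assumes "a * c \<le> b * c" "0 < c" "c < top"
  shows "a \<le> b"
  using assms by (metis ennreal_mult_divide_eq divide_right_mono_ennreal less_irrefl less_top)

context trace_setting
begin

text \<open>The radius 7/4 answers two demands. It is at most 2 - 1/4, so that every cube of radius
  \<open>2 * dy k\<close> with centre within \<open>dy k / 4\<close> of x contains this one; and it
  is at least 3/2 + 1/16, so that this one contains the support of a bump centred within
  \<open>dy k / 16\<close> of x.\<close>

definition ecube :: "nat \<Rightarrow> real^'n \<Rightarrow> (real^'n) set"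
  where "ecube k x = cube (7 / 4 * dy (int k)) x"

definition bst :: "real \<Rightarrow> (real^'n \<Rightarrow> real) \<Rightarrow> nat \<Rightarrow> real^'n \<Rightarrow> ennreal"
  where "bst \<sigma> \<phi> k x = best_approx (m k) \<sigma> \<phi> (ecube k x)"

text \<open>A choice made for each x separately. Allowing twice the best approximation ensures that
  such a constant exists at every point of E.\<close>

definition near :: "real \<Rightarrow> (real^'n \<Rightarrow> real) \<Rightarrow> nat \<Rightarrow> real^'n \<Rightarrow> real"
  where "near \<sigma> \<phi> k x = (SOME c. (\<integral>\<^sup>+y\<in>ecube k x. ennreal (\<bar>\<phi> y - c\<bar> powr \<sigma>) \<partial>m k)
    \<le> enn_powr (2 * bst \<sigma> \<phi> k x) \<sigma> * emeasure (m k) (ecube k x))"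

lemma sets_ecube [measurable]: "ecube k x \<in> sets borel"
  by (simp add: ecube_def)

lemma ecube_mass:
  assumes "x \<in> E"
  shows "ennreal (C2 * dy (int k) powr d) \<le> emeasure (m k) (ecube k x)" "0 < emeasure (m k) (ecube k x)"
    "emeasure (m k) (ecube k x) < top"
proof -
  have "ennreal (C2 * dy (int k) powr d) \<le> emeasure (m k) (cube (dy (int k)) x)"
    using assms dy_mono[of 0 "int k"] by (intro M2) (auto simp: dy_nat)
  also have "\<dots> \<le> emeasure (m k) (ecube k x)"
    unfolding ecube_def by (intro emeasure_mono cube_mono_radius) auto
  finally show "ennreal (C2 * dy (int k) powr d) \<le> emeasure (m k) (ecube k x)" .
  moreover have "0 < ennreal (C2 * dy (int k) powr d)" using C by simp
  ultimately show "0 < emeasure (m k) (ecube k x)" by (rule less_le_trans[rotated])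
  show "emeasure (m k) (ecube k x) < top"
    unfolding ecube_def by (rule emeasure_cube_finite[OF lf])
qed

lemma near_spec:
  assumes "x \<in> E" "0 < \<sigma>" and [measurable]: "\<phi> \<in> borel_measurable borel"
  shows "(\<integral>\<^sup>+y\<in>ecube k x. ennreal (\<bar>\<phi> y - near \<sigma> \<phi> k x\<bar> powr \<sigma>) \<partial>m k)
    \<le> enn_powr (2 * bst \<sigma> \<phi> k x) \<sigma> * emeasure (m k) (ecube k x)"
  unfolding near_def
proof (rule someI_ex)
  show "\<exists>c. (\<integral>\<^sup>+y\<in>ecube k x. ennreal (\<bar>\<phi> y - c\<bar> powr \<sigma>) \<partial>m k)
    \<le> enn_powr (2 * bst \<sigma> \<phi> k x) \<sigma> * emeasure (m k) (ecube k x)"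
    unfolding bst_def using assms by (intro best_approx_attained ecube_mass) auto
qed

text \<open>Both constants approximate \<phi> on the smaller cube: the inner one by its choice, the
  outer one because the two measures are compared by \<open>M3_shift\<close> and the masses of the
  two cubes are comparable. Two steps of scale are allowed since cubes at scale k whose centres are
  \<open>3 * dy k\<close> apart become nested when the outer one is enlarged by 4, but not by
  2.\<close>

lemma near_dist_le:
  assumes \<sigma>: "0 < \<sigma>"
  obtains K :: real where "0 < K"
    "\<And>\<phi> k i x x'. \<phi> \<in> borel_measurable borel \<Longrightarrow> i \<le> 2 \<Longrightarrow> x \<in> E \<Longrightarrow> x' \<in> E \<Longrightarrow> ecube (k + i) x' \<subseteq> ecube k x \<Longrightarrow>
       ennreal \<bar>near \<sigma> \<phi> (k + i) x' - near \<sigma> \<phi> k x\<bar> \<le> ennreal K * bst \<sigma> \<phi> k x"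
proof -
  obtain C4 where C4: "0 < C4"
    "\<And>k j x. int k - 6 \<le> j \<Longrightarrow> emeasure (m k) (cube (dy j) x) \<le> ennreal (C4 * dy j powr d)"
    using mass_le by blast
  \<comment> \<open>The outer cube has radius below \<open>2 * dy k\<close>, and \<open>dy k\<close>
    is at most \<open>4 * dy (k + i)\<close> as i \<le> 2; this gives the factor 8.\<close>
  define R where "R = C4 * 8 powr d / C2"
  define T where "T = (max 1 C3)\<^sup>2"
  define Y where "Y = (T * R) powr (1 / \<sigma>)"
  define K where "K = (2 powr \<sigma> * 2) powr (1 / \<sigma>) * (2 * Y * 2)"
  have pos: "0 < R" "1 \<le> T" using C4 C by (auto simp: R_def T_def one_le_power)
  then have "0 < Y" by (simp add: Y_def)
  then have "0 < K" by (simp add: K_def)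
  then show ?thesis
  proof (rule that)
    fix \<phi> :: "real^'n \<Rightarrow> real" and k i x x'
    assume \<phi>[measurable]: "\<phi> \<in> borel_measurable borel" and i: "i \<le> (2::nat)" and x: "x \<in> E" "x' \<in> E"
      and sub: "ecube (k + i) x' \<subseteq> ecube k x"
    let ?G = "ecube (k + i) x'" and ?M = "emeasure (m (k + i)) (ecube (k + i) x')"
    let ?c' = "near \<sigma> \<phi> (k + i) x'" and ?c = "near \<sigma> \<phi> k x" and ?X = "2 * bst \<sigma> \<phi> k x"
    let ?I = "\<lambda>c. \<integral>\<^sup>+y\<in>?G. ennreal (\<bar>\<phi> y - c\<bar> powr \<sigma>) \<partial>m (k + i)"
    have M: "0 < ?M" "?M < top" using ecube_mass[OF x(2)] by auto
    have mass: "emeasure (m k) (ecube k x) \<le> ennreal R * ?M"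
    proof -
      have "emeasure (m k) (ecube k x) \<le> emeasure (m k) (cube (dy (int k - 1)) x)"
        unfolding ecube_def by (intro emeasure_mono cube_mono_radius) (auto simp: dy_diff)
      also have "\<dots> \<le> ennreal (C4 * dy (int k - 1) powr d)" by (rule C4) simp
      also have "C4 * dy (int k - 1) powr d \<le> R * (C2 * dy (int (k + i)) powr d)"
      proof -
        have "dy 2 \<le> dy (int i)" using i by (intro dy_mono) simp
        then have "2 \<le> 8 * dy (int i)" by (simp add: dy_numeral)
        then have "2 * dy (int k) \<le> 8 * dy (int i) * dy (int k)" by (rule mult_right_mono) simp
        then have "dy (int k - 1) \<le> 8 * dy (int (k + i))"
          using dy_add[of "int k" "int i"] by (simp add: dy_diff mult_ac)
        then have "dy (int k - 1) powr d \<le> (8 * dy (int (k + i))) powr d" using d by (intro powr_mono2) auto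
        then show ?thesis using C4 C by (simp add: R_def powr_mult mult_left_mono)
      qed
      then have "ennreal (C4 * dy (int k - 1) powr d) \<le> ennreal R * ennreal (C2 * dy (int (k + i)) powr d)"
        using pos C by (simp add: ennreal_mult[symmetric] ennreal_leI)
      also have "\<dots> \<le> ennreal R * ?M" by (intro mult_left_mono ecube_mass x) auto
      finally show ?thesis .
    qed
    have "?I ?c \<le> ennreal (C3 ^ i) * (\<integral>\<^sup>+y\<in>?G. ennreal (\<bar>\<phi> y - ?c\<bar> powr \<sigma>) \<partial>m k)"
      by (rule M3_shift) measurable
    also have "\<dots> \<le> ennreal T * (\<integral>\<^sup>+y\<in>ecube k x. ennreal (\<bar>\<phi> y - ?c\<bar> powr \<sigma>) \<partial>m k)"
    proof (intro mult_mono nn_integral_mono ennreal_leI)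
      have "C3 ^ i \<le> (max 1 C3) ^ i" using C by (intro power_mono) auto
      also have "\<dots> \<le> T" unfolding T_def using i by (intro power_increasing) auto
      finally show "C3 ^ i \<le> T" .
    qed (use sub in \<open>auto simp: indicator_def\<close>)
    also have "\<dots> \<le> ennreal T * (enn_powr ?X \<sigma> * emeasure (m k) (ecube k x))"
      by (intro mult_left_mono near_spec x \<sigma> \<phi>) auto
    also have "\<dots> \<le> ennreal T * (enn_powr ?X \<sigma> * (ennreal R * ?M))"
      by (intro mult_left_mono mass) auto
    also have "\<dots> = enn_powr (ennreal Y * ?X) \<sigma> * ?M"
      using pos \<sigma> by (simp add: enn_powr_mult enn_powr_ennreal Y_def powr_powr ennreal_mult mult_ac)
    finally have I1: "?I ?c \<le> enn_powr (ennreal Y * ?X) \<sigma> * ?M" .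
    have "enn_powr (bst \<sigma> \<phi> (k + i) x') \<sigma> * ?M \<le> ?I ?c"
      unfolding bst_def by (rule best_approx_le[OF \<sigma> M])
    also note I1
    finally have "enn_powr (bst \<sigma> \<phi> (k + i) x') \<sigma> \<le> enn_powr (ennreal Y * ?X) \<sigma>"
      by (rule ennreal_mult_le_cancel[OF _ M])
    then have b: "bst \<sigma> \<phi> (k + i) x' \<le> ennreal Y * ?X" using \<sigma> by (simp add: enn_powr_le_iff)
    have I2: "?I ?c' \<le> enn_powr (2 * (ennreal Y * ?X)) \<sigma> * ?M"
      using near_spec[OF x(2) \<sigma> \<phi>, of "k + i"] mult_right_mono[OF enn_powr_mono[OF mult_left_mono[OF b, of 2]], of \<sigma> ?M] \<sigma>
      by (auto intro: order_trans)
    have I1': "?I ?c \<le> enn_powr (2 * (ennreal Y * ?X)) \<sigma> * ?M"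
    proof -
      have "ennreal Y * ?X \<le> 2 * (ennreal Y * ?X)" by (simp add: mult_2)
      then show ?thesis using I1 \<sigma> by (meson enn_powr_mono less_imp_le mult_right_mono order_trans zero_le)
    qed
    have "enn_powr (ennreal \<bar>?c' - ?c\<bar>) \<sigma> * ?M \<le> ennreal (2 powr \<sigma>) * (?I ?c' + ?I ?c)"
      using nn_integral_dist_powr_le[of \<phi> "m (k + i)" ?G \<sigma> ?c' ?c] \<sigma> by (simp add: enn_powr_ennreal)
    also have "\<dots> \<le> ennreal (2 powr \<sigma>) * (enn_powr (2 * (ennreal Y * ?X)) \<sigma> * ?M + enn_powr (2 * (ennreal Y * ?X)) \<sigma> * ?M)"
      by (intro mult_left_mono add_mono I2 I1') auto
    also have "\<dots> = ennreal (2 powr \<sigma> * 2) * enn_powr (2 * (ennreal Y * ?X)) \<sigma> * ?M"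
      by (simp add: ennreal_mult mult_2[symmetric] mult_ac)
    finally have "enn_powr (ennreal \<bar>?c' - ?c\<bar>) \<sigma> \<le> ennreal (2 powr \<sigma> * 2) * enn_powr (2 * (ennreal Y * ?X)) \<sigma>"
      by (rule ennreal_mult_le_cancel[OF _ M])
    also have "\<dots> = enn_powr (ennreal ((2 powr \<sigma> * 2) powr (1 / \<sigma>)) * (2 * (ennreal Y * ?X))) \<sigma>"
      using \<sigma> by (simp add: enn_powr_mult[of "ennreal ((2 powr \<sigma> * 2) powr (1 / \<sigma>))"] enn_powr_ennreal powr_powr)
    finally have "ennreal \<bar>?c' - ?c\<bar> \<le> ennreal ((2 powr \<sigma> * 2) powr (1 / \<sigma>)) * (2 * (ennreal Y * ?X))"
      using \<sigma> by (simp add: enn_powr_le_iff)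
    also have "\<dots> = ennreal K * bst \<sigma> \<phi> k x"
      using \<open>0 < Y\<close> by (simp add: K_def ennreal_mult mult_ac)
    finally show "ennreal \<bar>?c' - ?c\<bar> \<le> ennreal K * bst \<sigma> \<phi> k x" .
  qed
qed

text \<open>For every z within \<open>dy k / 4\<close> of x, the cube of radius
  \<open>2 * dy k\<close> about z contains \<open>ecube k x\<close> and has comparable mass, so the
  value at x is bounded by that of \<open>best_approx_mod\<close> at z. Averaging over z replaces a
  value at a point of E, to which Lebesgue measure may be blind, by an integral over R^n.\<close>

lemma bst_le_avg:
  assumes \<sigma>: "0 < \<sigma>"
  obtains K :: real where "0 < K"
    "\<And>\<phi> k x. \<phi> \<in> L_loc \<sigma> m \<Longrightarrow> x \<in> E \<Longrightarrow>
       bst \<sigma> \<phi> k x \<le> ennreal K * avg (int k + 2) (best_approx_mod (m k) \<sigma> \<phi> (dy (int k))) x"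
proof -
  obtain C4 where C4: "0 < C4"
    "\<And>k j x. int k - 6 \<le> j \<Longrightarrow> emeasure (m k) (cube (dy j) x) \<le> ennreal (C4 * dy j powr d)"
    using mass_le by blast
  define R where "R = C4 * 2 powr d / C2"
  define K where "K = R powr (1 / \<sigma>)"
  have R: "0 < R" using C4 C by (simp add: R_def)
  then have K: "0 < K" by (simp add: K_def)
  show ?thesis
  proof (rule that[OF K])
    fix \<phi> k x
    assume \<phi>: "\<phi> \<in> L_loc \<sigma> m" and x: "x \<in> E"
    have [measurable]: "\<phi> \<in> borel_measurable borel" using \<phi> by (simp add: L_loc_def)
    let ?B = "best_approx_mod (m k) \<sigma> \<phi> (dy (int k))"
    let ?b = "bst \<sigma> \<phi> k x" and ?r = "dy (int k)"
    have pw: "?b \<le> ennreal K * ?B z" if z: "z \<in> cube (dy (int k + 2)) x" for z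
    proof -
      have zx: "infnorm (z - x) \<le> ?r / 4" using z by (simp add: mem_cube dy_add dy_numeral)
      let ?Q = "cube (2 * ?r) z" and ?G = "ecube k x"
      have "infnorm (x - z) + 7 / 4 * ?r \<le> 2 * ?r" using zx by (simp add: infnorm_sub[of x z])
      then have sub: "?G \<subseteq> ?Q" unfolding ecube_def by (rule cube_mono)
      have "infnorm (x - z) \<le> ?r" using zx dy_pos(1)[of "int k"] unfolding infnorm_sub[of x z] by linarith
      then have hit: "x \<in> cube ?r z" by (simp add: mem_cube)
      have mG: "0 < emeasure (m k) ?G" "emeasure (m k) ?G < top" using ecube_mass[OF x] by auto
      have mQ: "0 < emeasure (m k) ?Q" "emeasure (m k) ?Q < top"
        using mG(1) emeasure_mono[OF sub, of "m k"] emeasure_cube_finite[OF lf] by (auto intro: less_le_trans)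
      have mass: "emeasure (m k) ?Q \<le> ennreal R * emeasure (m k) ?G"
      proof -
        have e: "2 * ?r = dy (int k - 1)" by (simp add: dy_diff)
        have "emeasure (m k) ?Q \<le> ennreal (C4 * (2 * ?r) powr d)"
          unfolding e by (rule C4) simp
        also have "\<dots> = ennreal R * ennreal (C2 * ?r powr d)"
          using R C by (simp add: ennreal_mult[symmetric] R_def powr_mult mult_ac)
        also have "\<dots> \<le> ennreal R * emeasure (m k) ?G" by (intro mult_left_mono ecube_mass x) auto
        finally show ?thesis .
      qed
      have "ennreal (1 / K) * ?b \<le> best_approx (m k) \<sigma> \<phi> ?Q"
      proof (rule best_approx_greatest[OF \<sigma> mQ])
        fix c
        have "enn_powr (ennreal (1 / K) * ?b) \<sigma> * emeasure (m k) ?Q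
          \<le> enn_powr (ennreal (1 / K) * ?b) \<sigma> * (ennreal R * emeasure (m k) ?G)"
          by (intro mult_left_mono mass) auto
        also have "\<dots> = (ennreal (1 / R) * ennreal R) * (enn_powr ?b \<sigma> * emeasure (m k) ?G)"
          using R K \<sigma> by (simp add: enn_powr_mult enn_powr_ennreal K_def powr_divide powr_powr mult_ac)
        also have "\<dots> = enn_powr ?b \<sigma> * emeasure (m k) ?G"
          using R by (simp add: ennreal_mult[symmetric])
        also have "\<dots> \<le> (\<integral>\<^sup>+y\<in>?G. ennreal (\<bar>\<phi> y - c\<bar> powr \<sigma>) \<partial>m k)"
          unfolding bst_def by (rule best_approx_le[OF \<sigma> mG])
        also have "\<dots> \<le> (\<integral>\<^sup>+y\<in>?Q. ennreal (\<bar>\<phi> y - c\<bar> powr \<sigma>) \<partial>m k)"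
          using sub by (intro nn_integral_mono) (auto simp: indicator_def)
        finally show "enn_powr (ennreal (1 / K) * ?b) \<sigma> * emeasure (m k) ?Q
          \<le> (\<integral>\<^sup>+y\<in>?Q. ennreal (\<bar>\<phi> y - c\<bar> powr \<sigma>) \<partial>m k)" .
      qed
      also have "\<dots> = ?B z" using x hit by (auto simp: best_approx_mod_def supp)
      finally have "ennreal K * (ennreal (1 / K) * ?b) \<le> ennreal K * ?B z" by (rule mult_left_mono) simp
      then show ?thesis using K by (simp add: mult.assoc[symmetric] ennreal_mult[symmetric])
    qed
    have [measurable]: "?B \<in> borel_measurable borel"
      using \<phi> closed_E by (intro measurable_best_approx_mod lf \<sigma>) (auto simp: supp L_loc_def)
    let ?j = "int k + 2"
    \<comment> \<open>\<open>avg\<close> exceeds the true mean by the factor 2^n, so replacing 1 by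
      2^n goes in the right direction.\<close>
    have "?b * 1 \<le> ?b * ennreal (2 ^ CARD('n))" by (intro mult_left_mono) auto
    also have "2 ^ CARD('n) = dy ?j powr (- real CARD('n)) * (2 * dy ?j) ^ CARD('n)"
      by (simp add: power_mult_distrib powr_minus powr_realpow)
    also have "?b * ennreal (dy ?j powr (- real CARD('n)) * (2 * dy ?j) ^ CARD('n))
      = ennreal (dy ?j powr (- real CARD('n))) * (?b * emeasure lborel (cube (dy ?j) x))"
      by (simp add: emeasure_lborel_cube mult.left_commute[of _ ?b] ennreal_mult)
    also have "?b * emeasure lborel (cube (dy ?j) x) = (\<integral>\<^sup>+z. ?b * indicator (cube (dy ?j) x) z \<partial>lborel)"
      by (subst nn_integral_cmult_indicator) auto
    also have "\<dots> \<le> (\<integral>\<^sup>+z. ennreal K * (?B z * indicator (cube (dy ?j) x) z) \<partial>lborel)"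
      using pw by (intro nn_integral_mono) (auto simp: indicator_def)
    also have "\<dots> = ennreal K * (\<integral>\<^sup>+z\<in>cube (dy ?j) x. ?B z \<partial>lborel)"
      by (simp add: nn_integral_cmult)
    finally show "?b \<le> ennreal K * avg ?j ?B x"
      by (simp add: avg_def mult_left_mono mult.left_commute)
  qed
qed

text \<open>The shift by \<open>2\<close> matches \<open>bst_le_avg\<close>; scales outside the range of \<open>k\<close> do not contribute.\<close>

definition appr :: "real \<Rightarrow> (real^'n \<Rightarrow> real) \<Rightarrow> int \<Rightarrow> real^'n \<Rightarrow> ennreal"
  where "appr \<sigma> \<phi> j y = (if j < 2 then 0 else
    ennreal (dy j powr (- s)) * best_approx_mod (m (nat (j - 2))) \<sigma> \<phi> (dy (j - 2)) y)"

lemma measurable_appr: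
  assumes "\<phi> \<in> L_loc \<sigma> m" "0 < \<sigma>"
  shows "appr \<sigma> \<phi> j \<in> borel_measurable borel"
proof -
  have [measurable]: "best_approx_mod (m (nat (j - 2))) \<sigma> \<phi> (dy (j - 2)) \<in> borel_measurable borel"
    using assms closed_E by (intro measurable_best_approx_mod lf) (auto simp: supp L_loc_def)
  show ?thesis unfolding appr_def by measurable
qed

text \<open>Writes the best approximations as an oscillation series in which \<open>appr\<close>
  plays the part of the gradients. All norm and finiteness results for \<open>osc_tail\<close>
  thereby apply to \<phi> without any function on R^n at hand.\<close>

lemma bst_sum_le:
  assumes \<sigma>: "0 < \<sigma>"
  obtains K :: real where "0 < K"
    "\<And>\<phi> k l x. \<phi> \<in> L_loc \<sigma> m \<Longrightarrow> x \<in> E \<Longrightarrow> k \<le> l + 2 \<Longrightarrow>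
       (\<Sum>i. bst \<sigma> \<phi> (i + l) x) \<le> ennreal K * osc_tail s (appr \<sigma> \<phi>) k x"
proof -
  obtain K where K: "0 < K" "\<And>\<phi> k x. \<phi> \<in> L_loc \<sigma> m \<Longrightarrow> x \<in> E \<Longrightarrow>
       bst \<sigma> \<phi> k x \<le> ennreal K * avg (int k + 2) (best_approx_mod (m k) \<sigma> \<phi> (dy (int k))) x"
    using bst_le_avg[OF \<sigma>] by blast
  show ?thesis
  proof (rule that[OF K(1)])
    fix \<phi> and k l :: nat and x assume \<phi>: "\<phi> \<in> L_loc \<sigma> m" and x: "x \<in> E" and kl: "k \<le> l + 2"
    \<comment> \<open>8 = 6 + 2: six for the early start of \<open>osc_tail\<close>, two for the
      shift in \<open>appr\<close>.\<close>
    have "(\<Sum>i. bst \<sigma> \<phi> (i + l) x) \<le> (\<Sum>i. ennreal K * osc_bound s (appr \<sigma> \<phi>) (int (l + 8) - 6 + int i) x)"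
    proof (intro suminf_le)
      fix i :: nat
      let ?j = "int l + 2 + int i" and ?B = "best_approx_mod (m (i + l)) \<sigma> \<phi> (dy (int (i + l)))"
      have [measurable]: "?B \<in> borel_measurable borel"
        using \<phi> closed_E by (intro measurable_best_approx_mod lf \<sigma>) (auto simp: supp L_loc_def)
      have e: "nat (?j - 2) = i + l" "?j - 2 = int (i + l)" "int (i + l) + 2 = ?j" by auto
      have ap: "appr \<sigma> \<phi> ?j = (\<lambda>y. ennreal (dy ?j powr (- s)) * ?B y)"
        unfolding appr_def e(2) nat_int fun_eq_iff by (simp del: of_nat_add)
      have "avg ?j (appr \<sigma> \<phi> ?j) x = ennreal (dy ?j powr (- s)) * avg ?j ?B x"
        unfolding ap avg_def mult.assoc by (subst nn_integral_cmult) (measurable, rule mult.left_commute)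
      then have "osc_bound s (appr \<sigma> \<phi>) ?j x = ennreal (4 * 32 ^ CARD('n)) * (ennreal (dy ?j powr s) * ennreal (dy ?j powr (- s))) * avg ?j ?B x"
        unfolding osc_bound_def by (subst ennreal_mult) (auto simp: mult_ac)
      also have "ennreal (dy ?j powr s) * ennreal (dy ?j powr (- s)) = 1"
        by (simp add: ennreal_mult[symmetric] powr_add[symmetric])
      finally have "osc_bound s (appr \<sigma> \<phi>) ?j x = ennreal (4 * 32 ^ CARD('n)) * avg ?j ?B x" by simp
      moreover have "1 \<le> (4 :: real) * 32 ^ CARD('n)" using one_le_power[of "32::real" "CARD('n)"] by linarith
      then have "ennreal 1 * avg ?j ?B x \<le> ennreal (4 * 32 ^ CARD('n)) * avg ?j ?B x"
        by (intro mult_right_mono ennreal_leI) auto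
      ultimately have "avg ?j ?B x \<le> osc_bound s (appr \<sigma> \<phi>) ?j x" by simp
      then have "bst \<sigma> \<phi> (i + l) x \<le> ennreal K * osc_bound s (appr \<sigma> \<phi>) ?j x"
        using K(2)[OF \<phi> x, of "i + l"] unfolding e(3) by (meson mult_left_mono order_trans zero_le)
      then show "bst \<sigma> \<phi> (i + l) x \<le> ennreal K * osc_bound s (appr \<sigma> \<phi>) (int (l + 8) - 6 + int i) x"
        by (simp add: algebra_simps)
    qed auto
    also have "\<dots> = ennreal K * osc_tail s (appr \<sigma> \<phi>) (l + 8) x" by (simp add: osc_tail_def)
    also have "\<dots> \<le> ennreal K * osc_tail s (appr \<sigma> \<phi>) k x"
      using kl by (intro mult_left_mono osc_tail_antimono) auto
    finally show "(\<Sum>i. bst \<sigma> \<phi> (i + l) x) \<le> ennreal K * osc_tail s (appr \<sigma> \<phi>) k x" .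
  qed
qed

text \<open>Strong regularity enters only here: the set where \<open>\<phi>\<close> is close to \<open>\<phi> x\<close> has positive upper
  density at almost every \<open>x\<close>, so the constants \<open>near \<sigma> \<phi> l x\<close> cannot converge to another value.\<close>

lemma near_limit:
  assumes \<sigma>: "0 < \<sigma>"
  obtains K :: real where "0 < K"
    "\<And>\<phi>. \<phi> \<in> L_loc \<sigma> m \<Longrightarrow> AE x in m 0. osc_tail s (appr \<sigma> \<phi>) 0 x < top \<longrightarrow>
       (\<forall>k l. k \<le> l + 2 \<longrightarrow> ennreal \<bar>\<phi> x - near \<sigma> \<phi> l x\<bar> \<le> ennreal K * osc_tail s (appr \<sigma> \<phi>) k x)"
proof -
  obtain K1 where K1: "0 < K1" "\<And>\<phi> k l x. \<phi> \<in> L_loc \<sigma> m \<Longrightarrow> x \<in> E \<Longrightarrow> k \<le> l + 2 \<Longrightarrow>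
       (\<Sum>i. bst \<sigma> \<phi> (i + l) x) \<le> ennreal K1 * osc_tail s (appr \<sigma> \<phi>) k x"
    using bst_sum_le[OF \<sigma>] by blast
  obtain K2 where K2: "0 < K2"
    "\<And>\<phi> k i x x'. \<phi> \<in> borel_measurable borel \<Longrightarrow> i \<le> 2 \<Longrightarrow> x \<in> E \<Longrightarrow> x' \<in> E \<Longrightarrow> ecube (k + i) x' \<subseteq> ecube k x \<Longrightarrow>
       ennreal \<bar>near \<sigma> \<phi> (k + i) x' - near \<sigma> \<phi> k x\<bar> \<le> ennreal K2 * bst \<sigma> \<phi> k x"
    using near_dist_le[OF \<sigma>] by blast
  obtain C4 where C4: "0 < C4"
    "\<And>k j x. int k - 6 \<le> j \<Longrightarrow> emeasure (m k) (cube (dy j) x) \<le> ennreal (C4 * dy j powr d)"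
    using mass_le by blast
  show ?thesis
  proof (rule that[of "K2 * K1"])
    fix \<phi> assume \<phi>: "\<phi> \<in> L_loc \<sigma> m"
    have \<phi>m[measurable]: "\<phi> \<in> borel_measurable borel" using \<phi> by (simp add: L_loc_def)
    \<comment> \<open>With rational bounds a and b there are countably many of these sets, so the
      density statement holds for all of them off one null set.\<close>
    define G where "G a b = {x \<in> E. a \<le> \<phi> x \<and> \<phi> x \<le> b}" for a b
    have Es[measurable]: "E \<in> sets borel" using closed_E by simp
    have Gs: "G a b \<in> sets borel" for a b unfolding G_def by measurable
    have "AE x in m 0. \<forall>a\<in>\<rat>. \<forall>b\<in>\<rat>. x \<in> G a b \<longrightarrow>
          0 < limsup (\<lambda>k. ereal (measure (m k) (cube (2 powr (- real k)) x \<inter> G a b) /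
                                   measure (m k) (cube (2 powr (- real k)) x)))"
      using strong[OF Gs] by (intro AE_ball_countable[THEN iffD2] countable_rat ballI) (auto simp: G_def)
    with AE_in_E[of 0]
    show "AE x in m 0. osc_tail s (appr \<sigma> \<phi>) 0 x < top \<longrightarrow>
       (\<forall>k l. k \<le> l + 2 \<longrightarrow> ennreal \<bar>\<phi> x - near \<sigma> \<phi> l x\<bar> \<le> ennreal (K2 * K1) * osc_tail s (appr \<sigma> \<phi>) k x)"
    proof (eventually_elim, intro impI allI)
      fix x k l assume x: "x \<in> E" and lim: "\<forall>a\<in>\<rat>. \<forall>b\<in>\<rat>. x \<in> G a b \<longrightarrow>
          0 < limsup (\<lambda>k. ereal (measure (m k) (cube (2 powr (- real k)) x \<inter> G a b) /
                                   measure (m k) (cube (2 powr (- real k)) x)))"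
        and fin: "osc_tail s (appr \<sigma> \<phi>) 0 x < top" and kl: "k \<le> l + (2::nat)"
      have bfin: "(\<Sum>i. bst \<sigma> \<phi> i x) < top"
        using K1(2)[OF \<phi> x, of 0 0] fin by (auto simp: ennreal_mult_less_top intro: le_less_trans)
      have step: "ennreal \<bar>near \<sigma> \<phi> (Suc i) x - near \<sigma> \<phi> i x\<bar> \<le> ennreal K2 * bst \<sigma> \<phi> i x" for i
        using K2(2)[OF \<phi>m, of 1 x x i] x dy_mono[of "int i" "int i + 1"] by (simp add: ecube_def cube_mono_radius algebra_simps)
      have "(\<Sum>i. ennreal K2 * bst \<sigma> \<phi> i x) < top" using bfin by (simp add: ennreal_mult_less_top)
      then obtain L where L: "(\<lambda>i. near \<sigma> \<phi> i x) \<longlonglongrightarrow> L"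
        "\<And>k. ennreal \<bar>L - near \<sigma> \<phi> k x\<bar> \<le> (\<Sum>i. ennreal K2 * bst \<sigma> \<phi> (i + k) x)"
        using telescoping_limit[of "\<lambda>i. near \<sigma> \<phi> i x", OF step] by blast
      have "\<phi> x = L"
      proof (rule ccontr)
        assume ne: "\<phi> x \<noteq> L"
        have "\<exists>a\<in>\<rat>. \<exists>b\<in>\<rat>. \<exists>\<eta>>0. a < \<phi> x \<and> \<phi> x < b \<and> (\<forall>t. a \<le> t \<longrightarrow> t \<le> b \<longrightarrow> \<eta> \<le> \<bar>t - L\<bar>)"
        proof (cases "\<phi> x < L")
          case True
          obtain b where b: "b \<in> \<rat>" "\<phi> x < b" "b < L" using Rats_dense_in_real[OF True] by blast
          obtain a where a: "a \<in> \<rat>" "a < \<phi> x" using Rats_dense_in_real[of "\<phi> x - 1" "\<phi> x"] by auto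
          show ?thesis using a b by (intro bexI[of _ a] bexI[of _ b] exI[of _ "L - b"]) auto
        next
          case False
          then have "L < \<phi> x" using ne by simp
          from Rats_dense_in_real[OF this] obtain a where a: "a \<in> \<rat>" "L < a" "a < \<phi> x" by blast
          obtain b where b: "b \<in> \<rat>" "\<phi> x < b" using Rats_dense_in_real[of "\<phi> x" "\<phi> x + 1"] by auto
          show ?thesis using a b by (intro bexI[of _ a] bexI[of _ b] exI[of _ "a - L"]) auto
        qed
        then obtain a b \<eta> where ab: "a \<in> \<rat>" "b \<in> \<rat>" "0 < \<eta>" "a < \<phi> x" "\<phi> x < b"
          "\<And>t. a \<le> t \<Longrightarrow> t \<le> b \<Longrightarrow> \<eta> \<le> \<bar>t - L\<bar>" by blast
        let ?q = "\<lambda>k. measure (m k) (cube (2 powr (- real k)) x \<inter> G a b) / measure (m k) (cube (2 powr (- real k)) x)"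
        have "x \<in> G a b" using ab x by (simp add: G_def)
        then have "0 < limsup (\<lambda>k. ereal (?q k))" using lim ab by blast
        then obtain \<delta>' where \<delta>': "0 < \<delta>'" "\<delta>' < limsup (\<lambda>k. ereal (?q k))" using dense by blast
        then obtain \<delta> where \<delta>: "0 < \<delta>" "ereal \<delta> < limsup (\<lambda>k. ereal (?q k))"
          by (cases \<delta>') auto
        have freq: "\<exists>\<^sub>F k in sequentially. \<delta> < ?q k"
        proof (rule ccontr)
          assume "\<not> ?thesis"
          then have "\<forall>\<^sub>F k in sequentially. ereal (?q k) \<le> ereal \<delta>"
            by (auto simp: not_frequently not_less elim!: eventually_mono)
          then have "limsup (\<lambda>k. ereal (?q k)) \<le> ereal \<delta>" by (rule Limsup_bounded)
          with \<delta>(2) show False by simp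
        qed
        \<comment> \<open>By Chebyshev's argument: if \<phi> differs from
          \<open>near \<sigma> \<phi> k x\<close> by at least \<eta>/2 on a set of mass at least
          \<delta> C2 r^d, then \<open>bst \<sigma> \<phi> k x\<close> is at least this
          number.\<close>
        define c0 where "c0 = ((\<eta> / 2) powr \<sigma> * \<delta> * C2 / (2 powr \<sigma> * (C4 * 2 powr d))) powr (1 / \<sigma>)"
        have c0: "0 < c0" using ab \<delta> C C4 by (simp add: c0_def)
        have "(\<lambda>i. bst \<sigma> \<phi> i x) \<longlonglongrightarrow> 0" by (rule ennreal_suminf_tendsto_0[OF bfin])
        then have "\<forall>\<^sub>F k in sequentially. bst \<sigma> \<phi> k x < ennreal c0"
          using c0 by (intro order_tendstoD) auto
        moreover have "\<forall>\<^sub>F k in sequentially. dist (near \<sigma> \<phi> k x) L < \<eta> / 2"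
          using L(1) ab by (intro tendstoD) auto
        ultimately have "\<forall>\<^sub>F k in sequentially. bst \<sigma> \<phi> k x < ennreal c0 \<and> dist (near \<sigma> \<phi> k x) L < \<eta> / 2"
          by eventually_elim simp
        \<comment> \<open>The density is large only for infinitely many k, while the two other
          conditions hold for all large k; a single k with all three yields the
          contradiction.\<close>
        with freq obtain k where k: "\<delta> < ?q k" "bst \<sigma> \<phi> k x < ennreal c0" "dist (near \<sigma> \<phi> k x) L < \<eta> / 2"
          using frequently_eventually_conj[of _ sequentially] by (metis (mono_tags, lifting) frequently_ex)
        let ?r = "dy (int k)" and ?A = "cube (dy (int k)) x \<inter> G a b"
        have As[measurable]: "?A \<in> sets borel" using Gs by auto
        have m1: "ennreal (C2 * ?r powr d) \<le> emeasure (m k) (cube ?r x)"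
          using x dy_mono[of 0 "int k"] by (intro M2) (auto simp: dy_nat)
        have fm: "emeasure (m k) (cube ?r x) = ennreal (measure (m k) (cube ?r x))"
          using emeasure_cube_finite[OF lf] by (intro emeasure_eq_ennreal_measure) (auto simp: less_top)
        have pm: "C2 * ?r powr d \<le> measure (m k) (cube ?r x)"
          using m1 unfolding fm by (simp add: ennreal_le_iff)
        then have p0: "0 < measure (m k) (cube ?r x)" using C by (smt (verit) dy_pos(1) mult_pos_pos powr_gt_zero)
        have "\<delta> * (C2 * ?r powr d) \<le> \<delta> * measure (m k) (cube ?r x)" using \<delta> pm by (intro mult_left_mono) auto
        also have "\<dots> \<le> measure (m k) ?A" using k(1) p0 by (simp add: dy_nat field_simps)
        finally have A: "ennreal (\<delta> * (C2 * ?r powr d)) \<le> emeasure (m k) ?A"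
          using emeasure_mono[of ?A "cube ?r x" "m k"] emeasure_cube_finite[OF lf, of k ?r x]
          by (subst emeasure_eq_ennreal_measure) (auto simp: less_top[symmetric] top_unique intro!: ennreal_leI)
        have "ennreal ((\<eta> / 2) powr \<sigma> * (\<delta> * (C2 * ?r powr d))) \<le> ennreal ((\<eta> / 2) powr \<sigma>) * emeasure (m k) ?A"
          using A \<delta> C by (subst ennreal_mult) (auto intro!: mult_left_mono)
        also have "\<dots> = (\<integral>\<^sup>+y. ennreal ((\<eta> / 2) powr \<sigma>) * indicator ?A y \<partial>m k)"
          by (subst nn_integral_cmult_indicator) auto
        also have "\<dots> \<le> (\<integral>\<^sup>+y\<in>ecube k x. ennreal (\<bar>\<phi> y - near \<sigma> \<phi> k x\<bar> powr \<sigma>) \<partial>m k)"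
        proof (intro nn_integral_mono)
          fix y
          show "ennreal ((\<eta> / 2) powr \<sigma>) * indicator ?A y \<le> ennreal (\<bar>\<phi> y - near \<sigma> \<phi> k x\<bar> powr \<sigma>) * indicator (ecube k x) y"
          proof (cases "y \<in> ?A")
            case True
            then have "y \<in> ecube k x" using cube_mono_radius[of ?r "7 / 4 * ?r" x] by (auto simp: ecube_def)
            moreover have "\<eta> \<le> \<bar>\<phi> y - L\<bar>" using True by (intro ab) (auto simp: G_def)
            then have "\<eta> / 2 \<le> \<bar>\<phi> y - near \<sigma> \<phi> k x\<bar>" using k(3) unfolding dist_real_def by linarith
            then have "(\<eta> / 2) powr \<sigma> \<le> \<bar>\<phi> y - near \<sigma> \<phi> k x\<bar> powr \<sigma>" using ab \<sigma> by (intro powr_mono2) auto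
            ultimately show ?thesis using True by (simp add: ennreal_leI)
          qed simp
        qed
        also have "\<dots> \<le> enn_powr (2 * bst \<sigma> \<phi> k x) \<sigma> * emeasure (m k) (ecube k x)"
          by (rule near_spec[OF x \<sigma> \<phi>m])
        also have "\<dots> \<le> enn_powr (2 * bst \<sigma> \<phi> k x) \<sigma> * ennreal (C4 * (2 * ?r) powr d)"
        proof (intro mult_left_mono)
          have e: "2 * ?r = dy (int k - 1)" by (simp add: dy_diff)
          have "emeasure (m k) (ecube k x) \<le> emeasure (m k) (cube (2 * ?r) x)"
            unfolding ecube_def by (intro emeasure_mono cube_mono_radius) auto
          also have "\<dots> \<le> ennreal (C4 * (2 * ?r) powr d)" unfolding e by (rule C4) simp
          finally show "emeasure (m k) (ecube k x) \<le> ennreal (C4 * (2 * ?r) powr d)" .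
        qed simp
        also obtain \<beta> where \<beta>: "bst \<sigma> \<phi> k x = ennreal \<beta>" "0 \<le> \<beta>" using k(2) by (cases "bst \<sigma> \<phi> k x") auto
        have "enn_powr (2 * bst \<sigma> \<phi> k x) \<sigma> * ennreal (C4 * (2 * ?r) powr d) = ennreal ((2 * \<beta>) powr \<sigma> * (C4 * (2 * ?r) powr d))"
        proof -
          have "2 * ennreal \<beta> = ennreal (2 * \<beta>)" using \<beta> by (simp add: ennreal_mult)
          then have "enn_powr (2 * ennreal \<beta>) \<sigma> = ennreal ((2 * \<beta>) powr \<sigma>)"
            using \<beta> by (simp only:) (intro enn_powr_ennreal, simp)
          then show ?thesis unfolding \<beta>(1) using C4 by (simp only: ennreal_mult[symmetric] powr_ge_zero mult_nonneg_nonneg less_imp_le)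
        qed
        finally have "(\<eta> / 2) powr \<sigma> * (\<delta> * (C2 * ?r powr d)) \<le> (2 * \<beta>) powr \<sigma> * (C4 * (2 * ?r) powr d)"
          using C4 by (simp add: ennreal_le_iff)
        then have "((\<eta> / 2) powr \<sigma> * \<delta> * C2) * ?r powr d \<le> (\<beta> powr \<sigma> * (2 powr \<sigma> * (C4 * 2 powr d))) * ?r powr d"
          using \<beta> by (simp add: powr_mult mult_ac)
        then have "(\<eta> / 2) powr \<sigma> * \<delta> * C2 \<le> \<beta> powr \<sigma> * (2 powr \<sigma> * (C4 * 2 powr d))"
          by (simp add: mult_le_cancel_right)
        then have "(\<eta> / 2) powr \<sigma> * \<delta> * C2 / (2 powr \<sigma> * (C4 * 2 powr d)) \<le> \<beta> powr \<sigma>"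
          using C4 by (simp add: pos_divide_le_eq)
        then have "c0 \<le> (\<beta> powr \<sigma>) powr (1 / \<sigma>)" unfolding c0_def using ab \<delta> C C4 \<sigma> by (intro powr_mono2) auto
        then have "c0 \<le> \<beta>" using \<sigma> \<beta> by (simp add: powr_powr)
        with k(2) show False by (simp add: \<beta> ennreal_less_iff)
      qed
      have "ennreal \<bar>\<phi> x - near \<sigma> \<phi> l x\<bar> \<le> ennreal K2 * (\<Sum>i. bst \<sigma> \<phi> (i + l) x)"
        using L(2)[of l] by (simp add: \<open>\<phi> x = L\<close>)
      also have "\<dots> \<le> ennreal K2 * (ennreal K1 * osc_tail s (appr \<sigma> \<phi>) k x)"
        by (intro mult_left_mono K1 \<phi> x kl) auto
      finally show "ennreal \<bar>\<phi> x - near \<sigma> \<phi> l x\<bar> \<le> ennreal (K2 * K1) * osc_tail s (appr \<sigma> \<phi>) k x"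
        using K1 K2 by (simp add: ennreal_mult mult.assoc)
    qed
  qed (use K1 K2 in auto)
qed

end


lemma Lp_norm_zero:
  assumes "0 < p"
  shows "Lp_norm M p (\<lambda>x. 0) = 0"
  using Lp_norm_cmult_le[OF assms, of "\<lambda>x. 0" M 0] by simp

text \<open>Takes care of the scales 0 and 1, which a comparison with the constant two scales above
  cannot reach.\<close>

lemma lq_norm_initial_le:
  assumes q: "0 < q"
  obtains K :: real where "0 < K"
    "\<And>X. lq_norm q (\<lambda>k::nat. if k < 2 then X else 0) \<le> ennreal K * X"
proof (cases "q = top")
  case True
  show ?thesis
    by (rule that[of 1]) (auto simp: True Lp_norm_top_le_iff AE_count_space)
next
  case False
  define Q where "Q = enn2real q"
  have Q: "0 < Q" using enn2real_pos[OF q False] by (simp add: Q_def)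
  show ?thesis
  proof (rule that[of "2 powr (1 / Q)"])
    fix X
    have "(\<integral>\<^sup>+(k::nat). enn_powr (if k < 2 then X else 0) Q \<partial>count_space UNIV)
      = (\<integral>\<^sup>+k. enn_powr X Q * indicator {..<2::nat} k \<partial>count_space UNIV)"
      by (intro nn_integral_cong) (auto simp: indicator_def)
    also have "\<dots> = enn_powr X Q * 2" by (subst nn_integral_cmult_indicator) auto
    also have "\<dots> = enn_powr (ennreal (2 powr (1 / Q)) * X) Q"
      using Q by (simp add: enn_powr_mult enn_powr_ennreal powr_powr mult.commute)
    finally show "lq_norm q (\<lambda>k::nat. if k < 2 then X else 0) \<le> ennreal (2 powr (1 / Q)) * X"
      by (simp add: Lp_norm_le_iff[OF q False] Q_def)
  qed simp
qed

section \<open>Reduction to exponent one\<close>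

context trace_setting
begin

lemma L_loc_1:
  assumes [measurable]: "\<phi> \<in> borel_measurable borel" and fin: "Lp_norm (m 0) p (\<lambda>x. ennreal \<bar>\<phi> x\<bar>) < top"
  shows "\<phi> \<in> L_loc 1 m"
proof -
  have "(\<integral>\<^sup>+x\<in>K. ennreal \<bar>\<phi> x\<bar> \<partial>m k) < top" if K: "compact K" for k K
  proof -
    have [measurable]: "K \<in> sets borel" using K by (simp add: borel_closed compact_imp_closed)
    have "(\<integral>\<^sup>+x\<in>K. ennreal \<bar>\<phi> x\<bar> \<partial>m (0 + k)) \<le> ennreal (C3 ^ k) * (\<integral>\<^sup>+x\<in>K. ennreal \<bar>\<phi> x\<bar> \<partial>m 0)"
      by (rule M3_shift) measurable
    also have "\<dots> < top"
      using Lp_locally_integrable[OF lf p _ fin K] by (simp add: ennreal_mult_less_top)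
    finally show ?thesis by simp
  qed
  then show ?thesis by (auto simp: L_loc_def)
qed

lemma Lp_norm_m_le:
  obtains K :: real where "0 < K"
    "\<And>k h. k < 2 \<Longrightarrow> h \<in> borel_measurable borel \<Longrightarrow> Lp_norm (m k) p h \<le> ennreal K * Lp_norm (m 0) p h"
proof -
  let ?P = "enn2real p"
  define T where "T = max 1 C3"
  have T: "1 \<le> T" by (simp add: T_def)
  show ?thesis
  proof (rule that[of "T powr (1 / ?P)"])
    fix k :: nat and h :: "real^'n \<Rightarrow> ennreal"
    assume k: "k < 2" and [measurable]: "h \<in> borel_measurable borel"
    show "Lp_norm (m k) p h \<le> ennreal (T powr (1 / ?P)) * Lp_norm (m 0) p h"
    proof (cases "p = top")
      case True
      have "AE x in m k. h x \<le> Lp_norm (m 0) top h" by (rule AE_m) (rule AE_le_Lp_norm_top)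
      then show ?thesis using True T by (simp add: Lp_norm_top_le_iff)
    next
      case False
      have "(\<integral>\<^sup>+x. enn_powr (h x) ?P \<partial>m (0 + k)) \<le> ennreal (C3 ^ k) * (\<integral>\<^sup>+x. enn_powr (h x) ?P \<partial>m 0)"
        by (rule M3_shift) measurable
      also have "\<dots> \<le> ennreal T * (\<integral>\<^sup>+x. enn_powr (h x) ?P \<partial>m 0)"
        using k C by (intro mult_right_mono ennreal_leI) (auto simp: T_def less_2_cases_iff)
      also have "\<dots> = enn_powr (ennreal (T powr (1 / ?P)) * Lp_norm (m 0) p h) ?P"
        using T enn2real_pos[OF p_pos False]
        by (simp add: enn_powr_mult enn_powr_ennreal powr_powr Lp_norm_powr[OF p_pos False])
      finally show ?thesis by (simp add: Lp_norm_le_iff[OF p_pos False])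
    qed
  qed (use T in simp)
qed

text \<open>4^s is the price of the shift by two scales in \<open>appr\<close>. Since the indices
  below 2 contribute nothing, the sum over all integers is a sum over k.\<close>

lemma appr_lq_norm_le:
  assumes q: "0 < q" and \<sigma>: "0 < \<sigma>" and \<phi>: "\<phi> \<in> L_loc \<sigma> m"
  shows "lq_norm q (\<lambda>j. Lp_norm lborel p (appr \<sigma> \<phi> j)) \<le> ennreal (4 powr s) *
    lq_norm q (\<lambda>k::nat. ennreal (2 powr (real k * s)) * Lp_norm lborel p (best_approx_mod (m k) \<sigma> \<phi> (2 powr (- real k))))"
proof -
  define a where "a k = ennreal (2 powr (real k * s)) * Lp_norm lborel p (best_approx_mod (m k) \<sigma> \<phi> (2 powr (- real k)))" for k :: nat
  define N where "N j = Lp_norm lborel p (appr \<sigma> \<phi> j)" for j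
  have N: "N j \<le> ennreal (4 powr s) * (if j - 2 < 0 then 0 else a (nat (j - 2)))" for j
  proof (cases "j < 2")
    case True
    then have "appr \<sigma> \<phi> j = (\<lambda>y. 0)" by (simp add: appr_def fun_eq_iff)
    then show ?thesis by (simp add: N_def Lp_norm_zero[OF p_pos])
  next
    case False
    define k where "k = nat (j - 2)"
    have k: "j - 2 = int k" "j = int k + 2" using False by (auto simp: k_def)
    have [measurable]: "best_approx_mod (m k) \<sigma> \<phi> (dy (int k)) \<in> borel_measurable borel"
      using \<phi> closed_E by (intro measurable_best_approx_mod lf \<sigma>) (auto simp: supp L_loc_def)
    have ap: "appr \<sigma> \<phi> j = (\<lambda>y. ennreal (dy j powr (- s)) * best_approx_mod (m k) \<sigma> \<phi> (dy (int k)) y)"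
      using False by (simp add: appr_def k fun_eq_iff)
    have "N j \<le> ennreal (dy j powr (- s)) * Lp_norm lborel p (best_approx_mod (m k) \<sigma> \<phi> (dy (int k)))"
      unfolding N_def ap by (intro Lp_norm_cmult_le p_pos) simp
    also have "dy j powr (- s) = 4 powr s * 2 powr (real k * s)"
    proof -
      have "dy j = 2 powr (- real k) * (1 / 4)" by (simp add: k(2) dy_add dy_nat dy_numeral)
      then have "dy j powr (- s) = (2 powr (- real k)) powr (- s) * (1 / 4) powr (- s)"
        by (simp only: powr_mult)
      also have "(1 / 4 :: real) powr (- s) = 4 powr s" by (simp add: powr_divide powr_minus)
      finally show ?thesis by (simp add: powr_powr)
    qed
    finally show ?thesis using False by (simp add: a_def k_def[symmetric] dy_nat ennreal_mult mult.assoc)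
  qed
  have lqN: "lq_norm q N \<le> ennreal (4 powr s) * lq_norm q a"
  proof -
    have "lq_norm q N \<le> lq_norm q (\<lambda>j. ennreal (4 powr s) * (if j - 2 < 0 then 0 else a (nat (j - 2))))"
      using N by (intro Lp_norm_mono_AE[OF q]) (auto simp: AE_count_space)
    also have "\<dots> \<le> ennreal (4 powr s) * lq_norm q (\<lambda>j. if j - 2 < 0 then 0 else a (nat (j - 2)))"
      by (intro Lp_norm_cmult_le[OF q]) auto
    also have "\<dots> \<le> ennreal (4 powr s) * lq_norm q (\<lambda>j::int. if j < 0 then 0 else a (nat j))"
      using lq_norm_inj_le[OF q, of "\<lambda>j::int. j - 2" "\<lambda>j. if j < 0 then 0 else a (nat j)"]
      by (intro mult_left_mono) (auto intro: injI)
    also have "\<dots> \<le> ennreal (4 powr s) * lq_norm q a"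
      by (intro mult_left_mono lq_norm_extend_le[OF q]) auto
    finally show ?thesis .
  qed
  show ?thesis using lqN by (simp only: N_def[abs_def] a_def[abs_def])
qed

lemma appr_finite_AE:
  assumes q: "0 < q" and \<sigma>: "0 < \<sigma>" and \<phi>: "\<phi> \<in> L_loc \<sigma> m" and fin: "intrinsic_norm s p q \<sigma> m \<phi> < top"
  shows "AE x in m 0. osc_tail s (appr \<sigma> \<phi>) 0 x < top"
proof (rule osc_tail_finite_AE[OF q measurable_appr[OF \<phi> \<sigma>]])
  show "lq_norm q (\<lambda>j. Lp_norm lborel p (appr \<sigma> \<phi> j)) < top"
    using fin by (intro le_less_trans[OF appr_lq_norm_le[OF q \<sigma> \<phi>]]) (auto simp: ennreal_mult_less_top intrinsic_norm_def)
qed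

text \<open>Only for exponent \<open>1\<close> are means, which are linear in \<open>\<phi>\<close>, nearly optimal constants.\<close>

lemma intrinsic_norm_1_le:
  assumes q: "0 < q" and \<sigma>: "0 < \<sigma>" "ennreal \<sigma> \<le> p"
  obtains C :: real where "0 < C"
    "\<And>\<phi>. \<phi> \<in> L_loc \<sigma> m \<Longrightarrow> intrinsic_norm s p q \<sigma> m \<phi> < top \<Longrightarrow>
       \<phi> \<in> L_loc 1 m \<and> intrinsic_norm s p q 1 m \<phi> \<le> ennreal C * intrinsic_norm s p q \<sigma> m \<phi>"
proof -
  define \<delta> where "\<delta> = (s - \<tau>) / 2"
  have \<delta>: "0 < \<delta>" using s by (auto simp: \<delta>_def)
  obtain CT where CT: "0 < CT"
    "\<And>g k. (\<And>j. g j \<in> borel_measurable borel) \<Longrightarrow>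
      Lp_norm (m k) p (osc_tail s g k) \<le> ennreal (CT * dy (int k) powr (s - \<tau>)) *
        (\<Sum>i. ennreal (2 powr (- \<delta> * real i)) * Lp_norm lborel p (g (int k - 6 + int i)))"
    using osc_tail_norm_le unfolding \<delta>_def by blast
  obtain CQ where CQ: "0 < CQ"
    "\<And>(M :: nat measure) f B. (\<And>i. f i \<in> borel_measurable M) \<Longrightarrow> (\<And>i. Lp_norm M q (f i) \<le> B) \<Longrightarrow>
       Lp_norm M q (\<lambda>x. \<Sum>i. ennreal (2 powr (- \<delta> * real i)) * f i x) \<le> ennreal CQ * B"
    using Lp_norm_geometric[OF \<delta>(1) q] by blast
  obtain CB where CB: "0 < CB"
    "\<And>k \<phi> c h. \<phi> \<in> L_loc 1 m \<Longrightarrow> h \<in> borel_measurable borel \<Longrightarrow>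
      (AE x in m k. \<forall>y. infnorm (x - y) \<le> 2 * dy (int k) \<longrightarrow> cube (dy (int k)) y \<inter> E \<noteq> {} \<longrightarrow>
         ennreal \<bar>\<phi> x - c y\<bar> \<le> h x) \<Longrightarrow>
      Lp_norm lborel p (best_approx_mod (m k) 1 \<phi> (dy (int k)))
        \<le> ennreal (CB * dy (int k) powr \<tau>) * Lp_norm (m k) p h"
    using best_approx_norm_le[of 1] p by auto
  obtain K1 where K1: "0 < K1" "\<And>\<phi> k l x. \<phi> \<in> L_loc \<sigma> m \<Longrightarrow> x \<in> E \<Longrightarrow> k \<le> l + 2 \<Longrightarrow>
       (\<Sum>i. bst \<sigma> \<phi> (i + l) x) \<le> ennreal K1 * osc_tail s (appr \<sigma> \<phi>) k x"
    using bst_sum_le[OF \<sigma>(1)] by blast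
  obtain K2 where K2: "0 < K2"
    "\<And>\<phi> k i x x'. \<phi> \<in> borel_measurable borel \<Longrightarrow> i \<le> 2 \<Longrightarrow> x \<in> E \<Longrightarrow> x' \<in> E \<Longrightarrow> ecube (k + i) x' \<subseteq> ecube k x \<Longrightarrow>
       ennreal \<bar>near \<sigma> \<phi> (k + i) x' - near \<sigma> \<phi> k x\<bar> \<le> ennreal K2 * bst \<sigma> \<phi> k x"
    using near_dist_le[OF \<sigma>(1)] by blast
  obtain K3 where K3: "0 < K3"
    "\<And>\<phi>. \<phi> \<in> L_loc \<sigma> m \<Longrightarrow> AE x in m 0. osc_tail s (appr \<sigma> \<phi>) 0 x < top \<longrightarrow>
       (\<forall>k l. k \<le> l + 2 \<longrightarrow> ennreal \<bar>\<phi> x - near \<sigma> \<phi> l x\<bar> \<le> ennreal K3 * osc_tail s (appr \<sigma> \<phi>) k x)"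
    using near_limit[OF \<sigma>(1)] by blast
  obtain CI where CI: "0 < CI"
    "\<And>X. lq_norm q (\<lambda>k::nat. if k < 2 then X else 0) \<le> ennreal CI * X"
    using lq_norm_initial_le[OF q] by blast
  obtain CM where CM: "0 < CM"
    "\<And>k h. k < 2 \<Longrightarrow> h \<in> borel_measurable borel \<Longrightarrow> Lp_norm (m k) p h \<le> ennreal CM * Lp_norm (m 0) p h"
    using Lp_norm_m_le by blast
  obtain CP where CP: "0 < CP"
    "\<And>(M :: nat measure) f g. f \<in> borel_measurable M \<Longrightarrow> g \<in> borel_measurable M \<Longrightarrow>
       Lp_norm M q (\<lambda>x. f x + g x) \<le> ennreal CP * (Lp_norm M q f + Lp_norm M q g)"
    using Lp_norm_add_le[OF q] by blast
  define K where "K = K3 + K2 * K1"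
  define D1 where "D1 = CB * K * CT"
  define D2 where "D2 = 2 * CB * CM"
  define D where "D = CP * (D1 * (CQ * 4 powr s) + CI * D2)"
  have pos: "0 < K" "0 < D1" "0 < D2" "0 < D"
    using K1(1) K2(1) K3(1) CB(1) CT(1) CM(1) CP(1) CQ(1) CI(1)
    by (auto simp: K_def D1_def D2_def D_def intro!: mult_pos_pos add_pos_pos)
  show ?thesis
  proof (rule that[of "1 + D"])
    fix \<phi> assume \<phi>: "\<phi> \<in> L_loc \<sigma> m" and fin: "intrinsic_norm s p q \<sigma> m \<phi> < top"
    have \<phi>m[measurable]: "\<phi> \<in> borel_measurable borel" using \<phi> by (simp add: L_loc_def)
    let ?P = "Lp_norm (m 0) p (\<lambda>x. ennreal \<bar>\<phi> x\<bar>)"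
    define a where "a k = ennreal (2 powr (real k * s)) * Lp_norm lborel p (best_approx_mod (m k) \<sigma> \<phi> (2 powr (- real k)))" for k :: nat
    define N where "N j = Lp_norm lborel p (appr \<sigma> \<phi> j)" for j
    define S where "S k = (\<Sum>i. ennreal (2 powr (- \<delta> * real i)) * N (int k - 6 + int i))" for k :: nat
    have \<phi>1: "\<phi> \<in> L_loc 1 m"
      using fin by (intro L_loc_1) (auto simp: intrinsic_norm_def)
    have apm[measurable]: "appr \<sigma> \<phi> j \<in> borel_measurable borel" for j by (rule measurable_appr[OF \<phi> \<sigma>(1)])
    have lqN: "lq_norm q N \<le> ennreal (4 powr s) * lq_norm q a"
      unfolding N_def[abs_def] a_def[abs_def] by (rule appr_lq_norm_le[OF q \<sigma>(1) \<phi>])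
    have "AE x in m 0. osc_tail s (appr \<sigma> \<phi>) 0 x < top" by (rule appr_finite_AE[OF q \<sigma>(1) \<phi> fin])
    with K3(2)[OF \<phi>] have near: "AE x in m 0. \<forall>k l. k \<le> l + 2 \<longrightarrow> ennreal \<bar>\<phi> x - near \<sigma> \<phi> l x\<bar> \<le> ennreal K3 * osc_tail s (appr \<sigma> \<phi>) k x"
      by eventually_elim blast
    \<comment> \<open>A point z of E near y supplies the constant
      \<open>near \<sigma> \<phi> k z\<close>. Its distance to \<phi> x is measured through the
      constant at scale k - 2 about x, whose cube contains the one about z.\<close>
    have late: "ennreal (2 powr (real k * s)) * Lp_norm lborel p (best_approx_mod (m k) 1 \<phi> (2 powr (- real k))) \<le> ennreal D1 * S k"
      if k: "2 \<le> k" for k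
    proof -
      define c where "c y = near \<sigma> \<phi> k (SOME z. z \<in> cube (dy (int k)) y \<inter> E)" for y
      have "Lp_norm lborel p (best_approx_mod (m k) 1 \<phi> (dy (int k)))
        \<le> ennreal (CB * dy (int k) powr \<tau>) * Lp_norm (m k) p (\<lambda>x. ennreal K * osc_tail s (appr \<sigma> \<phi>) k x)"
      proof (rule CB(2)[OF \<phi>1])
        show "AE x in m k. \<forall>y. infnorm (x - y) \<le> 2 * dy (int k) \<longrightarrow> cube (dy (int k)) y \<inter> E \<noteq> {} \<longrightarrow>
           ennreal \<bar>\<phi> x - c y\<bar> \<le> ennreal K * osc_tail s (appr \<sigma> \<phi>) k x"
          using AE_m[OF near, of k] AE_in_E[of k]
        proof (eventually_elim, intro allI impI)
          fix x y assume nx: "\<forall>k l. k \<le> l + 2 \<longrightarrow> ennreal \<bar>\<phi> x - near \<sigma> \<phi> l x\<bar> \<le> ennreal K3 * osc_tail s (appr \<sigma> \<phi>) k x"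
            and x: "x \<in> E" and xy: "infnorm (x - y) \<le> 2 * dy (int k)" and hit: "cube (dy (int k)) y \<inter> E \<noteq> {}"
          define z where "z = (SOME z. z \<in> cube (dy (int k)) y \<inter> E)"
          have "\<exists>z. z \<in> cube (dy (int k)) y \<inter> E" using hit by blast
          then have "z \<in> cube (dy (int k)) y \<inter> E" unfolding z_def by (rule someI_ex)
          then have z: "infnorm (z - y) \<le> dy (int k)" "z \<in> E" by (auto simp: mem_cube)
          let ?T = "osc_tail s (appr \<sigma> \<phi>) k x"
          have kk: "k - 2 + 2 = k" using k by simp
          \<comment> \<open>3 = 1 + 2: z is within \<open>dy k\<close> of y, and x within
            \<open>2 * dy k\<close>.\<close>
          have zx: "infnorm (z - x) \<le> 3 * dy (int k)"
            using infnorm_triangle[of "z - y" "y - x"] z(1) xy by (simp add: infnorm_sub[of y x])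
          have "dy (int (k - 2)) = 4 * dy (int k)"
            using k dy_diff[of "int k" 2] by (simp add: of_nat_diff dy_numeral)
          then have "ecube k z \<subseteq> ecube (k - 2) x"
            unfolding ecube_def using zx dy_pos(1)[of "int k"] by (intro cube_mono) (simp del: dy_pos)
          then have "ennreal \<bar>near \<sigma> \<phi> k z - near \<sigma> \<phi> (k - 2) x\<bar> \<le> ennreal K2 * bst \<sigma> \<phi> (k - 2) x"
            using K2(2)[OF \<phi>m, of 2 x z "k - 2"] x z kk by simp
          also have "bst \<sigma> \<phi> (k - 2) x \<le> (\<Sum>i. bst \<sigma> \<phi> (i + (k - 2)) x)"
            using sum_le_suminf[of "\<lambda>i. bst \<sigma> \<phi> (i + (k - 2)) x" "{0}"] by simp
          also have "\<dots> \<le> ennreal K1 * ?T" using kk by (intro K1 \<phi> x) simp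
          finally have 1: "ennreal \<bar>near \<sigma> \<phi> k z - near \<sigma> \<phi> (k - 2) x\<bar> \<le> ennreal K2 * (ennreal K1 * ?T)"
            by (simp add: mult_left_mono)
          have 2: "ennreal \<bar>\<phi> x - near \<sigma> \<phi> (k - 2) x\<bar> \<le> ennreal K3 * ?T" using nx kk by simp
          have "ennreal \<bar>\<phi> x - c y\<bar> \<le> ennreal \<bar>\<phi> x - near \<sigma> \<phi> (k - 2) x\<bar> + ennreal \<bar>near \<sigma> \<phi> (k - 2) x - c y\<bar>"
            by (rule ennreal_dist_triangle)
          also have "\<dots> \<le> ennreal K3 * ?T + ennreal K2 * (ennreal K1 * ?T)"
            using 1 2 by (intro add_mono) (auto simp: c_def z_def abs_minus_commute)
          also have "\<dots> = ennreal K * ?T"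
            using K1(1) K2(1) K3(1) by (simp add: K_def distrib_right ennreal_mult mult.assoc)
          finally show "ennreal \<bar>\<phi> x - c y\<bar> \<le> ennreal K * ?T" .
        qed
      qed measurable
      also have "\<dots> \<le> ennreal (CB * dy (int k) powr \<tau>) * (ennreal K * (ennreal (CT * dy (int k) powr (s - \<tau>)) * S k))"
      proof (intro mult_left_mono)
        have "Lp_norm (m k) p (\<lambda>x. ennreal K * osc_tail s (appr \<sigma> \<phi>) k x) \<le> ennreal K * Lp_norm (m k) p (osc_tail s (appr \<sigma> \<phi>) k)"
          by (intro Lp_norm_cmult_le p_pos) measurable
        also have "\<dots> \<le> ennreal K * (ennreal (CT * dy (int k) powr (s - \<tau>)) * S k)"
          using CT(2)[OF apm, of k] by (intro mult_left_mono) (auto simp: S_def N_def)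
        finally show "Lp_norm (m k) p (\<lambda>x. ennreal K * osc_tail s (appr \<sigma> \<phi>) k x)
          \<le> ennreal K * (ennreal (CT * dy (int k) powr (s - \<tau>)) * S k)" .
      qed simp
      finally have "ennreal (2 powr (real k * s)) * Lp_norm lborel p (best_approx_mod (m k) 1 \<phi> (dy (int k)))
        \<le> ennreal (2 powr (real k * s)) * (ennreal (CB * dy (int k) powr \<tau>) * (ennreal K * (ennreal (CT * dy (int k) powr (s - \<tau>)) * S k)))"
        by (rule mult_left_mono) simp
      also have "\<dots> = ennreal (2 powr (real k * s) * ((CB * dy (int k) powr \<tau>) * (K * (CT * dy (int k) powr (s - \<tau>))))) * S k"
        using CB(1) CT(1) pos by (simp add: ennreal_mult mult.assoc)
      also have "2 powr (real k * s) * ((CB * dy (int k) powr \<tau>) * (K * (CT * dy (int k) powr (s - \<tau>))))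
        = D1 * (2 powr (real k * s) * (dy (int k) powr \<tau> * dy (int k) powr (s - \<tau>)))" by (simp add: D1_def mult_ac)
      also have "dy (int k) powr \<tau> * dy (int k) powr (s - \<tau>) = dy (int k) powr s" by (simp flip: powr_add)
      also have "2 powr (real k * s) * dy (int k) powr s = 1"
        unfolding dy_nat powr_powr by (simp flip: powr_add)
      finally show ?thesis by (simp add: dy_nat)
    qed
    \<comment> \<open>There is no scale k - 2 here. The approximating constant is 0, and the L_p
      norm of \<phi> absorbs these two terms.\<close>
    have early: "ennreal (2 powr (real k * s)) * Lp_norm lborel p (best_approx_mod (m k) 1 \<phi> (2 powr (- real k))) \<le> ennreal D2 * ?P"
      if k: "k < 2" for k
    proof -
      have "Lp_norm lborel p (best_approx_mod (m k) 1 \<phi> (dy (int k))) \<le> ennreal (CB * dy (int k) powr \<tau>) * Lp_norm (m k) p (\<lambda>x. ennreal \<bar>\<phi> x\<bar>)"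
        by (rule CB(2)[OF \<phi>1, where c="\<lambda>y. 0"]) auto
      also have "\<dots> \<le> ennreal CB * (ennreal CM * ?P)"
      proof (intro mult_mono CM k ennreal_leI)
        have "dy (int k) powr \<tau> \<le> 1 powr \<tau>"
          using dy_mono[of 0 "int k"] \<tau>_nonneg by (intro powr_mono2) auto
        then show "CB * dy (int k) powr \<tau> \<le> CB" using CB(1) by (simp add: mult_left_le)
      qed auto
      finally have "ennreal (2 powr (real k * s)) * Lp_norm lborel p (best_approx_mod (m k) 1 \<phi> (dy (int k)))
        \<le> ennreal 2 * (ennreal CB * (ennreal CM * ?P))"
      proof (intro mult_mono ennreal_leI)
        have "real k * s \<le> 1" using k s s_pos by (auto simp: less_2_cases_iff)
        then show "2 powr (real k * s) \<le> 2" using powr_mono[of "real k * s" 1 2] by simp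
      qed auto
      also have "\<dots> = ennreal D2 * ?P" using CB(1) CM(1) by (simp add: D2_def ennreal_mult mult.assoc)
      finally show ?thesis by (simp add: dy_nat)
    qed
    have "lq_norm q (\<lambda>k::nat. ennreal (2 powr (real k * s)) * Lp_norm lborel p (best_approx_mod (m k) 1 \<phi> (2 powr (- real k))))
      \<le> lq_norm q (\<lambda>k. ennreal D1 * S k + (if k < 2 then ennreal D2 * ?P else 0))"
    proof (intro Lp_norm_mono_AE[OF q])
      show "AE k in count_space UNIV. ennreal (2 powr (real k * s)) * Lp_norm lborel p (best_approx_mod (m k) 1 \<phi> (2 powr (- real k)))
        \<le> ennreal D1 * S k + (if k < 2 then ennreal D2 * ?P else 0)"
        unfolding AE_count_space
      proof
        fix k :: nat
        show "ennreal (2 powr (real k * s)) * Lp_norm lborel p (best_approx_mod (m k) 1 \<phi> (2 powr (- real k)))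
          \<le> ennreal D1 * S k + (if k < 2 then ennreal D2 * ?P else 0)"
        proof (cases "k < 2")
          case True
          then show ?thesis using early[OF True] by (simp add: add_increasing)
        next
          case False
          then show ?thesis using late[of k] by simp
        qed
      qed
    qed auto
    also have "\<dots> \<le> ennreal CP * (lq_norm q (\<lambda>k. ennreal D1 * S k) + lq_norm q (\<lambda>k::nat. if k < 2 then ennreal D2 * ?P else 0))"
      by (intro CP) auto
    also have "\<dots> \<le> ennreal CP * (ennreal D1 * (ennreal CQ * (ennreal (4 powr s) * lq_norm q a)) + ennreal CI * (ennreal D2 * ?P))"
    proof (intro mult_left_mono add_mono CI)
      have "lq_norm q (\<lambda>k. ennreal D1 * S k) \<le> ennreal D1 * lq_norm q S"
        by (intro Lp_norm_cmult_le[OF q]) auto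
      also have "lq_norm q S \<le> ennreal CQ * lq_norm q N"
        unfolding S_def by (intro CQ(2) lq_norm_inj_le[OF q]) (auto intro!: injI)
      also have "lq_norm q N \<le> ennreal (4 powr s) * lq_norm q a" by (rule lqN)
      finally show "lq_norm q (\<lambda>k. ennreal D1 * S k) \<le> ennreal D1 * (ennreal CQ * (ennreal (4 powr s) * lq_norm q a))"
        by (simp add: mult_left_mono)
    qed simp
    also have "\<dots> \<le> ennreal D * (?P + lq_norm q a)"
    proof -
      have "ennreal D1 * (ennreal CQ * (ennreal (4 powr s) * lq_norm q a)) + ennreal CI * (ennreal D2 * ?P)
        = ennreal (D1 * (CQ * 4 powr s)) * lq_norm q a + ennreal (CI * D2) * ?P"
        using CQ(1) CI(1) pos by (simp add: ennreal_mult mult.assoc)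
      also have "\<dots> \<le> ennreal (D1 * (CQ * 4 powr s) + CI * D2) * lq_norm q a + ennreal (D1 * (CQ * 4 powr s) + CI * D2) * ?P"
        using CQ(1) CI(1) pos by (intro add_mono mult_right_mono ennreal_leI) auto
      also have "\<dots> = ennreal (D1 * (CQ * 4 powr s) + CI * D2) * (?P + lq_norm q a)" by (simp only: distrib_left add.commute)
      finally have "ennreal CP * (ennreal D1 * (ennreal CQ * (ennreal (4 powr s) * lq_norm q a)) + ennreal CI * (ennreal D2 * ?P))
        \<le> ennreal CP * (ennreal (D1 * (CQ * 4 powr s) + CI * D2) * (?P + lq_norm q a))" by (rule mult_left_mono) simp
      also have "\<dots> = ennreal D * (?P + lq_norm q a)"
        unfolding D_def mult.assoc[symmetric] using CP(1) CQ(1) CI(1) pos by (subst ennreal_mult) auto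
      finally show ?thesis .
    qed
    finally have "intrinsic_norm s p q 1 m \<phi> \<le> (?P + lq_norm q a) + ennreal D * (?P + lq_norm q a)"
      unfolding intrinsic_norm_def by (intro add_mono) auto
    also have "\<dots> = ennreal (1 + D) * intrinsic_norm s p q \<sigma> m \<phi>"
      using pos by (simp add: intrinsic_norm_def a_def[abs_def] distrib_right)
    finally show "\<phi> \<in> L_loc 1 m \<and> intrinsic_norm s p q 1 m \<phi> \<le> ennreal (1 + D) * intrinsic_norm s p q \<sigma> m \<phi>"
      using \<phi>1 by simp
  qed (use pos in simp)
qed

end


subsection \<open>The extension operator\<close>

text \<open>A bounded kernel that vanishes off Q sees f - c only on Q. When its integral is 0 the
  constant c disappears from the left side and can be chosen at will; this is how differences of
  means are estimated.\<close>

lemma kernel_mean: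
  fixes f \<kappa> :: "'a \<Rightarrow> real"
  assumes [measurable]: "f \<in> borel_measurable M" "\<kappa> \<in> borel_measurable M" "Q \<in> sets M"
    and Q: "emeasure M Q < top" "(\<integral>\<^sup>+y\<in>Q. ennreal \<bar>f y\<bar> \<partial>M) < top"
    and \<kappa>: "\<And>y. \<bar>\<kappa> y\<bar> \<le> B" "\<And>y. y \<notin> Q \<Longrightarrow> \<kappa> y = 0"
  shows "integrable M \<kappa>" "integrable M (\<lambda>y. \<kappa> y * f y)"
    "ennreal \<bar>(\<integral>y. \<kappa> y * f y \<partial>M) - c * (\<integral>y. \<kappa> y \<partial>M)\<bar> \<le> ennreal B * (\<integral>\<^sup>+y\<in>Q. ennreal \<bar>f y - c\<bar> \<partial>M)"
proof -
  have B: "0 \<le> B" using \<kappa>(1) abs_ge_zero order_trans by blast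
  have le: "ennreal \<bar>\<kappa> y * h\<bar> \<le> ennreal B * (ennreal \<bar>h\<bar> * indicator Q y)" for y h
    using \<kappa>[of y] B by (cases "y \<in> Q") (auto simp: abs_mult ennreal_mult[symmetric] intro!: ennreal_leI mult_right_mono)
  show i1: "integrable M \<kappa>"
  proof (rule integrableI_bounded)
    have "(\<integral>\<^sup>+y. ennreal (norm (\<kappa> y)) \<partial>M) \<le> (\<integral>\<^sup>+y. ennreal B * indicator Q y \<partial>M)"
      using le[of _ 1] by (intro nn_integral_mono) simp
    also have "\<dots> < \<infinity>" using Q by (simp add: nn_integral_cmult_indicator ennreal_mult_less_top)
    finally show "(\<integral>\<^sup>+y. ennreal (norm (\<kappa> y)) \<partial>M) < \<infinity>" .
  qed measurable
  show i2: "integrable M (\<lambda>y. \<kappa> y * f y)"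
  proof (rule integrableI_bounded)
    have "(\<integral>\<^sup>+y. ennreal (norm (\<kappa> y * f y)) \<partial>M) \<le> (\<integral>\<^sup>+y. ennreal B * (ennreal \<bar>f y\<bar> * indicator Q y) \<partial>M)"
      using le by (intro nn_integral_mono) simp
    also have "\<dots> < \<infinity>" using Q by (simp add: nn_integral_cmult ennreal_mult_less_top)
    finally show "(\<integral>\<^sup>+y. ennreal (norm (\<kappa> y * f y)) \<partial>M) < \<infinity>" .
  qed measurable
  have eq: "(\<integral>y. \<kappa> y * f y \<partial>M) - c * (\<integral>y. \<kappa> y \<partial>M) = (\<integral>y. \<kappa> y * f y - c * \<kappa> y \<partial>M)"
    using i1 i2 by simp
  have i3: "integrable M (\<lambda>y. \<kappa> y * f y - c * \<kappa> y)" using i1 i2 by simp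
  have "ennreal \<bar>(\<integral>y. \<kappa> y * f y \<partial>M) - c * (\<integral>y. \<kappa> y \<partial>M)\<bar> \<le> (\<integral>\<^sup>+y. ennreal (norm (\<kappa> y * f y - c * \<kappa> y)) \<partial>M)"
    unfolding eq using integral_norm_bound_ennreal[OF i3] by simp
  also have "\<dots> \<le> (\<integral>\<^sup>+y. ennreal B * (ennreal \<bar>f y - c\<bar> * indicator Q y) \<partial>M)"
    using le[of _ "f y - c" for y] by (intro nn_integral_mono) (simp add: algebra_simps)
  also have "\<dots> = ennreal B * (\<integral>\<^sup>+y\<in>Q. ennreal \<bar>f y - c\<bar> \<partial>M)"
    by (simp add: nn_integral_cmult)
  finally show "ennreal \<bar>(\<integral>y. \<kappa> y * f y \<partial>M) - c * (\<integral>y. \<kappa> y \<partial>M)\<bar> \<le> ennreal B * (\<integral>\<^sup>+y\<in>Q. ennreal \<bar>f y - c\<bar> \<partial>M)" .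
qed

lemma quotient_diff_le:
  fixes a a' D D' :: real
  assumes "0 < D" "0 < D'" "0 \<le> a'"
  shows "\<bar>a / D - a' / D'\<bar> \<le> \<bar>a - a'\<bar> / D + a' * \<bar>D - D'\<bar> / (D * D')"
proof -
  have "a / D - a' / D' = (a - a') / D + a' * (D' - D) / (D * D')"
    using assms by (simp add: field_simps)
  also have "\<bar>\<dots>\<bar> \<le> \<bar>(a - a') / D\<bar> + \<bar>a' * (D' - D) / (D * D')\<bar>" by (rule abs_triangle_ineq)
  also have "\<dots> = \<bar>a - a'\<bar> / D + a' * \<bar>D - D'\<bar> / (D * D')"
    using assms by (simp add: abs_mult abs_minus_commute)
  finally show ?thesis .
qed

text \<open>The bump is at least 1/4 on the cube of radius 5/4 \<open>dy k\<close>, which contains a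
  full cube of radius \<open>dy k\<close> about any point of E at distance at most
  \<open>dy k / 4\<close>. Its support, of radius 3/2 \<open>dy k\<close>, stays within radius
  \<open>2 * dy k\<close> when the centre moves by \<open>dy k / 4\<close>.\<close>

definition bump :: "nat \<Rightarrow> real^'n \<Rightarrow> real^'n \<Rightarrow> real"
  where "bump k x y = max 0 (3 / 2 - infnorm (x - y) / dy (int k))"

lemma bump_bounds: "0 \<le> bump k x y" "bump k x y \<le> 3 / 2"
proof -
  have "0 \<le> infnorm (x - y) / dy (int k)" by (intro divide_nonneg_pos infnorm_pos_le) simp
  then show "0 \<le> bump k x y" "bump k x y \<le> 3 / 2" unfolding bump_def by linarith+
qed

lemma bump_abs_le: "\<bar>bump k x y\<bar> \<le> 3 / 2"
  using bump_bounds[of k x y] by (simp only: abs_of_nonneg)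

lemma bump_eq_0: "y \<notin> cube (3 / 2 * dy (int k)) x \<Longrightarrow> bump k x y = 0"
  by (auto simp: bump_def mem_cube infnorm_sub[of y x] field_simps)

lemma bump_ge: "y \<in> cube (5 / 4 * dy (int k)) x \<Longrightarrow> 1 / 4 \<le> bump k x y"
proof -
  assume "y \<in> cube (5 / 4 * dy (int k)) x"
  then have "infnorm (x - y) / dy (int k) \<le> 5 / 4"
    by (simp add: mem_cube infnorm_sub[of y x] pos_divide_le_eq)
  then show ?thesis unfolding bump_def by linarith
qed

lemma bump_lipschitz: "\<bar>bump k x y - bump k x' y\<bar> \<le> infnorm (x - x') / dy (int k)"
proof -
  have "\<bar>infnorm (x - y) - infnorm (x' - y)\<bar> \<le> infnorm (x - x')"
    using absdiff_infnorm[of "x - y" "x' - y"] by simp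
  then have "\<bar>infnorm (x - y) / dy (int k) - infnorm (x' - y) / dy (int k)\<bar> \<le> infnorm (x - x') / dy (int k)"
    by (simp add: diff_divide_distrib[symmetric] abs_divide divide_right_mono)
  then show ?thesis unfolding bump_def by linarith
qed

lemma measurable_bump [measurable (raw)]:
  assumes [measurable]: "f \<in> borel_measurable M" "g \<in> borel_measurable M"
  shows "(\<lambda>z. bump k (f z) (g z)) \<in> borel_measurable M"
  unfolding bump_def by measurable

section \<open>Weighted means near E\<close>

context trace_setting
begin

definition den :: "nat \<Rightarrow> real^'n \<Rightarrow> real"
  where "den k x = (\<integral>y. bump k x y \<partial>m k)"

definition wmean :: "nat \<Rightarrow> (real^'n \<Rightarrow> real) \<Rightarrow> real^'n \<Rightarrow> real"
  where "wmean k \<phi> x = (\<integral>y. bump k x y / den k x * \<phi> y \<partial>m k)"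

text \<open>Here the denominators \<open>den k\<close> are bounded below. Elsewhere
  \<open>wmean k\<close> may divide by 0, but there the cutoff of the same scale vanishes.\<close>

definition nbhd :: "nat \<Rightarrow> (real^'n) set"
  where "nbhd k = {x. \<exists>y\<in>E. infnorm (x - y) \<le> dy (int k) / 4}"

lemma nbhd_antimono: "j \<le> k \<Longrightarrow> nbhd k \<subseteq> nbhd j"
proof
  fix x assume "j \<le> k" "x \<in> nbhd k"
  then obtain y where "y \<in> E" "infnorm (x - y) \<le> dy (int k) / 4" by (auto simp: nbhd_def)
  moreover have "dy (int k) \<le> dy (int j)" using \<open>j \<le> k\<close> by (intro dy_mono) simp
  ultimately show "x \<in> nbhd j" unfolding nbhd_def by (intro CollectI bexI[of _ y]) auto
qed

lemma nbhd_hits: "x \<in> nbhd k \<Longrightarrow> cube (dy (int k)) x \<inter> E \<noteq> {}"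
proof -
  assume "x \<in> nbhd k"
  then obtain y where y: "y \<in> E" "infnorm (x - y) \<le> dy (int k) / 4" by (auto simp: nbhd_def)
  then have "y \<in> cube (dy (int k)) x"
    using dy_pos(1)[of "int k"] unfolding mem_cube infnorm_sub[of y x] by linarith
  with y show ?thesis by blast
qed

lemma measurable_m_integral:
  assumes [measurable]: "case_prod f \<in> borel_measurable (borel \<Otimes>\<^sub>M borel)"
  shows "(\<lambda>x. \<integral>y. f x y \<partial>m k :: real) \<in> borel_measurable borel"
proof -
  interpret sigma_finite_measure "m k" by (rule locally_finite_borel_sigma_finite[OF lf])
  show ?thesis by (rule borel_measurable_lebesgue_integral) measurable
qed

lemma measurable_wmean:
  assumes [measurable]: "\<phi> \<in> borel_measurable borel"
  shows "wmean k \<phi> \<in> borel_measurable borel"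
proof -
  have [measurable]: "den k \<in> borel_measurable borel"
    unfolding den_def by (rule measurable_m_integral) measurable
  show ?thesis unfolding wmean_def by (rule measurable_m_integral) measurable
qed

lemma L_loc_1_cube:
  assumes "\<phi> \<in> L_loc 1 m"
  shows "\<phi> \<in> borel_measurable borel" "(\<integral>\<^sup>+y\<in>cube r x. ennreal \<bar>\<phi> y\<bar> \<partial>m k) < top"
  using assms compact_cube[of r x] by (auto simp: L_loc_def)

lemma den_ge:
  assumes "x \<in> nbhd k"
  shows "C2 * dy (int k) powr d / 4 \<le> den k x"
proof -
  obtain y0 where y0: "y0 \<in> E" "infnorm (x - y0) \<le> dy (int k) / 4" using assms by (auto simp: nbhd_def)
  have i: "integrable (m k) (bump k x)"
    by (rule kernel_mean(1)[where f="\<lambda>y. 0" and Q="cube (3 / 2 * dy (int k)) x" and B="3 / 2"])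
       (use emeasure_cube_finite[OF lf] bump_abs_le bump_eq_0 in auto)
  have "ennreal (C2 * dy (int k) powr d) \<le> emeasure (m k) (cube (dy (int k)) y0)"
    using y0 dy_mono[of 0 "int k"] by (intro M2) (auto simp: dy_nat)
  also have "\<dots> \<le> emeasure (m k) (cube (5 / 4 * dy (int k)) x)"
    using y0(2) by (intro emeasure_mono cube_mono) (auto simp: infnorm_sub[of y0 x])
  finally have "ennreal (1 / 4) * ennreal (C2 * dy (int k) powr d) \<le> ennreal (1 / 4) * emeasure (m k) (cube (5 / 4 * dy (int k)) x)"
    by (rule mult_left_mono) simp
  also have "\<dots> = (\<integral>\<^sup>+y. ennreal (1 / 4) * indicator (cube (5 / 4 * dy (int k)) x) y \<partial>m k)"
    by (subst nn_integral_cmult_indicator) auto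
  also have "\<dots> \<le> (\<integral>\<^sup>+y. ennreal (bump k x y) \<partial>m k)"
  proof (intro nn_integral_mono)
    fix y show "ennreal (1 / 4) * indicator (cube (5 / 4 * dy (int k)) x) y \<le> ennreal (bump k x y)"
      using bump_ge[of y k x] by (cases "y \<in> cube (5 / 4 * dy (int k)) x") (auto intro: ennreal_leI)
  qed
  also have "\<dots> = ennreal (den k x)"
    unfolding den_def using i bump_bounds by (intro nn_integral_eq_integral) auto
  finally have "ennreal (1 / 4 * (C2 * dy (int k) powr d)) \<le> ennreal (den k x)"
    using C by (subst ennreal_mult) auto
  moreover have "0 \<le> den k x" unfolding den_def by (intro integral_nonneg_AE) (simp add: bump_bounds)
  ultimately show ?thesis by (simp add: ennreal_le_iff)
qed

lemma den_pos: "x \<in> nbhd k \<Longrightarrow> 0 < den k x"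
  using den_ge[of x k] C by (smt (verit) dy_pos(1) divide_pos_pos mult_pos_pos powr_gt_zero)

text \<open>The difference of two normalized kernels has integral 0, so any c may be subtracted from
  \<phi>. Its size is at most a multiple of t r^(-d), with t the distance of the centres relative to
  r = \<open>dy k\<close>, as numerator and denominator both vary by a multiple of that
  fraction.\<close>

lemma wmean_bounds:
  obtains K :: real where "0 < K"
    "\<And>\<phi> k x c. \<phi> \<in> L_loc 1 m \<Longrightarrow> x \<in> nbhd k \<Longrightarrow>
       ennreal \<bar>wmean k \<phi> x - c\<bar> \<le> ennreal (K / dy (int k) powr d) * (\<integral>\<^sup>+y\<in>cube (3 / 2 * dy (int k)) x. ennreal \<bar>\<phi> y - c\<bar> \<partial>m k)"
    "\<And>\<phi> k x x' c. \<phi> \<in> L_loc 1 m \<Longrightarrow> x \<in> nbhd k \<Longrightarrow> x' \<in> nbhd k \<Longrightarrow> infnorm (x - x') \<le> dy (int k) / 4 \<Longrightarrow>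
       ennreal \<bar>wmean k \<phi> x - wmean k \<phi> x'\<bar> \<le> ennreal (K * (infnorm (x - x') / dy (int k)) / dy (int k) powr d) *
         (\<integral>\<^sup>+y\<in>cube (2 * dy (int k)) x. ennreal \<bar>\<phi> y - c\<bar> \<partial>m k)"
proof -
  obtain C4 where C4: "0 < C4"
    "\<And>k j x. int k - 6 \<le> j \<Longrightarrow> emeasure (m k) (cube (dy j) x) \<le> ennreal (C4 * dy j powr d)"
    using mass_le by blast
  \<comment> \<open>6 / C2 bounds one normalized kernel. In the bracket, 4 / C2 comes from varying
    the numerator and the other summand from varying the denominator.\<close>
  define K where "K = 6 / C2 + (4 / C2 + 24 * (C4 * 2 powr d) / C2\<^sup>2)"
  have K: "0 < K" "6 / C2 \<le> K" "4 / C2 + 24 * (C4 * 2 powr d) / C2\<^sup>2 \<le> K"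
  proof -
    have "0 < 6 / C2" "0 < 4 / C2" "0 < 24 * (C4 * 2 powr d) / C2\<^sup>2" using C C4(1) by auto
    then show "0 < K" "6 / C2 \<le> K" "4 / C2 + 24 * (C4 * 2 powr d) / C2\<^sup>2 \<le> K"
      unfolding K_def by linarith+
  qed
  show ?thesis
  proof (rule that[OF K(1)])
    fix \<phi> k x c
    assume \<phi>: "\<phi> \<in> L_loc 1 m" and x: "x \<in> nbhd k"
    note [measurable] = L_loc_1_cube(1)[OF \<phi>]
    let ?D = "den k x" and ?r = "dy (int k)"
    have D: "0 < ?D" "C2 * ?r powr d / 4 \<le> ?D" using den_pos den_ge x by auto
    have int1: "(\<integral>y. bump k x y / ?D \<partial>m k) = 1" using D by (simp add: den_def[symmetric])
    have "bump k x y / ?D \<le> (3 / 2) / (C2 * ?r powr d / 4)" for y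
      using D C bump_bounds[of k x y] by (intro frac_le) auto
    then have B: "\<bar>bump k x y / ?D\<bar> \<le> 6 / C2 / ?r powr d" for y
      using D bump_bounds(1)[of k x y] by (simp add: abs_of_nonneg)
    have "ennreal \<bar>wmean k \<phi> x - c * (\<integral>y. bump k x y / ?D \<partial>m k)\<bar>
      \<le> ennreal (6 / C2 / ?r powr d) * (\<integral>\<^sup>+y\<in>cube (3 / 2 * ?r) x. ennreal \<bar>\<phi> y - c\<bar> \<partial>m k)"
      unfolding wmean_def
      by (rule kernel_mean(3)[OF _ _ _ _ _ B])
         (use emeasure_cube_finite[OF lf] bump_eq_0 L_loc_1_cube(2)[OF \<phi>] in auto)
    also have "\<dots> \<le> ennreal (K / ?r powr d) * (\<integral>\<^sup>+y\<in>cube (3 / 2 * ?r) x. ennreal \<bar>\<phi> y - c\<bar> \<partial>m k)"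
      using K by (intro mult_right_mono ennreal_leI divide_right_mono) auto
    finally show "ennreal \<bar>wmean k \<phi> x - c\<bar> \<le> ennreal (K / ?r powr d) * (\<integral>\<^sup>+y\<in>cube (3 / 2 * ?r) x. ennreal \<bar>\<phi> y - c\<bar> \<partial>m k)"
      unfolding int1 by simp
  next
    fix \<phi> k x x' c
    assume \<phi>: "\<phi> \<in> L_loc 1 m" and x: "x \<in> nbhd k" "x' \<in> nbhd k" and xx: "infnorm (x - x') \<le> dy (int k) / 4"
    note [measurable] = L_loc_1_cube(1)[OF \<phi>]
    let ?D = "den k x" and ?D' = "den k x'" and ?r = "dy (int k)"
    let ?Q = "cube (2 * ?r) x"
    define t where "t = infnorm (x - x') / ?r"
    define D0 where "D0 = C2 * ?r powr d / 4"
    have t: "0 \<le> t" by (simp add: t_def infnorm_pos_le)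
    have D0: "0 < D0" using C by (simp add: D0_def)
    have D: "0 < ?D" "D0 \<le> ?D" "0 < ?D'" "D0 \<le> ?D'" using den_pos den_ge x by (auto simp: D0_def)
    have sub: "cube (3 / 2 * ?r) x \<subseteq> ?Q" "cube (3 / 2 * ?r) x' \<subseteq> ?Q"
    proof -
      have "3 / 2 * ?r \<le> 2 * ?r" by simp
      then show "cube (3 / 2 * ?r) x \<subseteq> ?Q" by (rule cube_mono_radius)
      have "infnorm (x' - x) + 3 / 2 * ?r \<le> 2 * ?r"
        using xx dy_pos(1)[of "int k"] unfolding infnorm_sub[of x' x] by linarith
      then show "cube (3 / 2 * ?r) x' \<subseteq> ?Q" by (rule cube_mono)
    qed
    have z: "bump k x y = 0" "bump k x' y = 0" if "y \<notin> ?Q" for y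
      using that sub bump_eq_0 by blast+
    have fQ: "emeasure (m k) ?Q < top" by (rule emeasure_cube_finite[OF lf])
    have mQ: "emeasure (m k) ?Q \<le> ennreal (C4 * (2 * ?r) powr d)"
    proof -
      have e: "2 * ?r = dy (int k - 1)" by (simp add: dy_diff)
      show ?thesis unfolding e by (rule C4) simp
    qed
    have ints: "integrable (m k) (bump k x)" "integrable (m k) (bump k x')"
      by (rule kernel_mean(1)[where f="\<lambda>y. 0" and Q="?Q" and B="3 / 2"];
          use fQ bump_abs_le z in auto)+
    \<comment> \<open>The kernel estimate for the constant function 1 with c = 0 controls the
      variation of the denominators.\<close>
    have "ennreal \<bar>(\<integral>y. (bump k x y - bump k x' y) * 1 \<partial>m k) - 0 * (\<integral>y. bump k x y - bump k x' y \<partial>m k)\<bar>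
       \<le> ennreal t * (\<integral>\<^sup>+y\<in>?Q. ennreal \<bar>1 - 0\<bar> \<partial>m k)"
      by (rule kernel_mean(3)) (use fQ z bump_lipschitz[of k x _ x'] in \<open>auto simp: t_def\<close>)
    then have "ennreal \<bar>?D - ?D'\<bar> \<le> ennreal t * emeasure (m k) ?Q"
      using ints by (simp add: den_def)
    also have "\<dots> \<le> ennreal t * ennreal (C4 * (2 * ?r) powr d)" by (intro mult_left_mono mQ) simp
    finally have DD: "\<bar>?D - ?D'\<bar> \<le> t * (C4 * (2 * ?r) powr d)"
      using t C4(1) by (simp add: ennreal_mult[symmetric] ennreal_le_iff)
    let ?\<kappa> = "\<lambda>y. bump k x y / ?D - bump k x' y / ?D'"
    have B: "\<bar>?\<kappa> y\<bar> \<le> K * t / ?r powr d" for y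
    proof -
      have "\<bar>?\<kappa> y\<bar> \<le> \<bar>bump k x y - bump k x' y\<bar> / ?D + bump k x' y * \<bar>?D - ?D'\<bar> / (?D * ?D')"
        by (rule quotient_diff_le[OF D(1) D(3) bump_bounds(1)])
      also have "\<dots> \<le> t / D0 + (3 / 2) * (t * (C4 * (2 * ?r) powr d)) / (D0 * D0)"
        using D D0 DD bump_bounds[of k x' y] bump_lipschitz[of k x y x', folded t_def] t C4(1)
        by (intro add_mono frac_le mult_mono) auto
      also have "\<dots> = (4 / C2 + 24 * (C4 * 2 powr d) / C2\<^sup>2) * t / ?r powr d"
        using C by (simp add: D0_def powr_mult power2_eq_square field_simps)
      also have "\<dots> \<le> K * t / ?r powr d"
        using K t by (intro divide_right_mono mult_right_mono) auto
      finally show ?thesis .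
    qed
    have i2: "integrable (m k) (\<lambda>y. bump k x y / ?D * \<phi> y)" "integrable (m k) (\<lambda>y. bump k x' y / ?D' * \<phi> y)"
    proof -
      have b: "\<bar>bump k w y / den k w\<bar> \<le> 3 / 2 / D0" if "0 < den k w" "D0 \<le> den k w" for w y
      proof -
        have "bump k w y / den k w \<le> 3 / 2 / D0" using that D0 bump_bounds[of k w y] by (intro frac_le) auto
        moreover have "0 \<le> bump k w y / den k w" using that bump_bounds[of k w y] by simp
        ultimately show ?thesis by (simp only: abs_of_nonneg)
      qed
      show "integrable (m k) (\<lambda>y. bump k x y / ?D * \<phi> y)"
        by (rule kernel_mean(2)[where Q="?Q" and B="3 / 2 / D0"]) (use fQ z L_loc_1_cube(2)[OF \<phi>] b D in auto)
      show "integrable (m k) (\<lambda>y. bump k x' y / ?D' * \<phi> y)"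
        by (rule kernel_mean(2)[where Q="?Q" and B="3 / 2 / D0"]) (use fQ z L_loc_1_cube(2)[OF \<phi>] b D in auto)
    qed
    have "(\<integral>y. ?\<kappa> y \<partial>m k) = 0"
      using ints D by (simp add: den_def[symmetric])
    moreover have "wmean k \<phi> x - wmean k \<phi> x' = (\<integral>y. ?\<kappa> y * \<phi> y \<partial>m k)"
      unfolding wmean_def by (subst Bochner_Integration.integral_diff[OF i2, symmetric]) (simp add: left_diff_distrib)
    moreover have "ennreal \<bar>(\<integral>y. ?\<kappa> y * \<phi> y \<partial>m k) - c * (\<integral>y. ?\<kappa> y \<partial>m k)\<bar>
      \<le> ennreal (K * t / ?r powr d) * (\<integral>\<^sup>+y\<in>?Q. ennreal \<bar>\<phi> y - c\<bar> \<partial>m k)"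
      by (rule kernel_mean(3)[OF _ _ _ _ _ B]) (use fQ z L_loc_1_cube(2)[OF \<phi>] in auto)
    ultimately show "ennreal \<bar>wmean k \<phi> x - wmean k \<phi> x'\<bar> \<le> ennreal (K * (infnorm (x - x') / ?r) / ?r powr d) *
         (\<integral>\<^sup>+y\<in>?Q. ennreal \<bar>\<phi> y - c\<bar> \<partial>m k)"
      by (simp add: t_def)
  qed
qed

end


section \<open>Synthesis of Besov functions\<close>

lemma suminf_le_two_sided:
  fixes T :: "int \<Rightarrow> ennreal"
  shows "(\<Sum>i. T (int i)) \<le> (\<Sum>l. T (j + int l) + T (j - int l))"
proof -
  have bij1: "bij_betw int UNIV {0..}" by (intro bij_betwI[where g=nat]) auto
  have half: "(\<integral>\<^sup>+z. U z * indicator {0..} z \<partial>count_space UNIV) = (\<Sum>l. U (int l))" for U :: "int \<Rightarrow> ennreal"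
  proof -
    have "(\<integral>\<^sup>+z. U z * indicator {0..} z \<partial>count_space UNIV) = (\<integral>\<^sup>+z. U z \<partial>count_space {0..})"
      by (subst nn_integral_count_space_indicator[of "{0..}"]) auto
    also have "\<dots> = (\<integral>\<^sup>+l. U (int l) \<partial>count_space UNIV)"
      by (rule nn_integral_bij_count_space[OF bij1, symmetric])
    finally show ?thesis by (simp add: nn_integral_count_space_nat)
  qed
  have "(\<Sum>i. T (int i)) = (\<integral>\<^sup>+z. T z * indicator {0..} z \<partial>count_space UNIV)" by (rule half[symmetric])
  also have "\<dots> \<le> (\<integral>\<^sup>+z. T z \<partial>count_space UNIV)" by (intro nn_integral_mono) (auto simp: indicator_def)
  also have "\<dots> = (\<integral>\<^sup>+z. T (j + z) \<partial>count_space UNIV)"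
    by (rule nn_integral_bij_count_space[symmetric]) (intro bij_betwI[where g="\<lambda>z. z - j"], auto)
  \<comment> \<open>The two half-lines overlap at 0, so that term is counted twice; an upper bound
    is all that is wanted.\<close>
  also have "\<dots> \<le> (\<integral>\<^sup>+z. T (j + z) * indicator {0..} z + T (j + z) * indicator {..0} z \<partial>count_space UNIV)"
    by (intro nn_integral_mono) (auto simp: indicator_def)
  also have "\<dots> = (\<Sum>l. T (j + int l)) + (\<integral>\<^sup>+z. T (j + z) * indicator {..0} z \<partial>count_space UNIV)"
    by (simp add: nn_integral_add half)
  also have "(\<integral>\<^sup>+z. T (j + z) * indicator {..0} z \<partial>count_space UNIV)
      = (\<integral>\<^sup>+z. T (j + (- z)) * indicator {..0} (- z) \<partial>count_space UNIV)"
    by (rule nn_integral_bij_count_space[symmetric]) (intro bij_betwI[where g=uminus], auto)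
  also have "\<dots> = (\<integral>\<^sup>+z. T (j - z) * indicator {0..} z \<partial>count_space UNIV)"
    by (intro nn_integral_cong) (auto simp: indicator_def)
  also have "\<dots> = (\<Sum>l. T (j - int l))" by (rule half)
  also have "(\<Sum>l. T (j + int l)) + (\<Sum>l. T (j - int l)) = (\<Sum>l. T (j + int l) + T (j - int l))"
    by (rule suminf_add) auto
  finally show ?thesis .
qed

lemma suminf_real_bounds:
  fixes v :: "nat \<Rightarrow> real" and R :: "nat \<Rightarrow> ennreal"
  assumes le: "\<And>i. ennreal \<bar>v i\<bar> \<le> R i" and fin: "(\<Sum>i. R i) < top"
  shows "summable v" "ennreal \<bar>\<Sum>i. v i\<bar> \<le> (\<Sum>i. R i)"
proof -
  have "(\<Sum>i. ennreal \<bar>v i\<bar>) \<le> (\<Sum>i. R i)" by (intro suminf_le le) auto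
  then have f: "(\<Sum>i. ennreal \<bar>v i\<bar>) < top" using fin by (rule le_less_trans)
  then have sa: "summable (\<lambda>i. \<bar>v i\<bar>)" by (intro summable_suminf_not_top) auto
  then show "summable v" by (rule summable_rabs_cancel)
  have "ennreal \<bar>\<Sum>i. v i\<bar> \<le> ennreal (\<Sum>i. \<bar>v i\<bar>)" by (intro ennreal_leI summable_rabs sa)
  also have "\<dots> = (\<Sum>i. ennreal \<bar>v i\<bar>)" using sa by (simp add: suminf_ennreal2)
  also have "\<dots> \<le> (\<Sum>i. R i)" by fact
  finally show "ennreal \<bar>\<Sum>i. v i\<bar> \<le> (\<Sum>i. R i)" .
qed

text \<open>The minimum is what a term of scale i contributes to a difference at distance
  \<open>dy j\<close>: its size if it is finer, its Lipschitz bound if it is coarser. The weights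
  decay on both sides of j, at rate s for finer terms and 1 - s for coarser ones.\<close>

lemma min_powr_le:
  fixes s \<delta> :: real and i j :: int
  assumes "\<delta> \<le> s" "\<delta> \<le> 1 - s"
  shows "dy j powr (- s) * min 1 (dy j / dy i) * dy i powr s \<le> 2 powr (- \<delta> * real_of_int \<bar>i - j\<bar>)"
proof -
  let ?t = "real_of_int (i - j)"
  have e1: "dy j powr (- s) * dy i powr s = 2 powr (- s * ?t)"
    by (simp add: dy_def powr_powr powr_add[symmetric] algebra_simps)
  have e2: "dy j / dy i = 2 powr ?t" by (simp add: dy_def powr_diff[symmetric])
  show ?thesis
  proof (cases "j \<le> i")
    case True
    have "dy j powr (- s) * min 1 (dy j / dy i) * dy i powr s \<le> dy j powr (- s) * 1 * dy i powr s"
      by (intro mult_right_mono mult_left_mono) auto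
    also have "\<dots> = 2 powr (- s * ?t)" using e1 by simp
    also have "\<dots> \<le> 2 powr (- \<delta> * real_of_int \<bar>i - j\<bar>)"
      using True assms by (intro powr_mono) (auto intro!: mult_right_mono)
    finally show ?thesis .
  next
    case False
    have "dy j powr (- s) * min 1 (dy j / dy i) * dy i powr s \<le> dy j powr (- s) * (dy j / dy i) * dy i powr s"
      by (intro mult_right_mono mult_left_mono) auto
    also have "\<dots> = 2 powr ?t * (dy j powr (- s) * dy i powr s)" unfolding e2 by (simp add: mult_ac)
    also have "\<dots> = 2 powr ((1 - s) * ?t)" unfolding e1 by (simp add: powr_add[symmetric] algebra_simps)
    also have "\<dots> \<le> 2 powr (- \<delta> * real_of_int \<bar>i - j\<bar>)"
    proof (intro powr_mono)
      have "(1 - s) * ?t \<le> \<delta> * ?t" using False assms by (intro mult_right_mono_neg) auto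
      then show "(1 - s) * ?t \<le> - \<delta> * real_of_int \<bar>i - j\<bar>" using False by (simp add: algebra_simps)
    qed simp
    finally show ?thesis .
  qed
qed

text \<open>As \<open>s < 1\<close>, it is enough that \<open>v i\<close> is Lipschitz at the scale \<open>dy i\<close>.\<close>

lemma besov_synthesis:
  fixes s :: real and p q :: ennreal
  assumes s: "0 < s" "s < 1" and p: "0 < p" and q: "0 < q"
  obtains C :: real where "0 < C"
    "\<And>(v :: nat \<Rightarrow> real^'n \<Rightarrow> real) R. (\<And>i. v i \<in> borel_measurable borel) \<Longrightarrow> (\<And>i. R i \<in> borel_measurable borel) \<Longrightarrow>
      (\<And>i x. ennreal \<bar>v i x\<bar> \<le> R i x) \<Longrightarrow>
      (\<And>i x y. ennreal \<bar>v i x - v i y\<bar> \<le> ennreal (infnorm (x - y) / dy (int i)) * (R i x + R i y)) \<Longrightarrow>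
      lq_norm q (\<lambda>i. ennreal (2 powr (real i * s)) * Lp_norm lborel p (R i)) < top \<Longrightarrow>
      (AE x in lborel. (\<Sum>i. R i x) < top) \<and>
      besov_norm s p q (\<lambda>x. \<Sum>i. v i x) \<le> ennreal C * lq_norm q (\<lambda>i. ennreal (2 powr (real i * s)) * Lp_norm lborel p (R i))"
proof -
  define \<delta> where "\<delta> = min s (1 - s)"
  have \<delta>: "0 < \<delta>" "0 < \<delta> / 2" "\<delta> \<le> s" "\<delta> \<le> 1 - s" using s by (auto simp: \<delta>_def)
  obtain G1 where G1: "0 < G1"
    "\<And>(M :: (real^'n) measure) f B. (\<And>i. f i \<in> borel_measurable M) \<Longrightarrow> (\<And>i. Lp_norm M p (f i) \<le> B) \<Longrightarrow>
       Lp_norm M p (\<lambda>x. \<Sum>i. ennreal (2 powr (- s * real i)) * f i x) \<le> ennreal G1 * B"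
    using Lp_norm_geometric[OF s(1) p] by blast
  obtain G2 where G2: "0 < G2"
    "\<And>(M :: (real^'n) measure) f B. (\<And>i. f i \<in> borel_measurable M) \<Longrightarrow> (\<And>i. Lp_norm M p (f i) \<le> B) \<Longrightarrow>
       Lp_norm M p (\<lambda>x. \<Sum>i. ennreal (2 powr (- (\<delta> / 2) * real i)) * f i x) \<le> ennreal G2 * B"
    using Lp_norm_geometric[OF \<delta>(2) p] by blast
  obtain G3 where G3: "0 < G3"
    "\<And>(M :: int measure) f B. (\<And>i. f i \<in> borel_measurable M) \<Longrightarrow> (\<And>i. Lp_norm M q (f i) \<le> B) \<Longrightarrow>
       Lp_norm M q (\<lambda>x. \<Sum>i. ennreal (2 powr (- (\<delta> / 2) * real i)) * f i x) \<le> ennreal G3 * B"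
    using Lp_norm_geometric[OF \<delta>(2) q] by blast
  obtain A2 where A2: "0 < A2"
    "\<And>(M :: (real^'n) measure) f g. f \<in> borel_measurable M \<Longrightarrow> g \<in> borel_measurable M \<Longrightarrow>
       Lp_norm M p (\<lambda>x. f x + g x) \<le> ennreal A2 * (Lp_norm M p f + Lp_norm M p g)"
    using Lp_norm_add_le[OF p] by blast
  obtain A3 where A3: "0 < A3"
    "\<And>(M :: int measure) f g. f \<in> borel_measurable M \<Longrightarrow> g \<in> borel_measurable M \<Longrightarrow>
       Lp_norm M q (\<lambda>x. f x + g x) \<le> ennreal A3 * (Lp_norm M q f + Lp_norm M q g)"
    using Lp_norm_add_le[OF q] by blast
  define C where "C = G1 + 2 powr s * (G2 * A2 * (G3 * (A3 * 2)))"
  have pos: "0 < 2 powr s * (G2 * A2 * (G3 * (A3 * 2)))" using G2(1) G3(1) A2(1) A3(1) by simp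
  show ?thesis
  proof (rule that[of C])
    show "0 < C" unfolding C_def by (rule add_pos_pos[OF G1(1) pos])
    fix v :: "nat \<Rightarrow> real^'n \<Rightarrow> real" and R
    assume [measurable]: "\<And>i. v i \<in> borel_measurable borel" "\<And>i. R i \<in> borel_measurable borel"
      and vR: "\<And>i x. ennreal \<bar>v i x\<bar> \<le> R i x"
      and vL: "\<And>i x y. ennreal \<bar>v i x - v i y\<bar> \<le> ennreal (infnorm (x - y) / dy (int i)) * (R i x + R i y)"
      and fin: "lq_norm q (\<lambda>i. ennreal (2 powr (real i * s)) * Lp_norm lborel p (R i)) < top"
    define b where "b i = ennreal (2 powr (real i * s)) * Lp_norm lborel p (R i)" for i
    let ?B = "lq_norm q b"
    let ?f = "\<lambda>x. \<Sum>i. v i x"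
    have Bfin: "?B < top" using fin by (simp add: b_def[abs_def])
    have bB: "b i \<le> ?B" for i by (rule le_lq_norm[OF q])
    \<comment> \<open>As s > 0, the weights 2^(is) already make the majorants summable in L_p; this
      controls the L_p part of the norm and makes the series converge almost everywhere.\<close>
    have sumR: "Lp_norm lborel p (\<lambda>x. \<Sum>i. R i x) \<le> ennreal G1 * ?B"
    proof -
      have "(\<lambda>x. \<Sum>i. R i x) = (\<lambda>x. \<Sum>i. ennreal (2 powr (- s * real i)) * (ennreal (2 powr (real i * s)) * R i x))"
        by (simp add: mult.assoc[symmetric] ennreal_mult[symmetric] powr_add[symmetric] mult.commute[of s])
      then show ?thesis
      proof (simp only:, intro G1(2))
        fix i
        have "Lp_norm lborel p (\<lambda>x. ennreal (2 powr (real i * s)) * R i x) \<le> b i"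
          unfolding b_def by (intro Lp_norm_cmult_le p) measurable
        also have "\<dots> \<le> ?B" by (rule bB)
        finally show "Lp_norm lborel p (\<lambda>x. ennreal (2 powr (real i * s)) * R i x) \<le> ?B" .
      qed measurable
    qed
    have AEfin: "AE x in lborel. (\<Sum>i. R i x) < top"
    proof (rule Lp_norm_finite_AE[OF p])
      show "Lp_norm lborel p (\<lambda>x. \<Sum>i. R i x) < top"
        using sumR Bfin by (auto simp: ennreal_mult_less_top intro: le_less_trans)
    qed measurable
    have normf: "Lp_norm lborel p (\<lambda>x. ennreal \<bar>?f x\<bar>) \<le> ennreal G1 * ?B"
    proof -
      have "Lp_norm lborel p (\<lambda>x. ennreal \<bar>?f x\<bar>) \<le> Lp_norm lborel p (\<lambda>x. \<Sum>i. R i x)"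
      proof (rule Lp_norm_mono_AE[OF p])
        show "AE x in lborel. ennreal \<bar>?f x\<bar> \<le> (\<Sum>i. R i x)"
          using AEfin by eventually_elim (rule suminf_real_bounds(2)[OF vR])
      qed measurable
      with sumR show ?thesis by (rule order_trans[rotated])
    qed
    define H where "H j x = (\<Sum>i. ennreal (min 1 (dy j / dy (int i))) * R i x)" for j x
    \<comment> \<open>2^s makes up for |x - y| being possibly as small as \<open>dy j / 2\<close>.
      Where \<open>H j\<close> is infinite, \<open>enn2real\<close> gives 0, but such points belong
      to the exceptional null set.\<close>
    define g where "g j x = 2 powr s * dy j powr (- s) * enn2real (H j x)" for j x
    have Hm[measurable]: "H j \<in> borel_measurable borel" for j unfolding H_def by measurable
    have gm[measurable]: "g j \<in> borel_measurable borel" for j unfolding g_def by measurable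
    have Hle: "H j x \<le> (\<Sum>i. R i x)" for j x
      unfolding H_def
    proof (intro suminf_le)
      fix i
      have "ennreal (min 1 (dy j / dy (int i))) * R i x \<le> ennreal 1 * R i x"
        by (intro mult_right_mono ennreal_leI) auto
      then show "ennreal (min 1 (dy j / dy (int i))) * R i x \<le> R i x" by simp
    qed auto
    have grad: "g \<in> frac_gradients s ?f"
      unfolding frac_gradients_def
    proof (intro CollectI conjI allI gm)
      show "0 \<le> g k x" for k x by (simp add: g_def)
      let ?N = "{x. \<not> (\<Sum>i. R i x) < top}"
      have "?N \<in> null_sets lborel"
        using AEfin by (subst (asm) AE_iff_null) auto
      then have N: "?N \<in> null_sets lebesgue" by (rule null_sets_completionI)
      show "\<exists>N\<in>null_sets lebesgue. \<forall>k. \<forall>x\<in>- N. \<forall>y\<in>- N. 2 powi (- k - 1) \<le> infnorm (x - y) \<and> infnorm (x - y) < 2 powi (- k) \<longrightarrow>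
           \<bar>?f x - ?f y\<bar> \<le> infnorm (x - y) powr s * (g k x + g k y)"
      proof (intro bexI[OF _ N] allI ballI impI)
        fix k x y assume x: "x \<in> - ?N" and y: "y \<in> - ?N"
          and r: "2 powi (- k - 1) \<le> infnorm (x - y) \<and> infnorm (x - y) < 2 powi (- k)"
        have "(2::real) powi (- k - 1) = dy k / 2" using dy_powi[of "k + 1"] by (simp add: dy_add)
        with r have r: "dy k / 2 \<le> infnorm (x - y)" "infnorm (x - y) < dy k" by (auto simp: dy_powi)
        have fx: "(\<Sum>i. R i x) < top" and fy: "(\<Sum>i. R i y) < top" using x y by auto
        have Hx: "H k x < top" "H k y < top" using Hle fx fy le_less_trans by blast+
        have diff: "?f x - ?f y = (\<Sum>i. v i x - v i y)"
          using suminf_real_bounds(1)[OF vR fx] suminf_real_bounds(1)[OF vR fy] by (rule suminf_diff)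
        have le: "ennreal \<bar>v i x - v i y\<bar> \<le> ennreal (min 1 (dy k / dy (int i))) * R i x + ennreal (min 1 (dy k / dy (int i))) * R i y" for i
        proof (cases "dy k / dy (int i) \<le> 1")
          case True
          have "ennreal \<bar>v i x - v i y\<bar> \<le> ennreal (infnorm (x - y) / dy (int i)) * (R i x + R i y)" by (rule vL)
          also have "\<dots> \<le> ennreal (dy k / dy (int i)) * (R i x + R i y)"
            using r by (intro mult_right_mono ennreal_leI divide_right_mono) auto
          finally show ?thesis using True by (simp add: min_absorb2 distrib_left)
        next
          case False
          have "ennreal \<bar>v i x - v i y\<bar> \<le> ennreal \<bar>v i x\<bar> + ennreal \<bar>v i y\<bar>"
            using ennreal_dist_triangle[of "v i x" "v i y" 0] by simp
          also have "\<dots> \<le> R i x + R i y" by (intro add_mono vR)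
          finally show ?thesis using False by (simp add: min_absorb1)
        qed
        have sumH: "(\<Sum>i. ennreal (min 1 (dy k / dy (int i))) * R i x + ennreal (min 1 (dy k / dy (int i))) * R i y) = H k x + H k y"
          unfolding H_def by (rule suminf_add[symmetric]) auto
        have "ennreal \<bar>?f x - ?f y\<bar> \<le> H k x + H k y"
          unfolding diff sumH[symmetric] by (rule suminf_real_bounds(2)[OF le]) (use Hx sumH in simp)
        also have "\<dots> = ennreal (enn2real (H k x) + enn2real (H k y))" using Hx by (simp add: less_top)
        finally have 1: "\<bar>?f x - ?f y\<bar> \<le> enn2real (H k x) + enn2real (H k y)"
          by (subst (asm) ennreal_le_iff) auto
        have "1 = (dy k / 2) powr s * (2 powr s * dy k powr (- s))"
          by (simp add: powr_divide powr_minus)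
        also have "\<dots> \<le> infnorm (x - y) powr s * (2 powr s * dy k powr (- s))"
          using r s by (intro mult_right_mono powr_mono2) auto
        finally have "1 * (enn2real (H k x) + enn2real (H k y))
          \<le> infnorm (x - y) powr s * (2 powr s * dy k powr (- s)) * (enn2real (H k x) + enn2real (H k y))"
          by (rule mult_right_mono) simp
        with 1 show "\<bar>?f x - ?f y\<bar> \<le> infnorm (x - y) powr s * (g k x + g k y)"
          by (simp add: g_def algebra_simps)
      qed
    qed
    \<comment> \<open>The majorants with their weights 2^(is), continued by 0 to negative scales so
      that shifts in both directions are defined for every integer j.\<close>
    define \<rho> where "\<rho> z x = (if z < 0 then 0 else ennreal (2 powr (real (nat z) * s)) * R (nat z) x)" for z :: int and x
    define \<beta> where "\<beta> z = (if z < 0 then 0 else b (nat z))" for z :: int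
    have \<rho>m[measurable]: "\<rho> z \<in> borel_measurable borel" for z unfolding \<rho>_def by measurable
    have \<rho>n: "Lp_norm lborel p (\<rho> z) \<le> \<beta> z" for z
    proof (cases "z < 0")
      case True
      then have "\<rho> z = (\<lambda>x. 0)" by (simp add: \<rho>_def fun_eq_iff)
      then show ?thesis by (simp add: Lp_norm_zero[OF p])
    next
      case False
      then have "\<rho> z = (\<lambda>x. ennreal (2 powr (real (nat z) * s)) * R (nat z) x)" by (simp add: \<rho>_def fun_eq_iff)
      then show ?thesis using False unfolding \<beta>_def b_def by (simp only: if_False) (intro Lp_norm_cmult_le p, measurable)
    qed
    have Hb: "ennreal (dy j powr (- s)) * H j x \<le> (\<Sum>l. ennreal (2 powr (- \<delta> * real l)) * (\<rho> (j + int l) x + \<rho> (j - int l) x))" for j x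
    proof -
      define T where "T z = ennreal (2 powr (- \<delta> * real_of_int \<bar>z - j\<bar>)) * \<rho> z x" for z
      have "ennreal (dy j powr (- s)) * H j x = (\<Sum>i. ennreal (dy j powr (- s)) * (ennreal (min 1 (dy j / dy (int i))) * R i x))"
        unfolding H_def by simp
      also have "\<dots> \<le> (\<Sum>i. T (int i))"
      proof (intro suminf_le)
        fix i
        have e: "R i x = ennreal (dy (int i) powr s) * \<rho> (int i) x"
        proof -
          have "dy (int i) powr s * 2 powr (real i * s) = 1"
            unfolding dy_nat powr_powr by (simp flip: powr_add)
          then have "ennreal (dy (int i) powr s) * ennreal (2 powr (real i * s)) = 1"
            by (simp flip: ennreal_mult)
          then show ?thesis by (simp add: \<rho>_def mult.assoc[symmetric])
        qed
        have "ennreal (dy j powr (- s)) * (ennreal (min 1 (dy j / dy (int i))) * R i x)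
          = ennreal (dy j powr (- s) * min 1 (dy j / dy (int i)) * dy (int i) powr s) * \<rho> (int i) x"
          unfolding e by (simp add: ennreal_mult mult.assoc)
        also have "\<dots> \<le> T (int i)"
          unfolding T_def by (intro mult_right_mono ennreal_leI min_powr_le \<delta>) simp
        finally show "ennreal (dy j powr (- s)) * (ennreal (min 1 (dy j / dy (int i))) * R i x) \<le> T (int i)" .
      qed auto
      also have "\<dots> \<le> (\<Sum>l. T (j + int l) + T (j - int l))" by (rule suminf_le_two_sided)
      finally show ?thesis by (simp add: T_def distrib_left)
    qed
    have \<beta>lq: "lq_norm q \<beta> \<le> ?B" unfolding \<beta>_def by (rule lq_norm_extend_le[OF q])
    \<comment> \<open>One half of the decay \<delta> has been kept for the L_p sum over l; the half
      used here also serves the l_q sum over shifts.\<close>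
    define S where "S j = (\<Sum>l. ennreal (2 powr (- (\<delta> / 2) * real l)) * (\<beta> (j + int l) + \<beta> (j - int l)))" for j :: int
    have gn: "Lp_norm lborel p (\<lambda>x. ennreal (g j x)) \<le> ennreal (2 powr s * (G2 * A2)) * S j" for j
    proof -
      define F where "F l x = ennreal (2 powr (- (\<delta> / 2) * real l)) * (\<rho> (j + int l) x + \<rho> (j - int l) x)" for l :: nat and x
      have Fm[measurable]: "F l \<in> borel_measurable borel" for l unfolding F_def by measurable
      have F: "Lp_norm lborel p (F l) \<le> ennreal A2 * S j" for l
      proof -
        have "Lp_norm lborel p (F l) \<le> ennreal (2 powr (- (\<delta> / 2) * real l)) * Lp_norm lborel p (\<lambda>x. \<rho> (j + int l) x + \<rho> (j - int l) x)"
          unfolding F_def by (intro Lp_norm_cmult_le p) measurable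
        also have "\<dots> \<le> ennreal (2 powr (- (\<delta> / 2) * real l)) * (ennreal A2 * (\<beta> (j + int l) + \<beta> (j - int l)))"
        proof (intro mult_left_mono)
          have "Lp_norm lborel p (\<lambda>x. \<rho> (j + int l) x + \<rho> (j - int l) x) \<le> ennreal A2 * (Lp_norm lborel p (\<rho> (j + int l)) + Lp_norm lborel p (\<rho> (j - int l)))"
            by (intro A2) auto
          also have "\<dots> \<le> ennreal A2 * (\<beta> (j + int l) + \<beta> (j - int l))" by (intro mult_left_mono add_mono \<rho>n) simp
          finally show "Lp_norm lborel p (\<lambda>x. \<rho> (j + int l) x + \<rho> (j - int l) x) \<le> ennreal A2 * (\<beta> (j + int l) + \<beta> (j - int l))" .
        qed simp
        also have "\<dots> = ennreal A2 * (ennreal (2 powr (- (\<delta> / 2) * real l)) * (\<beta> (j + int l) + \<beta> (j - int l)))"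
          by (rule mult.left_commute)
        also have "\<dots> \<le> ennreal A2 * S j"
          unfolding S_def using sum_le_suminf[of "\<lambda>l. ennreal (2 powr (- (\<delta> / 2) * real l)) * (\<beta> (j + int l) + \<beta> (j - int l))" "{l}"]
          by (intro mult_left_mono) auto
        finally show ?thesis .
      qed
      have "Lp_norm lborel p (\<lambda>x. ennreal (g j x)) \<le> Lp_norm lborel p (\<lambda>x. ennreal (2 powr s) * (\<Sum>l. ennreal (2 powr (- (\<delta> / 2) * real l)) * F l x))"
      proof (rule Lp_norm_mono_AE[OF p])
        show "AE x in lborel. ennreal (g j x) \<le> ennreal (2 powr s) * (\<Sum>l. ennreal (2 powr (- (\<delta> / 2) * real l)) * F l x)"
        proof (intro AE_I2)
          fix x
          have "ennreal (g j x) = ennreal (2 powr s) * (ennreal (dy j powr (- s)) * ennreal (enn2real (H j x)))"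
            by (simp add: g_def ennreal_mult mult.assoc)
          also have "\<dots> \<le> ennreal (2 powr s) * (ennreal (dy j powr (- s)) * H j x)"
            by (intro mult_left_mono) (cases "H j x"; simp)+
          also have "\<dots> \<le> ennreal (2 powr s) * (\<Sum>l. ennreal (2 powr (- \<delta> * real l)) * (\<rho> (j + int l) x + \<rho> (j - int l) x))"
            by (intro mult_left_mono Hb) simp
          also have "(\<Sum>l. ennreal (2 powr (- \<delta> * real l)) * (\<rho> (j + int l) x + \<rho> (j - int l) x))
            = (\<Sum>l. ennreal (2 powr (- (\<delta> / 2) * real l)) * F l x)"
            unfolding F_def
            by (intro suminf_cong) (simp add: mult.assoc[symmetric] ennreal_mult[symmetric] powr_add[symmetric] del: distrib_left)
          finally show "ennreal (g j x) \<le> ennreal (2 powr s) * (\<Sum>l. ennreal (2 powr (- (\<delta> / 2) * real l)) * F l x)" .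
        qed
      qed measurable
      also have "\<dots> \<le> ennreal (2 powr s) * Lp_norm lborel p (\<lambda>x. \<Sum>l. ennreal (2 powr (- (\<delta> / 2) * real l)) * F l x)"
        by (intro Lp_norm_cmult_le p) measurable
      also have "\<dots> \<le> ennreal (2 powr s) * (ennreal G2 * (ennreal A2 * S j))"
        by (intro mult_left_mono G2(2) F) auto
      finally show ?thesis using G2(1) A2(1) by (simp add: ennreal_mult mult.assoc)
    qed
    have "lq_norm q (\<lambda>j. Lp_norm lborel p (\<lambda>x. ennreal (g j x))) \<le> lq_norm q (\<lambda>j. ennreal (2 powr s * (G2 * A2)) * S j)"
      using gn by (intro Lp_norm_mono_AE[OF q]) (auto simp: AE_count_space)
    also have "\<dots> \<le> ennreal (2 powr s * (G2 * A2)) * lq_norm q S"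
      by (intro Lp_norm_cmult_le[OF q]) auto
    also have "\<dots> \<le> ennreal (2 powr s * (G2 * A2)) * (ennreal G3 * (ennreal A3 * (2 * ?B)))"
    proof (intro mult_left_mono)
      show "lq_norm q S \<le> ennreal G3 * (ennreal A3 * (2 * ?B))"
        unfolding S_def
      proof (intro G3(2))
        fix l
        have "lq_norm q (\<lambda>j. \<beta> (j + int l) + \<beta> (j - int l)) \<le> ennreal A3 * (lq_norm q (\<lambda>j. \<beta> (j + int l)) + lq_norm q (\<lambda>j. \<beta> (j - int l)))"
          by (intro A3(2)) auto
        also have "\<dots> \<le> ennreal A3 * (?B + ?B)"
        proof (intro mult_left_mono add_mono)
          show "lq_norm q (\<lambda>j. \<beta> (j + int l)) \<le> ?B"
            using lq_norm_inj_le[OF q, of "\<lambda>j. j + int l" \<beta>] \<beta>lq by (auto intro: order_trans injI)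
          show "lq_norm q (\<lambda>j. \<beta> (j - int l)) \<le> ?B"
            using lq_norm_inj_le[OF q, of "\<lambda>j. j - int l" \<beta>] \<beta>lq by (auto intro: order_trans injI)
        qed simp
        finally show "lq_norm q (\<lambda>j. \<beta> (j + int l) + \<beta> (j - int l)) \<le> ennreal A3 * (2 * ?B)" by (simp add: mult_2)
      qed auto
    qed simp
    also have "\<dots> = ennreal (2 powr s * (G2 * A2 * (G3 * (A3 * 2)))) * ?B"
      using G2(1) G3(1) A2(1) A3(1) by (simp add: ennreal_mult mult.assoc)
    finally have "lq_norm q (\<lambda>j. Lp_norm lborel p (\<lambda>x. ennreal (g j x))) \<le> ennreal (2 powr s * (G2 * A2 * (G3 * (A3 * 2)))) * ?B" .
    then have "(INF g\<in>frac_gradients s ?f. lq_norm q (\<lambda>k. Lp_norm lborel p (\<lambda>x. ennreal (g k x))))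
      \<le> ennreal (2 powr s * (G2 * A2 * (G3 * (A3 * 2)))) * ?B"
      by (rule INF_lower2[OF grad])
    with normf have "besov_norm s p q ?f \<le> ennreal G1 * ?B + ennreal (2 powr s * (G2 * A2 * (G3 * (A3 * 2)))) * ?B"
      unfolding besov_norm_def by (rule add_mono)
    also have "\<dots> = ennreal C * ?B" using G1(1) pos by (simp add: C_def distrib_right)
    finally show "(AE x in lborel. (\<Sum>i. R i x) < top) \<and>
      besov_norm s p q ?f \<le> ennreal C * lq_norm q (\<lambda>i. ennreal (2 powr (real i * s)) * Lp_norm lborel p (R i))"
      using AEfin by (simp add: b_def[abs_def])
  qed
qed


lemma ennreal_tail_tendsto_0:
  fixes b :: "nat \<Rightarrow> ennreal"
  assumes fin: "(\<Sum>i. b i) < top"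
  shows "(\<lambda>k. \<Sum>i. b (i + k)) \<longlonglongrightarrow> 0"
proof -
  have bt: "b i < top" for i
    using sum_le_suminf[of b "{i}"] fin by (simp add: le_less_trans)
  define \<beta> where "\<beta> i = enn2real (b i)" for i
  have \<beta>: "0 \<le> \<beta> i" "ennreal (\<beta> i) = b i" for i using bt[of i] by (auto simp: \<beta>_def less_top)
  have sm: "summable \<beta>" using fin \<beta> by (intro summable_suminf_not_top) auto
  have "(\<lambda>k. \<Sum>i<k. \<beta> i) \<longlonglongrightarrow> (\<Sum>i. \<beta> i)" by (rule summable_LIMSEQ[OF sm])
  then have "(\<lambda>k. (\<Sum>i. \<beta> i) - (\<Sum>i<k. \<beta> i)) \<longlonglongrightarrow> (\<Sum>i. \<beta> i) - (\<Sum>i. \<beta> i)" by (intro tendsto_intros)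
  then have "(\<lambda>k. ennreal (\<Sum>i. \<beta> (i + k))) \<longlonglongrightarrow> ennreal 0"
    by (intro tendsto_ennrealI) (simp add: suminf_minus_initial_segment[OF sm])
  moreover have "ennreal (\<Sum>i. \<beta> (i + k)) = (\<Sum>i. b (i + k))" for k
    using \<beta> sm by (subst suminf_ennreal2[symmetric]) (auto simp: summable_iff_shift)
  ultimately show ?thesis by simp
qed

lemma ennreal_combine:
  fixes a b c :: real
  assumes "0 \<le> a" "0 \<le> b" "0 \<le> c"
  shows "ennreal a * (ennreal b * X) + ennreal c * X = ennreal (a * b + c) * X"
  using assms by (simp add: distrib_right ennreal_mult mult.assoc)

section \<open>Cutoffs and the terms of the extension\<close>

context trace_setting
begin

definition ed :: "real^'n \<Rightarrow> real"
  where "ed x = (INF y\<in>E. infnorm (x - y))"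

lemma ed_bdd: "bdd_below ((\<lambda>y. infnorm (x - y)) ` E)"
  by (rule bdd_belowI[of _ 0]) (auto simp: infnorm_pos_le)

lemma ed_le: "y \<in> E \<Longrightarrow> ed x \<le> infnorm (x - y)"
  unfolding ed_def by (rule cINF_lower[OF ed_bdd])

lemma ed_less: "ed x < r \<Longrightarrow> \<exists>y\<in>E. infnorm (x - y) < r"
  unfolding ed_def using cINF_less_iff[OF E_ne ed_bdd] by blast

lemma ed_triangle: "ed x \<le> infnorm (x - x') + ed x'"
proof -
  have "ed x - infnorm (x - x') \<le> infnorm (x' - y)" if "y \<in> E" for y
    using ed_le[OF that, of x] infnorm_triangle[of "x - x'" "x' - y"] by simp
  then have "ed x - infnorm (x - x') \<le> ed x'" unfolding ed_def[of x'] by (intro cINF_greatest E_ne)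
  then show ?thesis by simp
qed

lemma ed_lipschitz: "\<bar>ed x - ed x'\<bar> \<le> infnorm (x - x')"
  using ed_triangle[of x x'] ed_triangle[of x' x] by (simp add: infnorm_sub[of x' x])

lemma measurable_ed [measurable]: "ed \<in> borel_measurable borel"
proof (rule borel_measurable_continuous_onI)
  show "continuous_on UNIV ed"
    unfolding continuous_on_iff
  proof (intro ballI allI impI)
    fix x :: "real^'n" and e :: real assume "0 < e"
    then show "\<exists>d>0. \<forall>x'\<in>UNIV. dist x' x < d \<longrightarrow> dist (ed x') (ed x) < e"
      using ed_lipschitz[of _ x] infnorm_le_norm[of "_ - x"]
      by (intro exI[of _ e]) (auto simp: dist_real_def dist_norm intro: le_less_trans order_trans)
  qed
qed

lemma nbhd_ed: "ed x < dy (int k) / 4 \<Longrightarrow> x \<in> nbhd k"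
  using ed_less[of x "dy (int k) / 4"] by (auto simp: nbhd_def intro: less_imp_le)

text \<open>The support reaches only to distance \<open>dy k / 8\<close> from E, half the width of
  \<open>nbhd k\<close>. A second point at distance \<open>dy k / 8\<close> from one in the support
  thus still lies where the weighted means are controlled.\<close>

definition cut :: "nat \<Rightarrow> real^'n \<Rightarrow> real"
  where "cut k x = max 0 (min 1 (2 - 16 * (ed x / dy (int k))))"

lemma measurable_cut [measurable]: "cut k \<in> borel_measurable borel"
  unfolding cut_def by measurable

lemma cut_bounds: "0 \<le> cut k x" "cut k x \<le> 1"
  by (auto simp: cut_def)

lemma cut_eq_0: "dy (int k) / 8 \<le> ed x \<Longrightarrow> cut k x = 0"
proof -
  assume "dy (int k) / 8 \<le> ed x"
  then have "1 / 8 \<le> ed x / dy (int k)" by (simp add: pos_le_divide_eq)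
  then show ?thesis unfolding cut_def by linarith
qed

lemma cut_eq_1: "ed x \<le> dy (int k) / 16 \<Longrightarrow> cut k x = 1"
proof -
  assume "ed x \<le> dy (int k) / 16"
  then have "ed x / dy (int k) \<le> 1 / 16" by (simp add: pos_divide_le_eq)
  then show ?thesis unfolding cut_def by linarith
qed

lemma cut_lipschitz: "\<bar>cut k x - cut k x'\<bar> \<le> 16 * (infnorm (x - x') / dy (int k))"
proof -
  have "\<bar>ed x / dy (int k) - ed x' / dy (int k)\<bar> \<le> infnorm (x - x') / dy (int k)"
    using ed_lipschitz[of x x'] by (simp add: diff_divide_distrib[symmetric] abs_divide divide_right_mono)
  then show ?thesis unfolding cut_def by linarith
qed

text \<open>Since \<open>cut i = 1\<close> wherever \<open>cut (i + 1) \<noteq> 0\<close>, the sum telescopes near \<open>E\<close> and no Whitney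
  decomposition is needed.\<close>

definition ext_term :: "(real^'n \<Rightarrow> real) \<Rightarrow> nat \<Rightarrow> real^'n \<Rightarrow> real"
  where "ext_term \<phi> i x = cut i x * (wmean i \<phi> x - (if i = 0 then 0 else wmean (i - 1) \<phi> x))"

definition extop :: "(real^'n \<Rightarrow> real) \<Rightarrow> real^'n \<Rightarrow> real"
  where "extop \<phi> x = (\<Sum>i. ext_term \<phi> i x)"

text \<open>Majorants of the terms, up to a constant. For i \<ge> 1 the means at scales i and i - 1
  are compared with one constant on a cube of the coarser scale, hence the index i - 1. Nothing is
  subtracted in the first term, which is bounded by an integral of \<phi> itself.\<close>

definition res :: "(real^'n \<Rightarrow> real) \<Rightarrow> nat \<Rightarrow> real^'n \<Rightarrow> ennreal"
  where "res \<phi> i x = (if i = 0 then (\<integral>\<^sup>+y\<in>cube 2 x. ennreal \<bar>\<phi> y\<bar> \<partial>m 0)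
    else best_approx_mod (m (i - 1)) 1 \<phi> (dy (int (i - 1))) x)"

lemma measurable_ext_term:
  assumes "\<phi> \<in> borel_measurable borel"
  shows "ext_term \<phi> i \<in> borel_measurable borel"
proof -
  note [measurable] = measurable_wmean[OF assms]
  show ?thesis unfolding ext_term_def by measurable
qed

lemma measurable_res:
  assumes "\<phi> \<in> L_loc 1 m"
  shows "res \<phi> i \<in> borel_measurable borel"
proof (cases "i = 0")
  case True
  have [measurable]: "\<phi> \<in> borel_measurable borel" using assms by (simp add: L_loc_def)
  have "(\<lambda>x. \<integral>\<^sup>+y\<in>cube 2 x. ennreal \<bar>\<phi> y\<bar> \<partial>m 0) \<in> borel_measurable borel"
    by (rule measurable_nn_integral_cube[OF lf]) measurable
  then show ?thesis using True by (simp add: res_def[abs_def])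
next
  case False
  have "best_approx_mod (m (i - 1)) 1 \<phi> (dy (int (i - 1))) \<in> borel_measurable borel"
    using assms closed_E by (intro measurable_best_approx_mod lf) (auto simp: supp L_loc_def)
  then show ?thesis using False by (simp add: res_def[abs_def])
qed

text \<open>The product rule: slope 16 from the cutoff and 1 from G make 17. Two points more than
  \<open>dy i / 8\<close> apart are treated by the size bound alone, which is enough because 17/8
  exceeds 1.\<close>

lemma cut_product_le:
  fixes G :: "real^'n \<Rightarrow> real" and R :: "real^'n \<Rightarrow> ennreal"
  assumes K: "0 \<le> K"
    and G1: "\<And>x. x \<in> nbhd i \<Longrightarrow> ennreal \<bar>G x\<bar> \<le> ennreal K * R x"
    and G2: "\<And>x x'. x \<in> nbhd i \<Longrightarrow> x' \<in> nbhd i \<Longrightarrow> infnorm (x - x') \<le> dy (int i) / 8 \<Longrightarrow>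
      ennreal \<bar>G x - G x'\<bar> \<le> ennreal (K * (infnorm (x - x') / dy (int i))) * R x"
  shows "ennreal \<bar>cut i x * G x\<bar> \<le> ennreal K * R x"
    and "ennreal \<bar>cut i x * G x - cut i x' * G x'\<bar> \<le> ennreal (17 * K * (infnorm (x - x') / dy (int i))) * (R x + R x')"
proof -
  have bd: "ennreal \<bar>cut i x * G x\<bar> \<le> ennreal K * R x" for x
  proof (cases "dy (int i) / 8 \<le> ed x")
    case True
    then show ?thesis by (simp add: cut_eq_0)
  next
    case False
    then have "ed x < dy (int i) / 4" using dy_pos(1)[of "int i"] by linarith
    then have x: "x \<in> nbhd i" by (rule nbhd_ed)
    have "\<bar>cut i x * G x\<bar> \<le> 1 * \<bar>G x\<bar>"
      unfolding abs_mult using cut_bounds[of i x] by (intro mult_right_mono) auto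
    then have "ennreal \<bar>cut i x * G x\<bar> \<le> ennreal \<bar>G x\<bar>" by (intro ennreal_leI) simp
    also have "\<dots> \<le> ennreal K * R x" by (rule G1[OF x])
    finally show ?thesis .
  qed
  then show "ennreal \<bar>cut i x * G x\<bar> \<le> ennreal K * R x" .
  define t where "t = infnorm (x - x') / dy (int i)"
  have t: "0 \<le> t" unfolding t_def by (intro divide_nonneg_pos infnorm_pos_le) simp
  \<comment> \<open>Only x is assumed to be where the cutoff may be nonzero, and only R x occurs in
    the bound; exchanging the points covers the other case, and if neither is there both products
    vanish.\<close>
  have asym: "ennreal \<bar>cut i x * G x - cut i x' * G x'\<bar> \<le> ennreal (17 * K * (infnorm (x - x') / dy (int i))) * R x"
    if close: "infnorm (x - x') \<le> dy (int i) / 8" and e: "ed x < dy (int i) / 8" for x x'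
  proof -
    have e': "ed x' < dy (int i) / 4" "ed x < dy (int i) / 4"
      using e close ed_lipschitz[of x x'] dy_pos(1)[of "int i"] by linarith+
    then have n: "x \<in> nbhd i" "x' \<in> nbhd i" by (auto intro: nbhd_ed)
    let ?t = "infnorm (x - x') / dy (int i)"
    have t0: "0 \<le> ?t" by (intro divide_nonneg_pos infnorm_pos_le) simp
    have "\<bar>cut i x * G x - cut i x' * G x'\<bar> = \<bar>(cut i x - cut i x') * G x + cut i x' * (G x - G x')\<bar>"
      by (simp add: algebra_simps)
    also have "\<dots> \<le> \<bar>cut i x - cut i x'\<bar> * \<bar>G x\<bar> + \<bar>cut i x'\<bar> * \<bar>G x - G x'\<bar>"
      using abs_triangle_ineq[of "(cut i x - cut i x') * G x" "cut i x' * (G x - G x')"] by (simp only: abs_mult)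
    also have "\<dots> \<le> (16 * ?t) * \<bar>G x\<bar> + 1 * \<bar>G x - G x'\<bar>"
      using cut_lipschitz[of i x x'] cut_bounds[of i x'] by (intro add_mono mult_right_mono) auto
    finally have "ennreal \<bar>cut i x * G x - cut i x' * G x'\<bar> \<le> ennreal ((16 * ?t) * \<bar>G x\<bar> + 1 * \<bar>G x - G x'\<bar>)" by (rule ennreal_leI)
    also have "\<dots> = ennreal (16 * ?t) * ennreal \<bar>G x\<bar> + ennreal \<bar>G x - G x'\<bar>"
    proof -
      have "ennreal (a * b + 1 * c) = ennreal a * ennreal b + ennreal c" if "0 \<le> a" "0 \<le> b" "0 \<le> c" for a b c :: real
        using that by (simp add: ennreal_mult)
      then show ?thesis by this (rule mult_nonneg_nonneg[OF _ t0], simp_all)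
    qed
    also have "\<dots> \<le> ennreal (16 * ?t) * (ennreal K * R x) + ennreal (K * ?t) * R x"
      by (intro add_mono mult_left_mono G1 G2 n close) simp
    also have "\<dots> = ennreal (17 * K * ?t) * R x"
    proof -
      have "ennreal (16 * ?t) * (ennreal K * R x) + ennreal (K * ?t) * R x = ennreal (16 * ?t * K + K * ?t) * R x"
        by (rule ennreal_combine[OF mult_nonneg_nonneg[OF _ t0] K mult_nonneg_nonneg[OF K t0]]) simp
      also have "16 * ?t * K + K * ?t = 17 * K * ?t" by algebra
      finally show ?thesis .
    qed
    finally show ?thesis .
  qed
  show "ennreal \<bar>cut i x * G x - cut i x' * G x'\<bar> \<le> ennreal (17 * K * (infnorm (x - x') / dy (int i))) * (R x + R x')"
  proof (cases "infnorm (x - x') \<le> dy (int i) / 8")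
    case close: True
    show ?thesis
    proof (cases "ed x < dy (int i) / 8")
      case True
      have "ennreal (17 * K * (infnorm (x - x') / dy (int i))) * R x \<le> ennreal (17 * K * (infnorm (x - x') / dy (int i))) * (R x + R x')"
        by (intro mult_left_mono) auto
      with asym[OF close True] show ?thesis by (rule order_trans)
    next
      case False
      show ?thesis
      proof (cases "ed x' < dy (int i) / 8")
        case True
        have "ennreal \<bar>cut i x' * G x' - cut i x * G x\<bar> \<le> ennreal (17 * K * (infnorm (x' - x) / dy (int i))) * R x'"
          using close True by (intro asym) (simp_all add: infnorm_sub[of x' x])
        also have "\<dots> \<le> ennreal (17 * K * (infnorm (x - x') / dy (int i))) * (R x + R x')"
          unfolding infnorm_sub[of x' x] by (intro mult_left_mono) auto
        finally show ?thesis by (simp only: abs_minus_commute)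
      next
        case f: False
        with False show ?thesis by (simp add: cut_eq_0)
      qed
    qed
  next
    case False
    then have "1 / 8 \<le> t" unfolding t_def by (simp add: pos_le_divide_eq)
    then have "1 * K \<le> (17 * t) * K" using K by (intro mult_right_mono) auto
    then have Kt: "K \<le> 17 * K * t" by (simp add: mult_ac)
    have "ennreal \<bar>cut i x * G x - cut i x' * G x'\<bar> \<le> ennreal \<bar>cut i x * G x\<bar> + ennreal \<bar>cut i x' * G x'\<bar>"
      using ennreal_dist_triangle[of "cut i x * G x" "cut i x' * G x'" 0] by simp
    also have "\<dots> \<le> ennreal K * R x + ennreal K * R x'" by (intro add_mono bd)
    also have "\<dots> = ennreal K * (R x + R x')" by (simp add: distrib_left)
    also have "\<dots> \<le> ennreal (17 * K * t) * (R x + R x')" using Kt by (intro mult_right_mono ennreal_leI) auto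
    finally show ?thesis by (simp add: t_def)
  qed
qed

text \<open>For i \<ge> 1 one nearly optimal c on the cube of radius \<open>2 * dy (i - 1)\<close>
  serves both means, since \<open>M3\<close> bounds the error integral for the finer measure by that
  for the coarser one. Differences in x use the same c, which the Lipschitz estimate for means
  leaves free. For i = 0 the constant is 0.\<close>

lemma ext_term_bounds:
  obtains K :: real where "0 < K"
    "\<And>\<phi> i x. \<phi> \<in> L_loc 1 m \<Longrightarrow> ennreal \<bar>ext_term \<phi> i x\<bar> \<le> ennreal K * res \<phi> i x"
    "\<And>\<phi> i x x'. \<phi> \<in> L_loc 1 m \<Longrightarrow>
       ennreal \<bar>ext_term \<phi> i x - ext_term \<phi> i x'\<bar> \<le> ennreal (K * (infnorm (x - x') / dy (int i))) * (res \<phi> i x + res \<phi> i x')"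
proof -
  obtain K0 where K0: "0 < K0"
    "\<And>\<phi> k x c. \<phi> \<in> L_loc 1 m \<Longrightarrow> x \<in> nbhd k \<Longrightarrow>
       ennreal \<bar>wmean k \<phi> x - c\<bar> \<le> ennreal (K0 / dy (int k) powr d) * (\<integral>\<^sup>+y\<in>cube (3 / 2 * dy (int k)) x. ennreal \<bar>\<phi> y - c\<bar> \<partial>m k)"
    "\<And>\<phi> k x x' c. \<phi> \<in> L_loc 1 m \<Longrightarrow> x \<in> nbhd k \<Longrightarrow> x' \<in> nbhd k \<Longrightarrow> infnorm (x - x') \<le> dy (int k) / 4 \<Longrightarrow>
       ennreal \<bar>wmean k \<phi> x - wmean k \<phi> x'\<bar> \<le> ennreal (K0 * (infnorm (x - x') / dy (int k)) / dy (int k) powr d) *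
         (\<integral>\<^sup>+y\<in>cube (2 * dy (int k)) x. ennreal \<bar>\<phi> y - c\<bar> \<partial>m k)"
    using wmean_bounds by blast
  obtain C4 where C4: "0 < C4"
    "\<And>k j x. int k - 6 \<le> j \<Longrightarrow> emeasure (m k) (cube (dy j) x) \<le> ennreal (C4 * dy j powr d)"
    using mass_le by blast
  define T where "T = 2 * (C4 * 2 powr d)"
  define D where "D = (K0 * 2 powr d * C3 + K0) * T"
  define K where "K = K0 + D"
  have T: "0 < T" using C4(1) by (simp add: T_def)
  have D: "0 < D" using K0(1) C T unfolding D_def by (intro mult_pos_pos add_pos_pos) auto
  have K: "0 < K" "K0 \<le> K" "D \<le> K" using K0(1) D by (auto simp: K_def)
  have bounds: "ennreal \<bar>ext_term \<phi> i x\<bar> \<le> ennreal K * res \<phi> i x"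
    "ennreal \<bar>ext_term \<phi> i x - ext_term \<phi> i x'\<bar> \<le> ennreal (17 * K * (infnorm (x - x') / dy (int i))) * (res \<phi> i x + res \<phi> i x')"
    if \<phi>: "\<phi> \<in> L_loc 1 m" for \<phi> i x x'
  proof -
    note [measurable] = L_loc_1_cube(1)[OF \<phi>]
    let ?G = "\<lambda>x. wmean i \<phi> x - (if i = 0 then 0 else wmean (i - 1) \<phi> x)"
    have G: "ennreal \<bar>?G x\<bar> \<le> ennreal K * res \<phi> i x"
      "x' \<in> nbhd i \<Longrightarrow> infnorm (x - x') \<le> dy (int i) / 8 \<Longrightarrow> ennreal \<bar>?G x - ?G x'\<bar> \<le> ennreal (K * (infnorm (x - x') / dy (int i))) * res \<phi> i x"
      if x: "x \<in> nbhd i" for x x'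
    proof -
      define t where "t = infnorm (x - x') / dy (int i)"
      have t: "0 \<le> t" unfolding t_def by (intro divide_nonneg_pos infnorm_pos_le) simp
      have "ennreal \<bar>?G x\<bar> \<le> ennreal K * res \<phi> i x \<and> (x' \<in> nbhd i \<longrightarrow> infnorm (x - x') \<le> dy (int i) / 8 \<longrightarrow>
        ennreal \<bar>?G x - ?G x'\<bar> \<le> ennreal (K * t) * res \<phi> i x)"
      proof (cases i)
        case 0
        have "ennreal \<bar>wmean 0 \<phi> x - 0\<bar> \<le> ennreal (K0 / dy (int 0) powr d) * (\<integral>\<^sup>+y\<in>cube (3 / 2 * dy (int 0)) x. ennreal \<bar>\<phi> y - 0\<bar> \<partial>m 0)"
          using x 0 by (intro K0(2) \<phi>) simp
        also have "\<dots> \<le> ennreal K * (\<integral>\<^sup>+y\<in>cube 2 x. ennreal \<bar>\<phi> y - 0\<bar> \<partial>m 0)"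
          using K cube_mono_radius[of "3 / 2" 2 x]
          by (intro mult_mono nn_integral_mono ennreal_leI) (auto simp: indicator_def)
        finally have 1: "ennreal \<bar>?G x\<bar> \<le> ennreal K * res \<phi> i x" using 0 by (simp add: res_def)
        have 2: "ennreal \<bar>?G x - ?G x'\<bar> \<le> ennreal (K * t) * res \<phi> i x" if "x' \<in> nbhd i" "infnorm (x - x') \<le> dy (int i) / 8"
        proof -
          have "ennreal \<bar>wmean 0 \<phi> x - wmean 0 \<phi> x'\<bar> \<le> ennreal (K0 * (infnorm (x - x') / dy (int 0)) / dy (int 0) powr d) * (\<integral>\<^sup>+y\<in>cube (2 * dy (int 0)) x. ennreal \<bar>\<phi> y - 0\<bar> \<partial>m 0)"
            using x 0 that by (intro K0(3) \<phi>) auto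
          also have "\<dots> = ennreal (K0 * t) * res \<phi> i x" using 0 by (simp add: t_def res_def)
          also have "\<dots> \<le> ennreal (K * t) * res \<phi> i x" using K t by (intro mult_right_mono ennreal_leI) auto
          finally show ?thesis using 0 by simp
        qed
        from 1 2 show ?thesis by blast
      next
        case (Suc k)
        have xk: "x \<in> nbhd (Suc k)" "x \<in> nbhd k" using x Suc nbhd_antimono[of k "Suc k"] by auto
        have dS: "dy (int (Suc k)) = dy (int k) / 2" using dy_add[of "int k" 1] by (simp add: add.commute)
        let ?r = "dy (int k)" and ?Q = "cube (2 * dy (int k)) x"
        let ?B = "best_approx_mod (m k) 1 \<phi> (dy (int k)) x"
        have hit: "cube ?r x \<inter> E \<noteq> {}" by (rule nbhd_hits[OF xk(2)])
        have mQ: "emeasure (m k) ?Q \<le> ennreal (C4 * (2 * ?r) powr d)"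
        proof -
          have e: "2 * ?r = dy (int k - 1)" by (simp add: dy_diff)
          show ?thesis unfolding e by (rule C4) simp
        qed
        have "0 < ennreal (C2 * ?r powr d)" using C by simp
        then have pQ: "0 < emeasure (m k) ?Q" using cube_mass_pos[OF hit] by (rule less_le_trans)
        obtain c where c: "(\<integral>\<^sup>+y\<in>?Q. ennreal (\<bar>\<phi> y - c\<bar> powr 1) \<partial>m k) \<le> enn_powr (2 * best_approx (m k) 1 \<phi> ?Q) 1 * emeasure (m k) ?Q"
          using best_approx_attained[of \<phi> "m k" ?Q 1] pQ emeasure_cube_finite[OF lf] by auto
        define I where "I = (\<integral>\<^sup>+y\<in>?Q. ennreal \<bar>\<phi> y - c\<bar> \<partial>m k)"
        have "I \<le> (2 * ?B) * ennreal (C4 * (2 * ?r) powr d)"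
        proof -
          have "I \<le> (2 * ?B) * emeasure (m k) ?Q"
            using c hit by (simp add: I_def best_approx_mod_def supp)
          also have "\<dots> \<le> (2 * ?B) * ennreal (C4 * (2 * ?r) powr d)" by (intro mult_left_mono mQ) simp
          finally show ?thesis .
        qed
        also have "\<dots> = ennreal (T * ?r powr d) * ?B"
          using C4(1) by (simp add: T_def powr_mult ennreal_mult mult_ac)
        finally have I: "I \<le> ennreal (T * ?r powr d) * ?B" .
        have sub: "(\<integral>\<^sup>+y\<in>cube r x. ennreal \<bar>\<phi> y - c\<bar> \<partial>m (Suc k)) \<le> ennreal C3 * I" if "r \<le> 2 * ?r" for r
        proof -
          have "(\<integral>\<^sup>+y\<in>cube r x. ennreal \<bar>\<phi> y - c\<bar> \<partial>m (Suc k)) \<le> ennreal C3 * (\<integral>\<^sup>+y\<in>cube r x. ennreal \<bar>\<phi> y - c\<bar> \<partial>m k)"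
            by (rule M3) measurable
          also have "\<dots> \<le> ennreal C3 * I"
            unfolding I_def using cube_mono_radius[OF that, of x] by (intro mult_left_mono nn_integral_mono) (auto simp: indicator_def)
          finally show ?thesis .
        qed
        have rS: "3 / 2 * dy (int (Suc k)) \<le> 2 * ?r" "2 * dy (int (Suc k)) \<le> 2 * ?r"
          unfolding dS by simp_all
        \<comment> \<open>Taken with u = 1 for the size of the term and with u = t for its
          variation.\<close>
        have comb: "ennreal (u * (K0 / dy (int (Suc k)) powr d)) * (ennreal C3 * I) + ennreal (u * (K0 / ?r powr d)) * I \<le> ennreal (K * u) * ?B"
          if u: "0 \<le> u" for u
        proof -
          have e: "dy (int (Suc k)) powr d = ?r powr d / 2 powr d" unfolding dS by (simp add: powr_divide)
          have "ennreal (u * (K0 / dy (int (Suc k)) powr d)) * (ennreal C3 * I) + ennreal (u * (K0 / ?r powr d)) * I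
            = ennreal (u * (K0 / dy (int (Suc k)) powr d) * C3 + u * (K0 / ?r powr d)) * I"
            using u K0(1) C by (intro ennreal_combine) auto
          also have "\<dots> \<le> ennreal (u * (K0 / dy (int (Suc k)) powr d) * C3 + u * (K0 / ?r powr d)) * (ennreal (T * ?r powr d) * ?B)"
            by (intro mult_left_mono I) simp
          also have "\<dots> = ennreal ((u * (K0 / dy (int (Suc k)) powr d) * C3 + u * (K0 / ?r powr d)) * (T * ?r powr d)) * ?B"
            using u K0(1) C T by (subst ennreal_mult) (auto simp: mult.assoc)
          also have "(u * (K0 / dy (int (Suc k)) powr d) * C3 + u * (K0 / ?r powr d)) * (T * ?r powr d) = D * u"
            unfolding e D_def by (simp add: field_simps)
          also have "ennreal (D * u) * ?B \<le> ennreal (K * u) * ?B"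
            using K u by (intro mult_right_mono ennreal_leI) auto
          finally show ?thesis .
        qed
        have rB: "res \<phi> i x = ?B" using Suc by (simp add: res_def)
        have 1: "ennreal \<bar>?G x\<bar> \<le> ennreal K * res \<phi> i x"
        proof -
          have "ennreal \<bar>?G x\<bar> \<le> ennreal \<bar>wmean (Suc k) \<phi> x - c\<bar> + ennreal \<bar>wmean k \<phi> x - c\<bar>"
            using ennreal_dist_triangle[of "wmean (Suc k) \<phi> x" "wmean k \<phi> x" c] Suc by (simp add: abs_minus_commute)
          also have "\<dots> \<le> ennreal (K0 / dy (int (Suc k)) powr d) * (ennreal C3 * I) + ennreal (K0 / ?r powr d) * I"
          proof (intro add_mono)
            have "ennreal \<bar>wmean (Suc k) \<phi> x - c\<bar> \<le> ennreal (K0 / dy (int (Suc k)) powr d) *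
                (\<integral>\<^sup>+y\<in>cube (3 / 2 * dy (int (Suc k))) x. ennreal \<bar>\<phi> y - c\<bar> \<partial>m (Suc k))"
              by (rule K0(2)[OF \<phi> xk(1)])
            also have "\<dots> \<le> ennreal (K0 / dy (int (Suc k)) powr d) * (ennreal C3 * I)"
              by (intro mult_left_mono sub rS) simp
            finally show "ennreal \<bar>wmean (Suc k) \<phi> x - c\<bar> \<le> ennreal (K0 / dy (int (Suc k)) powr d) * (ennreal C3 * I)" .
            have "ennreal \<bar>wmean k \<phi> x - c\<bar> \<le> ennreal (K0 / ?r powr d) * (\<integral>\<^sup>+y\<in>cube (3 / 2 * ?r) x. ennreal \<bar>\<phi> y - c\<bar> \<partial>m k)"
              by (rule K0(2)[OF \<phi> xk(2)])
            also have "\<dots> \<le> ennreal (K0 / ?r powr d) * I"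
              unfolding I_def using cube_mono_radius[of "3 / 2 * ?r" "2 * ?r" x]
              by (intro mult_left_mono nn_integral_mono) (auto simp: indicator_def)
            finally show "ennreal \<bar>wmean k \<phi> x - c\<bar> \<le> ennreal (K0 / ?r powr d) * I" .
          qed
          also have "\<dots> \<le> ennreal K * ?B" using comb[of 1] by simp
          finally show ?thesis by (simp add: rB)
        qed
        have 2: "ennreal \<bar>?G x - ?G x'\<bar> \<le> ennreal (K * t) * res \<phi> i x" if x': "x' \<in> nbhd i" and close: "infnorm (x - x') \<le> dy (int i) / 8"
        proof -
          have xk': "x' \<in> nbhd (Suc k)" "x' \<in> nbhd k" using x' Suc nbhd_antimono[of k "Suc k"] by auto
          have cl: "infnorm (x - x') \<le> dy (int (Suc k)) / 4" "infnorm (x - x') \<le> ?r / 4"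
            using close dy_pos(1)[of "int k"] unfolding Suc dS by linarith+
          have ti: "infnorm (x - x') / dy (int (Suc k)) = t" by (simp add: t_def Suc)
          have "infnorm (x - x') * dy (int (Suc k)) \<le> infnorm (x - x') * ?r"
            unfolding dS by (intro mult_left_mono infnorm_pos_le) simp
          then have tk: "infnorm (x - x') / ?r \<le> t"
            unfolding t_def Suc by (simp add: divide_simps)
          have "ennreal \<bar>?G x - ?G x'\<bar> \<le> ennreal \<bar>wmean (Suc k) \<phi> x - wmean (Suc k) \<phi> x'\<bar> + ennreal \<bar>wmean k \<phi> x - wmean k \<phi> x'\<bar>"
            using ennreal_dist_triangle[of "(wmean (Suc k) \<phi> x - wmean (Suc k) \<phi> x') - (wmean k \<phi> x - wmean k \<phi> x')" 0 "wmean (Suc k) \<phi> x - wmean (Suc k) \<phi> x'"] Suc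
            by (simp add: algebra_simps abs_minus_commute[of "wmean k \<phi> x" "wmean k \<phi> x'"])
          also have "\<dots> \<le> ennreal (t * (K0 / dy (int (Suc k)) powr d)) * (ennreal C3 * I) + ennreal (t * (K0 / ?r powr d)) * I"
          proof (intro add_mono)
            have "ennreal \<bar>wmean (Suc k) \<phi> x - wmean (Suc k) \<phi> x'\<bar> \<le> ennreal (K0 * (infnorm (x - x') / dy (int (Suc k))) / dy (int (Suc k)) powr d) *
                (\<integral>\<^sup>+y\<in>cube (2 * dy (int (Suc k))) x. ennreal \<bar>\<phi> y - c\<bar> \<partial>m (Suc k))"
              by (rule K0(3)[OF \<phi> xk(1) xk'(1) cl(1)])
            also have "\<dots> \<le> ennreal (K0 * (infnorm (x - x') / dy (int (Suc k))) / dy (int (Suc k)) powr d) * (ennreal C3 * I)"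
              by (intro mult_left_mono sub rS) simp
            finally show "ennreal \<bar>wmean (Suc k) \<phi> x - wmean (Suc k) \<phi> x'\<bar> \<le> ennreal (t * (K0 / dy (int (Suc k)) powr d)) * (ennreal C3 * I)"
              unfolding ti by (simp add: mult.commute)
            have "ennreal \<bar>wmean k \<phi> x - wmean k \<phi> x'\<bar> \<le> ennreal (K0 * (infnorm (x - x') / ?r) / ?r powr d) * I"
              unfolding I_def by (rule K0(3)[OF \<phi> xk(2) xk'(2) cl(2)])
            also have "\<dots> \<le> ennreal (t * (K0 / ?r powr d)) * I"
            proof (intro mult_right_mono ennreal_leI)
              have "infnorm (x - x') / ?r * (K0 / ?r powr d) \<le> t * (K0 / ?r powr d)" using tk K0(1) by (intro mult_right_mono) auto
              then show "K0 * (infnorm (x - x') / ?r) / ?r powr d \<le> t * (K0 / ?r powr d)" by (simp add: mult.commute)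
            qed simp
            finally show "ennreal \<bar>wmean k \<phi> x - wmean k \<phi> x'\<bar> \<le> ennreal (t * (K0 / ?r powr d)) * I" .
          qed
          also have "\<dots> \<le> ennreal (K * t) * ?B" by (rule comb[OF t])
          finally show ?thesis by (simp add: rB)
        qed
        from 1 2 show ?thesis by blast
      qed
      then show "ennreal \<bar>?G x\<bar> \<le> ennreal K * res \<phi> i x"
        "x' \<in> nbhd i \<Longrightarrow> infnorm (x - x') \<le> dy (int i) / 8 \<Longrightarrow> ennreal \<bar>?G x - ?G x'\<bar> \<le> ennreal (K * (infnorm (x - x') / dy (int i))) * res \<phi> i x"
        unfolding t_def by blast+
    qed
    show "ennreal \<bar>ext_term \<phi> i x\<bar> \<le> ennreal K * res \<phi> i x"
      unfolding ext_term_def using K by (intro cut_product_le(1)[where R="res \<phi> i"] G) auto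
    show "ennreal \<bar>ext_term \<phi> i x - ext_term \<phi> i x'\<bar> \<le> ennreal (17 * K * (infnorm (x - x') / dy (int i))) * (res \<phi> i x + res \<phi> i x')"
      unfolding ext_term_def using K by (intro cut_product_le(2)[where R="res \<phi> i"] G) auto
  qed
  show ?thesis
  proof (rule that[of "17 * K"])
    fix \<phi> i x assume \<phi>: "\<phi> \<in> L_loc 1 m"
    have "ennreal \<bar>ext_term \<phi> i x\<bar> \<le> ennreal K * res \<phi> i x" by (rule bounds(1)[OF \<phi>])
    also have "\<dots> \<le> ennreal (17 * K) * res \<phi> i x" using K by (intro mult_right_mono ennreal_leI) auto
    finally show "ennreal \<bar>ext_term \<phi> i x\<bar> \<le> ennreal (17 * K) * res \<phi> i x" .
  qed (use K bounds(2) in auto)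
qed

end


section \<open>Norm of the extension\<close>

context trace_setting
begin

lemma res_0_norm_le:
  obtains K :: real where "0 < K"
    "\<And>\<phi>. \<phi> \<in> L_loc 1 m \<Longrightarrow> Lp_norm lborel p (res \<phi> 0) \<le> ennreal K * Lp_norm (m 0) p (\<lambda>x. ennreal \<bar>\<phi> x\<bar>)"
proof -
  obtain C4 where C4: "0 < C4"
    "\<And>k j x. int k - 6 \<le> j \<Longrightarrow> emeasure (m k) (cube (dy j) x) \<le> ennreal (C4 * dy j powr d)"
    using mass_le by blast
  define A where "A = C4 * 2 powr d"
  have A: "0 < A" using C4(1) by (simp add: A_def)
  show ?thesis
  proof (rule that)
    show "0 < A powr (1 / 1 - 1 / enn2real p) * (4 ^ CARD('n)) powr (1 / enn2real p)" using A by simp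
    fix \<phi> assume \<phi>: "\<phi> \<in> L_loc 1 m"
    have [measurable]: "\<phi> \<in> borel_measurable borel" using \<phi> by (simp add: L_loc_def)
    show "Lp_norm lborel p (res \<phi> 0) \<le> ennreal (A powr (1 / 1 - 1 / enn2real p) * (4 ^ CARD('n)) powr (1 / enn2real p))
      * Lp_norm (m 0) p (\<lambda>x. ennreal \<bar>\<phi> x\<bar>)"
    proof (rule Lp_norm_averaging[OF lf locally_finite_borel_lborel])
      show "res \<phi> 0 \<in> borel_measurable borel" by (rule measurable_res[OF \<phi>])
      show "AE y in lborel. enn_powr (res \<phi> 0 y) 1 \<le> 1 * (\<integral>\<^sup>+x\<in>cube 2 y. enn_powr (ennreal \<bar>\<phi> x\<bar>) 1 \<partial>m 0)"
        by (simp add: res_def)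
      show "1 * emeasure (m 0) (cube 2 y) \<le> ennreal A" for y
        using C4(2)[of 0 "- 1" y] by (simp add: A_def)
      show "AE x in m 0. 1 * emeasure lborel (cube 2 x) \<le> ennreal (4 ^ CARD('n))"
        by (simp add: emeasure_lborel_cube)
    qed (use A p in \<open>auto simp: ennreal_1\<close>)
  qed
qed

lemma res_lq_norm_le:
  assumes q: "0 < q"
  obtains K :: real where "0 < K"
    "\<And>\<phi>. \<phi> \<in> L_loc 1 m \<Longrightarrow> lq_norm q (\<lambda>i. ennreal (2 powr (real i * s)) * Lp_norm lborel p (res \<phi> i)) \<le> ennreal K * intrinsic_norm s p q 1 m \<phi>"
proof -
  obtain K0 where K0: "0 < K0"
    "\<And>\<phi>. \<phi> \<in> L_loc 1 m \<Longrightarrow> Lp_norm lborel p (res \<phi> 0) \<le> ennreal K0 * Lp_norm (m 0) p (\<lambda>x. ennreal \<bar>\<phi> x\<bar>)"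
    using res_0_norm_le by blast
  obtain CI where CI: "0 < CI"
    "\<And>X. lq_norm q (\<lambda>k::nat. if k < 2 then X else 0) \<le> ennreal CI * X"
    using lq_norm_initial_le[OF q] by blast
  obtain CP where CP: "0 < CP"
    "\<And>(M :: nat measure) f g. f \<in> borel_measurable M \<Longrightarrow> g \<in> borel_measurable M \<Longrightarrow>
       Lp_norm M q (\<lambda>x. f x + g x) \<le> ennreal CP * (Lp_norm M q f + Lp_norm M q g)"
    using Lp_norm_add_le[OF q] by blast
  define K where "K = CP * (CI * K0 + 2 powr s)"
  show ?thesis
  proof (rule that[of K])
    show "0 < K" using CP(1) CI(1) K0(1) unfolding K_def by (intro mult_pos_pos add_pos_pos) auto
    fix \<phi> assume \<phi>: "\<phi> \<in> L_loc 1 m"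
    let ?P = "Lp_norm (m 0) p (\<lambda>x. ennreal \<bar>\<phi> x\<bar>)"
    define a where "a k = ennreal (2 powr (real k * s)) * Lp_norm lborel p (best_approx_mod (m k) 1 \<phi> (2 powr (- real k)))" for k :: nat
    \<comment> \<open>The value 0 at negative indices lets the shift by one scale be an injection of
      indices.\<close>
    let ?ext = "\<lambda>j::int. if j < 0 then 0 else a (nat j)"
    have le: "ennreal (2 powr (real i * s)) * Lp_norm lborel p (res \<phi> i)
      \<le> (if i < 2 then ennreal K0 * ?P else 0) + ennreal (2 powr s) * ?ext (int i - 1)" for i
    proof (cases i)
      case 0
      then show ?thesis using K0(2)[OF \<phi>] by simp
    next
      case (Suc k)
      have "res \<phi> (Suc k) = best_approx_mod (m k) 1 \<phi> (2 powr (- real k))" by (simp add: res_def fun_eq_iff dy_nat)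
      moreover have "2 powr (real (Suc k) * s) = 2 powr s * 2 powr (real k * s)" by (simp add: powr_add[symmetric] algebra_simps)
      ultimately have "ennreal (2 powr (real i * s)) * Lp_norm lborel p (res \<phi> i) = ennreal (2 powr s) * a k"
        using Suc by (simp add: a_def ennreal_mult mult.assoc)
      moreover have "?ext (int i - 1) = a k" using Suc by simp
      ultimately show ?thesis by (simp add: add_increasing)
    qed
    have "lq_norm q (\<lambda>i. ennreal (2 powr (real i * s)) * Lp_norm lborel p (res \<phi> i))
      \<le> lq_norm q (\<lambda>i. (if i < 2 then ennreal K0 * ?P else 0) + ennreal (2 powr s) * ?ext (int i - 1))"
      using le by (intro Lp_norm_mono_AE[OF q]) (auto simp: AE_count_space)
    also have "\<dots> \<le> ennreal CP * (lq_norm q (\<lambda>i::nat. if i < 2 then ennreal K0 * ?P else 0) + lq_norm q (\<lambda>i::nat. ennreal (2 powr s) * ?ext (int i - 1)))"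
      by (intro CP) auto
    also have "\<dots> \<le> ennreal CP * (ennreal CI * (ennreal K0 * ?P) + ennreal (2 powr s) * lq_norm q a)"
    proof (intro mult_left_mono add_mono CI)
      have "lq_norm q (\<lambda>i::nat. ennreal (2 powr s) * ?ext (int i - 1)) \<le> ennreal (2 powr s) * lq_norm q (\<lambda>i::nat. ?ext (int i - 1))"
        by (intro Lp_norm_cmult_le[OF q]) auto
      also have "lq_norm q (\<lambda>i::nat. ?ext (int i - 1)) \<le> lq_norm q ?ext"
        by (rule lq_norm_inj_le[OF q, of "\<lambda>i::nat. int i - 1" ?ext]) (auto intro: injI)
      also have "lq_norm q ?ext \<le> lq_norm q a" by (rule lq_norm_extend_le[OF q])
      finally show "lq_norm q (\<lambda>i::nat. ennreal (2 powr s) * ?ext (int i - 1)) \<le> ennreal (2 powr s) * lq_norm q a"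
        by (simp add: mult_left_mono)
    qed simp
    also have "\<dots> \<le> ennreal CP * (ennreal (CI * K0 + 2 powr s) * (?P + lq_norm q a))"
    proof (intro mult_left_mono)
      have "ennreal CI * (ennreal K0 * ?P) + ennreal (2 powr s) * lq_norm q a = ennreal (CI * K0) * ?P + ennreal (2 powr s) * lq_norm q a"
        using CI(1) K0(1) by (simp add: ennreal_mult mult.assoc)
      also have "\<dots> \<le> ennreal (CI * K0 + 2 powr s) * ?P + ennreal (CI * K0 + 2 powr s) * lq_norm q a"
        using CI(1) K0(1) by (intro add_mono mult_right_mono ennreal_leI) auto
      finally show "ennreal CI * (ennreal K0 * ?P) + ennreal (2 powr s) * lq_norm q a \<le> ennreal (CI * K0 + 2 powr s) * (?P + lq_norm q a)"
        by (simp only: distrib_left)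
    qed simp
    also have "\<dots> = ennreal K * (?P + lq_norm q a)"
      unfolding K_def mult.assoc[symmetric] using CP(1) CI(1) K0(1) by (subst ennreal_mult) auto
    finally show "lq_norm q (\<lambda>i. ennreal (2 powr (real i * s)) * Lp_norm lborel p (res \<phi> i)) \<le> ennreal K * intrinsic_norm s p q 1 m \<phi>"
      by (simp add: intrinsic_norm_def a_def[abs_def])
  qed
qed

text \<open>Finiteness of the majorant series is part of the conclusion because a divergent sum has
  a meaningless value: splitting off partial sums, and adding two extensions term by term, is
  legitimate exactly where convergence is known.\<close>

lemma extop_besov:
  assumes q: "0 < q"
  obtains C :: real where "0 < C"
    "\<And>\<phi>. \<phi> \<in> L_loc 1 m \<Longrightarrow> intrinsic_norm s p q 1 m \<phi> < top \<Longrightarrow>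
      extop \<phi> \<in> besov s p q \<and> besov_norm s p q (extop \<phi>) \<le> ennreal C * intrinsic_norm s p q 1 m \<phi> \<and>
      (AE x in lborel. (\<Sum>i. res \<phi> i x) < top)"
proof -
  obtain K1 where K1: "0 < K1"
    "\<And>\<phi> i x. \<phi> \<in> L_loc 1 m \<Longrightarrow> ennreal \<bar>ext_term \<phi> i x\<bar> \<le> ennreal K1 * res \<phi> i x"
    "\<And>\<phi> i x x'. \<phi> \<in> L_loc 1 m \<Longrightarrow>
       ennreal \<bar>ext_term \<phi> i x - ext_term \<phi> i x'\<bar> \<le> ennreal (K1 * (infnorm (x - x') / dy (int i))) * (res \<phi> i x + res \<phi> i x')"
    using ext_term_bounds by blast
  obtain K2 where K2: "0 < K2"
    "\<And>\<phi>. \<phi> \<in> L_loc 1 m \<Longrightarrow> lq_norm q (\<lambda>i. ennreal (2 powr (real i * s)) * Lp_norm lborel p (res \<phi> i)) \<le> ennreal K2 * intrinsic_norm s p q 1 m \<phi>"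
    using res_lq_norm_le[OF q] by blast
  show ?thesis
  proof (rule besov_synthesis[OF s_pos s(2) p_pos q])
    fix K3 :: real assume K3: "0 < K3"
    "\<And>(v :: nat \<Rightarrow> real^'n \<Rightarrow> real) R. (\<And>i. v i \<in> borel_measurable borel) \<Longrightarrow> (\<And>i. R i \<in> borel_measurable borel) \<Longrightarrow>
      (\<And>i x. ennreal \<bar>v i x\<bar> \<le> R i x) \<Longrightarrow>
      (\<And>i x y. ennreal \<bar>v i x - v i y\<bar> \<le> ennreal (infnorm (x - y) / dy (int i)) * (R i x + R i y)) \<Longrightarrow>
      lq_norm q (\<lambda>i. ennreal (2 powr (real i * s)) * Lp_norm lborel p (R i)) < top \<Longrightarrow>
      (AE x in lborel. (\<Sum>i. R i x) < top) \<and>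
      besov_norm s p q (\<lambda>x. \<Sum>i. v i x) \<le> ennreal K3 * lq_norm q (\<lambda>i. ennreal (2 powr (real i * s)) * Lp_norm lborel p (R i))"
  show ?thesis
  proof (rule that[of "K3 * (K1 * K2)"])
    show "0 < K3 * (K1 * K2)" using K1(1) K2(1) K3(1) by simp
    fix \<phi> assume \<phi>: "\<phi> \<in> L_loc 1 m" and fin: "intrinsic_norm s p q 1 m \<phi> < top"
    have \<phi>m: "\<phi> \<in> borel_measurable borel" using \<phi> by (simp add: L_loc_def)
    note [measurable] = measurable_ext_term[OF \<phi>m] measurable_res[OF \<phi>]
    define R where "R i x = ennreal K1 * res \<phi> i x" for i x
    have Rm: "R i \<in> borel_measurable borel" for i unfolding R_def by measurable
    let ?N = "lq_norm q (\<lambda>i. ennreal (2 powr (real i * s)) * Lp_norm lborel p (R i))"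
    have N: "?N \<le> ennreal (K1 * K2) * intrinsic_norm s p q 1 m \<phi>"
    proof -
      have "?N \<le> lq_norm q (\<lambda>i. ennreal K1 * (ennreal (2 powr (real i * s)) * Lp_norm lborel p (res \<phi> i)))"
      proof (intro Lp_norm_mono_AE[OF q])
        show "AE i in count_space UNIV. ennreal (2 powr (real i * s)) * Lp_norm lborel p (R i)
          \<le> ennreal K1 * (ennreal (2 powr (real i * s)) * Lp_norm lborel p (res \<phi> i))"
          unfolding R_def mult.left_commute[of "ennreal K1"]
          by (intro AE_I2 mult_left_mono Lp_norm_cmult_le p_pos) auto
      qed auto
      also have "\<dots> \<le> ennreal K1 * lq_norm q (\<lambda>i. ennreal (2 powr (real i * s)) * Lp_norm lborel p (res \<phi> i))"
        by (intro Lp_norm_cmult_le[OF q]) auto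
      also have "\<dots> \<le> ennreal K1 * (ennreal K2 * intrinsic_norm s p q 1 m \<phi>)"
        by (intro mult_left_mono K2 \<phi>) simp
      finally show ?thesis using K1(1) K2(1) by (simp add: ennreal_mult mult.assoc)
    qed
    have syn: "(AE x in lborel. (\<Sum>i. R i x) < top) \<and> besov_norm s p q (\<lambda>x. \<Sum>i. ext_term \<phi> i x) \<le> ennreal K3 * ?N"
    proof (rule K3(2))
      show "ennreal \<bar>ext_term \<phi> i x\<bar> \<le> R i x" for i x unfolding R_def by (rule K1(2)[OF \<phi>])
      show "ennreal \<bar>ext_term \<phi> i x - ext_term \<phi> i y\<bar> \<le> ennreal (infnorm (x - y) / dy (int i)) * (R i x + R i y)" for i x y
      proof -
        have t: "0 \<le> infnorm (x - y) / dy (int i)" by (intro divide_nonneg_pos infnorm_pos_le) simp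
        have "ennreal \<bar>ext_term \<phi> i x - ext_term \<phi> i y\<bar> \<le> ennreal (K1 * (infnorm (x - y) / dy (int i))) * (res \<phi> i x + res \<phi> i y)"
          by (rule K1(3)[OF \<phi>])
        also have "\<dots> = ennreal (infnorm (x - y) / dy (int i)) * (R i x + R i y)"
          unfolding R_def distrib_left[symmetric] ennreal_mult[OF less_imp_le[OF K1(1)] t] by (simp only: mult_ac)
        finally show ?thesis .
      qed
      show "?N < top" using N fin by (auto simp: ennreal_mult_less_top intro: le_less_trans)
    qed (use Rm in auto)
    have "besov_norm s p q (extop \<phi>) \<le> ennreal K3 * ?N" using syn unfolding extop_def[abs_def] by blast
    also have "\<dots> \<le> ennreal K3 * (ennreal (K1 * K2) * intrinsic_norm s p q 1 m \<phi>)" by (intro mult_left_mono N) simp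
    also have "\<dots> = ennreal (K3 * (K1 * K2)) * intrinsic_norm s p q 1 m \<phi>"
      using K1(1) K2(1) K3(1) by (simp add: ennreal_mult mult.assoc)
    finally have bn: "besov_norm s p q (extop \<phi>) \<le> ennreal (K3 * (K1 * K2)) * intrinsic_norm s p q 1 m \<phi>" .
    moreover have "besov_norm s p q (extop \<phi>) < top"
      using bn fin by (auto simp: ennreal_mult_less_top intro: le_less_trans)
    moreover have "extop \<phi> \<in> borel_measurable borel" unfolding extop_def[abs_def] by measurable
    moreover have "AE x in lborel. (\<Sum>i. res \<phi> i x) < top"
      using conjunct1[OF syn]
    proof eventually_elim
      case (elim x)
      then have "ennreal K1 * (\<Sum>i. res \<phi> i x) < top" by (simp add: R_def)
      then show ?case using K1(1) by (auto simp: ennreal_mult_less_top)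
    qed
    ultimately show "extop \<phi> \<in> besov s p q \<and> besov_norm s p q (extop \<phi>) \<le> ennreal (K3 * (K1 * K2)) * intrinsic_norm s p q 1 m \<phi> \<and>
      (AE x in lborel. (\<Sum>i. res \<phi> i x) < top)"
      by (simp add: besov_def)
  qed
  qed
qed

section \<open>Trace of the extension\<close>

lemma ext_partial_sum:
  assumes "ed z \<le> dy (int k) / 16"
  shows "(\<Sum>i<Suc k. ext_term \<phi> i z) = wmean k \<phi> z"
proof -
  have "cut i z = 1" if "i \<le> k" for i
    using assms dy_mono[of "int i" "int k"] that by (intro cut_eq_1) auto
  then have "(\<Sum>i<Suc j. ext_term \<phi> i z) = wmean j \<phi> z" if "j \<le> k" for j
    using that by (induction j) (auto simp: ext_term_def)
  then show ?thesis by simp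
qed

text \<open>The tail gains 2^(-ks) in L_p(R^n) and averaging at scale k + 4 costs 2^(k\<tau>), so
  the L_p(m_0) norms decay like 2^(-k(s-\<tau>)). The sum over k is then finite almost everywhere,
  and its terms tend to 0. The scale k + 4 means radius \<open>dy k / 16\<close>, within which the
  terms up to index k collapse to one mean.\<close>

lemma tail_average_tendsto_0:
  fixes R :: "nat \<Rightarrow> real^'n \<Rightarrow> ennreal"
  assumes [measurable]: "\<And>i. R i \<in> borel_measurable borel"
    and B: "B < top" "\<And>i. ennreal (2 powr (real i * s)) * Lp_norm lborel p (R i) \<le> B"
  shows "AE x in m 0. (\<lambda>k. avg (int k + 4) (\<lambda>z. \<Sum>i. R (i + Suc k) z) x) \<longlonglongrightarrow> 0"
proof -
  define \<delta> where "\<delta> = s - \<tau>"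
  have \<delta>: "0 < \<delta>" using s by (simp add: \<delta>_def)
  obtain CA where CA: "0 < CA"
    "\<And>k j h. int k - 6 \<le> j \<Longrightarrow> h \<in> borel_measurable borel \<Longrightarrow>
       Lp_norm (m k) p (avg j h) \<le> ennreal (CA * dy j powr (- \<tau>)) * Lp_norm lborel p h"
    using avg_norm_le by blast
  obtain G1 where G1: "0 < G1"
    "\<And>(M :: (real^'n) measure) f B. (\<And>i. f i \<in> borel_measurable M) \<Longrightarrow> (\<And>i. Lp_norm M p (f i) \<le> B) \<Longrightarrow>
       Lp_norm M p (\<lambda>x. \<Sum>i. ennreal (2 powr (- s * real i)) * f i x) \<le> ennreal G1 * B"
    using Lp_norm_geometric[OF s_pos p_pos] by blast
  obtain G2 where G2: "0 < G2"
    "\<And>(M :: (real^'n) measure) f B. (\<And>i. f i \<in> borel_measurable M) \<Longrightarrow> (\<And>i. Lp_norm M p (f i) \<le> B) \<Longrightarrow>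
       Lp_norm M p (\<lambda>x. \<Sum>i. ennreal (2 powr (- \<delta> * real i)) * f i x) \<le> ennreal G2 * B"
    using Lp_norm_geometric[OF \<delta> p_pos] by blast
  define T where "T k z = (\<Sum>i. R (i + Suc k) z)" for k z
  define X where "X k = avg (int k + 4) (T k)" for k :: nat
  have [measurable]: "T k \<in> borel_measurable borel" for k unfolding T_def by measurable
  have Xm[measurable]: "X k \<in> borel_measurable borel" for k unfolding X_def by measurable
  have Tn: "Lp_norm lborel p (T k) \<le> ennreal (G1 * 2 powr (- s * real k)) * B" for k
  proof -
    have e: "T k = (\<lambda>z. \<Sum>i. ennreal (2 powr (- s * real i)) * (ennreal (2 powr (s * real i)) * R (i + Suc k) z))"
      unfolding T_def fun_eq_iff
    proof (intro allI suminf_cong)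
      fix z and i :: nat
      have "ennreal (2 powr (- s * real i)) * ennreal (2 powr (s * real i)) = 1"
        by (simp flip: ennreal_mult powr_add)
      then show "R (i + Suc k) z = ennreal (2 powr (- s * real i)) * (ennreal (2 powr (s * real i)) * R (i + Suc k) z)"
        by (simp add: mult.assoc[symmetric])
    qed
    have "Lp_norm lborel p (T k) \<le> ennreal G1 * (ennreal (2 powr (- s * real k)) * B)"
      unfolding e
    proof (intro G1(2))
      fix i
      let ?j = "i + Suc k"
      have "Lp_norm lborel p (\<lambda>z. ennreal (2 powr (s * real i)) * R ?j z) \<le> ennreal (2 powr (s * real i)) * Lp_norm lborel p (R ?j)"
        by (intro Lp_norm_cmult_le p_pos) measurable
      also have "\<dots> \<le> ennreal (2 powr (- s * real k) * 2 powr (real ?j * s)) * Lp_norm lborel p (R ?j)"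
      proof (intro mult_right_mono ennreal_leI)
        show "2 powr (s * real i) \<le> 2 powr (- s * real k) * 2 powr (real ?j * s)"
          using s_pos by (simp flip: powr_add) (simp add: algebra_simps)
      qed simp
      also have "\<dots> = ennreal (2 powr (- s * real k)) * (ennreal (2 powr (real ?j * s)) * Lp_norm lborel p (R ?j))"
        by (simp only: ennreal_mult powr_ge_zero mult.assoc)
      also have "\<dots> \<le> ennreal (2 powr (- s * real k)) * B" by (intro mult_left_mono B) simp
      finally show "Lp_norm lborel p (\<lambda>z. ennreal (2 powr (s * real i)) * R ?j z) \<le> ennreal (2 powr (- s * real k)) * B" .
    qed measurable
    then show ?thesis using G1(1) by (simp add: ennreal_mult mult.assoc)
  qed
  define D where "D = CA * dy 4 powr (- \<tau>) * G1"
  have D: "0 < D" using CA(1) G1(1) by (simp add: D_def)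
  have Xn: "Lp_norm (m 0) p (\<lambda>x. ennreal (2 powr (\<delta> * real k)) * X k x) \<le> ennreal D * B" for k
  proof -
    have "Lp_norm (m 0) p (\<lambda>x. ennreal (2 powr (\<delta> * real k)) * X k x) \<le> ennreal (2 powr (\<delta> * real k)) * Lp_norm (m 0) p (X k)"
      by (intro Lp_norm_cmult_le p_pos) measurable
    also have "\<dots> \<le> ennreal (2 powr (\<delta> * real k)) * (ennreal (CA * dy (int k + 4) powr (- \<tau>)) * (ennreal (G1 * 2 powr (- s * real k)) * B))"
    proof (intro mult_left_mono)
      have "Lp_norm (m 0) p (X k) \<le> ennreal (CA * dy (int k + 4) powr (- \<tau>)) * Lp_norm lborel p (T k)"
        unfolding X_def by (intro CA) auto
      also have "\<dots> \<le> ennreal (CA * dy (int k + 4) powr (- \<tau>)) * (ennreal (G1 * 2 powr (- s * real k)) * B)"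
        by (intro mult_left_mono Tn) simp
      finally show "Lp_norm (m 0) p (X k) \<le> ennreal (CA * dy (int k + 4) powr (- \<tau>)) * (ennreal (G1 * 2 powr (- s * real k)) * B)" .
    qed simp
    also have "\<dots> = ennreal (2 powr (\<delta> * real k) * ((CA * dy (int k + 4) powr (- \<tau>)) * (G1 * 2 powr (- s * real k)))) * B"
      using CA(1) G1(1) by (simp add: ennreal_mult mult.assoc)
    also have "2 powr (\<delta> * real k) * ((CA * dy (int k + 4) powr (- \<tau>)) * (G1 * 2 powr (- s * real k))) = D"
    proof -
      have "dy (int k + 4) powr (- \<tau>) = 2 powr (\<tau> * real k) * dy 4 powr (- \<tau>)"
        unfolding dy_add powr_mult dy_nat by (simp add: powr_powr mult.commute)
      then have "2 powr (\<delta> * real k) * ((CA * dy (int k + 4) powr (- \<tau>)) * (G1 * 2 powr (- s * real k)))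
        = D * (2 powr (\<delta> * real k) * (2 powr (\<tau> * real k) * 2 powr (- s * real k)))"
        by (simp add: D_def mult_ac)
      also have "2 powr (\<delta> * real k) * (2 powr (\<tau> * real k) * 2 powr (- s * real k)) = 2 powr (\<delta> * real k + (\<tau> * real k + - s * real k))"
        by (simp only: powr_add)
      also have "\<delta> * real k + (\<tau> * real k + - s * real k) = 0" by (simp add: \<delta>_def algebra_simps)
      finally show ?thesis by simp
    qed
    finally show ?thesis .
  qed
  have e: "(\<lambda>x. \<Sum>k. X k x) = (\<lambda>x. \<Sum>k. ennreal (2 powr (- \<delta> * real k)) * (ennreal (2 powr (\<delta> * real k)) * X k x))"
    unfolding fun_eq_iff
  proof (intro allI suminf_cong)
    fix x and k :: nat
    have "ennreal (2 powr (- \<delta> * real k)) * ennreal (2 powr (\<delta> * real k)) = 1"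
      by (simp flip: ennreal_mult powr_add)
    then show "X k x = ennreal (2 powr (- \<delta> * real k)) * (ennreal (2 powr (\<delta> * real k)) * X k x)"
      by (simp add: mult.assoc[symmetric])
  qed
  have "Lp_norm (m 0) p (\<lambda>x. \<Sum>k. X k x) \<le> ennreal G2 * (ennreal D * B)"
    unfolding e by (intro G2(2) Xn) measurable
  also have "\<dots> < top" using B(1) by (simp add: ennreal_mult_less_top)
  finally have "AE x in m 0. (\<Sum>k. X k x) < top"
    by (intro Lp_norm_finite_AE[OF p_pos]) measurable
  then show ?thesis
  proof eventually_elim
    case (elim x)
    then show ?case using ennreal_suminf_tendsto_0[OF elim] by (simp add: X_def T_def[abs_def])
  qed
qed

text \<open>Within \<open>dy k / 16\<close> of a point x of E the extension is
  \<open>wmean k \<phi>\<close> plus a tail. The mean is close to \<open>near 1 \<phi> k x\<close>,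
  because its bump lives inside \<open>ecube k x\<close>, and this constant is close to \<phi> x. It
  is enough to follow the averages along the radii \<open>dy k / 16\<close>, since the limit over
  all radii exists almost everywhere by the trace result for Besov functions.\<close>

lemma extop_trace:
  assumes q: "0 < q" and \<phi>: "\<phi> \<in> L_loc 1 m" and fin: "intrinsic_norm s p q 1 m \<phi> < top"
  shows "has_trace (m 0) (extop \<phi>) \<phi>"
proof -
  have \<phi>m[measurable]: "\<phi> \<in> borel_measurable borel" using \<phi> by (simp add: L_loc_def)
  note resm[measurable] = measurable_res[OF \<phi>]
  obtain Cb where Cb: "0 < Cb"
    "\<And>\<phi>. \<phi> \<in> L_loc 1 m \<Longrightarrow> intrinsic_norm s p q 1 m \<phi> < top \<Longrightarrow>
      extop \<phi> \<in> besov s p q \<and> besov_norm s p q (extop \<phi>) \<le> ennreal Cb * intrinsic_norm s p q 1 m \<phi> \<and>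
      (AE x in lborel. (\<Sum>i. res \<phi> i x) < top)"
    using extop_besov[OF q] by blast
  have f: "extop \<phi> \<in> besov s p q" and resfin: "AE x in lborel. (\<Sum>i. res \<phi> i x) < top"
    using Cb(2)[OF \<phi> fin] by auto
  have fm[measurable]: "extop \<phi> \<in> borel_measurable borel" using f by (simp add: besov_def)
  obtain K1 where K1: "0 < K1"
    "\<And>\<phi> i x. \<phi> \<in> L_loc 1 m \<Longrightarrow> ennreal \<bar>ext_term \<phi> i x\<bar> \<le> ennreal K1 * res \<phi> i x"
    "\<And>\<phi> i x x'. \<phi> \<in> L_loc 1 m \<Longrightarrow>
       ennreal \<bar>ext_term \<phi> i x - ext_term \<phi> i x'\<bar> \<le> ennreal (K1 * (infnorm (x - x') / dy (int i))) * (res \<phi> i x + res \<phi> i x')"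
    using ext_term_bounds by blast
  obtain K2 where K2: "0 < K2"
    "\<And>\<phi>. \<phi> \<in> L_loc 1 m \<Longrightarrow> lq_norm q (\<lambda>i. ennreal (2 powr (real i * s)) * Lp_norm lborel p (res \<phi> i)) \<le> ennreal K2 * intrinsic_norm s p q 1 m \<phi>"
    using res_lq_norm_le[OF q] by blast
  obtain K3 where K3: "0 < K3"
    "\<And>\<phi>. \<phi> \<in> L_loc 1 m \<Longrightarrow> AE x in m 0. osc_tail s (appr 1 \<phi>) 0 x < top \<longrightarrow>
       (\<forall>k l. k \<le> l + 2 \<longrightarrow> ennreal \<bar>\<phi> x - near 1 \<phi> l x\<bar> \<le> ennreal K3 * osc_tail s (appr 1 \<phi>) k x)"
    using near_limit[of 1] by auto
  obtain K4 where K4: "0 < K4"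
    "\<And>\<phi> k x c. \<phi> \<in> L_loc 1 m \<Longrightarrow> x \<in> nbhd k \<Longrightarrow>
       ennreal \<bar>wmean k \<phi> x - c\<bar> \<le> ennreal (K4 / dy (int k) powr d) * (\<integral>\<^sup>+y\<in>cube (3 / 2 * dy (int k)) x. ennreal \<bar>\<phi> y - c\<bar> \<partial>m k)"
    "\<And>\<phi> k x x' c. \<phi> \<in> L_loc 1 m \<Longrightarrow> x \<in> nbhd k \<Longrightarrow> x' \<in> nbhd k \<Longrightarrow> infnorm (x - x') \<le> dy (int k) / 4 \<Longrightarrow>
       ennreal \<bar>wmean k \<phi> x - wmean k \<phi> x'\<bar> \<le> ennreal (K4 * (infnorm (x - x') / dy (int k)) / dy (int k) powr d) *
         (\<integral>\<^sup>+y\<in>cube (2 * dy (int k)) x. ennreal \<bar>\<phi> y - c\<bar> \<partial>m k)"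
    using wmean_bounds by blast
  obtain K5 where K5: "0 < K5" "\<And>\<phi> k l x. \<phi> \<in> L_loc 1 m \<Longrightarrow> x \<in> E \<Longrightarrow> k \<le> l + 2 \<Longrightarrow>
       (\<Sum>i. bst 1 \<phi> (i + l) x) \<le> ennreal K5 * osc_tail s (appr 1 \<phi>) k x"
    using bst_sum_le[of 1] by auto
  obtain C4 where C4: "0 < C4"
    "\<And>k j x. int k - 6 \<le> j \<Longrightarrow> emeasure (m k) (cube (dy j) x) \<le> ennreal (C4 * dy j powr d)"
    using mass_le by blast
  define R where "R i x = ennreal K1 * res \<phi> i x" for i x
  have Rm[measurable]: "R i \<in> borel_measurable borel" for i unfolding R_def by measurable
  define B where "B = ennreal K1 * (ennreal K2 * intrinsic_norm s p q 1 m \<phi>)"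
  have Bfin: "B < top" using fin by (simp add: B_def ennreal_mult_less_top)
  have RB: "ennreal (2 powr (real i * s)) * Lp_norm lborel p (R i) \<le> B" for i
  proof -
    have "ennreal (2 powr (real i * s)) * Lp_norm lborel p (R i)
      \<le> ennreal (2 powr (real i * s)) * (ennreal K1 * Lp_norm lborel p (res \<phi> i))"
      unfolding R_def by (intro mult_left_mono Lp_norm_cmult_le p_pos) auto
    also have "\<dots> = ennreal K1 * (ennreal (2 powr (real i * s)) * Lp_norm lborel p (res \<phi> i))" by (rule mult.left_commute)
    also have "\<dots> \<le> ennreal K1 * lq_norm q (\<lambda>i. ennreal (2 powr (real i * s)) * Lp_norm lborel p (res \<phi> i))"
      by (intro mult_left_mono le_lq_norm[OF q, of "\<lambda>i. ennreal (2 powr (real i * s)) * Lp_norm lborel p (res \<phi> i)" i]) simp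
    also have "\<dots> \<le> B" unfolding B_def by (intro mult_left_mono K2 \<phi>) simp
    finally show ?thesis .
  qed
  have Rfin: "AE z in lborel. (\<Sum>i. R i z) < top"
    using resfin by eventually_elim (simp add: R_def ennreal_mult_less_top)
  have osc: "AE x in m 0. osc_tail s (appr 1 \<phi>) 0 x < top"
    by (rule appr_finite_AE[OF q _ \<phi> fin]) simp
  let ?T = "\<lambda>k z. \<Sum>i. R (i + Suc k) z"
  define K6 where "K6 = K4 * (2 * (C4 * 2 powr d)) * K5 + K3"
  show ?thesis
    unfolding has_trace_def
    using trace_limit_AE[OF q f] tail_average_tendsto_0[OF Rm Bfin RB] osc K3(2)[OF \<phi>] AE_in_E[of 0]
  proof eventually_elim
    case (elim x)
    have x: "x \<in> E" and oscx: "osc_tail s (appr 1 \<phi>) 0 x < top" using elim by auto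
    have near: "ennreal \<bar>\<phi> x - near 1 \<phi> k x\<bar> \<le> ennreal K3 * osc_tail s (appr 1 \<phi>) k x" for k
      using elim by auto
    obtain L where L: "((\<lambda>r. average lborel (cube r x) (extop \<phi>)) \<longlongrightarrow> L) (at_right 0)" using elim by blast
    let ?o = "\<lambda>k. osc_tail s (appr 1 \<phi>) k x" and ?X = "\<lambda>k. avg (int k + 4) (?T k) x"
    have "filterlim (\<lambda>k. dy (int k + 4)) (at_right 0) sequentially"
      unfolding filterlim_at using dy_tendsto_0[of 4] by (auto intro!: always_eventually)
    from filterlim_compose[OF L this]
    have avl: "(\<lambda>k. average lborel (cube (dy (int k + 4)) x) (extop \<phi>)) \<longlonglongrightarrow> L" .
    have key: "ennreal \<bar>average lborel (cube (dy (int k + 4)) x) (extop \<phi>) - \<phi> x\<bar> \<le> ?X k + ennreal K6 * ?o k" for k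
    proof -
      let ?r = "dy (int k + 4)" and ?Q = "cube (dy (int k + 4)) x"
      have r: "?r = dy (int k) / 16" by (simp add: dy_add dy_numeral)
      have eQ: "emeasure lborel ?Q = ennreal ((2 * ?r) ^ CARD('n))" by (subst emeasure_lborel_cube) auto
      have pQ: "0 < emeasure lborel ?Q" "emeasure lborel ?Q < top" by (auto simp: eQ)
      have pw: "AE z in lborel. z \<in> ?Q \<longrightarrow> ennreal \<bar>extop \<phi> z - \<phi> x\<bar> \<le> ?T k z + ennreal K6 * ?o k"
        using Rfin
      proof (eventually_elim, intro impI)
        fix z assume Rz: "(\<Sum>i. R i z) < top" and z: "z \<in> ?Q"
        have zx: "infnorm (z - x) \<le> dy (int k) / 16" using z by (simp add: mem_cube r)
        have edz: "ed z \<le> dy (int k) / 16" using ed_le[OF x, of z] zx by simp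
        have "ed z < dy (int k) / 4" using edz dy_pos(1)[of "int k"] by linarith
        then have zn: "z \<in> nbhd k" by (rule nbhd_ed)
        have termR: "ennreal \<bar>ext_term \<phi> i z\<bar> \<le> R i z" for i unfolding R_def by (rule K1(2)[OF \<phi>])
        have sm: "summable (\<lambda>i. ext_term \<phi> i z)" by (rule suminf_real_bounds(1)[OF termR Rz])
        have "extop \<phi> z - wmean k \<phi> z = (\<Sum>i. ext_term \<phi> (i + Suc k) z)"
          unfolding extop_def ext_partial_sum[OF edz, symmetric] by (rule suminf_minus_initial_segment[OF sm, symmetric])
        moreover have "?T k z \<le> (\<Sum>i. R i z)"
          using suminf_offset[of "\<lambda>i. R i z" "Suc k"] by simp
        then have "?T k z < top" using Rz by (rule le_less_trans)
        ultimately have 1: "ennreal \<bar>extop \<phi> z - wmean k \<phi> z\<bar> \<le> ?T k z"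
          using suminf_real_bounds(2)[of "\<lambda>i. ext_term \<phi> (i + Suc k) z" "\<lambda>i. R (i + Suc k) z", OF termR] by simp
        have sub: "cube (3 / 2 * dy (int k)) z \<subseteq> ecube k x"
          unfolding ecube_def using zx dy_pos(1)[of "int k"] by (intro cube_mono) linarith
        have 2: "ennreal \<bar>wmean k \<phi> z - near 1 \<phi> k x\<bar> \<le> ennreal (K4 * (2 * (C4 * 2 powr d)) * K5) * ?o k"
        proof -
          have "ennreal \<bar>wmean k \<phi> z - near 1 \<phi> k x\<bar> \<le> ennreal (K4 / dy (int k) powr d) *
              (\<integral>\<^sup>+y\<in>cube (3 / 2 * dy (int k)) z. ennreal \<bar>\<phi> y - near 1 \<phi> k x\<bar> \<partial>m k)"
            by (rule K4(2)[OF \<phi> zn])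
          also have "\<dots> \<le> ennreal (K4 / dy (int k) powr d) * (\<integral>\<^sup>+y\<in>ecube k x. ennreal (\<bar>\<phi> y - near 1 \<phi> k x\<bar> powr 1) \<partial>m k)"
            using sub by (intro mult_left_mono nn_integral_mono) (auto simp: indicator_def)
          also have "\<dots> \<le> ennreal (K4 / dy (int k) powr d) * (enn_powr (2 * bst 1 \<phi> k x) 1 * emeasure (m k) (ecube k x))"
            by (intro mult_left_mono near_spec x \<phi>m) auto
          also have "\<dots> \<le> ennreal (K4 / dy (int k) powr d) * (enn_powr (2 * bst 1 \<phi> k x) 1 * ennreal (C4 * (2 * dy (int k)) powr d))"
          proof (intro mult_left_mono)
            have e: "2 * dy (int k) = dy (int k - 1)" by (simp add: dy_diff)
            have "emeasure (m k) (ecube k x) \<le> emeasure (m k) (cube (2 * dy (int k)) x)"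
              unfolding ecube_def by (intro emeasure_mono cube_mono_radius) auto
            also have "\<dots> \<le> ennreal (C4 * (2 * dy (int k)) powr d)" unfolding e by (rule C4) simp
            finally show "emeasure (m k) (ecube k x) \<le> ennreal (C4 * (2 * dy (int k)) powr d)" .
          qed auto
          also have "\<dots> = ennreal (K4 / dy (int k) powr d * (2 * (C4 * (2 * dy (int k)) powr d))) * bst 1 \<phi> k x"
          proof -
            have "ennreal a * (enn_powr (2 * X) 1 * ennreal b) = ennreal (a * (2 * b)) * X" if "0 \<le> a" "0 \<le> b" for a b X
              using that by (simp add: ennreal_mult mult_ac)
            then show ?thesis by this (use K4(1) C4(1) in auto)
          qed
          also have "K4 / dy (int k) powr d * (2 * (C4 * (2 * dy (int k)) powr d)) = K4 * (2 * (C4 * 2 powr d))"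
            by (simp add: powr_mult)
          also have "ennreal (K4 * (2 * (C4 * 2 powr d))) * bst 1 \<phi> k x \<le> ennreal (K4 * (2 * (C4 * 2 powr d))) * (ennreal K5 * ?o k)"
          proof (intro mult_left_mono)
            have "bst 1 \<phi> k x \<le> (\<Sum>i. bst 1 \<phi> (i + k) x)"
              using sum_le_suminf[of "\<lambda>i. bst 1 \<phi> (i + k) x" "{0}"] by simp
            also have "\<dots> \<le> ennreal K5 * ?o k" by (intro K5 \<phi> x) simp
            finally show "bst 1 \<phi> k x \<le> ennreal K5 * ?o k" .
          qed simp
          also have "\<dots> = ennreal (K4 * (2 * (C4 * 2 powr d)) * K5) * ?o k"
            unfolding mult.assoc[of "ennreal _", symmetric] using K4(1) C4(1) K5(1) by (subst ennreal_mult) auto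
          finally show ?thesis .
        qed
        have "ennreal \<bar>extop \<phi> z - \<phi> x\<bar> \<le> ennreal \<bar>extop \<phi> z - wmean k \<phi> z\<bar> + ennreal \<bar>wmean k \<phi> z - \<phi> x\<bar>"
          by (rule ennreal_dist_triangle)
        also have "\<dots> \<le> ennreal \<bar>extop \<phi> z - wmean k \<phi> z\<bar> + (ennreal \<bar>wmean k \<phi> z - near 1 \<phi> k x\<bar> + ennreal \<bar>near 1 \<phi> k x - \<phi> x\<bar>)"
          by (intro add_left_mono ennreal_dist_triangle)
        also have "\<dots> \<le> ?T k z + (ennreal (K4 * (2 * (C4 * 2 powr d)) * K5) * ?o k + ennreal K3 * ?o k)"
          using 1 2 near[of k] by (intro add_mono) (auto simp: abs_minus_commute)
        also have "ennreal (K4 * (2 * (C4 * 2 powr d)) * K5) * ?o k + ennreal K3 * ?o k = ennreal K6 * ?o k"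
          unfolding K6_def distrib_right[symmetric] using K3(1) K4(1) K5(1) C4(1) by (subst ennreal_plus) auto
        finally show "ennreal \<bar>extop \<phi> z - \<phi> x\<bar> \<le> ?T k z + ennreal K6 * ?o k" .
      qed
      have "ennreal \<bar>average lborel ?Q (extop \<phi>) - \<phi> x\<bar> * emeasure lborel ?Q \<le> (\<integral>\<^sup>+z\<in>?Q. ennreal \<bar>extop \<phi> z - \<phi> x\<bar> \<partial>lborel)"
        using pQ by (intro average_dist_le besov_locally_integrable[OF f compact_cube]) auto
      also have "\<dots> \<le> (\<integral>\<^sup>+z. ?T k z * indicator ?Q z + (ennreal K6 * ?o k) * indicator ?Q z \<partial>lborel)"
        using pw by (intro nn_integral_mono_AE) (auto simp: indicator_def elim!: eventually_mono)
      also have "\<dots> = (\<integral>\<^sup>+z\<in>?Q. ?T k z \<partial>lborel) + (ennreal K6 * ?o k) * emeasure lborel ?Q"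
        by (subst nn_integral_add) (auto simp: nn_integral_cmult_indicator)
      also have "(\<integral>\<^sup>+z\<in>?Q. ?T k z \<partial>lborel) = ennreal (?r ^ CARD('n)) * ?X k"
        by (simp add: avg_def mult.assoc[symmetric] ennreal_mult[symmetric] powr_minus powr_realpow)
      also have "\<dots> \<le> ?X k * emeasure lborel ?Q"
        unfolding eQ mult.commute[of "?X k"] by (intro mult_right_mono ennreal_leI power_mono) auto
      also have "?X k * emeasure lborel ?Q + (ennreal K6 * ?o k) * emeasure lborel ?Q = (?X k + ennreal K6 * ?o k) * emeasure lborel ?Q"
        by (rule distrib_right[symmetric])
      finally have "ennreal \<bar>average lborel ?Q (extop \<phi>) - \<phi> x\<bar> * emeasure lborel ?Q \<le> (?X k + ennreal K6 * ?o k) * emeasure lborel ?Q"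
        by simp
      then show ?thesis by (rule ennreal_mult_le_cancel[OF _ pQ])
    qed
    have "?o \<longlonglongrightarrow> 0"
    proof -
      have "?o k = (\<Sum>i. osc_bound s (appr 1 \<phi>) (int (i + k) - 6) x)" for k
        by (simp add: osc_tail_def algebra_simps)
      moreover have "(\<lambda>k. \<Sum>i. osc_bound s (appr 1 \<phi>) (int (i + k) - 6) x) \<longlonglongrightarrow> 0"
        by (rule ennreal_tail_tendsto_0) (use oscx in \<open>simp add: osc_tail_def algebra_simps\<close>)
      ultimately show ?thesis by simp
    qed
    then have "(\<lambda>k. ennreal K6 * ?o k) \<longlonglongrightarrow> ennreal K6 * 0" by (intro ennreal_tendsto_cmult) auto
    with elim(2) have "(\<lambda>k. ?X k + ennreal K6 * ?o k) \<longlonglongrightarrow> 0 + ennreal K6 * 0" by (intro tendsto_add)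
    then have lim0: "(\<lambda>k. ?X k + ennreal K6 * ?o k) \<longlonglongrightarrow> 0" by simp
    have "(\<lambda>k. ennreal \<bar>average lborel (cube (dy (int k + 4)) x) (extop \<phi>) - \<phi> x\<bar>) \<longlonglongrightarrow> 0"
      by (rule tendsto_sandwich[OF _ _ tendsto_const lim0]) (use key in auto)
    moreover have "(\<lambda>k. ennreal \<bar>average lborel (cube (dy (int k + 4)) x) (extop \<phi>) - \<phi> x\<bar>) \<longlonglongrightarrow> ennreal \<bar>L - \<phi> x\<bar>"
      by (intro tendsto_ennrealI tendsto_intros avl)
    ultimately have "ennreal \<bar>L - \<phi> x\<bar> = 0" using LIMSEQ_unique by blast
    then have "\<phi> x = L" by simp
    then show ?case using precise_rep_eq[OF L] by simp
  qed
qed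

section \<open>Linearity of the extension\<close>

lemma wmean_integrable:
  assumes "\<phi> \<in> L_loc 1 m"
  shows "integrable (m k) (\<lambda>y. bump k x y / den k x * \<phi> y)"
proof -
  note [measurable] = L_loc_1_cube(1)[OF assms]
  show ?thesis
  proof (rule kernel_mean(2)[where Q="cube (3 / 2 * dy (int k)) x" and B="3 / 2 / \<bar>den k x\<bar>"])
    show "\<bar>bump k x y / den k x\<bar> \<le> 3 / 2 / \<bar>den k x\<bar>" for y
      unfolding abs_divide by (intro divide_right_mono bump_abs_le) simp
  qed (use emeasure_cube_finite[OF lf] bump_eq_0 L_loc_1_cube(2)[OF assms] in auto)
qed

lemma ext_term_linear:
  assumes "\<phi> \<in> L_loc 1 m" "\<psi> \<in> L_loc 1 m"
  shows "ext_term (\<lambda>x. a * \<phi> x + b * \<psi> x) i x = a * ext_term \<phi> i x + b * ext_term \<psi> i x"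
proof -
  have "wmean k (\<lambda>x. a * \<phi> x + b * \<psi> x) x = a * wmean k \<phi> x + b * wmean k \<psi> x" for k
  proof -
    have "wmean k (\<lambda>x. a * \<phi> x + b * \<psi> x) x = (\<integral>y. a * (bump k x y / den k x * \<phi> y) + b * (bump k x y / den k x * \<psi> y) \<partial>m k)"
      unfolding wmean_def by (intro Bochner_Integration.integral_cong refl) (simp add: algebra_simps add_divide_distrib)
    also have "\<dots> = a * wmean k \<phi> x + b * wmean k \<psi> x"
      unfolding wmean_def
      by (subst Bochner_Integration.integral_add)
         (use wmean_integrable[OF assms(1)] wmean_integrable[OF assms(2)] in \<open>auto simp del: times_divide_eq_left\<close>)
    finally show ?thesis .
  qed
  then show ?thesis by (simp add: ext_term_def algebra_simps)
qed

text \<open>Termwise linearity holds everywhere, but it passes to the sums only where both series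
  converge, hence almost everywhere.\<close>

lemma extop_linear_AE:
  assumes q: "0 < q" and \<phi>: "\<phi> \<in> L_loc 1 m" "intrinsic_norm s p q 1 m \<phi> < top"
    and \<psi>: "\<psi> \<in> L_loc 1 m" "intrinsic_norm s p q 1 m \<psi> < top"
  shows "AE x in lborel. extop (\<lambda>x. a * \<phi> x + b * \<psi> x) x = a * extop \<phi> x + b * extop \<psi> x"
proof -
  obtain K1 where K1: "0 < K1"
    "\<And>\<phi> i x. \<phi> \<in> L_loc 1 m \<Longrightarrow> ennreal \<bar>ext_term \<phi> i x\<bar> \<le> ennreal K1 * res \<phi> i x"
    "\<And>\<phi> i x x'. \<phi> \<in> L_loc 1 m \<Longrightarrow>
       ennreal \<bar>ext_term \<phi> i x - ext_term \<phi> i x'\<bar> \<le> ennreal (K1 * (infnorm (x - x') / dy (int i))) * (res \<phi> i x + res \<phi> i x')"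
    using ext_term_bounds by blast
  have "AE x in lborel. (\<Sum>i. res \<phi> i x) < top" "AE x in lborel. (\<Sum>i. res \<psi> i x) < top"
    using extop_besov[OF q] \<phi> \<psi> by metis+
  then show ?thesis
  proof eventually_elim
    case (elim x)
    have "summable (\<lambda>i. ext_term \<phi> i x)" "summable (\<lambda>i. ext_term \<psi> i x)"
      using elim by (auto intro!: suminf_real_bounds(1)[OF K1(2)] \<phi>(1) \<psi>(1) simp: ennreal_mult_less_top)
    then show ?case
      unfolding extop_def ext_term_linear[OF \<phi>(1) \<psi>(1)]
      by (simp add: suminf_add[symmetric] suminf_mult summable_mult)
  qed
qed

text \<open>The equality is everywhere and not just almost everywhere: \<phi> enters only through
  integrals for the measures m_k, all of which ignore m_0-null sets.\<close>

lemma extop_cong_AE: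
  assumes [measurable]: "\<phi> \<in> borel_measurable borel" "\<psi> \<in> borel_measurable borel" and eq: "AE x in m 0. \<phi> x = \<psi> x"
  shows "extop \<phi> = extop \<psi>"
proof -
  have [measurable]: "(\<lambda>y. bump k x y) \<in> borel_measurable borel" for k and x :: "real^'n" by measurable
  have "wmean k \<phi> x = wmean k \<psi> x" for k x
    unfolding wmean_def
  proof (rule integral_cong_AE)
    show "AE y in m k. bump k x y / den k x * \<phi> y = bump k x y / den k x * \<psi> y"
      using AE_m[OF eq, of k] by eventually_elim simp
  qed measurable
  then have "wmean k \<phi> = wmean k \<psi>" for k by (intro ext)
  then have "ext_term \<phi> i x = ext_term \<psi> i x" for i x by (simp only: ext_term_def)
  then show ?thesis by (intro ext) (simp only: extop_def)
qed

end


subsection \<open>Conclusion\<close>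

context trace_setting
begin

lemma average_linear:
  fixes x :: "real^'n"
  assumes f: "f \<in> besov s p q" and g: "g \<in> besov s p q"
  shows "average lborel (cube r x) (\<lambda>y. a * f y + b * g y) = a * average lborel (cube r x) f + b * average lborel (cube r x) g"
proof -
  have i: "set_integrable lborel (cube r x) f" if f: "f \<in> besov s p q" for f :: "real^'n \<Rightarrow> real"
  proof -
    have [measurable]: "f \<in> borel_measurable borel" using f by (simp add: besov_def)
    show ?thesis
      unfolding set_integrable_def
    proof (rule integrableI_bounded)
      have "(\<integral>\<^sup>+y. ennreal (norm (indicator (cube r x) y *\<^sub>R f y)) \<partial>lborel) = (\<integral>\<^sup>+y\<in>cube r x. ennreal \<bar>f y\<bar> \<partial>lborel)"
        by (intro nn_integral_cong) (auto simp: indicator_def)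
      then show "(\<integral>\<^sup>+y. ennreal (norm (indicator (cube r x) y *\<^sub>R f y)) \<partial>lborel) < \<infinity>"
        using besov_locally_integrable[OF f compact_cube, of r x] by simp
    qed measurable
  qed
  have "(LINT y:cube r x|lborel. a * f y + b * g y) = a * (LINT y:cube r x|lborel. f y) + b * (LINT y:cube r x|lborel. g y)"
    using i[OF f] i[OF g] by (subst set_integral_add) auto
  then show ?thesis by (simp add: average_def add_divide_distrib)
qed

text \<open>The gradients are combined with weights |a| and |b|, off the union of the two
  exceptional sets. Since only finiteness is at stake, quasi-triangle inequalities are
  sufficient.\<close>

lemma besov_linear:
  fixes f g :: "real^'n \<Rightarrow> real"
  assumes q: "0 < q" and f: "f \<in> besov s p q" and g: "g \<in> besov s p q"
  shows "(\<lambda>x. a * f x + b * g x) \<in> besov s p q"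
proof -
  have [measurable]: "f \<in> borel_measurable borel" "g \<in> borel_measurable borel" using f g by (auto simp: besov_def)
  obtain A1 where A1: "0 < A1"
    "\<And>(M :: (real^'n) measure) f g. f \<in> borel_measurable M \<Longrightarrow> g \<in> borel_measurable M \<Longrightarrow>
       Lp_norm M p (\<lambda>x. f x + g x) \<le> ennreal A1 * (Lp_norm M p f + Lp_norm M p g)"
    using Lp_norm_add_le[OF p_pos] by blast
  obtain A2 where A2: "0 < A2"
    "\<And>(M :: int measure) f g. f \<in> borel_measurable M \<Longrightarrow> g \<in> borel_measurable M \<Longrightarrow>
       Lp_norm M q (\<lambda>x. f x + g x) \<le> ennreal A2 * (Lp_norm M q f + Lp_norm M q g)"
    using Lp_norm_add_le[OF q] by blast
  have comb: "Lp_norm lborel p (\<lambda>x. ennreal (\<bar>a\<bar> * u x + \<bar>b\<bar> * v x)) \<le> ennreal A1 * (ennreal \<bar>a\<bar> * Lp_norm lborel p (\<lambda>x. ennreal (u x)) + ennreal \<bar>b\<bar> * Lp_norm lborel p (\<lambda>x. ennreal (v x)))"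
    if [measurable]: "u \<in> borel_measurable borel" "v \<in> borel_measurable borel" and nn: "\<And>x. 0 \<le> u x" "\<And>x. 0 \<le> v x" for u v :: "real^'n \<Rightarrow> real"
  proof -
    have "Lp_norm lborel p (\<lambda>x. ennreal (\<bar>a\<bar> * u x + \<bar>b\<bar> * v x)) = Lp_norm lborel p (\<lambda>x. ennreal \<bar>a\<bar> * ennreal (u x) + ennreal \<bar>b\<bar> * ennreal (v x))"
      using nn by (simp add: ennreal_mult)
    also have "\<dots> \<le> ennreal A1 * (Lp_norm lborel p (\<lambda>x. ennreal \<bar>a\<bar> * ennreal (u x)) + Lp_norm lborel p (\<lambda>x. ennreal \<bar>b\<bar> * ennreal (v x)))"
      by (intro A1) auto
    also have "\<dots> \<le> ennreal A1 * (ennreal \<bar>a\<bar> * Lp_norm lborel p (\<lambda>x. ennreal (u x)) + ennreal \<bar>b\<bar> * Lp_norm lborel p (\<lambda>x. ennreal (v x)))"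
      by (intro mult_left_mono add_mono Lp_norm_cmult_le p_pos) auto
    finally show ?thesis .
  qed
  obtain g1 where g1: "g1 \<in> frac_gradients s f" "lq_norm q (\<lambda>k. Lp_norm lborel p (\<lambda>x. ennreal (g1 k x))) < top"
    using besov_gradient[OF f] by blast
  obtain g2 where g2: "g2 \<in> frac_gradients s g" "lq_norm q (\<lambda>k. Lp_norm lborel p (\<lambda>x. ennreal (g2 k x))) < top"
    using besov_gradient[OF g] by blast
  have gm[measurable]: "g1 k \<in> borel_measurable borel" "g2 k \<in> borel_measurable borel"
    and gn: "0 \<le> g1 k x" "0 \<le> g2 k x" for k x
    using g1(1) g2(1) by (auto simp: frac_gradients_def)
  define h where "h k x = \<bar>a\<bar> * g1 k x + \<bar>b\<bar> * g2 k x" for k x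
  have "h \<in> frac_gradients s (\<lambda>x. a * f x + b * g x)"
  proof -
    obtain N1 where N1: "N1 \<in> null_sets lebesgue" "\<forall>k. \<forall>x\<in>- N1. \<forall>y\<in>- N1.
           2 powi (- k - 1) \<le> infnorm (x - y) \<and> infnorm (x - y) < 2 powi (- k) \<longrightarrow>
           \<bar>f x - f y\<bar> \<le> infnorm (x - y) powr s * (g1 k x + g1 k y)"
      using g1(1) by (auto simp: frac_gradients_def)
    obtain N2 where N2: "N2 \<in> null_sets lebesgue" "\<forall>k. \<forall>x\<in>- N2. \<forall>y\<in>- N2.
           2 powi (- k - 1) \<le> infnorm (x - y) \<and> infnorm (x - y) < 2 powi (- k) \<longrightarrow>
           \<bar>g x - g y\<bar> \<le> infnorm (x - y) powr s * (g2 k x + g2 k y)"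
      using g2(1) by (auto simp: frac_gradients_def)
    have "\<bar>(a * f x + b * g x) - (a * f y + b * g y)\<bar> \<le> infnorm (x - y) powr s * (h k x + h k y)"
      if xy: "x \<in> - (N1 \<union> N2)" "y \<in> - (N1 \<union> N2)" and r: "2 powi (- k - 1) \<le> infnorm (x - y) \<and> infnorm (x - y) < 2 powi (- k)" for k x y
    proof -
      have "\<bar>(a * f x + b * g x) - (a * f y + b * g y)\<bar> = \<bar>a * (f x - f y) + b * (g x - g y)\<bar>" by (simp add: algebra_simps)
      also have "\<dots> \<le> \<bar>a\<bar> * \<bar>f x - f y\<bar> + \<bar>b\<bar> * \<bar>g x - g y\<bar>"
        using abs_triangle_ineq[of "a * (f x - f y)" "b * (g x - g y)"] by (simp only: abs_mult)
      also have "\<dots> \<le> \<bar>a\<bar> * (infnorm (x - y) powr s * (g1 k x + g1 k y)) + \<bar>b\<bar> * (infnorm (x - y) powr s * (g2 k x + g2 k y))"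
        using N1(2) N2(2) xy r by (intro add_mono mult_left_mono) auto
      also have "\<dots> = infnorm (x - y) powr s * (h k x + h k y)" by (simp add: h_def algebra_simps)
      finally show ?thesis .
    qed
    moreover have "N1 \<union> N2 \<in> null_sets lebesgue" using N1(1) N2(1) by (rule null_sets.Un)
    moreover have "h k \<in> borel_measurable borel" "0 \<le> h k x" for k x using gn unfolding h_def by auto
    ultimately show ?thesis unfolding frac_gradients_def by blast
  qed
  then have "(INF g\<in>frac_gradients s (\<lambda>x. a * f x + b * g x). lq_norm q (\<lambda>k. Lp_norm lborel p (\<lambda>x. ennreal (g k x))))
    \<le> lq_norm q (\<lambda>k. Lp_norm lborel p (\<lambda>x. ennreal (h k x)))" by (rule INF_lower)
  also have "\<dots> \<le> lq_norm q (\<lambda>k. ennreal A1 * (ennreal \<bar>a\<bar> * Lp_norm lborel p (\<lambda>x. ennreal (g1 k x)) + ennreal \<bar>b\<bar> * Lp_norm lborel p (\<lambda>x. ennreal (g2 k x))))"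
  proof (rule Lp_norm_mono_AE[OF q])
    have "Lp_norm lborel p (\<lambda>x. ennreal (h k x)) \<le> ennreal A1 * (ennreal \<bar>a\<bar> * Lp_norm lborel p (\<lambda>x. ennreal (g1 k x)) + ennreal \<bar>b\<bar> * Lp_norm lborel p (\<lambda>x. ennreal (g2 k x)))" for k
      unfolding h_def by (rule comb) (rule gm gn)+
    then show "AE k in count_space UNIV. Lp_norm lborel p (\<lambda>x. ennreal (h k x)) \<le> ennreal A1 * (ennreal \<bar>a\<bar> * Lp_norm lborel p (\<lambda>x. ennreal (g1 k x)) + ennreal \<bar>b\<bar> * Lp_norm lborel p (\<lambda>x. ennreal (g2 k x)))"
      by (intro AE_I2)
  qed simp
  also have "\<dots> \<le> ennreal A1 * lq_norm q (\<lambda>k. ennreal \<bar>a\<bar> * Lp_norm lborel p (\<lambda>x. ennreal (g1 k x)) + ennreal \<bar>b\<bar> * Lp_norm lborel p (\<lambda>x. ennreal (g2 k x)))"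
    by (intro Lp_norm_cmult_le[OF q]) auto
  also have "\<dots> \<le> ennreal A1 * (ennreal A2 * (lq_norm q (\<lambda>k. ennreal \<bar>a\<bar> * Lp_norm lborel p (\<lambda>x. ennreal (g1 k x))) + lq_norm q (\<lambda>k. ennreal \<bar>b\<bar> * Lp_norm lborel p (\<lambda>x. ennreal (g2 k x)))))"
    by (intro mult_left_mono A2) auto
  also have "\<dots> \<le> ennreal A1 * (ennreal A2 * (ennreal \<bar>a\<bar> * lq_norm q (\<lambda>k. Lp_norm lborel p (\<lambda>x. ennreal (g1 k x))) + ennreal \<bar>b\<bar> * lq_norm q (\<lambda>k. Lp_norm lborel p (\<lambda>x. ennreal (g2 k x)))))"
    by (intro mult_left_mono add_mono Lp_norm_cmult_le[OF q]) auto
  also have "\<dots> < top" using g1(2) g2(2) by (simp add: ennreal_mult_less_top)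
  finally have 1: "(INF g\<in>frac_gradients s (\<lambda>x. a * f x + b * g x). lq_norm q (\<lambda>k. Lp_norm lborel p (\<lambda>x. ennreal (g k x)))) < top" .
  have "Lp_norm lborel p (\<lambda>x. ennreal \<bar>a * f x + b * g x\<bar>) \<le> Lp_norm lborel p (\<lambda>x. ennreal (\<bar>a\<bar> * \<bar>f x\<bar> + \<bar>b\<bar> * \<bar>g x\<bar>))"
  proof (intro Lp_norm_mono_AE[OF p_pos] AE_I2 ennreal_leI)
    show "\<bar>a * f x + b * g x\<bar> \<le> \<bar>a\<bar> * \<bar>f x\<bar> + \<bar>b\<bar> * \<bar>g x\<bar>" for x
      using abs_triangle_ineq[of "a * f x" "b * g x"] by (simp only: abs_mult)
  qed measurable
  also have "\<dots> \<le> ennreal A1 * (ennreal \<bar>a\<bar> * Lp_norm lborel p (\<lambda>x. ennreal \<bar>f x\<bar>) + ennreal \<bar>b\<bar> * Lp_norm lborel p (\<lambda>x. ennreal \<bar>g x\<bar>))"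
    by (intro comb) auto
  also have "\<dots> < top" using f g by (auto simp: ennreal_mult_less_top besov_def besov_norm_def)
  finally show ?thesis using 1 by (simp add: besov_def besov_norm_def)
qed

text \<open>Upper limits are not additive; additivity comes from the genuine limits, which exist
  m_0-almost everywhere for both functions.\<close>

lemma has_trace_linear:
  assumes q: "0 < q" and f: "f \<in> besov s p q" "has_trace (m 0) f \<phi>" and g: "g \<in> besov s p q" "has_trace (m 0) g \<psi>"
  shows "has_trace (m 0) (\<lambda>x. a * f x + b * g x) (\<lambda>x. a * \<phi> x + b * \<psi> x)"
  unfolding has_trace_def
  using trace_limit_AE[OF q f(1)] trace_limit_AE[OF q g(1)] f(2)[unfolded has_trace_def] g(2)[unfolded has_trace_def]
proof eventually_elim
  case (elim x)
  obtain l1 where l1: "((\<lambda>r. average lborel (cube r x) f) \<longlongrightarrow> l1) (at_right 0)" using elim(1) by (elim exE)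
  obtain l2 where l2: "((\<lambda>r. average lborel (cube r x) g) \<longlongrightarrow> l2) (at_right 0)" using elim(2) by (elim exE)
  have "((\<lambda>r. average lborel (cube r x) (\<lambda>x. a * f x + b * g x)) \<longlongrightarrow> a * l1 + b * l2) (at_right 0)"
    unfolding average_linear[OF f(1) g(1)] by (intro tendsto_intros l1 l2)
  from precise_rep_eq[OF this] show ?case
    using elim(3,4) precise_rep_eq[OF l1] precise_rep_eq[OF l2] by simp
qed

text \<open>The representative has to be Borel on the whole space, so it is defined as a limit along
  a sequence of radii, with the default value of \<open>lim\<close> where there is none.\<close>

lemma trace_exists:
  assumes q: "0 < q" and f: "f \<in> besov s p q"
  shows "\<exists>\<phi>\<in>trace_space s p q (m 0). has_trace (m 0) f \<phi>"
proof -
  have [measurable]: "f \<in> borel_measurable borel" using f by (simp add: besov_def)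
  define \<phi> where "\<phi> x = lim (\<lambda>k. average lborel (cube (dy (int k)) x) f)" for x
  have ind: "(\<lambda>z. indicator (cube r (fst z)) (snd z) :: real) \<in> borel_measurable (borel \<Otimes>\<^sub>M borel)" for r :: real
    unfolding indicator_def by measurable
  have "(\<lambda>x. average lborel (cube r x) f) \<in> borel_measurable borel" if "0 \<le> r" for r
  proof -
    have [measurable]: "(\<lambda>x. LINT y:cube r x|lborel. f y) \<in> borel_measurable borel"
      unfolding set_lebesgue_integral_def
      by (rule lborel.borel_measurable_lebesgue_integral) (use ind[of r] in \<open>simp add: split_def\<close>)
    show ?thesis unfolding average_def measure_lborel_cube[OF that] by measurable
  qed
  then have \<phi>m: "\<phi> \<in> borel_measurable borel"
    unfolding \<phi>_def by (intro borel_measurable_lim_metric) auto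
  have tr: "has_trace (m 0) f \<phi>"
    unfolding has_trace_def using trace_limit_AE[OF q f]
  proof eventually_elim
    case (elim x)
    then obtain l where l: "((\<lambda>r. average lborel (cube r x) f) \<longlongrightarrow> l) (at_right 0)" by (elim exE)
    have "filterlim (\<lambda>k. dy (int k)) (at_right 0) sequentially"
      unfolding filterlim_at using dy_tendsto_0[of 0] by (auto intro!: always_eventually)
    from filterlim_compose[OF l this] have "\<phi> x = l" unfolding \<phi>_def by (rule limI)
    then show ?case using precise_rep_eq[OF l] by simp
  qed
  show ?thesis using f tr \<phi>m by (intro bexI[of _ \<phi>]) (auto simp: trace_space_def)
qed

text \<open>One constant is used for both bounds. If the intrinsic norm is infinite, the upper bound
  is trivial; if \<phi> is not a trace, the infimum in the trace norm runs over the empty set and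
  equals \<open>top\<close>, so the lower bound is trivial.\<close>

lemma trace_characterization:
  assumes q: "0 < q" and \<sigma>: "0 < \<sigma>" "ennreal \<sigma> \<le> p"
  shows "(\<forall>\<phi>\<in>L_loc \<sigma> m. \<phi> \<in> trace_space s p q (m 0) \<longleftrightarrow> intrinsic_norm s p q \<sigma> m \<phi> < \<infinity>) \<and>
         (\<exists>C>0. \<forall>\<phi>\<in>L_loc \<sigma> m.
            ennreal (1 / C) * intrinsic_norm s p q \<sigma> m \<phi> \<le> trace_norm s p q (m 0) \<phi> \<and>
            trace_norm s p q (m 0) \<phi> \<le> ennreal C * intrinsic_norm s p q \<sigma> m \<phi>)"
proof -
  let ?I = "\<lambda>\<phi>. intrinsic_norm s p q \<sigma> m \<phi>"
  obtain A where A: "0 < A"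
    "\<And>f \<phi>. f \<in> besov s p q \<Longrightarrow> \<phi> \<in> L_loc \<sigma> m \<Longrightarrow> has_trace (m 0) f \<phi> \<Longrightarrow> ?I \<phi> \<le> ennreal A * besov_norm s p q f"
    by (rule intrinsic_norm_le_besov_norm[OF q \<sigma>]) auto
  obtain B where B: "0 < B" "\<And>\<phi>. \<phi> \<in> L_loc \<sigma> m \<Longrightarrow> ?I \<phi> < top \<Longrightarrow>
       \<phi> \<in> L_loc 1 m \<and> intrinsic_norm s p q 1 m \<phi> \<le> ennreal B * ?I \<phi>"
    using intrinsic_norm_1_le[OF q \<sigma>] by blast
  obtain D where D: "0 < D" "\<And>\<phi>. \<phi> \<in> L_loc 1 m \<Longrightarrow> intrinsic_norm s p q 1 m \<phi> < top \<Longrightarrow>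
      extop \<phi> \<in> besov s p q \<and> besov_norm s p q (extop \<phi>) \<le> ennreal D * intrinsic_norm s p q 1 m \<phi> \<and>
      (AE x in lborel. (\<Sum>i. res \<phi> i x) < top)"
    using extop_besov[OF q] by blast
  have ext: "extop \<phi> \<in> besov s p q" "has_trace (m 0) (extop \<phi>) \<phi>" "besov_norm s p q (extop \<phi>) \<le> ennreal (D * B) * ?I \<phi>"
    if \<phi>: "\<phi> \<in> L_loc \<sigma> m" and fin: "?I \<phi> < top" for \<phi>
  proof -
    have \<phi>1: "\<phi> \<in> L_loc 1 m" and le: "intrinsic_norm s p q 1 m \<phi> \<le> ennreal B * ?I \<phi>" using B(2)[OF \<phi> fin] by auto
    have fin1: "intrinsic_norm s p q 1 m \<phi> < top" using le fin by (auto simp: ennreal_mult_less_top intro: le_less_trans)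
    show "extop \<phi> \<in> besov s p q" using D(2)[OF \<phi>1 fin1] by blast
    show "has_trace (m 0) (extop \<phi>) \<phi>" by (rule extop_trace[OF q \<phi>1 fin1])
    have "besov_norm s p q (extop \<phi>) \<le> ennreal D * intrinsic_norm s p q 1 m \<phi>" using D(2)[OF \<phi>1 fin1] by blast
    also have "\<dots> \<le> ennreal D * (ennreal B * ?I \<phi>)" by (intro mult_left_mono le) simp
    finally show "besov_norm s p q (extop \<phi>) \<le> ennreal (D * B) * ?I \<phi>"
      using B(1) D(1) by (simp add: ennreal_mult mult.assoc)
  qed
  have "\<phi> \<in> trace_space s p q (m 0) \<longleftrightarrow> ?I \<phi> < \<infinity>" if \<phi>: "\<phi> \<in> L_loc \<sigma> m" for \<phi>
  proof
    assume "\<phi> \<in> trace_space s p q (m 0)"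
    then obtain f where f: "f \<in> besov s p q" "has_trace (m 0) f \<phi>" by (auto simp: trace_space_def)
    have "?I \<phi> \<le> ennreal A * besov_norm s p q f" by (rule A(2)[OF f(1) \<phi> f(2)])
    also have "\<dots> < \<infinity>" using f(1) by (simp add: besov_def ennreal_mult_less_top)
    finally show "?I \<phi> < \<infinity>" .
  next
    assume "?I \<phi> < \<infinity>"
    then have fin: "?I \<phi> < top" by simp
    show "\<phi> \<in> trace_space s p q (m 0)"
      using ext(1,2)[OF \<phi> fin] \<phi> by (auto simp: trace_space_def L_loc_def)
  qed
  moreover have "ennreal (1 / (A + D * B)) * ?I \<phi> \<le> trace_norm s p q (m 0) \<phi> \<and> trace_norm s p q (m 0) \<phi> \<le> ennreal (A + D * B) * ?I \<phi>"
    if \<phi>: "\<phi> \<in> L_loc \<sigma> m" for \<phi>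
  proof
    have c: "0 < A + D * B" using A(1) B(1) D(1) by (simp add: add_pos_pos)
    show "ennreal (1 / (A + D * B)) * ?I \<phi> \<le> trace_norm s p q (m 0) \<phi>"
      unfolding trace_norm_def
    proof (rule INF_greatest)
      fix f assume f: "f \<in> {f \<in> besov s p q. has_trace (m 0) f \<phi>}"
      have "ennreal (1 / (A + D * B)) * ?I \<phi> \<le> ennreal (1 / (A + D * B)) * (ennreal (A + D * B) * besov_norm s p q f)"
      proof (intro mult_left_mono)
        have "?I \<phi> \<le> ennreal A * besov_norm s p q f" using A(2)[OF _ \<phi>] f by blast
        also have "\<dots> \<le> ennreal (A + D * B) * besov_norm s p q f"
          using B(1) D(1) by (intro mult_right_mono ennreal_leI) auto
        finally show "?I \<phi> \<le> ennreal (A + D * B) * besov_norm s p q f" .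
      qed simp
      also have "\<dots> = besov_norm s p q f"
      proof -
        have "ennreal (1 / (A + D * B)) * ennreal (A + D * B) = 1" using c by (simp flip: ennreal_mult)
        then show ?thesis by (simp add: mult.assoc[symmetric])
      qed
      finally show "ennreal (1 / (A + D * B)) * ?I \<phi> \<le> besov_norm s p q f" .
    qed
    show "trace_norm s p q (m 0) \<phi> \<le> ennreal (A + D * B) * ?I \<phi>"
    proof (cases "?I \<phi> < top")
      case True
      have "trace_norm s p q (m 0) \<phi> \<le> besov_norm s p q (extop \<phi>)"
        unfolding trace_norm_def using ext(1,2)[OF \<phi> True] by (intro INF_lower) simp
      also have "\<dots> \<le> ennreal (D * B) * ?I \<phi>" by (rule ext(3)[OF \<phi> True])
      also have "\<dots> \<le> ennreal (A + D * B) * ?I \<phi>" using A(1) by (intro mult_right_mono ennreal_leI) auto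
      finally show ?thesis .
    next
      case False
      then have "?I \<phi> = top" using top.not_eq_extremum by blast
      then show ?thesis using c by (simp add: ennreal_mult_top)
    qed
  qed
  moreover have "0 < A + D * B" using A(1) B(1) D(1) by (simp add: add_pos_pos)
  ultimately show ?thesis by blast
qed

text \<open>Everything happens at exponent 1, so the operator is independent of \<sigma>. A trace is
  first seen to lie in L_p(m_0), hence in \<open>L_loc 1 m\<close>; after that its intrinsic norm is
  bounded by the Besov norm of any function having this trace, and the infimum over such functions
  gives boundedness.\<close>

lemma extop_extension:
  assumes q: "0 < q"
  shows "bounded_linear_trace_extension s p q (m 0) extop"
proof -
  have p1: "ennreal 1 \<le> p" using p by simp
  obtain A where A: "0 < A"
    "\<And>f \<phi>. f \<in> besov s p q \<Longrightarrow> \<phi> \<in> borel_measurable borel \<Longrightarrow> has_trace (m 0) f \<phi> \<Longrightarrow>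
       Lp_norm (m 0) p (\<lambda>x. ennreal \<bar>\<phi> x\<bar>) \<le> ennreal A * besov_norm s p q f"
    "\<And>f \<phi>. f \<in> besov s p q \<Longrightarrow> \<phi> \<in> L_loc 1 m \<Longrightarrow> has_trace (m 0) f \<phi> \<Longrightarrow>
       intrinsic_norm s p q 1 m \<phi> \<le> ennreal A * besov_norm s p q f"
    by (rule intrinsic_norm_le_besov_norm[OF q _ p1]) auto
  obtain D where D: "0 < D" "\<And>\<phi>. \<phi> \<in> L_loc 1 m \<Longrightarrow> intrinsic_norm s p q 1 m \<phi> < top \<Longrightarrow>
      extop \<phi> \<in> besov s p q \<and> besov_norm s p q (extop \<phi>) \<le> ennreal D * intrinsic_norm s p q 1 m \<phi> \<and>
      (AE x in lborel. (\<Sum>i. res \<phi> i x) < top)"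
    using extop_besov[OF q] by blast
  have tr: "\<phi> \<in> borel_measurable borel" "\<phi> \<in> L_loc 1 m" "intrinsic_norm s p q 1 m \<phi> < top" if \<phi>: "\<phi> \<in> trace_space s p q (m 0)" for \<phi>
  proof -
    obtain f where f: "f \<in> besov s p q" "has_trace (m 0) f \<phi>" using \<phi> by (auto simp: trace_space_def)
    show \<phi>m: "\<phi> \<in> borel_measurable borel" using \<phi> by (simp add: trace_space_def)
    have "ennreal A * besov_norm s p q f < top" using f(1) by (simp add: besov_def ennreal_mult_less_top)
    then show \<phi>1: "\<phi> \<in> L_loc 1 m" using A(2)[OF f(1) \<phi>m f(2)] \<phi>m by (intro L_loc_1) (auto intro: le_less_trans)
    show "intrinsic_norm s p q 1 m \<phi> < top"
      using A(3)[OF f(1) \<phi>1 f(2)] \<open>ennreal A * besov_norm s p q f < top\<close> by (rule le_less_trans)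
  qed
  have bound: "besov_norm s p q (extop \<phi>) \<le> ennreal (D * A) * trace_norm s p q (m 0) \<phi>" if \<phi>: "\<phi> \<in> trace_space s p q (m 0)" for \<phi>
  proof -
    have "besov_norm s p q (extop \<phi>) \<le> ennreal (D * A) * (0 + (INF f\<in>{f \<in> besov s p q. has_trace (m 0) f \<phi>}. besov_norm s p q f))"
    proof (rule ennreal_le_INF_affine)
      show "0 < D * A" using A(1) D(1) by simp
      fix f assume f: "f \<in> {f \<in> besov s p q. has_trace (m 0) f \<phi>}"
      have "besov_norm s p q (extop \<phi>) \<le> ennreal D * intrinsic_norm s p q 1 m \<phi>" using D(2) tr[OF \<phi>] by blast
      also have "\<dots> \<le> ennreal D * (ennreal A * besov_norm s p q f)"
        using A(3)[OF _ tr(2)[OF \<phi>]] f by (intro mult_left_mono) auto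
      finally show "besov_norm s p q (extop \<phi>) \<le> ennreal (D * A) * (0 + besov_norm s p q f)"
        using A(1) D(1) by (simp add: ennreal_mult mult.assoc)
    qed
    then show ?thesis by (simp add: trace_norm_def)
  qed
  have lin: "(\<lambda>x. a * \<phi> x + b * \<psi> x) \<in> trace_space s p q (m 0)"
    if \<phi>: "\<phi> \<in> trace_space s p q (m 0)" and \<psi>: "\<psi> \<in> trace_space s p q (m 0)" for \<phi> \<psi> a b
  proof -
    obtain f where f: "f \<in> besov s p q" "has_trace (m 0) f \<phi>" using \<phi> by (auto simp: trace_space_def)
    obtain g where g: "g \<in> besov s p q" "has_trace (m 0) g \<psi>" using \<psi> by (auto simp: trace_space_def)
    have [measurable]: "\<phi> \<in> borel_measurable borel" "\<psi> \<in> borel_measurable borel" using tr(1) \<phi> \<psi> by auto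
    have "(\<lambda>x. a * \<phi> x + b * \<psi> x) \<in> borel_measurable borel" by measurable
    then show ?thesis
      unfolding trace_space_def using besov_linear[OF q f(1) g(1)] has_trace_linear[OF q f g] by blast
  qed
  have "0 < D * A" using A(1) D(1) by simp
  moreover have "extop \<phi> \<in> besov s p q" if "\<phi> \<in> trace_space s p q (m 0)" for \<phi> using D(2) tr[OF that] by blast
  moreover have "has_trace (m 0) (extop \<phi>) \<phi>" if "\<phi> \<in> trace_space s p q (m 0)" for \<phi>
    using tr[OF that] by (intro extop_trace[OF q])
  moreover have "AE x in lborel. extop \<phi> x = extop \<psi> x"
    if "\<phi> \<in> trace_space s p q (m 0)" "\<psi> \<in> trace_space s p q (m 0)" "AE x in m 0. \<phi> x = \<psi> x" for \<phi> \<psi>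
    using extop_cong_AE[OF tr(1)[OF that(1)] tr(1)[OF that(2)] that(3)] by simp
  moreover have "AE x in lborel. extop (\<lambda>x. a * \<phi> x + b * \<psi> x) x = a * extop \<phi> x + b * extop \<psi> x"
    if "\<phi> \<in> trace_space s p q (m 0)" "\<psi> \<in> trace_space s p q (m 0)" for \<phi> \<psi> a b
    using tr[OF that(1)] tr[OF that(2)] by (intro extop_linear_AE[OF q])
  ultimately show ?thesis
    unfolding bounded_linear_trace_extension_def using bound lin by blast
qed

end

section \<open>From the hypotheses to the setting\<close>

lemma trace_setting_intro:
  fixes E :: "(real^'n) set"
  assumes d: "0 \<le> d" "d \<le> real CARD('n)" and E: "E \<noteq> {}" "closed E" and reg: "strongly_regular_seq d E m"
    and p: "1 \<le> p" and s: "ennreal (real CARD('n) - d) / p < ennreal s" "s < 1"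
  obtains C1 C2 C3 \<tau> where "trace_setting d s p E m C1 C2 C3 \<tau>"
proof -
  obtain C1 C2 C3 \<gamma> where C: "0 < C1" "0 < C2" "0 < C3" and
    M: "\<And>k. (\<forall>x. \<forall>r\<in>{0 <.. 2 powr (- real k)}. emeasure (m k) (cube r x) \<le> ennreal (C1 * r powr d)) \<and>
       (\<forall>x\<in>E. \<forall>r\<in>{2 powr (- real k) .. 1}. ennreal (C2 * r powr d) \<le> emeasure (m k) (cube r x)) \<and>
       \<gamma> k \<in> borel_measurable borel \<and>
       (\<exists>B. AE x in m 0. 0 \<le> \<gamma> k x \<and> \<gamma> k x \<le> B) \<and>
       m k = density (m 0) (\<lambda>x. ennreal (\<gamma> k x)) \<and>
       (\<forall>j. AE x in m 0. x \<in> E \<longrightarrow>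
          2 powr ((d - real CARD('n)) * real j) / C3 * \<gamma> (k + j) x \<le> \<gamma> k x \<and>
          \<gamma> k x \<le> C3 * \<gamma> (k + j) x)"
    using reg unfolding strongly_regular_seq_def regular_seq_def by blast
  have lf: "locally_finite_borel (m k)" and supp: "msupport (m k) = E" for k
    using reg by (auto simp: strongly_regular_seq_def regular_seq_def)
  \<comment> \<open>The density bounds with j = 1 read \<gamma>_{k+1} \<le> C3 2^(n-d)
    \<gamma>_k.\<close>
  define D where "D = C3 * 2 powr (real CARD('n) - d)"
  have D: "0 < D" using C by (simp add: D_def)
  have M3: "(\<integral>\<^sup>+x. h x \<partial>m (Suc k)) \<le> ennreal D * (\<integral>\<^sup>+x. h x \<partial>m k)"
    if h: "h \<in> borel_measurable borel" for h k
  proof -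
    note [measurable_cong] = locally_finite_borel_sets[OF lf]
    have [measurable]: "h \<in> borel_measurable borel" "\<gamma> k \<in> borel_measurable borel" "\<gamma> (Suc k) \<in> borel_measurable borel" using h M by auto
    have dens: "(\<integral>\<^sup>+x. h x \<partial>m j) = (\<integral>\<^sup>+x. ennreal (\<gamma> j x) * h x \<partial>m 0)" if [measurable]: "\<gamma> j \<in> borel_measurable borel" for j
    proof -
      have "m j = density (m 0) (\<lambda>x. ennreal (\<gamma> j x))" using M by blast
      then have "(\<integral>\<^sup>+x. h x \<partial>m j) = (\<integral>\<^sup>+x. h x \<partial>density (m 0) (\<lambda>x. ennreal (\<gamma> j x)))" by simp
      also have "\<dots> = (\<integral>\<^sup>+x. ennreal (\<gamma> j x) * h x \<partial>m 0)" by (rule nn_integral_density) measurable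
      finally show ?thesis .
    qed
    have "AE x in m 0. x \<in> E" using AE_msupport[OF lf[of 0]] by (simp add: supp)
    moreover have "AE x in m 0. x \<in> E \<longrightarrow> 2 powr ((d - real CARD('n)) * real 1) / C3 * \<gamma> (k + 1) x \<le> \<gamma> k x \<and> \<gamma> k x \<le> C3 * \<gamma> (k + 1) x"
      using M by blast
    ultimately have "AE x in m 0. ennreal (\<gamma> (Suc k) x) * h x \<le> ennreal D * (ennreal (\<gamma> k x) * h x)"
    proof eventually_elim
      case (elim x)
      then have "2 powr (d - real CARD('n)) / C3 * \<gamma> (Suc k) x \<le> \<gamma> k x" by simp
      then have "D * (2 powr (d - real CARD('n)) / C3 * \<gamma> (Suc k) x) \<le> D * \<gamma> k x" using D by (intro mult_left_mono) auto
      also have "D * (2 powr (d - real CARD('n)) / C3 * \<gamma> (Suc k) x) = (2 powr (real CARD('n) - d) * 2 powr (d - real CARD('n))) * \<gamma> (Suc k) x"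
        using C by (simp add: D_def)
      also have "2 powr (real CARD('n) - d) * 2 powr (d - real CARD('n)) = 1" by (simp flip: powr_add)
      finally have "ennreal (\<gamma> (Suc k) x) \<le> ennreal D * ennreal (\<gamma> k x)"
        using D by (simp flip: ennreal_mult' add: ennreal_leI)
      then have "ennreal (\<gamma> (Suc k) x) * h x \<le> (ennreal D * ennreal (\<gamma> k x)) * h x" by (rule mult_right_mono) simp
      then show ?case by (simp only: mult.assoc)
    qed
    then have "(\<integral>\<^sup>+x. ennreal (\<gamma> (Suc k) x) * h x \<partial>m 0) \<le> (\<integral>\<^sup>+x. ennreal D * (ennreal (\<gamma> k x) * h x) \<partial>m 0)"
      by (rule nn_integral_mono_AE)
    also have "\<dots> = ennreal D * (\<integral>\<^sup>+x. ennreal (\<gamma> k x) * h x \<partial>m 0)" by (rule nn_integral_cmult) measurable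
    finally show ?thesis by (simp add: dens)
  qed
  \<comment> \<open>For infinite p both quotients are 0, the one because it is a division by
    \<open>top\<close> and the other because \<open>enn2real p\<close> is 0; the condition is then 0
    < s.\<close>
  have \<tau>: "(real CARD('n) - d) / enn2real p < s"
  proof (cases "p = top")
    case True
    then show ?thesis using s(1) by simp
  next
    case False
    then obtain P where P: "p = ennreal P" "0 < P"
      using p by (cases p) (auto simp: ennreal_1[symmetric] simp del: ennreal_1 intro: less_le_trans[of 0 1])
    have "ennreal ((real CARD('n) - d) / P) < ennreal s"
      using s(1) P d by (simp add: divide_ennreal)
    then show ?thesis using P d by (simp add: ennreal_less_iff)
  qed
  have "trace_setting d s p E m C1 C2 D ((real CARD('n) - d) / enn2real p)"
  proof
    show "emeasure (m k) (cube r x) \<le> ennreal (C1 * r powr d)" if "0 < r" "r \<le> 2 powr (- real k)" for k r x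
    proof -
      have "r \<in> {0 <.. 2 powr (- real k)}" using that by simp
      then show ?thesis using M[of k] by blast
    qed
    show "ennreal (C2 * r powr d) \<le> emeasure (m k) (cube r x)" if "x \<in> E" "2 powr (- real k) \<le> r" "r \<le> 1" for k r x
    proof -
      have "r \<in> {2 powr (- real k) .. 1}" using that by simp
      then show ?thesis using M[of k] that(1) by blast
    qed
    show "AE x in m 0. x \<in> G \<longrightarrow> 0 < limsup (\<lambda>k. ereal (measure (m k) (cube (2 powr (- real k)) x \<inter> G) /
                                   measure (m k) (cube (2 powr (- real k)) x)))" if "G \<in> sets borel" "G \<subseteq> E" for G
      using reg that unfolding strongly_regular_seq_def by blast
  qed (use d E p \<tau> s(2) lf supp C D M3 in auto)
  then show ?thesis by (rule that)
qed

theorem theorem1p2: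
  fixes d s \<sigma> :: real and p q :: ennreal
    and E :: "(real^'n) set" and m :: "nat \<Rightarrow> (real^'n) measure"
  assumes "0 \<le> d" and "d \<le> real CARD('n)"
    and "E \<noteq> {}" and "closed E" and "thick d E"
    and "strongly_regular_seq d E m"
    and "1 \<le> p" and "0 < q"
    and "ennreal (real CARD('n) - d) / p < ennreal s" and "s < 1"
    and "0 < \<sigma>" and "ennreal \<sigma> \<le> p"
  shows "(\<forall>\<phi>\<in>L_loc \<sigma> m.
            \<phi> \<in> trace_space s p q (m 0) \<longleftrightarrow> intrinsic_norm s p q \<sigma> m \<phi> < \<infinity>) \<and>
         (\<exists>C>0. \<forall>\<phi>\<in>L_loc \<sigma> m.
            ennreal (1 / C) * intrinsic_norm s p q \<sigma> m \<phi> \<le> trace_norm s p q (m 0) \<phi> \<and>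
            trace_norm s p q (m 0) \<phi> \<le> ennreal C * intrinsic_norm s p q \<sigma> m \<phi>) \<and>
         (\<forall>f\<in>besov s p q. \<exists>\<phi>\<in>trace_space s p q (m 0). has_trace (m 0) f \<phi>) \<and>
         (\<exists>Ext. bounded_linear_trace_extension s p q (m 0) Ext)"
proof -
  obtain C1 C2 C3 \<tau> where "trace_setting d s p E m C1 C2 C3 \<tau>"
    by (rule trace_setting_intro[OF assms(1-4) assms(6,7,9,10)])
  then interpret trace_setting d s p E m C1 C2 C3 \<tau> .
  show ?thesis
    using trace_characterization[OF assms(8,11,12)] trace_exists[OF assms(8)] extop_extension[OF assms(8)] by blast
qed

end
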